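(* Let $m>0$ and $q\in\mathbb R$. For $\lambda>0$ and $B\in\mathcal A^{(m)}_\phi$ let $\rho_\lambda(B)=\lim_{n\to+\infty}\underline W(iu_n)^*_\lambda\,\phi_\lambda(B)\,\underline W(iu_n)_\lambda$ (norm limit), a morphism from $\mathcal A^{(m)}_\phi$ into $\mathcal A^{(m)}$, and let $\boldsymbol\rho^\bullet(B)=(\lambda\mapsto\rho_\lambda(B))$. The following statements hold: (i) for $B\in\mathcal A^{(m)}_\phi$, one has $\boldsymbol\rho^\bullet(B)\in\underline{\mathcal A}^{(m)\bullet}$ and $\pi^\bullet_{0,\iota}(\boldsymbol\rho^\bullet(B))=\rho_{q,\iota}(\pi^\bullet_{0,\iota}\boldsymbol\phi^\bullet(B))\in\mathcal A^{(m)}_{0,\iota}$; (ii) the map $B\in\mathcal A^{(m)}_\phi\mapsto\boldsymbol\rho^\bullet(B)\in\underline{\mathcal A}^{(m)\bullet}$ is norm continuous; (iii) $\pi^\bullet_{0,\iota}\big(\boldsymbol\rho^\bullet\big(\bigcup_O\mathcal A^{(m)}_\phi(O)\big)\big)\subset\bigcup_O\mathcal A^{(m)}_{0,\iota}(O)$.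
   Context: **Weyl algebra and net.** $\mathcal D(\mathbb R)$ is the space of complex-valued compactly supported smooth functions on $\mathbb R$ (as a real vector space); $\hat f(p)=(2\pi)^{-1/2}\int_{\mathbb R}e^{-ipx}f(x)\,dx$. $\mathfrak W$ is the Weyl C*-algebra generated by unitaries $W(f)$, $f\in\mathcal D(\mathbb R)$, with $W(f)W(g)=e^{-\frac i2\sigma(f,g)}W(f+g)$, $\sigma(f,g)=\mathrm{Im}\int_{\mathbb R}\overline fg$. For $m\ge0$ put $\omega_m(p)=\sqrt{p^2+m^2}$. The proper orthochronous Poincaré group of $\mathbb R^2$ acts on $\mathcal D(\mathbb R)$ by real-linear maps $\tau^{(m)}_{(\Lambda,x)}$ determined by: with $\tilde f(p)=\widehat{\mathrm{Re}f}(p)+i\omega_m(p)\widehat{\mathrm{Im}f}(p)$ and $x=(t,\boldsymbol x)$, $(\tau^{(m)}_{(\Lambda,x)}f)^{\sim}(p)=e^{i(t\omega_m(p)-\boldsymbol xp)}\tilde f(\Lambda^{-1}p)$, where $\Lambda^{-1}p$ is the spatial component of $\Lambda^{-1}(\omega_m(p),p)$. So space translations act by $f\mapsto f(\cdot-\boldsymbol x)$ and time translations by $(\tau^{(m)}_tf)\hat{\ }=[\cos(t\omega_m)+i\omega_m^{-1}\sin(t\omega_m)]\widehat{\mathrm{Re}f}+i[\cos(t\omega_m)+i\omega_m\sin(t\omega_m)]\widehat{\mathrm{Im}f}$. $\alpha^{(m)}_{(\Lambda,x)}(W(f))=W(\tau^{(m)}_{(\Lambda,x)}f)$. For $m>0$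 the vacuum state is $\omega^{(m)}(W(f))=e^{-\frac12\|f\|_m^2}$, $\|f\|_m^2=\frac12\int_{\mathbb R}dp\,|\omega_m^{-1/2}\widehat{\mathrm{Re}f}+i\omega_m^{1/2}\widehat{\mathrm{Im}f}|^2$, with GNS triple $(\pi^{(m)},\mathcal H^{(m)},\Omega^{(m)})$; $\pi^{(m)}$ is omitted in the notation. $O_I$ is the open double cone with base the bounded open interval $I$ of the time-zero line, and $\mathcal A^{(m)}(\Lambda O_I+x)=\{\pi^{(m)}(\alpha^{(m)}_{(\Lambda,x)}(W(f))):\mathrm{supp}f\subset I\}''$; $\mathcal A^{(m)}$ also denotes the norm closure of $\bigcup_O\mathcal A^{(m)}(O)$. $\alpha^{(m)}$ extends to $\mathcal A^{(m)}$. Dilations: $(\delta_\lambda f)(x)=\lambda^{-1}\mathrm{Re}f(\lambda^{-1}x)+i\,\mathrm{Im}f(\lambda^{-1}x)$; $\phi_\lambda$, $\lambda>0$, is the automorphism of $\mathcal A^{(m)}$, normal on local algebras, with $\phi_\lambda(W(f))=W(\delta_\lambda f)$, and $\boldsymbol\phi^\bullet(A)=(\lambda\mapsto\phi_\lambda(A))$. **Scaling limit.** Let $\mathcal G$ be a subgroup of the connected component of the Poincaré group containing the translations. $\underline{\mathcal A}^{(m)}(O)$ is the C*-algebra (pointwise operations, sup norm) of bounded functions $\lambda\in(0,\infty)\mapsto\underline A_\lambda\in\mathcal A^{(m)}(\lambda O)$ with $\sup_{\lambda>0}\|\alpha^{(m)}_{(\Lambda,\lambda x)}(\underline A_\lambda)-\underline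 A_\lambda\|\to0$ as $(\Lambda,x)\to(\mathbf 1,0)$ in $\mathcal G$; $\underline{\mathcal A}^{(m)}=\overline{\bigcup_O\underline{\mathcal A}^{(m)}(O)}$. A scaling limit state $\underline\omega_{0,\iota}=\lim_\kappa\underline\omega_{\lambda_\kappa}$ is fixed, i.e. a weak* limit point as $\lambda\to0$, along a fixed net $\lambda_\kappa\to0$, of $\underline\omega_\lambda(\underline A)=\omega^{(m)}(\underline A_\lambda)$; with GNS triple $(\pi_{0,\iota},\mathcal H^{(m)}_{0,\iota},\Omega_{0,\iota})$, $\mathcal A^{(m)}_{0,\iota}(O)=\pi_{0,\iota}(\underline{\mathcal A}^{(m)}(O))''$, and $\mathcal A^{(m)}_{0,\iota}$ also denotes the quasi-local C*-algebra. $\underline{\mathcal A}^{(m)\bullet}(O)$ is the C*-algebra of bounded functions $\lambda\mapsto A_\lambda\in\mathcal A^{(m)}(\lambda O)$ such that for all double cones $\hat O\supset\overline O$ and $\varepsilon>0$ there are $\underline A,\underline A'\in\underline{\mathcal A}^{(m)}(\hat O)$ with $\limsup_\kappa\|(A_{\lambda_\kappa}-\underline A_{\lambda_\kappa})\Omega^{(m)}\|+\|(A^*_{\lambda_\kappa}-\underline A'_{\lambda_\kappa})\Omega^{(m)}\|<\varepsilon$; $\underline{\mathcal A}^{(m)\bullet}=\overline{\bigcup_O\underline{\mathcal A}^{(m)\bullet}(O)}$. $\pi_{0,\iota}$ extends to a morphism $\pi^\bullet_{0,\iota}:\underline{\mathcal A}^{(m)\bullet}\to\mathcal A^{(m)}_{0,\iota}$,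 determined on local elements $A\in\underline{\mathcal A}^{(m)\bullet}(O)$ by $\pi^\bullet_{0,\iota}(A)\Omega_{0,\iota}=\lim_j\pi_{0,\iota}(\underline A_j)\Omega_{0,\iota}$ whenever $\underline A_j\in\underline{\mathcal A}^{(m)}(\hat O)$ satisfy $\limsup_\kappa\|(A_{\lambda_\kappa}-(\underline A_j)_{\lambda_\kappa})\Omega^{(m)}\|\to0$ as $j\to\infty$. **Subalgebra.** $\mathcal A^{(m)}_\phi(O)\subset\mathcal A^{(m)}(O)$ is the C*-subalgebra of all $A\in\mathcal A^{(m)}(O)$ with $\boldsymbol\phi^\bullet(A)\in\underline{\mathcal A}^{(m)\bullet}(O)$, and $\mathcal A^{(m)}_\phi=\overline{\bigcup_O\mathcal A^{(m)}_\phi(O)}$. **Sectors.** $\underline W(f)_\lambda=W(\delta_\lambda f)$, $\underline W(f)\in\underline{\mathcal A}^{(m)\bullet}$, $W_{0,\iota}(f)=\pi^\bullet_{0,\iota}(\underline W(f))$. For $q\in\mathbb R$, $a>0$, $u_n\in\mathcal D(\mathbb R)$, $n\in\mathbb N$, are real-valued with $u_n(x)=0$ for $x\le-a$, $u_n|_{(-a,a)}$ independent of $n$, $u_n(x)=q$ for $a\le x\le na$. $\rho_{q,\iota}$ is the automorphism of $\mathcal A^{(m)}_{0,\iota}$ which on local elements $A\in\bigcup_O\mathcal A^{(m)}_{0,\iota}(O)$ is given by the norm limit $\rho_{q,\iota}(A)=\lim_nW_{0,\iota}(iu_n)^*AW_{0,\iota}(iu_n)$, and is extended by norm continuity. *)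

theory Defs
  imports "HOL-Analysis.Analysis"
begin

section \<open>Hilbert spaces and bounded operators\<close>

text \<open>Complex Hilbert spaces; the inner product is antilinear in its first argument.\<close>

class complex_hilbert = banach +
  fixes scaleC :: "complex \<Rightarrow> 'a \<Rightarrow> 'a"  (infixr "*\<^sub>C" 75)
    and cinner :: "'a \<Rightarrow> 'a \<Rightarrow> complex"
  assumes scaleR_scaleC: "r *\<^sub>R x = complex_of_real r *\<^sub>C x"
    and scaleC_add_right: "c *\<^sub>C (x + y) = c *\<^sub>C x + c *\<^sub>C y"
    and scaleC_add_left: "(c + d) *\<^sub>C x = c *\<^sub>C x + d *\<^sub>C x"
    and scaleC_scaleC: "c *\<^sub>C d *\<^sub>C x = (c * d) *\<^sub>C x"
    and cinner_commute: "cinner x y = cnj (cinner y x)"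
    and cinner_add_right: "cinner x (y + z) = cinner x y + cinner x z"
    and cinner_scaleC_right: "cinner x (c *\<^sub>C y) = c * cinner x y"
    and cinner_ge_zero: "0 \<le> Re (cinner x x)"
    and norm_eq_sqrt_cinner: "norm x = sqrt (Re (cinner x x))"

instantiation complex :: complex_hilbert
begin

definition scaleC_complex :: "complex \<Rightarrow> complex \<Rightarrow> complex"
  where "scaleC_complex c x = c * x"

definition cinner_complex :: "complex \<Rightarrow> complex \<Rightarrow> complex"
  where "cinner_complex x y = cnj x * y"

instance
  by standard
    (auto simp: scaleC_complex_def cinner_complex_def scaleR_conv_of_real algebra_simps
      cmod_def power2_eq_square)

end

type_synonym 'h op = "'h \<Rightarrow>\<^sub>L 'h"

text \<open>Elements of \<open>'h op\<close> are only real linear; the bounded operators of the complex Hilbert space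
  are the complex linear ones. Both carry the same operator norm.\<close>

definition bounded_ops :: "'h::complex_hilbert op set"
  where "bounded_ops = {A. \<forall>c x. blinfun_apply A (c *\<^sub>C x) = c *\<^sub>C blinfun_apply A x}"

definition adj :: "'h::complex_hilbert op \<Rightarrow> 'h op"
  where "adj A = (THE B. B \<in> bounded_ops \<and>
    (\<forall>x y. cinner (blinfun_apply B x) y = cinner x (blinfun_apply A y)))"

definition commutant :: "'h::complex_hilbert op set \<Rightarrow> 'h op set"
  where "commutant M = {A \<in> bounded_ops. \<forall>B\<in>M. A o\<^sub>L B = B o\<^sub>L A}"

definition square_summable :: "(nat \<Rightarrow> 'h::complex_hilbert) \<Rightarrow> bool"
  where "square_summable x \<longleftrightarrow> summable (\<lambda>n. (norm (x n))\<^sup>2)"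

definition sigma_weak :: "'h::complex_hilbert op topology"
  where "sigma_weak = topology_generated_by
    {{A. (\<Sum>n. cinner (x n) (blinfun_apply A (y n))) \<in> U} | x y U.
      square_summable x \<and> square_summable y \<and> open U}"

definition normal_on :: "'h::complex_hilbert op set \<Rightarrow> ('h op \<Rightarrow> 'h op) \<Rightarrow> bool"
  where "normal_on M h \<longleftrightarrow> continuous_map (subtopology sigma_weak M) sigma_weak h"

section \<open>Unital C*-algebras, morphisms, states, GNS triples\<close>

record 'a star_alg =
  carr :: "'a set"
  azero :: 'a
  aone :: 'a
  aadd :: "'a \<Rightarrow> 'a \<Rightarrow> 'a"
  amult :: "'a \<Rightarrow> 'a \<Rightarrow> 'a"
  ascale :: "complex \<Rightarrow> 'a \<Rightarrow> 'a"
  astar :: "'a \<Rightarrow> 'a"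
  anorm :: "'a \<Rightarrow> real"

definition adiff :: "'a star_alg \<Rightarrow> 'a \<Rightarrow> 'a \<Rightarrow> 'a"
  where "adiff A x y = aadd A x (ascale A (-1) y)"

definition cstar_algebra :: "'a star_alg \<Rightarrow> bool"
  where "cstar_algebra A \<longleftrightarrow>
    azero A \<in> carr A \<and> aone A \<in> carr A \<and>
    (\<forall>x\<in>carr A. \<forall>y\<in>carr A. aadd A x y \<in> carr A \<and> amult A x y \<in> carr A) \<and>
    (\<forall>c. \<forall>x\<in>carr A. ascale A c x \<in> carr A) \<and> (\<forall>x\<in>carr A. astar A x \<in> carr A) \<and>
    (\<forall>x\<in>carr A. \<forall>y\<in>carr A. \<forall>z\<in>carr A. aadd A (aadd A x y) z = aadd A x (aadd A y z)) \<and>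
    (\<forall>x\<in>carr A. \<forall>y\<in>carr A. aadd A x y = aadd A y x) \<and>
    (\<forall>x\<in>carr A. aadd A (azero A) x = x \<and> adiff A x x = azero A \<and> ascale A 1 x = x) \<and>
    (\<forall>c d. \<forall>x\<in>carr A. ascale A c (ascale A d x) = ascale A (c * d) x \<and>
      ascale A (c + d) x = aadd A (ascale A c x) (ascale A d x)) \<and>
    (\<forall>c. \<forall>x\<in>carr A. \<forall>y\<in>carr A.
      ascale A c (aadd A x y) = aadd A (ascale A c x) (ascale A c y)) \<and>
    (\<forall>x\<in>carr A. \<forall>y\<in>carr A. \<forall>z\<in>carr A.
      amult A (amult A x y) z = amult A x (amult A y z) \<and>
      amult A x (aadd A y z) = aadd A (amult A x y) (amult A x z) \<and>
      amult A (aadd A x y) z = aadd A (amult A x z) (amult A y z)) \<and>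
    (\<forall>c. \<forall>x\<in>carr A. \<forall>y\<in>carr A.
      amult A (ascale A c x) y = ascale A c (amult A x y) \<and>
      amult A x (ascale A c y) = ascale A c (amult A x y)) \<and>
    (\<forall>x\<in>carr A. amult A (aone A) x = x \<and> amult A x (aone A) = x) \<and>
    (\<forall>x\<in>carr A. astar A (astar A x) = x) \<and>
    (\<forall>x\<in>carr A. \<forall>y\<in>carr A. astar A (aadd A x y) = aadd A (astar A x) (astar A y) \<and>
      astar A (amult A x y) = amult A (astar A y) (astar A x)) \<and>
    (\<forall>c. \<forall>x\<in>carr A. astar A (ascale A c x) = ascale A (cnj c) (astar A x)) \<and>
    (\<forall>x\<in>carr A. 0 \<le> anorm A x \<and> (anorm A x = 0 \<longleftrightarrow> x = azero A)) \<and>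
    (\<forall>c. \<forall>x\<in>carr A. anorm A (ascale A c x) = cmod c * anorm A x) \<and>
    (\<forall>x\<in>carr A. \<forall>y\<in>carr A. anorm A (aadd A x y) \<le> anorm A x + anorm A y \<and>
      anorm A (amult A x y) \<le> anorm A x * anorm A y) \<and>
    (\<forall>x\<in>carr A. anorm A (amult A (astar A x) x) = (anorm A x)\<^sup>2) \<and>
    (\<forall>s. (\<forall>n::nat. s n \<in> carr A) \<longrightarrow>
      (\<forall>e>0. \<exists>N. \<forall>i\<ge>N. \<forall>j\<ge>N. anorm A (adiff A (s i) (s j)) < e) \<longrightarrow>
      (\<exists>x\<in>carr A. (\<lambda>n. anorm A (adiff A (s n) x)) \<longlonglongrightarrow> 0))"

definition cstar_subalgebra :: "'a set \<Rightarrow> 'a star_alg \<Rightarrow> bool"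
  where "cstar_subalgebra M A \<longleftrightarrow> M \<subseteq> carr A \<and> cstar_algebra (A\<lparr>carr := M\<rparr>)"

definition cstar_morphism :: "'a star_alg \<Rightarrow> 'b star_alg \<Rightarrow> ('a \<Rightarrow> 'b) \<Rightarrow> bool"
  where "cstar_morphism A B h \<longleftrightarrow> cstar_algebra A \<and> cstar_algebra B \<and>
    h ` carr A \<subseteq> carr B \<and> h (aone A) = aone B \<and>
    (\<forall>x\<in>carr A. \<forall>y\<in>carr A. h (aadd A x y) = aadd B (h x) (h y) \<and>
      h (amult A x y) = amult B (h x) (h y)) \<and>
    (\<forall>c. \<forall>x\<in>carr A. h (ascale A c x) = ascale B c (h x)) \<and>
    (\<forall>x\<in>carr A. h (astar A x) = astar B (h x))"

definition cstar_automorphism :: "'a star_alg \<Rightarrow> ('a \<Rightarrow> 'a) \<Rightarrow> bool"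
  where "cstar_automorphism A h \<longleftrightarrow> cstar_morphism A A h \<and> bij_betw h (carr A) (carr A)"

definition unitary_in :: "'a star_alg \<Rightarrow> 'a \<Rightarrow> bool"
  where "unitary_in A x \<longleftrightarrow> x \<in> carr A \<and>
    amult A (astar A x) x = aone A \<and> amult A x (astar A x) = aone A"

definition state_on :: "'a star_alg \<Rightarrow> ('a \<Rightarrow> complex) \<Rightarrow> bool"
  where "state_on A \<omega> \<longleftrightarrow>
    (\<forall>x\<in>carr A. \<forall>y\<in>carr A. \<omega> (aadd A x y) = \<omega> x + \<omega> y) \<and>
    (\<forall>c. \<forall>x\<in>carr A. \<omega> (ascale A c x) = c * \<omega> x) \<and>
    (\<forall>x\<in>carr A. Im (\<omega> (amult A (astar A x) x)) = 0 \<and> 0 \<le> Re (\<omega> (amult A (astar A x) x))) \<and>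
    \<omega> (aone A) = 1"

definition operator_algebra :: "'h::complex_hilbert op set \<Rightarrow> 'h op star_alg"
  where "operator_algebra M = \<lparr>carr = M, azero = 0, aone = id_blinfun,
    aadd = (+), amult = (o\<^sub>L), ascale = (\<lambda>c A. Blinfun (\<lambda>x. c *\<^sub>C blinfun_apply A x)),
    astar = adj, anorm = norm\<rparr>"

definition gns_triple ::
    "'a star_alg \<Rightarrow> ('a \<Rightarrow> complex) \<Rightarrow> ('a \<Rightarrow> 'h::complex_hilbert op) \<Rightarrow> 'h \<Rightarrow> bool"
  where "gns_triple A \<omega> \<pi> \<Omega> \<longleftrightarrow> state_on A \<omega> \<and>
    cstar_morphism A (operator_algebra bounded_ops) \<pi> \<and>
    closure ((\<lambda>x. blinfun_apply (\<pi> x) \<Omega>) ` carr A) = UNIV \<and>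
    (\<forall>x\<in>carr A. \<omega> x = cinner \<Omega> (blinfun_apply (\<pi> x) \<Omega>))"

section \<open>Test functions and the Poincare group\<close>

definition test_functions :: "(real \<Rightarrow> complex) set"
  where "test_functions = {f. compact (closure {x. f x \<noteq> 0}) \<and>
    (\<forall>n x. ((\<lambda>g x. vector_derivative g (at x)) ^^ n) f differentiable (at x))}"

definition fourier :: "(real \<Rightarrow> complex) \<Rightarrow> real \<Rightarrow> complex"
  where "fourier f p =
    complex_of_real (1 / sqrt (2 * pi)) * (LINT x|lborel. cis (- p * x) * f x)"

abbreviation re_fun :: "(real \<Rightarrow> complex) \<Rightarrow> real \<Rightarrow> complex"
  where "re_fun f \<equiv> (\<lambda>x. complex_of_real (Re (f x)))"

abbreviation im_fun :: "(real \<Rightarrow> complex) \<Rightarrow> real \<Rightarrow> complex"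
  where "im_fun f \<equiv> (\<lambda>x. complex_of_real (Im (f x)))"

definition symp :: "(real \<Rightarrow> complex) \<Rightarrow> (real \<Rightarrow> complex) \<Rightarrow> real"
  where "symp f g = Im (LINT x|lborel. cnj (f x) * g x)"

definition omega :: "real \<Rightarrow> real \<Rightarrow> real"
  where "omega m p = sqrt (p\<^sup>2 + m\<^sup>2)"

definition tilde :: "real \<Rightarrow> (real \<Rightarrow> complex) \<Rightarrow> real \<Rightarrow> complex"
  where "tilde m f p =
    fourier (re_fun f) p + \<i> * complex_of_real (omega m p) * fourier (im_fun f) p"

definition mass_norm_sq :: "real \<Rightarrow> (real \<Rightarrow> complex) \<Rightarrow> real"
  where "mass_norm_sq m f = 1 / 2 * (LINT p|lborel.
    (cmod (complex_of_real (omega m p powr (- 1 / 2)) * fourier (re_fun f) p +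
      \<i> * complex_of_real (omega m p powr (1 / 2)) * fourier (im_fun f) p))\<^sup>2)"

definition dilate :: "real \<Rightarrow> (real \<Rightarrow> complex) \<Rightarrow> real \<Rightarrow> complex"
  where "dilate l f x =
    complex_of_real (Re (f (x / l)) / l) + \<i> * complex_of_real (Im (f (x / l)))"

text \<open>Points of Minkowski space are \<open>x :: real^2\<close> with time \<open>x $ 1\<close> and space \<open>x $ 2\<close>.
  The pair \<open>(\<Lambda>, y)\<close> is the transformation \<open>x \<mapsto> \<Lambda> x + y\<close>.\<close>

type_synonym poincare = "(real^2^2) \<times> (real^2)"

definition minkowski :: "real^2^2"
  where "minkowski = vector [vector [1, 0], vector [0, -1]]"

definition lorentz :: "(real^2^2) set"
  where "lorentz = {L. transpose L ** minkowski ** L = minkowski \<and> det L = 1 \<and> L $ 1 $ 1 > 0}"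

definition poincare_group :: "poincare set"
  where "poincare_group = lorentz \<times> UNIV"

definition poincare_mult :: "poincare \<Rightarrow> poincare \<Rightarrow> poincare"
  where "poincare_mult g h = (fst g ** fst h, fst g *v snd h + snd g)"

definition poincare_inv :: "poincare \<Rightarrow> poincare"
  where "poincare_inv g = (matrix_inv (fst g), - (matrix_inv (fst g) *v snd g))"

definition poincare_subgroup_with_translations :: "poincare set \<Rightarrow> bool"
  where "poincare_subgroup_with_translations G \<longleftrightarrow> G \<subseteq> poincare_group \<and>
    (\<forall>y. (mat 1, y) \<in> G) \<and> (\<forall>g\<in>G. \<forall>h\<in>G. poincare_mult g h \<in> G) \<and>
    (\<forall>g\<in>G. poincare_inv g \<in> G)"

definition poincare_tau :: "real \<Rightarrow> poincare \<Rightarrow> (real \<Rightarrow> complex) \<Rightarrow> real \<Rightarrow> complex"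
  where "poincare_tau m g f = (THE h. h \<in> test_functions \<and>
    (\<forall>p. tilde m h p = cis (snd g $ 1 * omega m p - snd g $ 2 * p) *
      tilde m f ((matrix_inv (fst g) *v vector [omega m p, p]) $ 2)))"

definition base_cone :: "real \<Rightarrow> real \<Rightarrow> (real^2) set"
  where "base_cone a b = {x. a + \<bar>x $ 1\<bar> < x $ 2 \<and> x $ 2 < b - \<bar>x $ 1\<bar>}"

definition move_region :: "poincare \<Rightarrow> (real^2) set \<Rightarrow> (real^2) set"
  where "move_region g Q = (\<lambda>x. fst g *v x + snd g) ` Q"

definition double_cones :: "(real^2) set set"
  where "double_cones = {move_region g (base_cone a b) | g a b. g \<in> poincare_group \<and> a < b}"

definition scale_region :: "real \<Rightarrow> (real^2) set \<Rightarrow> (real^2) set"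
  where "scale_region l Q = (\<lambda>x. l *\<^sub>R x) ` Q"

section \<open>The Weyl algebra and the massive free field net\<close>

definition weyl_algebra :: "'w star_alg \<Rightarrow> ((real \<Rightarrow> complex) \<Rightarrow> 'w) \<Rightarrow> bool"
  where "weyl_algebra A W \<longleftrightarrow> cstar_algebra A \<and>
    (\<forall>f\<in>test_functions. unitary_in A (W f)) \<and>
    (\<forall>f\<in>test_functions. \<forall>g\<in>test_functions.
      amult A (W f) (W g) = ascale A (cis (- symp f g / 2)) (W (\<lambda>x. f x + g x))) \<and>
    (\<forall>M. cstar_subalgebra M A \<and> W ` test_functions \<subseteq> M \<longrightarrow> M = carr A)"

text \<open>The data of the field: the Weyl C*-algebra with its generators, the Poincare automorphisms
  and the vacuum state on it, the GNS representation and vector of that state, and the extensions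
  of the Poincare automorphisms and of the dilations to the represented quasi-local algebra.\<close>

record (overloaded) ('w, 'h) free_field =
  weyl_alg :: "'w star_alg"
  weyl :: "(real \<Rightarrow> complex) \<Rightarrow> 'w"
  weyl_aut :: "poincare \<Rightarrow> 'w \<Rightarrow> 'w"
  vac_state :: "'w \<Rightarrow> complex"
  vac_rep :: "'w \<Rightarrow> 'h::complex_hilbert op"
  vac :: 'h
  aut :: "poincare \<Rightarrow> 'h op \<Rightarrow> 'h op"
  dil :: "real \<Rightarrow> 'h op \<Rightarrow> 'h op"

text \<open>A double cone \<open>\<Lambda>O\<^sub>I + y\<close> determines \<open>\<Lambda>\<close>, but \<open>I\<close> and \<open>y\<close> only up to a common spatial
  translation. The generators below are collected over all choices; each choice alone
  gives the same set, because spatial translations act geometrically on test functions.\<close>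

definition local_algebra ::
    "('w, 'h::complex_hilbert) free_field \<Rightarrow> (real^2) set \<Rightarrow> 'h op set"
  where "local_algebra X Q = commutant (commutant
    {vac_rep X (weyl_aut X g (weyl X f)) | g a b f.
      g \<in> poincare_group \<and> a < b \<and> Q = move_region g (base_cone a b) \<and>
      f \<in> test_functions \<and> closure {x. f x \<noteq> 0} \<subseteq> {a<..<b}})"

definition quasilocal :: "('w, 'h::complex_hilbert) free_field \<Rightarrow> 'h op set"
  where "quasilocal X = closure (\<Union>Q\<in>double_cones. local_algebra X Q)"

text \<open>Normality on the local algebras makes an automorphism of the quasi-local algebra uniquely
  determined by its values on the Weyl operators; this is how the extensions \<open>aut\<close> and \<open>dil\<close>
  are pinned down below.\<close>

definition locally_normal_automorphism ::
    "('w, 'h::complex_hilbert) free_field \<Rightarrow> ('h op \<Rightarrow> 'h op) \<Rightarrow> bool"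
  where "locally_normal_automorphism X h \<longleftrightarrow>
    cstar_automorphism (operator_algebra (quasilocal X)) h \<and>
    (\<forall>Q\<in>double_cones. normal_on (local_algebra X Q) h)"

definition massive_free_field :: "real \<Rightarrow> ('w, 'h::complex_hilbert) free_field \<Rightarrow> bool"
  where "massive_free_field m X \<longleftrightarrow>
    weyl_algebra (weyl_alg X) (weyl X) \<and>
    (\<forall>g\<in>poincare_group. cstar_automorphism (weyl_alg X) (weyl_aut X g) \<and>
      (\<forall>f\<in>test_functions. weyl_aut X g (weyl X f) = weyl X (poincare_tau m g f))) \<and>
    (\<forall>f\<in>test_functions.
      vac_state X (weyl X f) = complex_of_real (exp (- mass_norm_sq m f / 2))) \<and>
    gns_triple (weyl_alg X) (vac_state X) (vac_rep X) (vac X) \<and>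
    (\<forall>g\<in>poincare_group. locally_normal_automorphism X (aut X g) \<and>
      (\<forall>w\<in>carr (weyl_alg X). aut X g (vac_rep X w) = vac_rep X (weyl_aut X g w))) \<and>
    (\<forall>l>0. locally_normal_automorphism X (dil X l) \<and>
      (\<forall>f\<in>test_functions.
        dil X l (vac_rep X (weyl X f)) = vac_rep X (weyl X (dilate l f))))"

section \<open>Scaling algebras and scaling limit\<close>

text \<open>A function on \<open>(0,\<infinity>)\<close> is represented by its extension by zero to the real line.\<close>

definition on_pos :: "(real \<Rightarrow> 'b::zero) \<Rightarrow> real \<Rightarrow> 'b"
  where "on_pos A = (\<lambda>l. if 0 < l then A l else 0)"

definition bounded_functions :: "(real \<Rightarrow> 'h::complex_hilbert op) set"
  where "bounded_functions =
    {A. (\<forall>l. A l \<in> bounded_ops) \<and> (\<forall>l\<le>0. A l = 0) \<and> bounded (range A)}"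

definition sup_norm :: "(real \<Rightarrow> 'h::complex_hilbert op) \<Rightarrow> real"
  where "sup_norm A = (SUP l\<in>{0<..}. norm (A l))"

definition function_algebra ::
    "(real \<Rightarrow> 'h::complex_hilbert op) set \<Rightarrow> (real \<Rightarrow> 'h op) star_alg"
  where "function_algebra M = \<lparr>carr = M, azero = (\<lambda>_. 0), aone = on_pos (\<lambda>_. id_blinfun),
    aadd = (\<lambda>A B l. A l + B l), amult = (\<lambda>A B l. A l o\<^sub>L B l),
    ascale = (\<lambda>c A l. Blinfun (\<lambda>x. c *\<^sub>C blinfun_apply (A l) x)),
    astar = (\<lambda>A l. adj (A l)), anorm = sup_norm\<rparr>"

definition sup_closure ::
    "(real \<Rightarrow> 'h::complex_hilbert op) set \<Rightarrow> (real \<Rightarrow> 'h op) set"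
  where "sup_closure M =
    {A \<in> bounded_functions. \<forall>e>0. \<exists>B\<in>M. sup_norm (\<lambda>l. A l - B l) < e}"

text \<open>The data of a scaling limit: the subgroup of the Poincare group, the net of scales
  converging to zero (\<open>scale\<close>, with limits taken along the filter \<open>scale_net\<close>), the scaling limit
  state with its GNS representation and vector, and the extended representation.\<close>

record (overloaded) ('i, 'h, 'k) scaling_limit =
  sym_group :: "poincare set"
  scale_net :: "'i filter"
  scale :: "'i \<Rightarrow> real"
  lim_state :: "(real \<Rightarrow> 'h::complex_hilbert op) \<Rightarrow> complex"
  lim_rep :: "(real \<Rightarrow> 'h op) \<Rightarrow> 'k::complex_hilbert op"
  lim_vac :: 'k
  lim_rep_ext :: "(real \<Rightarrow> 'h op) \<Rightarrow> 'k op"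

definition scaling_local :: "('w, 'h::complex_hilbert) free_field \<Rightarrow>
    ('i, 'h, 'k::complex_hilbert) scaling_limit \<Rightarrow> (real^2) set \<Rightarrow> (real \<Rightarrow> 'h op) set"
  where "scaling_local X S Q = {A \<in> bounded_functions.
    (\<forall>l>0. A l \<in> local_algebra X (scale_region l Q)) \<and>
    ((\<lambda>g. SUP l\<in>{0<..}. norm (aut X (fst g, l *\<^sub>R snd g) (A l) - A l)) \<longlongrightarrow> 0)
      (at (mat 1, 0) within sym_group S)}"

definition scaling_algebra :: "('w, 'h::complex_hilbert) free_field \<Rightarrow>
    ('i, 'h, 'k::complex_hilbert) scaling_limit \<Rightarrow> (real \<Rightarrow> 'h op) set"
  where "scaling_algebra X S = sup_closure (\<Union>Q\<in>double_cones. scaling_local X S Q)"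

definition is_scaling_limit :: "('w, 'h::complex_hilbert) free_field \<Rightarrow>
    ('i, 'h, 'k::complex_hilbert) scaling_limit \<Rightarrow> bool"
  where "is_scaling_limit X S \<longleftrightarrow>
    poincare_subgroup_with_translations (sym_group S) \<and>
    scale_net S \<noteq> bot \<and> (\<forall>\<kappa>. 0 < scale S \<kappa>) \<and> (scale S \<longlongrightarrow> 0) (scale_net S) \<and>
    (\<forall>A\<in>scaling_algebra X S.
      ((\<lambda>\<kappa>. cinner (vac X) (blinfun_apply (A (scale S \<kappa>)) (vac X))) \<longlongrightarrow> lim_state S A)
        (scale_net S)) \<and>
    gns_triple (function_algebra (scaling_algebra X S)) (lim_state S) (lim_rep S) (lim_vac S)"

definition limit_local :: "('w, 'h::complex_hilbert) free_field \<Rightarrow>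
    ('i, 'h, 'k::complex_hilbert) scaling_limit \<Rightarrow> (real^2) set \<Rightarrow> 'k op set"
  where "limit_local X S Q = commutant (commutant (lim_rep S ` scaling_local X S Q))"

definition limit_quasilocal :: "('w, 'h::complex_hilbert) free_field \<Rightarrow>
    ('i, 'h, 'k::complex_hilbert) scaling_limit \<Rightarrow> 'k op set"
  where "limit_quasilocal X S = closure (\<Union>Q\<in>double_cones. limit_local X S Q)"

definition bullet_local :: "('w, 'h::complex_hilbert) free_field \<Rightarrow>
    ('i, 'h, 'k::complex_hilbert) scaling_limit \<Rightarrow> (real^2) set \<Rightarrow> (real \<Rightarrow> 'h op) set"
  where "bullet_local X S Q = {A \<in> bounded_functions.
    (\<forall>l>0. A l \<in> local_algebra X (scale_region l Q)) \<and>
    (\<forall>R\<in>double_cones. closure Q \<subseteq> R \<longrightarrow> (\<forall>e>0.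
      \<exists>B\<in>scaling_local X S R. \<exists>C\<in>scaling_local X S R.
        Limsup (scale_net S) (\<lambda>\<kappa>. ereal (
          norm (blinfun_apply (A (scale S \<kappa>) - B (scale S \<kappa>)) (vac X)) +
          norm (blinfun_apply (adj (A (scale S \<kappa>)) - C (scale S \<kappa>)) (vac X)))) < ereal e))}"

definition bullet_algebra :: "('w, 'h::complex_hilbert) free_field \<Rightarrow>
    ('i, 'h, 'k::complex_hilbert) scaling_limit \<Rightarrow> (real \<Rightarrow> 'h op) set"
  where "bullet_algebra X S = sup_closure (\<Union>Q\<in>double_cones. bullet_local X S Q)"

definition is_bullet_extension :: "('w, 'h::complex_hilbert) free_field \<Rightarrow>
    ('i, 'h, 'k::complex_hilbert) scaling_limit \<Rightarrow> bool"
  where "is_bullet_extension X S \<longleftrightarrow>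
    cstar_morphism (function_algebra (bullet_algebra X S))
      (operator_algebra (limit_quasilocal X S)) (lim_rep_ext S) \<and>
    (\<forall>A\<in>scaling_algebra X S. lim_rep_ext S A = lim_rep S A) \<and>
    (\<forall>Q\<in>double_cones. \<forall>A\<in>bullet_local X S Q. \<forall>R\<in>double_cones. closure Q \<subseteq> R \<longrightarrow>
      (\<forall>B. (\<forall>j::nat. B j \<in> scaling_local X S R) \<longrightarrow>
        (\<lambda>j. Limsup (scale_net S) (\<lambda>\<kappa>. ereal (
          norm (blinfun_apply (A (scale S \<kappa>) - B j (scale S \<kappa>)) (vac X))))) \<longlonglongrightarrow> 0 \<longrightarrow>
        (\<lambda>j. blinfun_apply (lim_rep S (B j)) (lim_vac S))
          \<longlonglongrightarrow> blinfun_apply (lim_rep_ext S A) (lim_vac S)))"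

section \<open>The dilation-covariant subalgebra and the sectors\<close>

definition phi_bullet ::
    "('w, 'h::complex_hilbert) free_field \<Rightarrow> 'h op \<Rightarrow> real \<Rightarrow> 'h op"
  where "phi_bullet X A = on_pos (\<lambda>l. dil X l A)"

definition phi_local :: "('w, 'h::complex_hilbert) free_field \<Rightarrow>
    ('i, 'h, 'k::complex_hilbert) scaling_limit \<Rightarrow> (real^2) set \<Rightarrow> 'h op set"
  where "phi_local X S Q = {A \<in> local_algebra X Q. phi_bullet X A \<in> bullet_local X S Q}"

definition phi_algebra :: "('w, 'h::complex_hilbert) free_field \<Rightarrow>
    ('i, 'h, 'k::complex_hilbert) scaling_limit \<Rightarrow> 'h op set"
  where "phi_algebra X S = closure (\<Union>Q\<in>double_cones. phi_local X S Q)"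

definition scaled_weyl ::
    "('w, 'h::complex_hilbert) free_field \<Rightarrow> (real \<Rightarrow> complex) \<Rightarrow> real \<Rightarrow> 'h op"
  where "scaled_weyl X f = on_pos (\<lambda>l. vac_rep X (weyl X (dilate l f)))"

definition limit_weyl :: "('w, 'h::complex_hilbert) free_field \<Rightarrow>
    ('i, 'h, 'k::complex_hilbert) scaling_limit \<Rightarrow> (real \<Rightarrow> complex) \<Rightarrow> 'k op"
  where "limit_weyl X S f = lim_rep_ext S (scaled_weyl X f)"

definition charge_functions :: "real \<Rightarrow> real \<Rightarrow> (nat \<Rightarrow> real \<Rightarrow> real) \<Rightarrow> bool"
  where "charge_functions q a u \<longleftrightarrow>
    (\<forall>n. (\<lambda>x. complex_of_real (u n x)) \<in> test_functions) \<and>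
    (\<forall>n x. x \<le> - a \<longrightarrow> u n x = 0) \<and>
    (\<forall>n k x. - a < x \<and> x < a \<longrightarrow> u n x = u k x) \<and>
    (\<forall>n x. a \<le> x \<and> x \<le> real n * a \<longrightarrow> u n x = q)"

definition ifun :: "(real \<Rightarrow> real) \<Rightarrow> real \<Rightarrow> complex"
  where "ifun v = (\<lambda>x. \<i> * complex_of_real (v x))"

definition is_sector_automorphism :: "('w, 'h::complex_hilbert) free_field \<Rightarrow>
    ('i, 'h, 'k::complex_hilbert) scaling_limit \<Rightarrow> (nat \<Rightarrow> real \<Rightarrow> real) \<Rightarrow>
    ('k op \<Rightarrow> 'k op) \<Rightarrow> bool"
  where "is_sector_automorphism X S u \<rho> \<longleftrightarrow>
    cstar_automorphism (operator_algebra (limit_quasilocal X S)) \<rho> \<and>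
    (\<forall>Q\<in>double_cones. \<forall>A\<in>limit_local X S Q.
      (\<lambda>n. adj (limit_weyl X S (ifun (u n))) o\<^sub>L A o\<^sub>L limit_weyl X S (ifun (u n))) \<longlonglongrightarrow> \<rho> A)"

definition rho_approx :: "('w, 'h::complex_hilbert) free_field \<Rightarrow>
    (nat \<Rightarrow> real \<Rightarrow> real) \<Rightarrow> real \<Rightarrow> 'h op \<Rightarrow> nat \<Rightarrow> 'h op"
  where "rho_approx X u l B n =
    adj (scaled_weyl X (ifun (u n)) l) o\<^sub>L dil X l B o\<^sub>L scaled_weyl X (ifun (u n)) l"

definition rho_scale :: "('w, 'h::complex_hilbert) free_field \<Rightarrow>
    (nat \<Rightarrow> real \<Rightarrow> real) \<Rightarrow> real \<Rightarrow> 'h op \<Rightarrow> 'h op"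
  where "rho_scale X u l B = lim (rho_approx X u l B)"

definition rho_bullet :: "('w, 'h::complex_hilbert) free_field \<Rightarrow>
    (nat \<Rightarrow> real \<Rightarrow> real) \<Rightarrow> 'h op \<Rightarrow> real \<Rightarrow> 'h op"
  where "rho_bullet X u B = on_pos (\<lambda>l. rho_scale X u l B)"

end

theory Submission
 imports Defs
begin

text \<open>The charge functions \<open>u\<^sub>n\<close> and \<open>u\<^sub>N\<close> agree on \<open>x < N a\<close> when \<open>N \<le> n\<close>, and the test function
 \<open>\<delta>\<^sub>\<lambda>(i u\<^sub>n)\<close> is \<open>i u\<^sub>n(x / \<lambda>)\<close>. For \<open>B\<close> in a local algebra, \<open>\<phi>\<^sub>\<lambda>(B)\<close> is localized in a region that scales
 with \<open>\<lambda>\<close>. Hence by locality at time zero the operators \<open>W(\<delta>\<^sub>\<lambda> i u\<^sub>n)\<^sup>* \<phi>\<^sub>\<lambda>(B) W(\<delta>\<^sub>\<lambda> i u\<^sub>n)\<close> do not depend on \<open>n\<close>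
 from some \<open>n = N\<close> on, and the same \<open>N\<close> serves for all \<open>\<lambda>\<close> (\<open>conj_W_stable\<close>, \<open>stable_index_exists\<close>). So
 \<open>\<rho>\<^sup>\<bullet>(B) = W(i u\<^sub>N)\<^sup>* \<phi>\<^sup>\<bullet>(B) W(i u\<^sub>N)\<close> is a product in \<open>\<A>\<^sup>\<bullet>\<close>, which \<open>\<pi>\<^sup>\<bullet>\<close> maps to
 \<open>W\<^sub>0(i u\<^sub>N)\<^sup>* \<pi>\<^sup>\<bullet>(\<phi>\<^sup>\<bullet>(B)) W\<^sub>0(i u\<^sub>N)\<close>. All maps involved are contractive, because a morphism of C*-algebras is
 (\<open>cstar_morphism_norm_le\<close>); this gives (ii), and existence of the limits and (i) pass from the
 union of the local algebras to its closure (\<open>rho_scale_morphism\<close>, \<open>ext_rho_bullet\<close>).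

 For (iii), \<open>\<rho>\<^sup>\<bullet>(B)\<close> is localized for local \<open>B\<close>, but \<open>\<pi>\<^sup>\<bullet>\<close> is only known to send \<open>\<A>\<^sup>\<bullet>\<close> into the
 quasi-local algebra of the limit: the local limit algebras are generated by the scaling algebra,
 whose elements are continuous under the symmetry group. A function \<open>A\<close> in \<open>\<A>\<^sup>\<bullet>\<close> with values in
 the scaled algebras of a fixed cone is therefore regularized: at scale \<open>\<lambda>\<close> it is averaged over
 lightlike translations by at most \<open>\<lambda> d\<close> and over boosts by at most \<open>d\<close>. The averages lie in the
 scaling algebra of a larger cone, and as \<open>d\<close> tends to \<open>0\<close> their images converge strongly to
 \<open>\<pi>\<^sup>\<bullet>(A)\<close>, so that \<open>\<pi>\<^sup>\<bullet>(A)\<close> lies in the bicommutant (\<open>ext_localized\<close>). The symmetry group need not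
 contain all boosts; its rapidities form a subgroup of the reals, which is discrete or dense, and
 in the first case the average over boosts is left out.

 Both arguments need the geometry of the net. The action of the Poincare group on test functions,
 given by Fourier transforms, is identified with the solution of the Cauchy problem of the
 Klein-Gordon equation, written down explicitly with a Bessel function in light-cone coordinates
 (\<open>poincare_tau_eq\<close>). Finite propagation speed, isotony and covariance can be read off from it. The
 Poincare automorphisms are implemented by unitaries: on Weyl operators by the invariance of the
 vacuum, and on the local von Neumann algebras by normality (\<open>normal_on_bicommutant_eq\<close>). Strong
 continuity of these unitaries comes from the continuity of the one-particle norm and of the
 symplectic form along the action.\<close>

text \<open>Notation: composition \<open>oo\<close> of operators, application \<open>ap\<close> of an operator (usually a coercion), the
 test functions \<open>\<D>\<close>, the double cones \<open>\<K>\<close>, the bounded complex-linear operators \<open>\<B>\<close>, and the bounded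
 functions \<open>\<F>\<close> from the scales to operators. \<open>dc r\<close> is the double cone over \<open>(- r, r)\<close>.\<close>

no_notation fps_compose (infixl "oo" 55)
notation blinfun_compose (infixl "oo" 55)
notation LIMSEQ ("((_)/ ---> (_))" [60, 60] 60)
notation test_functions ("\<D>")
notation double_cones ("\<K>")
notation bounded_ops ("\<B>")
notation bounded_functions ("\<F>")
notation blinfun_apply ("ap")
abbreviation "dc r \<equiv> base_cone (- r) r"

section \<open>Geometry of complex Hilbert spaces\<close>

lemma scaleC_zero_right [simp]: "c *\<^sub>C (0::'h::complex_hilbert) = 0"
 using scaleC_add_right[of c 0 0] by simp

lemma scaleC_zero_left [simp]: "0 *\<^sub>C (x::'h::complex_hilbert) = 0"
 using scaleC_add_left[of 0 0 x] by simp

lemma scaleC_one [simp]: "1 *\<^sub>C (x::'h::complex_hilbert) = x"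
 using scaleR_scaleC[of 1 x] by simp

lemma scaleC_minus_right: "c *\<^sub>C (- x) = - (c *\<^sub>C (x::'h::complex_hilbert))"
 using scaleC_add_right[of c x "- x"] by (simp add: eq_neg_iff_add_eq_0 add.commute)

lemma scaleC_minus_left [simp]: "(- c) *\<^sub>C x = - (c *\<^sub>C (x::'h::complex_hilbert))"
 using scaleC_add_left[of c "- c" x] by (simp add: eq_neg_iff_add_eq_0 add.commute)

lemma scaleC_diff_right: "c *\<^sub>C (x - y) = c *\<^sub>C x - c *\<^sub>C (y::'h::complex_hilbert)"
 using scaleC_add_right[of c x "- y"] by (simp add: scaleC_minus_right)

lemma cinner_add_left: "cinner (x + y) z = cinner x z + cinner y (z::'h::complex_hilbert)"
 by (metis cinner_commute cinner_add_right complex_cnj_add)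

lemma cinner_scaleC_left: "cinner (c *\<^sub>C x) y = cnj c * cinner x (y::'h::complex_hilbert)"
 by (metis cinner_commute cinner_scaleC_right complex_cnj_mult)

lemma cinner_scaleR_right: "cinner x (r *\<^sub>R y) = of_real r * cinner x (y::'h::complex_hilbert)"
 by (simp add: scaleR_scaleC cinner_scaleC_right)

lemma cinner_scaleR_left: "cinner (r *\<^sub>R x) y = of_real r * cinner x (y::'h::complex_hilbert)"
 by (simp add: scaleR_scaleC cinner_scaleC_left)

lemma cinner_minus_right: "cinner x (- y) = - cinner x (y::'h::complex_hilbert)"
 using cinner_scaleR_right[of x "-1" y] by simp

lemma cinner_minus_left: "cinner (- x) y = - cinner x (y::'h::complex_hilbert)"
 using cinner_scaleR_left[of "-1" x y] by simp

lemma cinner_diff_right: "cinner x (y - z) = cinner x y - cinner x (z::'h::complex_hilbert)"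
 using cinner_add_right[of x y "- z"] by (simp add: cinner_minus_right)

lemma cinner_diff_left: "cinner (x - y) z = cinner x z - cinner y (z::'h::complex_hilbert)"
 using cinner_add_left[of x "- y" z] by (simp add: cinner_minus_left)

lemma cinner_zero_right [simp]: "cinner x (0::'h::complex_hilbert) = 0"
 using cinner_scaleR_right[of x 0 0] by simp

lemma cinner_zero_left [simp]: "cinner (0::'h::complex_hilbert) x = 0"
 using cinner_scaleR_left[of 0 0 x] by simp

lemma Re_cinner_self: "Re (cinner x x) = (norm (x::'h::complex_hilbert))^2"
 by (simp add: norm_eq_sqrt_cinner cinner_ge_zero)

lemma cinner_self: "cinner x x = of_real ((norm (x::'h::complex_hilbert))^2)"
 using cinner_commute[of x x] complex_eq_iff Re_cinner_self by fastforce

lemma norm_scaleC: "norm (c *\<^sub>C x) = cmod c * norm (x::'h::complex_hilbert)"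
proof -
 have "cinner (c *\<^sub>C x) (c *\<^sub>C x) = (c * cnj c) * cinner x x"
  by (simp add: cinner_scaleC_left cinner_scaleC_right)
 hence "cinner (c *\<^sub>C x) (c *\<^sub>C x) = of_real ((cmod c)^2) * cinner x x"
  by (simp only: complex_norm_square)
 hence "(norm (c *\<^sub>C x))^2 = (cmod c * norm x)^2"
  by (metis Re_cinner_self cinner_self of_real_mult Re_complex_of_real power_mult_distrib)
 thus ?thesis by simp
qed

lemma cauchy_schwarz: "cmod (cinner x y) <= norm x * norm (y::'h::complex_hilbert)"
proof (cases "x = 0")
 case False
 define c n where "c = cinner x y" and "n = (norm x)^2"
 have n: "n > 0" using False by (simp add: n_def)
 have yx: "cinner y x = cnj c" unfolding c_def by (rule cinner_commute)
 define v where "v = of_real n *\<^sub>C y - c *\<^sub>C x"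
 have xx: "cinner x x = of_real n" and yy: "cinner y y = of_real ((norm y)^2)"
  by (simp_all only: cinner_self n_def)
 have "cinner v v = of_real n * of_real n * of_real ((norm y)^2) - of_real n * (c * cnj c)"
  unfolding v_def
  by (simp only: cinner_diff_left cinner_diff_right cinner_scaleC_left cinner_scaleC_right
    xx yy yx c_def[symmetric]) (simp add: algebra_simps)
 hence "cinner v v = of_real (n * n * (norm y)^2 - n * (cmod c)^2)"
  by (simp only: complex_norm_square[symmetric] of_real_mult of_real_diff)
 hence "Re (cinner v v) = n * n * (norm y)^2 - n * (cmod c)^2"
  by (simp only: Re_complex_of_real)
 hence "0 <= n * (n * (norm y)^2 - (cmod c)^2)"
  using cinner_ge_zero[of v] by (simp add: algebra_simps)
 hence "(cmod c)^2 <= (norm x * norm y)^2"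
  using n by (simp add: zero_le_mult_iff n_def power_mult_distrib)
 thus ?thesis unfolding c_def by simp
qed simp

lemma bounded_bilinear_cinner: "bounded_bilinear (cinner :: 'h::complex_hilbert => 'h => complex)"
 by (rule bounded_bilinear.intro)
  (auto simp: cinner_add_left cinner_add_right cinner_scaleR_left cinner_scaleR_right
   scaleR_conv_of_real intro!: exI[of _ 1] cauchy_schwarz)

lemma bounded_bilinear_scaleC:
 "bounded_bilinear (scaleC :: complex => 'h::complex_hilbert => 'h)"
 by (rule bounded_bilinear.intro)
  (auto simp: scaleC_add_left scaleC_add_right scaleR_scaleC[where 'a='h] scaleC_scaleC norm_scaleC
   scaleR_conv_of_real mult.commute intro!: exI[of _ 1])

lemmas tendsto_cinner = bounded_bilinear.tendsto[OF bounded_bilinear_cinner]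
lemmas tendsto_scaleC = bounded_bilinear.tendsto[OF bounded_bilinear_scaleC]
lemmas bounded_linear_scaleC = bounded_bilinear.bounded_linear_right[OF bounded_bilinear_scaleC]
lemmas bounded_linear_cinner = bounded_bilinear.bounded_linear_right[OF bounded_bilinear_cinner]

lemma cinner_eqI: "(!!y. cinner y x = cinner y x') ==> x = (x'::'h::complex_hilbert)"
 using cinner_self[of "x - x'"] by (simp add: cinner_diff_right)

lemma norm_diff_sq: "(norm (x - y))^2 = (norm x)^2 + (norm y)^2 - 2 * Re (cinner x (y::'h::complex_hilbert))"
proof -
 have "cinner y x = cnj (cinner x y)" by (rule cinner_commute)
 moreover have "(norm (x - y))^2 = Re (cinner (x - y) (x - y))" by (simp add: Re_cinner_self)
 ultimately show ?thesis
  by (simp add: cinner_diff_left cinner_diff_right Re_cinner_self)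
qed

lemma parallelogram:
 "(norm (x + y))^2 + (norm (x - y))^2 = 2 * (norm x)^2 + 2 * (norm (y::'h::complex_hilbert))^2"
 using norm_diff_sq[of x y] norm_diff_sq[of x "- y"] by (simp add: cinner_minus_right)

text \<open>Orthogonal projection onto a closed complex subspace: the minimising sequence is Cauchy by
 the parallelogram law.\<close>

lemma orthogonal_projection_exists:
 fixes V :: "'h::complex_hilbert set"
 assumes "closed V" and V0: "0 \<in> V" and Vadd: "!!x y. x \<in> V ==> y \<in> V ==> x + y \<in> V"
  and Vsc: "!!c x. x \<in> V ==> c *\<^sub>C x \<in> V"
 shows "\<exists>p\<in>V. \<forall>v\<in>V. cinner v (x - p) = 0"
proof -
 define d where "d = infdist x V"
 have dle: "d <= norm (x - v)" if "v \<in> V" for v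
  using infdist_le[OF that, of x] by (simp add: d_def dist_norm)
 have d0: "d >= 0" by (simp add: d_def infdist_nonneg)
 have "\<exists>v\<in>V. (norm (x - v))^2 < d^2 + 1 / real (Suc n)" for n
 proof -
  have "d < sqrt (d^2 + 1 / real (Suc n))"
   by (rule real_less_rsqrt) (simp add: )
  then obtain v where "v \<in> V" "dist x v < sqrt (d^2 + 1 / real (Suc n))"
   using V0 infdist_attains_inf unfolding d_def infdist_def
   by (auto simp: cINF_less_iff split: if_splits)
  thus ?thesis
   by (metis dist_norm norm_ge_zero real_less_lsqrt real_sqrt_less_iff real_sqrt_abs
     abs_of_nonneg real_sqrt_pow2 zero_le_dist not_less real_le_rsqrt)
 qed
 then obtain v where v: "!!n. v n \<in> V" "!!n. (norm (x - v n))^2 < d^2 + 1 / real (Suc n)"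
  by metis
 have close: "(norm (v i - v j))^2 <= 2 / real (Suc i) + 2 / real (Suc j)" for i j
 proof -
  have "(1/2) *\<^sub>R (v i + v j) \<in> V"
   unfolding scaleR_scaleC by (intro Vsc Vadd v)
  hence "d^2 <= (norm (x - (1/2) *\<^sub>R (v i + v j)))^2"
   using dle d0 by simp
  also have "x - (1/2) *\<^sub>R (v i + v j) = (1/2) *\<^sub>R ((x - v i) + (x - v j))"
   by (simp add: algebra_simps flip: scaleR_add_left)
  finally have "4 * d^2 <= (norm ((x - v i) + (x - v j)))^2"
   by (simp add: power_divide)
  moreover have "norm (v i - v j) = norm ((x - v i) - (x - v j))"
   by (simp add: norm_minus_commute)
  ultimately show ?thesis
   using parallelogram[of "x - v i" "x - v j"] v(2)[of i] v(2)[of j] by (simp add: )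
 qed
 have "Cauchy v"
 proof (rule CauchyI)
  fix e :: real assume e: "e > 0"
  obtain N where N: "1 / real (Suc N) < e^2 / 4"
   using nat_approx_posE[of "e^2 / 4"] e by auto
  have "norm (v i - v j) < e" if "i >= N" "j >= N" for i j
  proof -
   have "1 / real (Suc i) <= 1 / real (Suc N)" "1 / real (Suc j) <= 1 / real (Suc N)"
    using that by (simp_all add: frac_le)
   hence "(norm (v i - v j))^2 < e^2"
    using close[of i j] N by simp
   thus ?thesis using e by (simp add: power2_less_imp_less)
  qed
  thus "\<exists>M. \<forall>m\<ge>M. \<forall>n\<ge>M. norm (v m - v n) < e" by blast
 qed
 then obtain p where p: "v ---> p" using Cauchy_convergent_iff convergent_def by blast
 have pV: "p \<in> V" using closed_sequentially[OF \<open>closed V\<close> v(1) p] .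
 have "(\<lambda>n. d^2 + 1 / real (Suc n)) ---> d\<^sup>2 + 0"
  by (intro tendsto_intros LIMSEQ_Suc[OF lim_1_over_n])
 hence pd: "(norm (x - p))^2 <= d^2"
  using v(2) by (intro LIMSEQ_le[of "\<lambda>n. (norm (x - v n))^2" _ "\<lambda>n. d^2 + 1 / real (Suc n)"]
    tendsto_intros p) (auto intro: less_imp_le)
 have "cinner w (x - p) = 0" if w: "w \<in> V" for w
 proof (cases "w = 0")
  case False
  define c where "c = cinner w (x - p) / of_real ((norm w)^2)"
  have "c *\<^sub>C w + p \<in> V" by (intro Vadd Vsc w pV)
  hence "d^2 <= (norm ((x - p) - c *\<^sub>C w))^2"
   using dle[of "c *\<^sub>C w + p"] d0 by (auto simp: algebra_simps intro: power_mono)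
  also have "... = (norm (x - p))^2 + (cmod c)^2 * (norm w)^2 - 2 * Re (c * cinner (x - p) w)"
   by (simp add: norm_diff_sq norm_scaleC cinner_scaleC_right power_mult_distrib)
  also have "cinner (x - p) w = cnj c * of_real ((norm w)^2)"
   by (simp add: c_def cinner_commute[of "x - p" w])
  also have "Re (c * (cnj c * of_real ((norm w)^2))) = (cmod c)^2 * (norm w)^2"
   by (metis complex_norm_square of_real_mult mult.assoc Re_complex_of_real)
  finally have "(cmod c)^2 * (norm w)^2 <= 0" using pd by (simp add: mult.commute)
  hence "c = 0" using False by (simp add: mult_le_0_iff)
  thus ?thesis using False by (simp add: c_def)
 qed simp
 thus ?thesis using pV by blast
qed

lemma riesz_representation:
 fixes \<phi> :: "'h::complex_hilbert => complex"
 assumes lin: "bounded_linear \<phi>" and sc: "!!c x. \<phi> (c *\<^sub>C x) = c * \<phi> x"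
 shows "\<exists>z. \<forall>x. \<phi> x = cinner z x"
proof (cases "\<forall>x. \<phi> x = 0")
 case False
 interpret bounded_linear \<phi> by (rule lin)
 define V where "V = {x. \<phi> x = 0}"
 have clV: "closed V" unfolding V_def
  by (intro closed_Collect_eq linear_continuous_on lin continuous_intros)
 obtain x0 where x0: "\<phi> x0 ~= 0" using False by auto
 obtain p where p: "p \<in> V" "\<forall>v\<in>V. cinner v (x0 - p) = 0"
  using orthogonal_projection_exists[OF clV, of x0] by (auto simp: V_def zero add sc)
 define e where "e = x0 - p"
 have e: "\<phi> e ~= 0" using x0 p(1) by (simp add: e_def diff V_def)
 hence e0: "e ~= 0" by auto
 have "\<phi> x = cinner (cnj (\<phi> e / of_real ((norm e)^2)) *\<^sub>C e) x" for x
 proof -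
  have "x - (\<phi> x / \<phi> e) *\<^sub>C e \<in> V" using e by (simp add: V_def diff sc)
  hence "cinner e (x - (\<phi> x / \<phi> e) *\<^sub>C e) = 0"
   using p(2) unfolding e_def[symmetric] by (metis cinner_commute complex_cnj_zero)
  hence "cinner e x = \<phi> x / \<phi> e * of_real ((norm e)^2)"
   by (simp add: cinner_diff_right cinner_scaleC_right cinner_self)
  thus ?thesis using e e0 by (simp add: cinner_scaleC_left)
 qed
 thus ?thesis by blast
qed (auto intro: exI[of _ 0])

section \<open>Bounded operators and adjoints\<close>

text \<open>Complex multiples of operators: the type of bounded operators is only a real vector space.\<close>

definition op_scale :: "complex => 'h::complex_hilbert op => 'h op"
 where "op_scale c A = Blinfun (\<lambda>x. c *\<^sub>C A x)"

lemma op_scale_apply [simp]: "op_scale c A x = c *\<^sub>C A x"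
 by (simp add: bounded_linear_compose[OF bounded_linear_scaleC] blinfun.bounded_linear_right op_scale_def bounded_linear_Blinfun_apply)

lemma bounded_opsI: "(!!c x. ap A (c *\<^sub>C x) = c *\<^sub>C ap A x) ==> A \<in> \<B>"
 by (simp add: bounded_ops_def)

lemma bounded_opsD: "A \<in> \<B> ==> A (c *\<^sub>C x) = c *\<^sub>C A x"
 by (simp add: bounded_ops_def)

lemma bounded_ops_intros [simp, intro]:
 shows "0 \<in> \<B>" "id_blinfun \<in> \<B>"
  "A \<in> \<B> ==> B \<in> \<B> ==> A + B \<in> \<B>"
  "A \<in> \<B> ==> B \<in> \<B> ==> A - B \<in> \<B>"
  "A \<in> \<B> ==> B \<in> \<B> ==> A oo B \<in> \<B>"
  "A \<in> \<B> ==> op_scale c A \<in> \<B>"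
 by (auto simp: bounded_ops_def plus_blinfun.rep_eq minus_blinfun.rep_eq scaleC_add_right
   scaleC_diff_right scaleC_scaleC mult.commute)

lemma tendsto_blinfun_apply_left:
 "(F \<longlongrightarrow> A) G ==> ((\<lambda>i. ap (F i) x) \<longlongrightarrow> ap A x) G"
 by (intro blinfun.tendsto tendsto_const)

lemma closed_bounded_ops: "closed (\<B> :: 'h::complex_hilbert op set)"
 unfolding bounded_ops_def Collect_all_eq
 by (intro closed_INT ballI closed_Collect_eq continuous_intros
   bounded_linear.continuous_on[OF bounded_linear_scaleC])

text \<open>Existence of adjoints, by the Riesz representation theorem.\<close>

lemma adj_exists:
 assumes A: "A \<in> (\<B> :: 'h::complex_hilbert op set)"
 shows "\<exists>B\<in>\<B>. \<forall>x y. cinner (B x) y = cinner x (A y)"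
proof -
 have "\<exists>z. \<forall>y. cinner x (A y) = cinner z y" for x
  by (intro riesz_representation bounded_linear_compose[OF bounded_linear_cinner]
    blinfun.bounded_linear_right) (simp add: bounded_opsD[OF A] cinner_scaleC_right)
 then obtain b where b: "!!x y. cinner x (A y) = cinner (b x) y" by metis
 have b': "cinner y (b x) = cinner (A y) x" for x y
  by (metis b cinner_commute)
 have badd: "b (x + y) = b x + b y" for x y
  by (rule cinner_eqI) (simp add: b' cinner_add_right)
 have bsc: "b (c *\<^sub>C x) = c *\<^sub>C b x" for c x
  by (rule cinner_eqI) (simp add: b' cinner_scaleC_right)
 have bn: "norm (b x) <= norm A * norm x" for x
 proof -
  have "(norm (b x))^2 = Re (cinner (A (b x)) x)"
   by (simp add: Re_cinner_self flip: b')
  also have "... <= norm (A (b x)) * norm x"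
   using complex_Re_le_cmod cauchy_schwarz order_trans by blast
  also have "... <= norm A * norm (b x) * norm x"
   by (intro mult_right_mono norm_blinfun) simp
  finally show ?thesis
   by (cases "norm (b x) = 0") (auto simp: power2_eq_square mult_ac)
 qed
 have bl: "bounded_linear b"
  by (rule bounded_linear_intro[where K = "norm A"])
   (use bn in "auto simp: badd bsc scaleR_scaleC mult.commute")
 show ?thesis
  by (rule bexI[of _ "Blinfun b"])
   (auto simp: bounded_linear_Blinfun_apply[OF bl] b bsc intro: bounded_opsI)
qed

lemma adj_eqI:
 assumes "B \<in> \<B>"
  "!!x y. cinner (ap B x) y = cinner x (ap A (y::'h::complex_hilbert))"
 shows "adj A = B"
 unfolding adj_def
proof (rule the_equality)
 fix C assume C: "C \<in> \<B> \<and>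
  (\<forall>x y. cinner (ap C x) y = cinner x (ap A y))"
 show "C = B"
  by (rule blinfun_eqI, rule cinner_eqI) (metis C assms(2) cinner_commute)
qed (use assms in auto)

lemma adj_bounded_ops [simp, intro]: "A \<in> \<B> ==> adj A \<in> \<B>"
 using adj_exists[of A] adj_eqI by metis

lemma cinner_adj_left:
 "A \<in> \<B> ==> cinner (adj A x) y = cinner x (A y)"
 using adj_exists[of A] adj_eqI by metis

lemma cinner_adj_right:
 "A \<in> \<B> ==> cinner x (adj A y) = cinner (A x) y"
 by (metis cinner_adj_left cinner_commute)

lemma adj_adj [simp]: "A \<in> \<B> ==> adj (adj A) = A"
 by (intro adj_eqI) (auto simp: cinner_adj_right)

lemma adj_id [simp]: "adj id_blinfun = id_blinfun"
 by (intro adj_eqI) auto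

lemma adj_zero [simp]: "adj 0 = 0"
 by (intro adj_eqI) auto

lemma adj_compose: "A \<in> \<B> ==> B \<in> \<B> ==> adj (A oo B) = adj B oo adj A"
 by (intro adj_eqI) (auto simp: cinner_adj_left)

lemma adj_add: "A \<in> \<B> ==> B \<in> \<B> ==> adj (A + B) = adj A + adj B"
 by (intro adj_eqI) (auto simp: cinner_adj_left plus_blinfun.rep_eq cinner_add_left cinner_add_right)

lemma adj_diff: "A \<in> \<B> ==> B \<in> \<B> ==> adj (A - B) = adj A - adj B"
 by (intro adj_eqI) (auto simp: cinner_adj_left minus_blinfun.rep_eq cinner_diff_left cinner_diff_right)

lemma adj_scale: "A \<in> \<B> ==> adj (op_scale c A) = op_scale (cnj c) (adj A)"
 by (intro adj_eqI) (auto simp: cinner_adj_left cinner_scaleC_left cinner_scaleC_right)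

lemma norm_adj_compose_self:
 assumes A: "A \<in> \<B>"
 shows "norm (adj A oo A) = (norm (A::'h::complex_hilbert op))^2"
proof (rule antisym)
 have sq: "(norm (B x))^2 <= norm (adj B oo B) * (norm x)^2"
  if B: "B \<in> \<B>" for B :: "'h op" and x
 proof -
  have "(norm (B x))^2 = Re (cinner x ((adj B oo B) x))"
   by (simp add: cinner_adj_right[OF B] Re_cinner_self)
  also have "... <= norm x * norm ((adj B oo B) x)"
   using complex_Re_le_cmod cauchy_schwarz order_trans by blast
  also have "... <= norm x * (norm (adj B oo B) * norm x)"
   by (intro mult_left_mono norm_blinfun) simp
  finally show ?thesis by (simp add: power2_eq_square mult_ac)
 qed
 have sq': "norm B <= sqrt (norm (adj B oo B))" if B: "B \<in> \<B>" for B :: "'h op"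
 proof (rule norm_blinfun_bound)
  fix x
  have "norm (B x) = sqrt ((norm (B x))^2)" by simp
  also have "... <= sqrt (norm (adj B oo B) * (norm x)^2)"
   by (rule real_sqrt_le_mono[OF sq[OF B]])
  finally show "norm (B x) <= sqrt (norm (adj B oo B)) * norm x"
   by (simp add: real_sqrt_mult)
 qed simp
 have le: "(norm B)^2 <= norm (adj B oo B)" if B: "B \<in> \<B>" for B :: "'h op"
  using power_mono[OF sq'[OF B], of 2] by simp
 have na: "norm B <= norm (adj B)" if B: "B \<in> \<B>" for B :: "'h op"
 proof -
  have "(norm B)^2 <= norm (adj B) * norm B"
   using le[OF B] norm_blinfun_compose[of "adj B" B] by linarith
  thus ?thesis by (cases "norm B = 0") (auto simp: power2_eq_square)
 qed
 have "norm (adj A) <= norm A" using na[of "adj A"] A by simp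
 hence "norm (adj A) * norm A <= norm A * norm A" by (intro mult_right_mono) auto
 thus "norm (adj A oo A) <= (norm A)^2"
  using norm_blinfun_compose[of "adj A" A] by (simp add: power2_eq_square)
 show "(norm A)^2 <= norm (adj A oo A)" by (rule le[OF A])
qed

lemma norm_adj:
 assumes A: "A \<in> \<B>" shows "norm (adj A) = norm (A::'h::complex_hilbert op)"
proof -
 have na: "norm B <= norm (adj B)" if B: "B \<in> \<B>" for B :: "'h op"
 proof -
  have "(norm B)^2 <= norm (adj B) * norm B"
   using norm_adj_compose_self[OF B] norm_blinfun_compose[of "adj B" B] by linarith
  thus ?thesis by (cases "norm B = 0") (auto simp: power2_eq_square)
 qed
 show ?thesis using na[OF A] na[of "adj A"] A by simp
qed

lemma tendsto_adj:
 assumes "(F \<longlongrightarrow> A) G" "!!i. F i \<in> \<B>" "A \<in> \<B>"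
 shows "((\<lambda>i. adj (F i :: 'h::complex_hilbert op)) \<longlongrightarrow> adj A) G"
proof -
 have "((\<lambda>i. norm (F i - A)) \<longlongrightarrow> 0) G"
  using assms(1) by (simp add: LIM_zero_iff tendsto_norm_zero)
 hence "((\<lambda>i. norm (adj (F i) - adj A)) \<longlongrightarrow> 0) G"
  using assms(2,3) by (simp add: norm_adj flip: adj_diff)
 thus ?thesis using LIM_zero_cancel tendsto_norm_zero_iff by blast
qed

lemma norm_compose3_le:
 "norm (A oo B oo C) <= norm A * norm B * norm C"
 by (meson mult_right_mono norm_blinfun_compose norm_ge_zero order_trans)

lemma cstar_algebra_operator_algebra:
 assumes M: "M \<subseteq> (\<B> :: 'h::complex_hilbert op set)" "closed M" "0 \<in> M" "id_blinfun \<in> M"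
  and add: "!!x y. x \<in> M ==> y \<in> M ==> x + y \<in> M"
  and comp: "!!x y. x \<in> M ==> y \<in> M ==> x oo y \<in> M"
  and sc: "!!c x. x \<in> M ==> op_scale c x \<in> M"
  and star: "!!x. x \<in> M ==> adj x \<in> M"
 shows "cstar_algebra (operator_algebra M)"
proof -
 have bo: "x \<in> M ==> x \<in> \<B>" for x using M(1) by auto
 have neg: "op_scale (-1) x = - x" for x :: "'h op"
  by (rule blinfun_eqI)
   (simp add: uminus_blinfun.rep_eq)
 have nsc: "norm (op_scale c x) = cmod c * norm x" for c and x :: "'h op"
 proof -
  have le: "norm (op_scale c x) <= cmod c * norm x" for c and x :: "'h op"
   by (rule norm_blinfun_bound)
    (auto simp: norm_scaleC mult.assoc intro!: mult_left_mono norm_blinfun)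
  show ?thesis
  proof (cases "c = 0")
   case True thus ?thesis using le[of 0 x] by simp
  next
   case False
   have "x = op_scale (inverse c) (op_scale c x)"
    using False by (intro blinfun_eqI) (simp add: scaleC_scaleC)
   hence "norm x <= inverse (cmod c) * norm (op_scale c x)"
    using le[of "inverse c" "op_scale c x"] by (simp add: norm_inverse)
   hence "cmod c * norm x <= norm (op_scale c x)"
    using False by (simp add: field_simps)
   thus ?thesis using le[of c x] by simp
  qed
 qed
 have complete: "\<exists>x\<in>M. (\<lambda>n. norm (s n - x)) ---> 0"
  if s: "\<forall>n::nat. s n \<in> M" "\<forall>e>0. \<exists>N. \<forall>i\<ge>N. \<forall>j\<ge>N. norm (s i - s j) < e" for s
  by (metis s(2) CauchyI Cauchy_convergent_iff convergent_def closed_sequentially M(2) s(1) LIM_zero tendsto_norm_zero)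
 show ?thesis
  unfolding cstar_algebra_def operator_algebra_def adiff_def star_alg.simps op_scale_def[symmetric]
  apply (intro conjI ballI allI impI)
  apply (auto simp: assms bo neg nsc norm_adj_compose_self adj_compose adj_add adj_scale
    norm_triangle_ineq norm_blinfun_compose plus_blinfun.rep_eq scaleC_scaleC scaleC_add_left
    scaleC_add_right bounded_opsD blinfun.add_right blinfun.add_left intro!: blinfun_eqI complete)
  done
qed

lemma operator_algebra_simps [simp]:
 "carr (operator_algebra M) = M" "azero (operator_algebra M) = 0"
 "aone (operator_algebra M) = id_blinfun" "aadd (operator_algebra M) x y = x + y"
 "amult (operator_algebra M) x y = x oo y" "ascale (operator_algebra M) c x = op_scale c x"
 "astar (operator_algebra M) x = adj x" "anorm (operator_algebra M) x = norm x"
 by (simp_all add: operator_algebra_def op_scale_def)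

section \<open>Morphisms into operator algebras are contractive\<close>

context
 fixes A :: "'a star_alg"
 assumes A: "cstar_algebra A"
begin

lemma cstar_closed:
 shows "azero A \<in> carr A" "aone A \<in> carr A"
  "x \<in> carr A ==> y \<in> carr A ==> aadd A x y \<in> carr A"
  "x \<in> carr A ==> y \<in> carr A ==> amult A x y \<in> carr A"
  "x \<in> carr A ==> ascale A c x \<in> carr A"
  "x \<in> carr A ==> astar A x \<in> carr A"
  "x \<in> carr A ==> y \<in> carr A ==> adiff A x y \<in> carr A"
 using A unfolding cstar_algebra_def adiff_def by simp_all

lemma cstar_add_assoc: "x \<in> carr A ==> y \<in> carr A ==> z \<in> carr A ==>
  aadd A (aadd A x y) z = aadd A x (aadd A y z)"
 by (insert A, unfold cstar_algebra_def, elim conjE, blast)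

lemma cstar_add_comm: "x \<in> carr A ==> y \<in> carr A ==> aadd A x y = aadd A y x"
 using A by (simp only: cstar_algebra_def)

lemma cstar_add_zero: "x \<in> carr A ==> aadd A (azero A) x = x"
 by (insert A, unfold cstar_algebra_def, elim conjE, blast)

lemma cstar_diff_self: "x \<in> carr A ==> adiff A x x = azero A"
 using A by (simp only: cstar_algebra_def)

lemma cstar_scale_one: "x \<in> carr A ==> ascale A 1 x = x"
 using A by (simp only: cstar_algebra_def)

lemma cstar_scale_scale: "x \<in> carr A ==> ascale A c (ascale A d x) = ascale A (c * d) x"
 using A by (simp only: cstar_algebra_def)

lemma cstar_scale_add_left: "x \<in> carr A ==> ascale A (c + d) x = aadd A (ascale A c x) (ascale A d x)"
 using A by (simp only: cstar_algebra_def)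

lemma cstar_scale_add: "x \<in> carr A ==> y \<in> carr A ==>
  ascale A c (aadd A x y) = aadd A (ascale A c x) (ascale A c y)"
 using A by (simp only: cstar_algebra_def)

lemma cstar_mult_assoc: "x \<in> carr A ==> y \<in> carr A ==> z \<in> carr A ==>
  amult A (amult A x y) z = amult A x (amult A y z)"
 using A by (simp only: cstar_algebra_def)

lemma cstar_mult_add_right: "x \<in> carr A ==> y \<in> carr A ==> z \<in> carr A ==>
  amult A x (aadd A y z) = aadd A (amult A x y) (amult A x z)"
 using A by (simp only: cstar_algebra_def)

lemma cstar_mult_add: "x \<in> carr A ==> y \<in> carr A ==> z \<in> carr A ==>
  amult A (aadd A x y) z = aadd A (amult A x z) (amult A y z)"
 using A by (simp only: cstar_algebra_def)

lemma cstar_mult_scale: "x \<in> carr A ==> y \<in> carr A ==>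
  amult A (ascale A c x) y = ascale A c (amult A x y)"
 using A by (simp only: cstar_algebra_def)

lemma cstar_mult_scale_right: "x \<in> carr A ==> y \<in> carr A ==>
  amult A x (ascale A c y) = ascale A c (amult A x y)"
 using A by (simp only: cstar_algebra_def)

lemma cstar_one_mult: "x \<in> carr A ==> amult A (aone A) x = x"
 using A by (simp only: cstar_algebra_def)

lemma cstar_mult_one: "x \<in> carr A ==> amult A x (aone A) = x"
 using A by (simp only: cstar_algebra_def)

lemma cstar_star_star: "x \<in> carr A ==> astar A (astar A x) = x"
 using A by (simp only: cstar_algebra_def)

lemma cstar_star_add: "x \<in> carr A ==> y \<in> carr A ==> astar A (aadd A x y) = aadd A (astar A x) (astar A y)"
 using A by (simp only: cstar_algebra_def)

lemma cstar_star_mult: "x \<in> carr A ==> y \<in> carr A ==> astar A (amult A x y) = amult A (astar A y) (astar A x)"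
 using A by (simp only: cstar_algebra_def)

lemma cstar_star_scale: "x \<in> carr A ==> astar A (ascale A c x) = ascale A (cnj c) (astar A x)"
 using A by (simp only: cstar_algebra_def)

lemma cstar_norm_nonneg: "x \<in> carr A ==> 0 <= anorm A x"
 using A by (simp only: cstar_algebra_def)

lemma cstar_norm_zero: "x \<in> carr A ==> anorm A x = 0 \<longleftrightarrow> x = azero A"
 using A by (simp only: cstar_algebra_def)

lemma cstar_norm_scale: "x \<in> carr A ==> anorm A (ascale A c x) = cmod c * anorm A x"
 using A by (simp only: cstar_algebra_def)

lemma cstar_norm_add: "x \<in> carr A ==> y \<in> carr A ==> anorm A (aadd A x y) <= anorm A x + anorm A y"
 using A by (simp only: cstar_algebra_def)

lemma cstar_norm_mult: "x \<in> carr A ==> y \<in> carr A ==> anorm A (amult A x y) <= anorm A x * anorm A y"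
 using A by (simp only: cstar_algebra_def)

lemma cstar_norm_star: "x \<in> carr A ==> anorm A (amult A (astar A x) x) = (anorm A x)^2"
 using A by (simp only: cstar_algebra_def)

lemma cstar_complete: "(!!n::nat. s n \<in> carr A) ==>
   (\<forall>e>0. \<exists>N. \<forall>i\<ge>N. \<forall>j\<ge>N. anorm A (adiff A (s i) (s j)) < e) ==>
   (\<exists>x\<in>carr A. (\<lambda>n. anorm A (adiff A (s n) x)) ---> 0)"
proof -
 assume s: "!!n. s n \<in> carr A" "\<forall>e>0. \<exists>N. \<forall>i\<ge>N. \<forall>j\<ge>N. anorm A (adiff A (s i) (s j)) < e"
 have "\<forall>s. (\<forall>n::nat. s n \<in> carr A) -->
   (\<forall>e>0. \<exists>N. \<forall>i\<ge>N. \<forall>j\<ge>N. anorm A (adiff A (s i) (s j)) < e) -->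
   (\<exists>x\<in>carr A. (\<lambda>n. anorm A (adiff A (s n) x)) ---> 0)"
  using A unfolding cstar_algebra_def by (elim conjE) assumption
 thus ?thesis using s by simp
qed

lemma cstar_add_swap:
 assumes "p \<in> carr A" "q \<in> carr A" "r \<in> carr A" "s \<in> carr A"
 shows "aadd A (aadd A p q) (aadd A r s) = aadd A (aadd A p r) (aadd A q s)"
 using assms by (metis cstar_add_assoc cstar_add_comm cstar_closed(3))

lemma cstar_diff_zero: "x \<in> carr A ==> adiff A x (azero A) = x"
 by (metis adiff_def cstar_add_comm cstar_add_zero cstar_closed(1) cstar_closed(5) cstar_diff_self)

lemma cstar_diff_add:
 assumes "x \<in> carr A" "y \<in> carr A" "z \<in> carr A"
 shows "aadd A (adiff A x y) (adiff A y z) = adiff A x z"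
proof -
 have "aadd A (adiff A x y) (adiff A y z) = aadd A (aadd A x (ascale A (-1) y)) (aadd A (ascale A (-1) z) y)"
  using assms by (simp add: adiff_def cstar_add_comm cstar_closed)
 also have "... = aadd A (aadd A x (ascale A (-1) z)) (aadd A (ascale A (-1) y) y)"
  using assms by (intro cstar_add_swap cstar_closed)
 also have "aadd A (ascale A (-1) y) y = azero A"
  using assms cstar_diff_self[of y] by (simp add: adiff_def cstar_add_comm cstar_closed)
 finally show ?thesis
  using assms by (metis adiff_def cstar_add_comm cstar_add_zero cstar_closed(1) cstar_closed(7))
qed

lemma cstar_diff_swap:
 assumes "x \<in> carr A" "y \<in> carr A"
 shows "anorm A (adiff A y x) = anorm A (adiff A x y)"
proof -
 have "ascale A (-1) (adiff A x y) = adiff A y x"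
  using assms
  by (simp add: adiff_def cstar_scale_add cstar_scale_scale cstar_scale_one cstar_add_comm cstar_closed)
 thus ?thesis using cstar_norm_scale[OF cstar_closed(7)[OF assms], of "-1"] by simp
qed

lemma cstar_diff_eqI:
 assumes "x \<in> carr A" "y \<in> carr A" "anorm A (adiff A x y) = 0"
 shows "x = y"
 by (metis cstar_norm_zero[OF cstar_closed(7)[OF assms(1,2)]] cstar_diff_add assms cstar_closed cstar_diff_zero cstar_add_zero)

lemma cstar_norm_triangle:
 assumes "x \<in> carr A" "y \<in> carr A" "z \<in> carr A"
 shows "anorm A (adiff A x z) <= anorm A (adiff A x y) + anorm A (adiff A y z)"
 using cstar_norm_add[OF cstar_closed(7)[OF assms(1,2)] cstar_closed(7)[OF assms(2,3)]]
 by (simp add: cstar_diff_add[OF assms])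

text \<open>The Neumann series: \<open>y = 1 + a + a^2 + \<dots>\<close> is a left inverse of \<open>1 - a\<close>.\<close>

lemma cstar_neumann:
 assumes a: "a \<in> carr A" and a1: "anorm A a < 1"
 shows "\<exists>y\<in>carr A. y = aadd A (aone A) (amult A y a)"
proof -
 define F where "F y = aadd A (aone A) (amult A y a)" for y
 define s where "s n = (F ^^ n) (azero A)" for n
 define r where "r = anorm A a"
 have r: "0 <= r" "r < 1" using a a1 cstar_norm_nonneg by (auto simp: r_def)
 have Fc: "y \<in> carr A ==> F y \<in> carr A" for y using a by (simp add: F_def cstar_closed)
 have sc: "s n \<in> carr A" for n
  by (induction n) (auto simp: s_def cstar_closed intro: Fc)
 have dF: "anorm A (adiff A (F x) (F y)) <= anorm A (adiff A x y) * r"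
  if x: "x \<in> carr A" and y: "y \<in> carr A" for x y
 proof -
  have "adiff A (F x) (F y) = aadd A (adiff A (aone A) (aone A)) (adiff A (amult A x a) (amult A y a))"
   unfolding F_def adiff_def
    cstar_scale_add[OF cstar_closed(2) cstar_closed(4)[OF y a]]
   by (rule cstar_add_swap) (simp_all add: x y a cstar_closed)
  also have "... = adiff A (amult A x a) (amult A y a)"
   using x y a by (simp add: cstar_diff_self cstar_add_zero cstar_closed)
  also have "... = amult A (adiff A x y) a"
   using x y a by (simp add: adiff_def cstar_mult_add cstar_mult_scale cstar_closed)
  finally show ?thesis
   using x y a by (simp add: cstar_norm_mult cstar_closed r_def)
 qed
 define K where "K = anorm A (aone A) / (1 - r)"
 have K0: "K >= 0" using r cstar_norm_nonneg cstar_closed by (simp add: K_def)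
 have sK: "anorm A (s n) <= K" for n
 proof (induction n)
  case 0 thus ?case using K0 cstar_norm_zero[OF cstar_closed(1)] by (simp add: s_def)
 next
  case (Suc n)
  have "anorm A (s (Suc n)) = anorm A (aadd A (aone A) (amult A (s n) a))"
   by (simp add: s_def F_def)
  also have "... <= anorm A (aone A) + anorm A (s n) * r"
   unfolding r_def using cstar_norm_add[of "aone A" "amult A (s n) a"]
    cstar_norm_mult[OF sc[of n] a] cstar_closed(2) cstar_closed(4)[OF sc[of n] a] by linarith
  also have "... <= anorm A (aone A) + K * r"
   using Suc r by (simp add: mult_right_mono)
  also have "... = K" using r by (simp add: K_def field_simps)
  finally show ?case .
 qed
 have sd: "anorm A (adiff A (s (n + k)) (s n)) <= r ^ n * K" for n k
 proof (induction n)
  case 0 thus ?case using sK[of k] sc[of k] by (simp add: s_def cstar_diff_zero)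
 next
  case (Suc n)
  have "anorm A (adiff A (s (Suc n + k)) (s (Suc n))) <= anorm A (adiff A (s (n + k)) (s n)) * r"
   using dF[OF sc[of "n + k"] sc[of n]] by (simp add: s_def)
  also have "... <= r ^ n * K * r" using Suc r by (simp add: mult_right_mono)
  finally show ?case by (simp add: mult_ac)
 qed
 have lim0: "(\<lambda>n. r ^ n * K) ---> 0"
  using r tendsto_mult_right[of "\<lambda>n. r ^ n" 0 sequentially K] by (simp add: LIMSEQ_power_zero)
 have "\<forall>e>0. \<exists>N. \<forall>i\<ge>N. \<forall>j\<ge>N. anorm A (adiff A (s i) (s j)) < e"
 proof (intro allI impI)
  fix e :: real assume "e > 0"
  then obtain N where N: "r ^ N * K < e / 2"
   using order_tendstoD(2)[OF lim0, of "e / 2"] by (auto simp: eventually_sequentially)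
  have "anorm A (adiff A (s i) (s j)) < e" if ij: "i >= N" "j >= N" for i j
  proof -
   have "anorm A (adiff A (s i) (s j)) <= anorm A (adiff A (s i) (s N)) + anorm A (adiff A (s N) (s j))"
    by (rule cstar_norm_triangle[OF sc sc sc])
   also have "anorm A (adiff A (s N) (s j)) = anorm A (adiff A (s j) (s N))"
    by (rule cstar_diff_swap[OF sc sc])
   finally show ?thesis
    using sd[of N "i - N"] sd[of N "j - N"] ij N by simp
  qed
  thus "\<exists>N. \<forall>i\<ge>N. \<forall>j\<ge>N. anorm A (adiff A (s i) (s j)) < e" by blast
 qed
 then obtain y where y: "y \<in> carr A" "(\<lambda>n. anorm A (adiff A (s n) y)) ---> 0"
  using cstar_complete[of s, OF sc] by blast
 have le: "anorm A (adiff A y (F y)) <= anorm A (adiff A (s (Suc n)) y) + anorm A (adiff A (s n) y) * r" for n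
 proof -
  have "anorm A (adiff A y (F y)) <= anorm A (adiff A y (s (Suc n))) + anorm A (adiff A (s (Suc n)) (F y))"
   by (rule cstar_norm_triangle[OF y(1) sc Fc[OF y(1)]])
  moreover have "anorm A (adiff A y (s (Suc n))) = anorm A (adiff A (s (Suc n)) y)"
   by (rule cstar_diff_swap[OF sc y(1)])
  moreover have "anorm A (adiff A (s (Suc n)) (F y)) <= anorm A (adiff A (s n) y) * r"
   using dF[OF sc[of n] y(1)] by (simp add: s_def)
  ultimately show ?thesis by simp
 qed
 have "(\<lambda>n. anorm A (adiff A (s (Suc n)) y) + anorm A (adiff A (s n) y) * r) ---> 0 + 0 * r"
  by (intro tendsto_intros LIMSEQ_Suc[OF y(2)] y(2))
 hence "anorm A (adiff A y (F y)) <= 0 + 0 * r"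
  using le by (intro LIMSEQ_le_const) auto
 hence "anorm A (adiff A y (F y)) = 0"
  using cstar_norm_nonneg[of "adiff A y (F y)"] cstar_closed(7)[OF y(1) Fc[OF y(1)]] by simp
 hence "y = F y" using cstar_diff_eqI[OF y(1) Fc[OF y(1)]] by blast
 thus ?thesis using y(1) unfolding F_def by blast
qed

text \<open>A nonempty part of a C*-algebra that is closed under the operations and under norm limits is
 a C*-subalgebra.\<close>

lemma cstar_subalgebraI:
 assumes M: "M \<subseteq> carr A" "azero A \<in> M" "aone A \<in> M"
  and add: "!!x y. x \<in> M ==> y \<in> M ==> aadd A x y \<in> M"
  and mult: "!!x y. x \<in> M ==> y \<in> M ==> amult A x y \<in> M"
  and sc: "!!c x. x \<in> M ==> ascale A c x \<in> M"
  and star: "!!x. x \<in> M ==> astar A x \<in> M"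
  and lim: "!!s x. (!!n::nat. s n \<in> M) ==> x \<in> carr A ==>
   (\<lambda>n. anorm A (adiff A (s n) x)) ---> 0 ==> x \<in> M"
 shows "cstar_subalgebra M A"
proof -
 have c: "x \<in> M ==> x \<in> carr A" for x using M(1) by auto
 have *: "adiff (A\<lparr>carr := M\<rparr>) = adiff A" by (intro ext) (simp add: adiff_def)
 have sel: "carr (A\<lparr>carr := M\<rparr>) = M" "azero (A\<lparr>carr := M\<rparr>) = azero A" "aone (A\<lparr>carr := M\<rparr>) = aone A"
  "aadd (A\<lparr>carr := M\<rparr>) = aadd A" "amult (A\<lparr>carr := M\<rparr>) = amult A" "ascale (A\<lparr>carr := M\<rparr>) = ascale A"
  "astar (A\<lparr>carr := M\<rparr>) = astar A" "anorm (A\<lparr>carr := M\<rparr>) = anorm A"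
  by simp_all
 have compl: "\<exists>x\<in>M. (\<lambda>n. anorm A (adiff A (s n) x)) ---> 0"
  if s: "\<forall>n::nat. s n \<in> M" "\<forall>e>0. \<exists>N. \<forall>i\<ge>N. \<forall>j\<ge>N. anorm A (adiff A (s i) (s j)) < e" for s
  using cstar_complete[of s] s lim[of s] c by blast
 have "cstar_algebra (A\<lparr>carr := M\<rparr>)"
  unfolding cstar_algebra_def * sel
  apply (intro conjI ballI allI impI)
  apply (((rule M add mult sc star compl
   cstar_add_assoc cstar_add_comm cstar_add_zero cstar_diff_self
   cstar_scale_one cstar_scale_scale cstar_scale_add_left cstar_scale_add
   cstar_mult_assoc cstar_mult_add_right cstar_mult_add cstar_mult_scale
   cstar_mult_scale_right cstar_one_mult cstar_mult_one cstar_star_star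
   cstar_star_add cstar_star_mult cstar_star_scale cstar_norm_nonneg
   cstar_norm_zero cstar_norm_scale cstar_norm_add cstar_norm_mult
   cstar_norm_star); (rule c)?; assumption?)+)
  done
 thus ?thesis using M(1) by (simp add: cstar_subalgebra_def)
qed

end

text \<open>For \<open>t = \<parallel>h x\<parallel> > \<parallel>x\<parallel>\<close> the element \<open>1 - x\<^sup>*x / t^2\<close> has an inverse in the algebra, whereas
 \<open>h x\<close> almost attaining its norm on a vector \<open>v\<close> makes \<open>v\<close> an approximate eigenvector of
 \<open>(h x)\<^sup>* h x\<close> for the eigenvalue \<open>t\<^sup>2\<close>.\<close>

theorem cstar_morphism_norm_le:
 fixes M :: "'h::complex_hilbert op set"
 assumes h: "cstar_morphism A (operator_algebra M) h" and M: "M \<subseteq> \<B>"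
  and x: "x \<in> carr A"
 shows "norm (h x) <= anorm A x"
proof (rule ccontr)
 assume "\<not> norm (h x) <= anorm A x"
 define t where "t = norm (h x)"
 define r0 where "r0 = anorm A x"
 have A: "cstar_algebra A" using h by (simp add: cstar_morphism_def)
 note cl = cstar_closed[OF A]
 have r0: "0 <= r0" using cstar_norm_nonneg[OF A x] by (simp add: r0_def)
 have t: "r0 < t" "0 < t"
  using \<open>\<not> norm (h x) <= anorm A x\<close> r0 by (auto simp: t_def r0_def)
 define a where "a = ascale A (of_real (1 / t^2)) (amult A (astar A x) x)"
 have a: "a \<in> carr A" using x by (simp add: a_def cl)
 have "anorm A a = r0^2 / t^2"
  using x unfolding a_def
  by (simp add: cstar_norm_scale[OF A] cl cstar_norm_star[OF A] r0_def norm_divide norm_power)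
 also have "... < 1" using t r0 by (simp add: power_strict_mono)
 finally obtain y where y: "y \<in> carr A" "y = aadd A (aone A) (amult A y a)"
  using cstar_neumann[OF A a] by blast
 define X Y where "X = h x" and "Y = h y"
 have X: "X \<in> \<B>" using h x M by (auto simp: cstar_morphism_def X_def)
 have ha: "h a = op_scale (of_real (1 / t^2)) (adj X oo X)"
  using h x unfolding a_def cstar_morphism_def X_def by (simp add: cl)
 have "h (aadd A (aone A) (amult A y a)) = id_blinfun + (Y oo h a)"
  using h y(1) a unfolding cstar_morphism_def Y_def by (simp add: cl)
 hence Yeq: "Y = id_blinfun + (Y oo h a)" using y(2) unfolding Y_def by simp
 have Yv: "v = Y (v - h a v)" for v
 proof -
  have "Y v = v + Y (h a v)"
   using arg_cong[OF Yeq, of "\<lambda>T. ap T v"] by (simp add: plus_blinfun.rep_eq)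
  thus ?thesis by (simp add: blinfun.diff_right)
 qed
 define K where "K = (norm Y)^2"
 define r where "r = sqrt (1 - 1 / (2 * K + 2))"
 have K: "K >= 0" by (simp add: K_def)
 have r: "r^2 = 1 - 1 / (2 * K + 2)" "0 <= r" "r < 1"
  using K by (auto simp: r_def)
 have "\<not> (\<forall>v. norm (X v) <= r * t * norm v)"
 proof
  assume "\<forall>v. norm (X v) <= r * t * norm v"
  hence "norm X <= r * t"
   using r t by (intro norm_blinfun_bound) auto
  thus False using r t unfolding X_def t_def[symmetric] by simp
 qed
 then obtain v where v: "norm (X v) > r * t * norm v" by (auto simp: not_le)
 have v0: "norm v > 0" using v by (cases "v = 0") auto
 have na: "norm (h a v) <= norm v"
 proof -
  have "norm ((adj X oo X) v) <= norm (adj X oo X) * norm v"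
   by (rule norm_blinfun)
  also have "norm (adj X oo X) = t^2" using norm_adj_compose_self[OF X] by (simp only: X_def t_def)
  finally show ?thesis using t by (simp add: ha norm_scaleC norm_divide norm_power field_simps)
 qed
 have ca: "Re (cinner v (h a v)) = (norm (X v))^2 / t^2"
  by (simp add: ha cinner_scaleC_right cinner_adj_right[OF X] cinner_self)
 have "(norm (v - h a v))^2 <= 2 * (norm v)^2 - 2 * ((norm (X v))^2 / t^2)"
  unfolding norm_diff_sq ca using na by simp
 also have "(norm (X v))^2 / t^2 >= r^2 * (norm v)^2"
 proof -
  have "(r * t * norm v)^2 <= (norm (X v))^2"
   using v r t by (intro power_mono) auto
  thus ?thesis using t by (simp add: field_simps)
 qed
 hence "2 * (norm v)^2 - 2 * ((norm (X v))^2 / t^2) <= 2 * (1 - r^2) * (norm v)^2"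
  by (simp add: algebra_simps)
 finally have 1: "(norm (v - h a v))^2 <= 2 * (1 - r^2) * (norm v)^2" .
 have "(norm v)^2 <= (norm Y * norm (v - h a v))^2"
  using norm_blinfun[of Y "v - h a v"] Yv[of v] by (intro power_mono) auto
 also have "... <= K * (2 * (1 - r^2) * (norm v)^2)"
  unfolding power_mult_distrib K_def by (intro mult_left_mono 1) simp
 finally have "(norm v)^2 * 1 <= (norm v)^2 * (K * (2 * (1 - r^2)))"
  by (simp only: mult_ac)
 hence "1 <= K * (2 * (1 - r^2))" using v0 by (simp only: mult_le_cancel_left_pos zero_less_power)
 moreover have "K * (2 * (1 - r^2)) < 1"
  using K unfolding r(1) by (simp add: field_simps)
 ultimately show False by simp
qed

section \<open>Square-summable sequences of vectors\<close>

text \<open>The Hilbert space \<open>\<ell>\<^sup>2 \<otimes> H\<close>. It turns the square-summable sequences in the definition of the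
 sigma-weak topology into single vectors.\<close>

typedef (overloaded) 'a ell2 = "{x :: nat => 'a::complex_hilbert. square_summable x}"
 morphisms ell2_seq Abs_ell2
 by (rule exI[of _ "\<lambda>_. 0"]) (simp add: square_summable_def)

setup_lifting type_definition_ell2

lemma ell2_eqI: "(!!n. ell2_seq x n = ell2_seq y n) ==> x = y"
 by (simp add: ell2_seq_inject[symmetric] fun_eq_iff)

lemma summable_ell2: "summable (\<lambda>n. (norm (ell2_seq x n))^2)"
 using ell2_seq[of x] by (simp add: square_summable_def)

lemma square_summable_add:
 assumes "square_summable x" "square_summable y"
 shows "square_summable (\<lambda>n. x n + y n)"
 unfolding square_summable_def
proof (rule summable_comparison_test)
 show "summable (\<lambda>n. 2 * (norm (x n))^2 + 2 * (norm (y n))^2)"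
  using assms by (intro summable_add summable_mult) (simp_all add: square_summable_def)
 have "(norm (x n + y n))^2 <= 2 * (norm (x n))^2 + 2 * (norm (y n))^2" for n
  using parallelogram[of "x n" "y n"] zero_le_power2[of "norm (x n - y n)"] by linarith
 thus "\<exists>N. \<forall>n\<ge>N. norm ((norm (x n + y n))^2) <= 2 * (norm (x n))^2 + 2 * (norm (y n))^2"
  by auto
qed

lemma square_summable_scaleC:
 "square_summable x ==> square_summable (\<lambda>n. c *\<^sub>C x n)"
 by (simp add: square_summable_def norm_scaleC power_mult_distrib)

lemma summable_cinner:
 assumes "square_summable x" "square_summable y"
 shows "summable (\<lambda>n. cinner (x n) (y n))"
proof (rule summable_norm_cancel, rule summable_comparison_test)
 show "summable (\<lambda>n. (norm (x n))^2 + (norm (y n))^2)"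
  using assms by (intro summable_add) (simp_all add: square_summable_def)
 have "cmod (cinner (x n) (y n)) <= (norm (x n))^2 + (norm (y n))^2" for n
  using cauchy_schwarz[of "x n" "y n"] sum_squares_bound[of "norm (x n)" "norm (y n)"]
   mult_nonneg_nonneg[OF norm_ge_zero[of "x n"] norm_ge_zero[of "y n"]] by linarith
 thus "\<exists>N. \<forall>n\<ge>N. norm (cmod (cinner (x n) (y n))) <= (norm (x n))^2 + (norm (y n))^2"
  by auto
qed

instantiation ell2 :: (complex_hilbert) real_normed_vector
begin

lift_definition zero_ell2 :: "'a ell2" is "\<lambda>_. 0" by (simp add: square_summable_def)

lift_definition plus_ell2 :: "'a ell2 => 'a ell2 => 'a ell2" is "\<lambda>x y n. x n + y n"
 by (rule square_summable_add)

lift_definition uminus_ell2 :: "'a ell2 => 'a ell2" is "\<lambda>x n. - x n"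
 by (simp add: square_summable_def)

lift_definition minus_ell2 :: "'a ell2 => 'a ell2 => 'a ell2" is "\<lambda>x y n. x n - y n"
 subgoal for x y using square_summable_add[of x "\<lambda>n. - y n"] by (simp add: square_summable_def)
 done

lift_definition scaleR_ell2 :: "real => 'a ell2 => 'a ell2" is "\<lambda>r x n. r *\<^sub>R x n"
 unfolding scaleR_scaleC by (rule square_summable_scaleC)

definition norm_ell2 :: "'a ell2 => real"
 where "norm_ell2 x = sqrt (\<Sum>n. (norm (ell2_seq x n))^2)"

definition dist_ell2 :: "'a ell2 => 'a ell2 => real"
 where "dist_ell2 x y = norm (x - y)"

definition sgn_ell2 :: "'a ell2 => 'a ell2"
 where "sgn_ell2 x = scaleR (inverse (norm x)) x"

definition uniformity_ell2 :: "('a ell2 \<times> 'a ell2) filter"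
 where "uniformity_ell2 = (INF e\<in>{0<..}. principal {(x, y). dist x y < e})"

definition open_ell2 :: "'a ell2 set => bool"
 where "open_ell2 U \<longleftrightarrow> (\<forall>x\<in>U. eventually (\<lambda>(x', y). x' = x --> y \<in> U) uniformity)"

lemma ell2_norm_le_iff:
 "norm (x :: 'a ell2) <= B \<longleftrightarrow> 0 <= B \<and> (\<forall>N. (\<Sum>n<N. (norm (ell2_seq x n))^2) <= B^2)"
proof
 assume B: "norm x <= B"
 have s0: "0 <= (\<Sum>n. (norm (ell2_seq x n))^2)" by (intro suminf_nonneg summable_ell2) simp
 hence "0 <= B" using order_trans[OF _ B, of 0] by (simp add: norm_ell2_def)
 moreover have "(\<Sum>n. (norm (ell2_seq x n))^2) <= B^2"
  using B unfolding norm_ell2_def by (rule sqrt_le_D)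
 ultimately show "0 <= B \<and> (\<forall>N. (\<Sum>n<N. (norm (ell2_seq x n))^2) <= B^2)"
  using sum_le_suminf[OF summable_ell2[of x] finite_lessThan]
  by (intro conjI allI) (assumption, meson order_trans zero_le_power2)
next
 assume "0 <= B \<and> (\<forall>N. (\<Sum>n<N. (norm (ell2_seq x n))^2) <= B^2)"
 thus "norm x <= B"
  unfolding norm_ell2_def by (intro real_le_lsqrt suminf_le_const summable_ell2) auto
qed

lemma ell2_partial_le: "sqrt (\<Sum>n<N. (norm (ell2_seq x n))^2) <= norm (x :: 'a ell2)"
 unfolding norm_ell2_def by (intro real_sqrt_le_mono sum_le_suminf summable_ell2) auto

lemma ell2_component_le: "norm (ell2_seq x k) <= norm (x :: 'a ell2)"
proof -
 have "norm (ell2_seq x k) = sqrt ((norm (ell2_seq x k))^2)" by simp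
 also have "... <= sqrt (\<Sum>n<Suc k. (norm (ell2_seq x n))^2)"
  by (intro real_sqrt_le_mono member_le_sum) auto
 also have "... <= norm x" by (rule ell2_partial_le)
 finally show ?thesis .
qed

lemma ell2_triangle: "norm (x + y) <= norm x + norm (y :: 'a ell2)"
proof -
 have nn: "0 <= norm z" for z :: "'a ell2"
  using ell2_partial_le[where N = 0 and x = z] by simp
 have "(\<Sum>n<N. (norm (ell2_seq (x + y) n))^2) <= (norm x + norm y)^2" for N
 proof -
  have "sqrt (\<Sum>n<N. (norm (ell2_seq (x + y) n))^2)
    <= L2_set (\<lambda>n. norm (ell2_seq x n) + norm (ell2_seq y n)) {..<N}"
   unfolding L2_set_def plus_ell2.rep_eq
   by (intro real_sqrt_le_mono sum_mono power_mono norm_triangle_ineq) auto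
  also have "... <= L2_set (\<lambda>n. norm (ell2_seq x n)) {..<N} + L2_set (\<lambda>n. norm (ell2_seq y n)) {..<N}"
   by (rule L2_set_triangle_ineq)
  also have "... <= norm x + norm y"
   unfolding L2_set_def by (intro add_mono ell2_partial_le)
  finally show ?thesis
   by (rule sqrt_le_D)
 qed
 thus ?thesis by (simp add: ell2_norm_le_iff nn)
qed

instance
proof
 note rep = zero_ell2.rep_eq plus_ell2.rep_eq uminus_ell2.rep_eq minus_ell2.rep_eq scaleR_ell2.rep_eq
 fix x y z :: "'a ell2" and a b :: real
 show "x + y + z = x + (y + z)" "x + y = y + x" "0 + x = x" "- x + x = 0" "x - y = x + - y"
  by (rule ell2_eqI; simp add: rep algebra_simps)+
 show "a *\<^sub>R (x + y) = a *\<^sub>R x + a *\<^sub>R y" "1 *\<^sub>R x = x"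
  "(a + b) *\<^sub>R x = a *\<^sub>R x + b *\<^sub>R x" "a *\<^sub>R b *\<^sub>R x = (a * b) *\<^sub>R x"
  by (rule ell2_eqI; simp add: rep algebra_simps)+
 show "dist x y = norm (x - y)" "sgn x = scaleR (inverse (norm x)) x"
  by (simp_all add: dist_ell2_def sgn_ell2_def)
 show "uniformity = (INF e\<in>{0<..}. principal {(x, y). dist x y < (e::real)} :: ('a ell2 \<times> 'a ell2) filter)"
  by (simp add: uniformity_ell2_def)
 show "open U \<longleftrightarrow> (\<forall>x\<in>U. eventually (\<lambda>(x', y). x' = x --> y \<in> U) uniformity)" for U :: "'a ell2 set"
  by (simp add: open_ell2_def)
 show "norm (x + y) <= norm x + norm y" by (rule ell2_triangle)
 show "norm x = 0 \<longleftrightarrow> x = 0"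
 proof
  assume "norm x = 0"
  hence "ell2_seq x n = 0" for n using ell2_component_le[of x n] by simp
  thus "x = 0" by (intro ell2_eqI) (simp add: rep)
 qed (simp add: norm_ell2_def rep)
 have "(\<Sum>n. (norm (a *\<^sub>R ell2_seq x n))^2) = a^2 * (\<Sum>n. (norm (ell2_seq x n))^2)"
  by (simp add: power_mult_distrib suminf_mult summable_ell2)
 thus "norm (a *\<^sub>R x) = \<bar>a\<bar> * norm x"
  by (simp add: norm_ell2_def rep real_sqrt_mult)
qed

end

instance ell2 :: (complex_hilbert) banach
proof
 fix X :: "nat => 'a ell2" assume X: "Cauchy X"
 have Cd: "\<exists>M. \<forall>i\<ge>M. \<forall>j\<ge>M. norm (X i - X j) < e" if "e > 0" for e
  using X that by (auto simp: Cauchy_def dist_norm)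
 have sub: "ell2_seq (X i - X j) k = ell2_seq (X i) k - ell2_seq (X j) k" for i j k
  by (simp add: minus_ell2.rep_eq)
 have "Cauchy (\<lambda>i. ell2_seq (X i) k)" for k
 proof (rule CauchyI)
  fix e :: real assume "e > 0"
  then obtain M where M: "\<forall>i\<ge>M. \<forall>j\<ge>M. norm (X i - X j) < e" using Cd by blast
  hence "norm (ell2_seq (X i) k - ell2_seq (X j) k) < e" if "i >= M" "j >= M" for i j
   using ell2_component_le[of "X i - X j" k] that unfolding sub by fastforce
  thus "\<exists>M. \<forall>m\<ge>M. \<forall>n\<ge>M. norm (ell2_seq (X m) k - ell2_seq (X n) k) < e" by blast
 qed
 hence "\<exists>l. (\<lambda>i. ell2_seq (X i) k) ---> l" for k
  using Cauchy_convergent_iff convergent_def by blast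
 then obtain l where l: "!!k. (\<lambda>i. ell2_seq (X i) k) ---> l k" by metis
 have bound: "(\<Sum>k<N. (norm (ell2_seq (X i) k - l k))^2) <= e^2"
  if "\<forall>j\<ge>M. norm (X i - X j) < e" for i M e N
 proof (rule LIMSEQ_le_const2)
  show "(\<lambda>j. \<Sum>k<N. (norm (ell2_seq (X i) k - ell2_seq (X j) k))^2)
    ---> (\<Sum>k<N. (norm (ell2_seq (X i) k - l k))^2)"
   by (intro tendsto_intros l)
  show "\<exists>J. \<forall>j\<ge>J. (\<Sum>k<N. (norm (ell2_seq (X i) k - ell2_seq (X j) k))^2) <= e^2"
  proof (intro exI allI impI)
   fix j assume "j >= M"
   hence "norm (X i - X j) <= e" using that by auto
   thus "(\<Sum>k<N. (norm (ell2_seq (X i) k - ell2_seq (X j) k))^2) <= e^2"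
    unfolding ell2_norm_le_iff sub by blast
  qed
 qed
 obtain M1 where M1: "\<forall>i\<ge>M1. \<forall>j\<ge>M1. norm (X i - X j) < 1" using Cd[of 1] by auto
 have "square_summable (\<lambda>k. ell2_seq (X M1) k - l k)"
  unfolding square_summable_def
  by (rule summableI_nonneg_bounded[of _ "1\<^sup>2"]) (use bound[of M1 M1 1] M1 in auto)
 hence "square_summable (\<lambda>k. (-1) *\<^sub>C (ell2_seq (X M1) k - l k) + ell2_seq (X M1) k)"
  using ell2_seq[of "X M1"] by (intro square_summable_add square_summable_scaleC) auto
 hence ls: "square_summable l" by simp
 have sl: "ell2_seq (X i - Abs_ell2 l) k = ell2_seq (X i) k - l k" for i k
  using ls by (simp add: minus_ell2.rep_eq Abs_ell2_inverse)
 have "X ---> Abs_ell2 l"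
 proof (rule metric_LIMSEQ_I)
  fix e :: real assume e: "e > 0"
  then obtain M where M: "\<forall>i\<ge>M. \<forall>j\<ge>M. norm (X i - X j) < e / 2" using Cd[of "e / 2"] by auto
  have "norm (X i - Abs_ell2 l) <= e / 2" if "i >= M" for i
   using bound[of M i "e / 2"] M that e unfolding ell2_norm_le_iff sl by simp
  hence "dist (X i) (Abs_ell2 l) < e" if "i >= M" for i
   using e that unfolding dist_norm by (rule_tac order_le_less_trans[of _ "e / 2"]) auto
  thus "\<exists>no. \<forall>n\<ge>no. dist (X n) (Abs_ell2 l) < e" by blast
 qed
 thus "convergent X" by (auto simp: convergent_def)
qed

instantiation ell2 :: (complex_hilbert) complex_hilbert
begin

lift_definition scaleC_ell2 :: "complex => 'a ell2 => 'a ell2" is "\<lambda>c x n. c *\<^sub>C x n"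
 by (rule square_summable_scaleC)

definition cinner_ell2 :: "'a ell2 => 'a ell2 => complex"
 where "cinner_ell2 x y = (\<Sum>n. cinner (ell2_seq x n) (ell2_seq y n))"

instance
proof
 note rep = plus_ell2.rep_eq scaleR_ell2.rep_eq scaleC_ell2.rep_eq
 fix x y z :: "'a ell2" and a b :: real and c d :: complex
 show "a *\<^sub>R x = of_real a *\<^sub>C x"
  by (rule ell2_eqI) (simp add: rep scaleR_scaleC)
 show "c *\<^sub>C (x + y) = c *\<^sub>C x + c *\<^sub>C y" "(c + d) *\<^sub>C x = c *\<^sub>C x + d *\<^sub>C x"
  "c *\<^sub>C d *\<^sub>C x = (c * d) *\<^sub>C x"
  by (rule ell2_eqI; simp add: rep scaleC_add_right scaleC_add_left scaleC_scaleC)+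
 have sq: "square_summable (ell2_seq w)" for w :: "'a ell2" using ell2_seq[of w] by simp
 have "cnj (\<Sum>n. cinner (ell2_seq y n) (ell2_seq x n)) = (\<Sum>n. cnj (cinner (ell2_seq y n) (ell2_seq x n)))"
  by (rule bounded_linear.suminf[OF bounded_linear_cnj summable_cinner[OF sq sq]])
 thus "cinner x y = cnj (cinner y x)"
  unfolding cinner_ell2_def by (simp add: cinner_commute[symmetric])
 show "cinner x (y + z) = cinner x y + cinner x z"
  unfolding cinner_ell2_def plus_ell2.rep_eq cinner_add_right
  by (intro suminf_add[symmetric] summable_cinner sq)
 show "cinner x (c *\<^sub>C y) = c * cinner x y"
  unfolding cinner_ell2_def scaleC_ell2.rep_eq cinner_scaleC_right
  by (intro suminf_mult summable_cinner sq)
 have "Re (cinner x x) = (\<Sum>n. Re (cinner (ell2_seq x n) (ell2_seq x n)))"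
  unfolding cinner_ell2_def by (intro bounded_linear.suminf[OF bounded_linear_Re] summable_cinner sq)
 also have "... = (\<Sum>n. (norm (ell2_seq x n))^2)" by (simp add: Re_cinner_self)
 finally have Re: "Re (cinner x x) = (\<Sum>n. (norm (ell2_seq x n))^2)" .
 thus "0 <= Re (cinner x x)" by (simp add: suminf_nonneg summable_ell2)
 show "norm x = sqrt (Re (cinner x x))" by (simp add: norm_ell2_def Re)
qed

end

section \<open>The bicommutant theorem and normal maps\<close>

lemma commutantD: "A \<in> commutant M ==> B \<in> M ==> A oo B = B oo A"
 and commutant_bounded_ops: "A \<in> commutant M ==> A \<in> \<B>"
 by (auto simp: commutant_def)

lemma commutant_mono: "M \<subseteq> N ==> commutant N \<subseteq> commutant M"
 by (auto simp: commutant_def)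

lemma bicommutant_incl: "M \<subseteq> \<B> ==> M \<subseteq> commutant (commutant M)"
 by (auto simp: commutant_def)

lemma tricommutant:
 "M \<subseteq> \<B> ==> commutant (commutant (commutant M)) = commutant M"
 using bicommutant_incl[of M] bicommutant_incl[of "commutant M"] commutant_mono
 by (auto simp: commutant_def)

lemma bicommutant_minimal:
 "M \<subseteq> commutant N ==> N \<subseteq> \<B> ==> commutant (commutant M) \<subseteq> commutant N"
 using commutant_mono[OF commutant_mono] tricommutant by metis

lemma commutant_iff:
 "A \<in> commutant M \<longleftrightarrow> A \<in> \<B> \<and>
  (\<forall>B\<in>M. \<forall>x. A (B x) = B (A x))"
proof -
 have "A oo B = B oo A \<longleftrightarrow> (\<forall>x. A (B x) = B (A x))" for B
  by (auto intro!: blinfun_eqI) (metis blinfun_apply_blinfun_compose)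
 thus ?thesis by (simp add: commutant_def)
qed

lemma commutant_closed [intro]:
 shows "0 \<in> commutant M" "id_blinfun \<in> commutant M"
  "A \<in> commutant M ==> B \<in> commutant M ==> A + B \<in> commutant M"
  "A \<in> commutant M ==> B \<in> commutant M ==> A - B \<in> commutant M"
  "A \<in> commutant M ==> B \<in> commutant M ==> A oo B \<in> commutant M"
  "M \<subseteq> \<B> ==> A \<in> commutant M ==> op_scale c A \<in> commutant M"
 by (auto simp: commutant_iff plus_blinfun.rep_eq minus_blinfun.rep_eq blinfun.add_right
   blinfun.diff_right bounded_opsD subset_iff)

lemma commutant_adj_closed:
 assumes M: "M \<subseteq> \<B>" "!!B. B \<in> M ==> adj B \<in> M" and A: "A \<in> commutant M"
 shows "adj A \<in> commutant M"
 unfolding commutant_def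
proof (intro CollectI conjI ballI)
 have Ab: "A \<in> \<B>" using A by (rule commutant_bounded_ops)
 thus "adj A \<in> \<B>" by simp
 fix B assume B: "B \<in> M"
 hence Bb: "B \<in> \<B>" using M by auto
 have "adj (adj B oo A) = adj (A oo adj B)" using commutantD[OF A M(2)[OF B]] by simp
 thus "adj A oo B = B oo adj A" using Ab Bb by (simp add: adj_compose)
qed

lemma closed_commutant: "closed (commutant (M :: 'h::complex_hilbert op set))"
proof -
 have "commutant M = \<B> \<inter> (\<Inter>B\<in>M. {A. A oo B = B oo A})"
  by (auto simp: commutant_def)
 moreover have "closed {A. A oo B = B oo A}" for B :: "'h op"
  by (intro closed_Collect_eq
    bounded_linear.continuous_on[OF bounded_bilinear.bounded_linear_left[OF bounded_bilinear_blinfun_compose]]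
    bounded_linear.continuous_on[OF bounded_bilinear.bounded_linear_right[OF bounded_bilinear_blinfun_compose]]
    continuous_on_id)
 ultimately show ?thesis by (simp add: closed_Int closed_bounded_ops closed_INT)
qed

text \<open>The amplification \<open>1 \<otimes> A\<close> of an operator \<open>A\<close>.\<close>

lift_definition ell2_map :: "'h::complex_hilbert op => 'h ell2 => 'h ell2"
 is "\<lambda>A x n. ap A (x n)"
 subgoal premises prems for A x
  unfolding square_summable_def
 proof (rule summable_comparison_test)
  show "summable (\<lambda>n. (norm A)^2 * (norm (x n))^2)"
   using prems by (intro summable_mult) (simp add: square_summable_def)
  have "(norm (ap A (x n)))^2 <= (norm A)^2 * (norm (x n))^2" for n
   unfolding power_mult_distrib[symmetric] by (intro power_mono norm_blinfun) simp
  thus "\<exists>N. \<forall>n\<ge>N. norm ((norm (ap A (x n)))^2) <= (norm A)^2 * (norm (x n))^2"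
   by auto
 qed
 done

text \<open>The vector with \<open>v\<close> in position \<open>j\<close> and zeros elsewhere.\<close>

lift_definition ell2_unit :: "nat => 'h::complex_hilbert => 'h ell2"
 is "\<lambda>j v n. if n = j then v else 0"
 subgoal for j v
  unfolding square_summable_def
  by (rule summable_finite[of "{j}"]) auto
 done

lemmas ell2_reps = zero_ell2.rep_eq plus_ell2.rep_eq uminus_ell2.rep_eq minus_ell2.rep_eq
 scaleR_ell2.rep_eq scaleC_ell2.rep_eq ell2_map.rep_eq ell2_unit.rep_eq

lemma norm_ell2_map: "norm (ell2_map A x) <= norm A * norm x"
 unfolding ell2_norm_le_iff
proof (intro conjI allI)
 fix N
 have "(\<Sum>n<N. (norm (ell2_seq (ell2_map A x) n))^2) <= (\<Sum>n<N. (norm A)^2 * (norm (ell2_seq x n))^2)"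
  unfolding ell2_map.rep_eq power_mult_distrib[symmetric]
  by (intro sum_mono power_mono norm_blinfun) simp
 also have "... = (norm A)^2 * (\<Sum>n<N. (norm (ell2_seq x n))^2)" by (simp add: sum_distrib_left)
 also have "... <= (norm A)^2 * (norm x)^2"
  using ell2_norm_le_iff[of x "norm x"] by (intro mult_left_mono) auto
 finally show "(\<Sum>n<N. (norm (ell2_seq (ell2_map A x) n))^2) <= (norm A * norm x)^2"
  by (simp add: power_mult_distrib)
qed simp

lemma bounded_linear_ell2_map: "bounded_linear (ell2_map A)"
 by (rule bounded_linear_intro[where K = "norm A"])
  (auto intro!: ell2_eqI norm_ell2_map[THEN order_trans]
   simp: ell2_reps blinfun.add_right blinfun.scaleR_right mult.commute)

lemma norm_ell2_unit: "norm (ell2_unit j v) = norm v"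
proof -
 have "(\<Sum>n. (norm (if n = j then v else 0))^2) = (\<Sum>n\<in>{j}. (norm (if n = j then v else 0))^2)"
  by (rule suminf_finite) auto
 thus ?thesis by (simp add: norm_ell2_def ell2_reps)
qed

lemma bounded_linear_ell2_seq: "bounded_linear (\<lambda>x. ell2_seq x n)"
 by (rule bounded_linear_intro[where K = 1]) (auto simp: ell2_reps intro: ell2_component_le)

lemma ell2_expansion: "(\<lambda>N. \<Sum>j<N. ell2_unit j (ell2_seq x j)) ---> x"
proof (rule metric_LIMSEQ_I)
 fix e :: real assume e: "e > 0"
 obtain N where N: "!!m. norm (\<Sum>i. (norm (ell2_seq x (i + (N + m))))^2) < e^2"
 proof -
  have "(\<lambda>n. \<Sum>i. (norm (ell2_seq x (i + n)))^2) ---> 0"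
   by (rule suminf_exist_split2[OF summable_ell2])
  then obtain N where "\<forall>n\<ge>N. norm ((\<Sum>i. (norm (ell2_seq x (i + n)))^2) - 0) < e^2"
   using LIMSEQ_D[of _ 0 "e^2"] e by (meson zero_less_power)
  thus ?thesis using that[of N] by simp
 qed
 have seq: "ell2_seq (\<Sum>j<n. ell2_unit j (ell2_seq x j)) k = (if k < n then ell2_seq x k else 0)" for n k
  by (induction n) (auto simp: ell2_reps less_Suc_eq)
 have "dist (\<Sum>j<n. ell2_unit j (ell2_seq x j)) x < e" if "n >= N" for n
 proof -
  have "(norm (x - (\<Sum>j<n. ell2_unit j (ell2_seq x j))))^2
    = (\<Sum>k. (norm (ell2_seq (x - (\<Sum>j<n. ell2_unit j (ell2_seq x j))) k))^2)"
   unfolding norm_ell2_def by (simp add: suminf_nonneg summable_ell2)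
  also have "... = (\<Sum>k. (norm (if k < n then 0 else ell2_seq x k))^2)"
   by (intro suminf_cong) (simp add: ell2_reps seq)
  also have "... = (\<Sum>k. (norm (ell2_seq x (k + n)))^2)"
  proof -
   have "summable (\<lambda>k. (norm (if k < n then 0 else ell2_seq x k))^2)"
    by (rule summable_comparison_test[OF _ summable_ell2[of x]]) auto
   from suminf_split_initial_segment[OF this, of n] show ?thesis by simp
  qed
  also have "... < e^2" using N[of "n - N"] that by simp
  finally show ?thesis
   using e by (simp add: dist_norm norm_minus_commute power2_less_imp_less)
 qed
 thus "\<exists>no. \<forall>n\<ge>no. dist (\<Sum>j<n. ell2_unit j (ell2_seq x j)) x < e" by blast
qed

lemma ell2_linear_eq:
 assumes "bounded_linear (F :: 'h::complex_hilbert ell2 => 'h ell2)" "bounded_linear G"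
  and "!!j v. F (ell2_unit j v) = G (ell2_unit j v)"
 shows "F x = G x"
proof -
 have "(\<lambda>N. F (\<Sum>j<N. ell2_unit j (ell2_seq x j))) ---> F x"
  by (rule bounded_linear.tendsto[OF assms(1) ell2_expansion])
 moreover have "F (\<Sum>j<N. ell2_unit j (ell2_seq x j)) = G (\<Sum>j<N. ell2_unit j (ell2_seq x j))" for N
  using assms by (simp add: linear_sum bounded_linear.linear)
 ultimately have "(\<lambda>N. G (\<Sum>j<N. ell2_unit j (ell2_seq x j))) ---> F x" by simp
 thus ?thesis
  using LIMSEQ_unique[OF _ bounded_linear.tendsto[OF assms(2) ell2_expansion]] by blast
qed

lemma cinner_ell2_map_adj:
 assumes "A \<in> \<B>"
 shows "cinner (ell2_map (adj A) x) y = cinner x (ell2_map A y)"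
 by (simp add: cinner_ell2_def ell2_reps cinner_adj_left[OF assms])

text \<open>The projection onto the closure of \<open>{B y | B \<in> N}\<close> in \<open>\<ell>\<^sup>2 \<otimes> H\<close> has matrix elements in the
 commutant of \<open>N\<close>, so it commutes with the amplification of every \<open>A\<close> in the bicommutant.\<close>

theorem bicommutant_density:
 fixes N :: "'h::complex_hilbert op set"
 assumes N: "N \<subseteq> \<B>" "id_blinfun \<in> N"
  and add: "!!A B. A \<in> N ==> B \<in> N ==> A + B \<in> N"
  and comp: "!!A B. A \<in> N ==> B \<in> N ==> A oo B \<in> N"
  and sc: "!!c A. A \<in> N ==> op_scale c A \<in> N"
  and star: "!!A. A \<in> N ==> adj A \<in> N"
  and A: "A \<in> commutant (commutant N)" and e: "e > 0"
 shows "\<exists>B\<in>N. norm (ell2_map A y - ell2_map B y) < e"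
proof -
 define V where "V = closure ((\<lambda>B. ell2_map B y) ` N)"
 note bl = bounded_linear_ell2_map
 have V_lim: "F x \<in> V" if F: "bounded_linear F" and "!!B. B \<in> N ==> F (ell2_map B y) \<in> V" and x: "x \<in> V" for F x
 proof -
  have "F ` closure ((\<lambda>B. ell2_map B y) ` N) \<subseteq> V"
   using that by (intro image_closure_subset linear_continuous_on) (auto simp: V_def)
  thus ?thesis using x by (auto simp: V_def)
 qed
 have gen: "ell2_map B y \<in> V" if "B \<in> N" for B
  unfolding V_def by (intro subsetD[OF closure_subset] imageI that)
 have V_sc: "c *\<^sub>C x \<in> V" if "x \<in> V" for c x
 proof (rule V_lim[OF bounded_linear_scaleC _ that])
  fix B assume "B \<in> N"
  moreover have "c *\<^sub>C ell2_map B y = ell2_map (op_scale c B) y"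
   by (rule ell2_eqI) (simp add: ell2_reps)
  ultimately show "c *\<^sub>C ell2_map B y \<in> V" using gen sc by simp
 qed
 have V_N: "ell2_map B x \<in> V" if "B \<in> N" "x \<in> V" for B x
 proof (rule V_lim[OF bl _ that(2)])
  fix C assume "C \<in> N"
  moreover have "ell2_map B (ell2_map C y) = ell2_map (B oo C) y"
   by (rule ell2_eqI) (simp add: ell2_reps)
  ultimately show "ell2_map B (ell2_map C y) \<in> V" using gen comp[OF that(1)] by simp
 qed
 have V_add: "x + x' \<in> V" if xV: "x \<in> V" "x' \<in> V" for x x'
 proof -
  obtain s where s: "\<forall>n. s n \<in> (\<lambda>B. ell2_map B y) ` N" "s ---> x"
   using xV(1) unfolding V_def closure_sequential by auto
  obtain s' where s': "\<forall>n. s' n \<in> (\<lambda>B. ell2_map B y) ` N" "s' ---> x'"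
   using xV(2) unfolding V_def closure_sequential by auto
  have "s n + s' n \<in> (\<lambda>B. ell2_map B y) ` N" for n
  proof -
   obtain B B' where "B \<in> N" "B' \<in> N" "s n = ell2_map B y" "s' n = ell2_map B' y"
    using s(1)[rule_format, of n] s'(1)[rule_format, of n] by blast
   moreover have "ell2_map B y + ell2_map B' y = ell2_map (B + B') y"
    by (rule ell2_eqI) (simp add: ell2_reps blinfun.add_left)
   ultimately show ?thesis using add by auto
  qed
  thus ?thesis
   unfolding V_def closure_sequential using tendsto_add[OF s(2) s'(2)]
   by (intro exI[of _ "\<lambda>n. s n + s' n"]) auto
 qed
 have yV: "y \<in> V"
 proof -
  have "ell2_map id_blinfun y = y" by (rule ell2_eqI) (simp add: ell2_reps)
  thus ?thesis using gen[OF N(2)] by simp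
 qed
 have V0: "0 \<in> V" using V_sc[OF yV, of 0] by simp
 have clV: "closed V" by (simp add: V_def)
 have "\<forall>x. \<exists>p. p \<in> V \<and> (\<forall>v\<in>V. cinner v (x - p) = 0)"
  using orthogonal_projection_exists[OF clV V0 V_add V_sc] by (simp add: Bex_def)
 from choice[OF this] obtain P where P': "\<forall>x. P x \<in> V \<and> (\<forall>v\<in>V. cinner v (x - P x) = 0)"
  by (elim exE)
 have P: "P x \<in> V" "v \<in> V ==> cinner v (x - P x) = 0" for x v using P' by simp_all
 have P_eq: "P x = p" if "p \<in> V" "!!v. v \<in> V ==> cinner v (x - p) = 0" for x p
 proof -
  have "P x + (-1) *\<^sub>C p \<in> V" by (intro V_add P(1) V_sc that(1))
  hence *: "P x - p \<in> V" by simp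
  have "cinner (P x - p) (P x - p) = cinner (P x - p) (x - p) - cinner (P x - p) (x - P x)"
   by (simp flip: cinner_diff_right)
  thus ?thesis using that(2)[OF *] P(2)[OF *] by (simp add: cinner_self)
 qed
 have P_add: "P (x + x') = P x + P x'" for x x'
 proof (rule P_eq)
  fix v assume "v \<in> V"
  hence "cinner v ((x - P x) + (x' - P x')) = 0" using P(2) by (simp add: cinner_add_right)
  thus "cinner v (x + x' - (P x + P x')) = 0" by (simp add: algebra_simps)
 qed (intro V_add P(1))
 have P_sc: "P (c *\<^sub>C x) = c *\<^sub>C P x" for c x
  by (rule P_eq) (auto simp: cinner_scaleC_right P simp flip: scaleC_diff_right intro: V_sc P(1))
 have P_norm: "norm (P x) <= norm x" for x
 proof -
  have "cinner (P x) x = cinner (P x) (P x)"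
   using P(2)[OF P(1), of x x] by (simp add: cinner_diff_right)
  hence "(norm (P x))^2 <= norm (P x) * norm x"
   using cauchy_schwarz[of "P x" x] by (simp add: cinner_self norm_power)
  thus ?thesis by (cases "norm (P x) = 0") (auto simp: power2_eq_square)
 qed
 have P_bl: "bounded_linear P"
  by (rule bounded_linear_intro[where K = 1]) (auto simp: P_add P_sc scaleR_scaleC P_norm)
 have P_N: "P (ell2_map B x) = ell2_map B (P x)" if B: "B \<in> N" for B x
 proof (rule P_eq)
  show "ell2_map B (P x) \<in> V" by (rule V_N[OF B P(1)])
  fix v assume v: "v \<in> V"
  have Bb: "B \<in> \<B>" using B N(1) by auto
  have "ell2_map B x - ell2_map B (P x) = ell2_map B (x - P x)"
   by (simp add: linear_diff[OF bounded_linear.linear[OF bl]])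
  thus "cinner v (ell2_map B x - ell2_map B (P x)) = 0"
   using P(2)[OF V_N[OF star[OF B] v], of x] by (simp flip: cinner_ell2_map_adj[OF Bb])
 qed
 define p where "p i j = Blinfun (\<lambda>v. ell2_seq (P (ell2_unit j v)) i)" for i j
 have unit_bl: "bounded_linear (ell2_unit j :: 'h => 'h ell2)" for j
  by (rule bounded_linear_intro[where K = 1])
   (auto intro!: ell2_eqI simp: ell2_reps norm_ell2_unit)
 have p: "p i j v = ell2_seq (P (ell2_unit j v)) i" for i j v
  unfolding p_def
  by (subst bounded_linear_Blinfun_apply) (auto intro!: bounded_linear_compose[OF bounded_linear_ell2_seq]
    bounded_linear_compose[OF P_bl] unit_bl)
 have map_unit: "ell2_map B (ell2_unit j v) = ell2_unit j (B v)" for B j and v :: 'h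
  by (rule ell2_eqI) (simp add: ell2_reps)
 have "p i j \<in> commutant N" for i j
  unfolding commutant_def
 proof (intro CollectI conjI ballI)
  have "ell2_unit j (c *\<^sub>C v) = c *\<^sub>C ell2_unit j v" for c and v :: 'h
   by (rule ell2_eqI) (simp add: ell2_reps)
  thus "p i j \<in> \<B>" by (auto simp: bounded_ops_def p P_sc ell2_reps)
  fix B assume "B \<in> N"
  thus "p i j oo B = B oo p i j"
   by (intro blinfun_eqI) (simp add: p P_N ell2_reps flip: map_unit)
 qed
 hence Ap: "A (p i j v) = p i j (A v)" for i j v
  using commutantD[OF A] by (metis blinfun_apply_blinfun_compose)
 have "ell2_map A (P x) = P (ell2_map A x)" for x
 proof (rule ell2_linear_eq[of "\<lambda>x. ell2_map A (P x)" "\<lambda>x. P (ell2_map A x)"])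
  show "ell2_map A (P (ell2_unit j v)) = P (ell2_map A (ell2_unit j v))" for j v
   using Ap[of _ j v] by (intro ell2_eqI) (simp add: p ell2_reps map_unit)
 qed (auto intro: bounded_linear_compose[OF bl P_bl] bounded_linear_compose[OF P_bl bl])
 moreover have "P y = y" using yV by (intro P_eq) auto
 ultimately have "ell2_map A y \<in> V" using P(1)[of "ell2_map A y"] by metis
 then obtain w where "w \<in> (\<lambda>B. ell2_map B y) ` N" "dist w (ell2_map A y) < e"
  using e unfolding V_def closure_approachable by blast
 thus ?thesis by (auto simp: dist_norm norm_minus_commute)
qed

text \<open>A \<open>\<sigma>\<close>-weak neighbourhood of \<open>A\<close> contains all \<open>B\<close> whose amplification is close to that of \<open>A\<close> on a
 single vector; finitely many conditions are combined into one by interleaving sequences.\<close>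

lemma sigma_weak_neighbourhood:
 fixes A :: "'h::complex_hilbert op"
 assumes "openin sigma_weak U" "A \<in> U"
 shows "\<exists>y e. e > 0 \<and> (\<forall>B. norm (ell2_map A y - ell2_map B y) < e --> B \<in> U)"
proof -
 have "generate_topology_on {{A :: 'h op. (\<Sum>n. cinner (x n) (ap A (y n))) \<in> U} | x y U.
   square_summable x \<and> square_summable y \<and> open U} U"
  using assms(1) unfolding sigma_weak_def openin_topology_generated_by_iff .
 thus ?thesis using assms(2)
 proof (induction rule: generate_topology_on.induct)
  case Empty thus ?case by simp
 next
  case (Int U1 U2)
  have A12: "A \<in> U1" "A \<in> U2" using Int.prems by simp_all
  obtain y1 e1 where *: "e1 > 0" "\<forall>B. norm (ell2_map A y1 - ell2_map B y1) < e1 --> B \<in> U1"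
   using Int.IH(1)[OF A12(1)] by (elim exE conjE)
  obtain y2 e2 where **: "e2 > 0" "\<forall>B. norm (ell2_map A y2 - ell2_map B y2) < e2 --> B \<in> U2"
   using Int.IH(2)[OF A12(2)] by (elim exE conjE)
  \<comment> \<open>interleaving combines the two test sequences into one\<close>
  define f where "f n = (if even n then ell2_seq y1 (n div 2) else 0)" for n
  define g where "g n = (if odd n then ell2_seq y2 (n div 2) else 0)" for n
  have sm1: "strict_mono (\<lambda>n::nat. 2 * n)" and sm2: "strict_mono (\<lambda>n::nat. 2 * n + 1)"
   by (auto simp: strict_mono_def)
  have "square_summable f"
   unfolding square_summable_def
   by (rule iffD1[OF summable_mono_reindex[OF sm1]])
    (auto simp: f_def summable_ell2 image_iff elim: evenE)
  moreover have "square_summable g"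
   unfolding square_summable_def
   by (rule iffD1[OF summable_mono_reindex[OF sm2]])
    (auto simp: g_def summable_ell2 image_iff elim: oddE)
  ultimately have fg: "square_summable (\<lambda>n. f n + g n)" by (rule square_summable_add)
  define y where "y = Abs_ell2 (\<lambda>n. f n + g n)"
  have y: "ell2_seq y = (\<lambda>n. f n + g n)" using fg by (simp add: y_def Abs_ell2_inverse)
  have sub: "norm (ell2_map A z - ell2_map B z) <= norm (ell2_map A y - ell2_map B y)"
   if h: "inj h" "!!n. ell2_seq z n = ell2_seq y (h n)" for z h B
  proof -
   let ?f = "\<lambda>n. (norm (ell2_seq (ell2_map A y - ell2_map B y) n))^2"
   have eq: "(\<lambda>n. (norm (ell2_seq (ell2_map A z - ell2_map B z) n))^2) = ?f \<circ> h"
    by (auto simp: ell2_reps h(2))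
   show ?thesis
    unfolding norm_ell2_def eq
    by (intro real_sqrt_le_mono suminf_reindex_mono[OF summable_ell2 h(1)]) simp
  qed
  have le1: "norm (ell2_map A y1 - ell2_map B y1) <= norm (ell2_map A y - ell2_map B y)" for B
   by (rule sub[of "\<lambda>n. 2 * n"]) (auto simp: y f_def g_def inj_on_def)
  have U1: "B \<in> U1" if "norm (ell2_map A y - ell2_map B y) < min e1 e2" for B
   using *(2) le1[of B] that by simp
  have le2: "norm (ell2_map A y2 - ell2_map B y2) <= norm (ell2_map A y - ell2_map B y)" for B
   by (rule sub[of "\<lambda>n. 2 * n + 1"]) (auto simp: y f_def g_def inj_on_def)
  have U2: "B \<in> U2" if "norm (ell2_map A y - ell2_map B y) < min e1 e2" for B
   using **(2) le2[of B] that by simp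
  have "min e1 e2 > 0" using *(1) **(1) by simp
  thus ?case by (intro exI[of _ y] exI[of _ "min e1 e2"]) (simp add: U1 U2)
 next
  case (UN K)
  obtain k where k: "k \<in> K" "A \<in> k" using UN.prems by auto
  obtain y e where ye: "e > 0" "\<forall>B. norm (ell2_map A y - ell2_map B y) < e --> B \<in> k"
   using UN.IH[OF k] by (elim exE conjE)
  show ?case using ye k(1) by (intro exI[of _ y] exI[of _ e]) auto
 next
  case (Basis s)
  then obtain x y U where s: "s = {A. (\<Sum>n. cinner (x n) (ap A (y n))) \<in> U}"
   and xy: "square_summable x" "square_summable y" "open U" by blast
  define X Y where "X = Abs_ell2 x" and "Y = Abs_ell2 y"
  have eq: "(\<Sum>n. cinner (x n) (ap B (y n))) = cinner X (ell2_map B Y)" for B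
   using xy by (simp add: cinner_ell2_def X_def Y_def Abs_ell2_inverse ell2_reps)
  have "cinner X (ell2_map A Y) \<in> U" using Basis s eq by auto
  then obtain d where d: "d > 0" "!!z. dist z (cinner X (ell2_map A Y)) < d ==> z \<in> U"
   using xy(3) unfolding open_dist by blast
  have "B \<in> s" if B: "norm (ell2_map A Y - ell2_map B Y) < d / (norm X + 1)" for B
  proof -
   have "dist (cinner X (ell2_map B Y)) (cinner X (ell2_map A Y))
     = cmod (cinner X (ell2_map A Y - ell2_map B Y))"
    by (simp add: dist_norm cinner_diff_right norm_minus_commute)
   also have "... <= norm X * norm (ell2_map A Y - ell2_map B Y)" by (rule cauchy_schwarz)
   also have "... <= (norm X + 1) * norm (ell2_map A Y - ell2_map B Y)"
    by (intro mult_right_mono) auto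
   also have "... < d" using B by (simp add: pos_less_divide_eq mult.commute add_nonneg_pos)
   finally show ?thesis using d(2) eq s by auto
  qed
  thus ?case using d(1) by (intro exI[of _ Y] exI[of _ "d / (norm X + 1)"]) (auto simp: add_nonneg_pos)
 qed
qed

lemma openin_sigma_weak_functional:
 fixes v w :: "'h::complex_hilbert"
 assumes "open W"
 shows "openin sigma_weak {T. cinner v (ap T w) \<in> W}"
proof -
 have *: "(\<Sum>n. cinner (if n = 0 then v else 0) (ap T (if n = 0 then w else 0)))
   = cinner v (ap T w)" for T
  by (subst suminf_finite[of "{0::nat}"]) auto
 have sq: "square_summable (\<lambda>n. if n = 0 then x else 0)" for x :: 'h
  unfolding square_summable_def by (rule summable_finite[of "{0}"]) auto
 show ?thesis
  unfolding sigma_weak_def openin_topology_generated_by_iff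
  by (rule generate_topology_on.Basis, rule CollectI, rule exI[of _ "\<lambda>n::nat. if n = 0 then v else 0"],
    rule exI[of _ "\<lambda>n::nat. if n = 0 then w else 0"], rule exI[of _ W])
   (simp only: * sq assms simp_thms)
qed

text \<open>A normal map on a von Neumann algebra that is given by \<open>T \<mapsto> U T V\<close> on a weakly dense
 *-subalgebra is given by this formula everywhere.\<close>

theorem normal_on_bicommutant_eq:
 fixes N :: "'h::complex_hilbert op set"
 assumes N: "N \<subseteq> \<B>" "id_blinfun \<in> N"
  and add: "!!A B. A \<in> N ==> B \<in> N ==> A + B \<in> N"
  and comp: "!!A B. A \<in> N ==> B \<in> N ==> A oo B \<in> N"
  and sc: "!!c A. A \<in> N ==> op_scale c A \<in> N"
  and star: "!!A. A \<in> N ==> adj A \<in> N"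
  and h: "normal_on (commutant (commutant N)) h" "!!B. B \<in> N ==> h B = U oo B oo V"
  and U: "U \<in> \<B>" and A: "A \<in> commutant (commutant N)"
 shows "h A = U oo A oo V"
proof (rule blinfun_eqI, rule cinner_eqI, rule ccontr)
 fix w v
 define d where "d = cmod (cinner v (ap (h A) w) - cinner v (ap (U oo A oo V) w))"
 assume "cinner v (ap (h A) w) ~= cinner v (ap (U oo A oo V) w)"
 hence d: "d > 0" by (simp add: d_def)
 let ?M = "commutant (commutant N)"
 have ts: "A' \<in> topspace sigma_weak" for A' :: "'h op"
  using openin_subset[OF openin_sigma_weak_functional[of UNIV 0 0]] by auto
 define O1 where "O1 = {T. cinner v (ap T w) \<in> ball (cinner v (ap (h A) w)) (d / 2)}"
 define O2 where "O2 = {T. cinner (ap (adj U) v) (ap T (ap V w))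
  \<in> ball (cinner (ap (adj U) v) (ap A (ap V w))) (d / 2)}"
 have o1: "openin sigma_weak O1" and o2: "openin sigma_weak O2"
  unfolding O1_def O2_def by (intro openin_sigma_weak_functional open_ball)+
 have "openin (subtopology sigma_weak ?M) {T \<in> topspace (subtopology sigma_weak ?M). h T \<in> O1}"
  using h(1) o1 unfolding normal_on_def continuous_map_def by simp
 then obtain O3 where o3: "openin sigma_weak O3"
  and O3: "{T \<in> topspace (subtopology sigma_weak ?M). h T \<in> O1} = O3 \<inter> ?M"
  unfolding openin_subtopology by (elim exE conjE)
 have "A \<in> {T \<in> topspace (subtopology sigma_weak ?M). h T \<in> O1}"
  using A ts d by (simp add: O1_def)
 hence "A \<in> O3 \<inter> O2" unfolding O3 using d by (simp add: O2_def)
 from sigma_weak_neighbourhood[OF openin_Int[OF o3 o2] this]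
 obtain y e where ye: "e > 0" "\<forall>B. norm (ell2_map A y - ell2_map B y) < e --> B \<in> O3 \<inter> O2"
  by (elim exE conjE)
 have "\<exists>B\<in>N. norm (ell2_map A y - ell2_map B y) < e"
  by (rule bicommutant_density[OF N _ _ _ _ A ye(1)]; fact add comp sc star)
 then obtain B where B: "B \<in> N" "norm (ell2_map A y - ell2_map B y) < e" by (elim bexE)
 have BO: "B \<in> O3" "B \<in> O2" using ye(2) B(2) by simp_all
 have "B \<in> ?M" by (rule subsetD[OF bicommutant_incl[OF N(1)] B(1)])
 hence "B \<in> {T \<in> topspace (subtopology sigma_weak ?M). h T \<in> O1}" using BO(1) unfolding O3 by simp
 hence 1: "cmod (cinner v (ap (h A) w) - cinner v (ap (h B) w)) < d / 2"
  by (simp add: O1_def dist_norm)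
 have "cmod (cinner v (ap (U oo A oo V) w) - cinner v (ap (h B) w)) < d / 2"
  using BO(2) by (simp add: O2_def dist_norm cinner_adj_left[OF U] h(2)[OF B(1)])
 with 1 show False
  using norm_triangle_ineq4[of "cinner v (ap (h A) w) - cinner v (ap (h B) w)"
    "cinner v (ap (U oo A oo V) w) - cinner v (ap (h B) w)"]
  by (simp add: d_def)
qed

section \<open>Smooth functions\<close>

text \<open>\<open>Ck n f\<close>: the function \<open>f\<close> on a Euclidean space is \<open>n\<close> times continuously differentiable.\<close>

primrec Ck :: "nat => ('a::euclidean_space => 'b::real_normed_vector) => bool" where
 "Ck 0 f \<longleftrightarrow> continuous_on UNIV f"
| "Ck (Suc n) f \<longleftrightarrow> (\<exists>f'. (\<forall>x. (f has_derivative f' x) (at x)) \<and> (\<forall>h. Ck n (\<lambda>x. f' x h)))"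

text \<open>Smooth functions on a Euclidean space.\<close>

definition smooth_fun :: "('a::euclidean_space => 'b::real_normed_vector) => bool"
 where "smooth_fun f \<longleftrightarrow> (\<forall>n. Ck n f)"

lemma Ck_SucI:
 "(!!x. (f has_derivative f' x) (at x)) ==> (!!h. Ck n (\<lambda>x. f' x h)) ==> Ck (Suc n) f"
 by auto

lemma Ck_Suc_imp: "Ck (Suc n) f ==> Ck n f"
proof (induction n arbitrary: f)
 case 0
 then obtain f' where "!!x. (f has_derivative f' x) (at x)" by auto
 thus ?case
  by (auto intro: has_derivative_continuous_on)
next
 case (Suc n)
 then obtain f' where f': "!!x. (f has_derivative f' x) (at x)" "!!h. Ck (Suc n) (\<lambda>x. f' x h)"
  by (auto simp del: Ck.simps(2) simp: Ck.simps(2)[of "Suc n"])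
 show ?case by (rule Ck_SucI[OF f'(1)]) (rule Suc.IH[OF f'(2)])
qed

lemma Ck_const: "Ck n (\<lambda>_. c)"
proof (induction n arbitrary: c)
 case (Suc n)
 show ?case by (rule Ck_SucI[where f' = "\<lambda>_ _. 0"]) (auto intro: Suc)
qed simp

lemma Ck_linear: "bounded_linear f ==> Ck n f"
 by (cases n) (auto simp: linear_continuous_on bounded_linear_imp_has_derivative
   intro!: exI[of _ "\<lambda>_. f"] Ck_const)

lemma Ck_compose_linear: "bounded_linear T ==> Ck n f ==> Ck n (\<lambda>x. T (f x))"
proof (induction n arbitrary: f)
 case 0 thus ?case by (auto intro: bounded_linear.continuous_on)
next
 case (Suc n)
 from Suc.prems(2) obtain f' where f': "!!x. (f has_derivative f' x) (at x)" "!!h. Ck n (\<lambda>x. f' x h)"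
  by auto
 show ?case
  by (rule Ck_SucI[OF bounded_linear.has_derivative[OF Suc.prems(1) f'(1)]])
   (rule Suc.IH[OF Suc.prems(1) f'(2)])
qed

lemma Ck_add: "Ck n f ==> Ck n g ==> Ck n (\<lambda>x. f x + g x)"
proof (induction n arbitrary: f g)
 case 0 thus ?case by (auto intro: continuous_intros)
next
 case (Suc n)
 from Suc.prems obtain f' g' where f': "!!x. (f has_derivative f' x) (at x)" "!!h. Ck n (\<lambda>x. f' x h)"
  and g': "!!x. (g has_derivative g' x) (at x)" "!!h. Ck n (\<lambda>x. g' x h)"
  by auto
 show ?case
  by (rule Ck_SucI[OF has_derivative_add[OF f'(1) g'(1)]]) (rule Suc.IH[OF f'(2) g'(2)])
qed

lemma Ck_bilinear:
 assumes b: "bounded_bilinear b"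
 shows "Ck n f ==> Ck n g ==> Ck n (\<lambda>x. b (f x) (g x))"
proof (induction n arbitrary: f g)
 case 0 thus ?case by (auto intro: bounded_bilinear.continuous_on[OF b])
next
 case (Suc n)
 from Suc.prems obtain f' g' where f': "!!x. (f has_derivative f' x) (at x)" "!!h. Ck n (\<lambda>x. f' x h)"
  and g': "!!x. (g has_derivative g' x) (at x)" "!!h. Ck n (\<lambda>x. g' x h)"
  by auto
 show ?case
  by (rule Ck_SucI[OF bounded_bilinear.FDERIV[OF b f'(1) g'(1)]])
   (intro Ck_add Suc.IH Ck_Suc_imp[OF Suc.prems(1)] Ck_Suc_imp[OF Suc.prems(2)] f'(2) g'(2))
qed

lemmas Ck_mult = Ck_bilinear[OF bounded_bilinear_mult]
lemmas Ck_scaleR = Ck_bilinear[OF bounded_bilinear_scaleR]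

lemma Ck_compose_real:
 fixes g :: "'a::euclidean_space => real"
 shows "Ck n \<sigma> ==> Ck n g ==> Ck n (\<lambda>x. \<sigma> (g x))"
proof (induction n arbitrary: \<sigma>)
 case 0 thus ?case by (auto intro: continuous_on_compose2)
next
 case (Suc n)
 from Suc.prems(2) obtain g' where g': "!!x. (g has_derivative g' x) (at x)" "!!h. Ck n (\<lambda>x. g' x h)"
  by auto
 from Suc.prems(1) obtain s' where s': "!!x. (\<sigma> has_derivative s' x) (at x)" "!!h. Ck n (\<lambda>x. s' x h)"
  by auto
 have s1: "s' y t = t *\<^sub>R s' y 1" for y t
  using linear_cmul[OF has_derivative_linear[OF s'(1)], of y t 1] by simp
 have "((\<lambda>x. \<sigma> (g x)) has_derivative (\<lambda>h. s' (g x) (g' x h))) (at x)" for x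
  by (rule has_derivative_compose[OF g'(1) s'(1)])
 moreover have "(\<lambda>h. s' (g x) (g' x h)) = (\<lambda>h. g' x h *\<^sub>R s' (g x) 1)" for x
  by (rule ext) (rule s1)
 ultimately have "((\<lambda>x. \<sigma> (g x)) has_derivative (\<lambda>h. g' x h *\<^sub>R s' (g x) 1)) (at x)" for x
  by simp
 thus ?case
  by (rule Ck_SucI) (intro Ck_scaleR g'(2) Suc.IH s'(2) Ck_Suc_imp[OF Suc.prems(2)])
qed

lemma Ck_compose_affine:
 assumes L: "bounded_linear L"
 shows "Ck n f ==> Ck n (\<lambda>x. f (L x + c))"
proof (induction n arbitrary: f)
 case 0
 thus ?case
  by (auto intro!: continuous_on_compose2[of UNIV f] continuous_on_add continuous_on_const
    linear_continuous_on[OF L])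
next
 case (Suc n)
 from Suc.prems obtain f' where f': "!!x. (f has_derivative f' x) (at x)" "!!h. Ck n (\<lambda>x. f' x h)"
  by auto
 have "((\<lambda>x. f (L x + c)) has_derivative (\<lambda>h. f' (L x + c) (L h))) (at x)" for x
  by (rule has_derivative_compose[OF _ f'(1), where f = "\<lambda>x. L x + c"])
   (auto intro!: derivative_eq_intros bounded_linear_imp_has_derivative L)
 thus ?case by (rule Ck_SucI) (rule Suc.IH[OF f'(2)])
qed

lemma smooth_const: "smooth_fun (\<lambda>_. c)"
 by (simp add: smooth_fun_def Ck_const)

lemma smooth_linear: "bounded_linear T ==> smooth_fun T"
 by (simp add: smooth_fun_def Ck_linear)

lemma smooth_compose_linear: "bounded_linear T ==> smooth_fun f ==> smooth_fun (\<lambda>x. T (f x))"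
 by (simp add: smooth_fun_def Ck_compose_linear)

lemma smooth_add: "smooth_fun f ==> smooth_fun g ==> smooth_fun (\<lambda>x. f x + g x)"
 by (simp add: smooth_fun_def Ck_add)

lemma smooth_bilinear:
 "bounded_bilinear b ==> smooth_fun f ==> smooth_fun g ==> smooth_fun (\<lambda>x. b (f x) (g x))"
 by (simp add: smooth_fun_def Ck_bilinear)

lemma smooth_compose_affine:
 "bounded_linear L ==> smooth_fun f ==> smooth_fun (\<lambda>x. f (L x + c))"
 by (simp add: smooth_fun_def Ck_compose_affine)

lemma smooth_imp_continuous: "smooth_fun f ==> continuous_on S f"
 unfolding smooth_fun_def using continuous_on_subset[of UNIV f S] Ck.simps(1)[of f] by blast

lemma smooth_compose_real: "smooth_fun \<sigma> ==> smooth_fun g ==> smooth_fun (\<lambda>x. \<sigma> (g x :: real))"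
 unfolding smooth_fun_def by (simp add: Ck_compose_real)

lemmas smooth_mult = smooth_bilinear[OF bounded_bilinear_mult]
lemmas smooth_scaleR = smooth_bilinear[OF bounded_bilinear_scaleR]

lemma smooth_minus: "smooth_fun f ==> smooth_fun (\<lambda>x. - f x)"
 by (rule smooth_compose_linear[OF bounded_linear_minus[OF bounded_linear_ident]])

lemma smooth_diff: "smooth_fun f ==> smooth_fun g ==> smooth_fun (\<lambda>x. f x - g x)"
 using smooth_add[OF _ smooth_minus, of f g] by simp

text \<open>The derivative of \<open>f\<close> at \<open>x\<close> in the direction \<open>h\<close>.\<close>

definition dird :: "'a::euclidean_space => ('a => 'b::real_normed_vector) => 'a => 'b"
 where "dird h f x = frechet_derivative f (at x) h"

lemma dird_eqI: "(f has_derivative f') (at x) ==> dird h f x = f' h"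
 unfolding dird_def by (simp flip: frechet_derivative_at)

lemma smooth_has_derivative:
 assumes "smooth_fun f" shows "(f has_derivative (\<lambda>h. dird h f x)) (at x)"
proof -
 have "Ck (Suc 0) f" using assms by (simp only: smooth_fun_def)
 then obtain f' where f': "(f has_derivative f' x) (at x)" by auto
 have "(\<lambda>h. dird h f x) = f' x" by (rule ext) (rule dird_eqI[OF f'])
 thus ?thesis using f' by simp
qed

lemma smooth_dird:
 assumes "smooth_fun f" shows "smooth_fun (dird h f)"
 unfolding smooth_fun_def
proof
 fix n
 have "Ck (Suc n) f" using assms by (simp only: smooth_fun_def)
 then obtain f' where f': "!!x. (f has_derivative f' x) (at x)" "!!h. Ck n (\<lambda>x. f' x h)"
  by auto
 have "dird h f = (\<lambda>x. f' x h)" using dird_eqI[OF f'(1)] by auto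
 thus "Ck n (dird h f)" using f'(2) by simp
qed

lemma dird_linear:
 assumes "smooth_fun f"
 shows "dird (a *\<^sub>R h + b *\<^sub>R k) f x = a *\<^sub>R dird h f x + b *\<^sub>R dird k f x"
 using has_derivative_linear[OF smooth_has_derivative[OF assms, of x]] linear_add linear_cmul by fastforce

lemma dird_add: "smooth_fun f ==> smooth_fun g ==> dird h (\<lambda>x. f x + g x) x = dird h f x + dird h g x"
 by (rule dird_eqI[OF has_derivative_add[OF smooth_has_derivative smooth_has_derivative]])

lemma dird_diff: "smooth_fun f ==> smooth_fun g ==> dird h (\<lambda>x. f x - g x) x = dird h f x - dird h g x"
 by (rule dird_eqI[OF has_derivative_diff[OF smooth_has_derivative smooth_has_derivative]])

lemma dird_bilinear: "bounded_bilinear b ==> smooth_fun f ==> smooth_fun g ==>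
  dird h (\<lambda>x. b (f x) (g x)) x = b (f x) (dird h g x) + b (dird h f x) (g x)"
 by (rule dird_eqI[OF bounded_bilinear.FDERIV[OF _ smooth_has_derivative smooth_has_derivative]])

lemma dird_compose_linear: "bounded_linear T ==> smooth_fun f ==> dird h (\<lambda>x. T (f x)) x = T (dird h f x)"
 by (rule dird_eqI[OF bounded_linear.has_derivative[OF _ smooth_has_derivative]])

lemma smooth_has_vector_derivative_line:
 assumes "smooth_fun f"
 shows "((\<lambda>t. f (p + t *\<^sub>R h)) has_vector_derivative dird h f (p + t *\<^sub>R h)) (at t within S)"
proof -
 have "((\<lambda>t. f (p + t *\<^sub>R h)) has_derivative (\<lambda>s. dird (s *\<^sub>R h) f (p + t *\<^sub>R h))) (at t)"
  by (rule has_derivative_compose[OF _ smooth_has_derivative[OF assms], where f = "\<lambda>t. p + t *\<^sub>R h"])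
   (auto intro!: derivative_eq_intros)
 moreover have "dird (s *\<^sub>R h) f x = s *\<^sub>R dird h f x" for s x
  using dird_linear[OF assms, of s h 0 0 x] by simp
 ultimately show ?thesis
  by (simp add: has_vector_derivative_def has_derivative_at_withinI)
qed

section \<open>Integrals depending on a parameter\<close>

lemma param_integral_has_derivative:
 fixes k :: "real \<times> 'a::euclidean_space => 'b::banach"
 assumes k: "!!p. (k has_derivative k' p) (at p)" and c: "!!h. continuous_on UNIV (\<lambda>p. k' p h)"
 shows "((\<lambda>x. integral {0..1} (\<lambda>w. k (w, x))) has_derivative
  (\<lambda>h. integral {0..1} (\<lambda>w. k' (w, x) (0, h)))) (at x)"
proof -
 define fx where "fx x w = Blinfun (\<lambda>h. k' (w, x) (0, h))" for x w
 have bl: "bounded_linear (\<lambda>h. k' (w, x) (0, h))" for w x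
  by (intro bounded_linear_compose[OF has_derivative_bounded_linear[OF k]] bounded_linear_Pair
    bounded_linear_zero bounded_linear_ident)
 have fx: "ap (fx x w) h = k' (w, x) (0, h)" for x w h
  unfolding fx_def by (simp add: bounded_linear_Blinfun_apply[OF bl])
 have cont: "continuous_on (UNIV \<times> cbox 0 1) (\<lambda>(x, w). fx x w)"
 proof (rule continuous_on_blinfun_componentwise)
  fix i :: 'a
  have "continuous_on (UNIV \<times> cbox 0 1) (\<lambda>q. k' (snd q, fst q) (0, i))"
   by (rule continuous_on_compose2[OF c]) (auto intro!: continuous_intros)
  thus "continuous_on (UNIV \<times> cbox 0 1) (\<lambda>q. ap (case q of (x, w) => fx x w) i)"
   by (simp add: case_prod_beta fx)
 qed
 have kc: "continuous_on UNIV k"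
  by (rule has_derivative_continuous_on) (rule has_derivative_at_withinI[OF k])
 have "((\<lambda>x. integral (cbox 0 1) ((\<lambda>x w. k (w, x)) x)) has_derivative integral (cbox 0 1) (fx x)) (at x within UNIV)"
 proof (rule leibniz_rule[OF _ _ cont])
  fix x :: 'a and w :: real
  have "((\<lambda>x. k (w, x)) has_derivative (\<lambda>h. k' (w, x) (0, h))) (at x)"
   by (rule has_derivative_compose[OF _ k, where f = "\<lambda>x. (w, x)"])
    (auto intro!: derivative_eq_intros)
  thus "((\<lambda>x. k (w, x)) has_derivative ap (fx x w)) (at x within UNIV)"
   by (simp add: fx[abs_def])
 next
  show "(\<lambda>w. k (w, x)) integrable_on cbox 0 1" for x
   by (intro integrable_continuous continuous_on_compose2[OF kc]) (auto intro!: continuous_intros)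
 qed auto
 moreover have "fx x integrable_on cbox 0 1" for x
  by (intro integrable_continuous continuous_on_compose2[OF cont, where f = "\<lambda>w. (x, w)", simplified])
   (auto intro!: continuous_intros)
 hence "ap (integral (cbox 0 1) (fx x)) = (\<lambda>h. integral (cbox 0 1) (\<lambda>w. k' (w, x) (0, h)))"
  by (intro ext) (simp only: blinfun_apply_integral fx)
 ultimately show ?thesis by simp
qed

lemma smooth_param_integral:
 fixes k :: "real \<times> 'a::euclidean_space => 'b::banach"
 assumes "smooth_fun k"
 shows "smooth_fun (\<lambda>x. integral {0..1} (\<lambda>w. k (w, x)))"
proof -
 have "Ck n (\<lambda>x. integral {0..1} (\<lambda>w. k (w, x)))" if "smooth_fun k" for n and k :: "real \<times> 'a => 'b"
  using that
 proof (induction n arbitrary: k)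
  case 0
  have "continuous_on (UNIV \<times> cbox 0 1) (\<lambda>(x, t). k (t, x))"
   unfolding case_prod_beta
   by (intro continuous_on_compose2[OF smooth_imp_continuous[OF 0, of UNIV]] continuous_intros) auto
  thus ?case using integral_continuous_on_param[of UNIV 0 1 "\<lambda>x t. k (t, x)"] by simp
 next
  case (Suc n)
  show ?case
   by (rule Ck_SucI[OF param_integral_has_derivative[OF smooth_has_derivative[OF Suc.prems]
      smooth_imp_continuous[OF smooth_dird[OF Suc.prems]]]])
    (rule Suc.IH[OF smooth_dird[OF Suc.prems]])
 qed
 thus ?thesis using assms by (simp add: smooth_fun_def)
qed

lemma dird_param_integral:
 fixes k :: "real \<times> 'a::euclidean_space => 'b::banach"
 assumes "smooth_fun k"
 shows "dird h (\<lambda>x. integral {0..1} (\<lambda>w. k (w, x))) x = integral {0..1} (\<lambda>w. dird (0, h) k (w, x))"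
 by (rule dird_eqI[OF param_integral_has_derivative[OF smooth_has_derivative[OF assms]
    smooth_imp_continuous[OF smooth_dird[OF assms]]]])

lemma smooth_ftc_line:
 fixes f :: "'a::euclidean_space => 'b::banach"
 assumes f: "smooth_fun f" and ab: "a <= b"
 shows "((\<lambda>t. dird h f (p + t *\<^sub>R h)) has_integral (f (p + b *\<^sub>R h) - f (p + a *\<^sub>R h))) {a..b}"
 by (rule fundamental_theorem_of_calculus[OF ab smooth_has_vector_derivative_line[OF f]])

text \<open>Symmetry of second derivatives, from differentiating \<open>f(x + t k) - f(x)\<close>, written as an integral,
 in the direction \<open>h\<close>.\<close>

lemma dird_commute:
 fixes f :: "'a::euclidean_space => 'b::banach"
 assumes f: "smooth_fun f"
 shows "dird h (dird k f) x = dird k (dird h f) x"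
proof -
 define G where "G = dird h (dird k f)"
 have G: "smooth_fun G" unfolding G_def by (intro smooth_dird f)
 have eq: "dird h f (y + t *\<^sub>R k) - dird h f y = t *\<^sub>R integral {0..1} (\<lambda>w. G (y + w *\<^sub>R (t *\<^sub>R k)))" for t y
 proof -
  define K where "K p = dird k f (snd p + fst p *\<^sub>R (t *\<^sub>R k))" for p :: "real \<times> 'a"
  have Lbl: "bounded_linear (\<lambda>p :: real \<times> 'a. snd p + fst p *\<^sub>R (t *\<^sub>R k))"
   by (intro bounded_linear_add bounded_linear_snd
     bounded_linear_compose[OF bounded_linear_scaleR_left bounded_linear_fst])
  have K: "smooth_fun K"
   using smooth_compose_affine[OF Lbl smooth_dird[OF f, of k], of 0]
   by (simp only: K_def[abs_def] add_0_right)
  have int: "f (y + t *\<^sub>R k) = f y + t *\<^sub>R integral {0..1} (\<lambda>w. K (w, y))" for y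
  proof -
   have "((\<lambda>w. dird (t *\<^sub>R k) f (y + w *\<^sub>R (t *\<^sub>R k))) has_integral
     (f (y + 1 *\<^sub>R (t *\<^sub>R k)) - f (y + 0 *\<^sub>R (t *\<^sub>R k)))) {0..1}"
    by (rule smooth_ftc_line[OF f]) simp
   moreover have "dird (t *\<^sub>R k) f z = t *\<^sub>R dird k f z" for z
    using dird_linear[OF f, of t k 0 0 z] by simp
   ultimately have "((\<lambda>w. t *\<^sub>R K (w, y)) has_integral (f (y + t *\<^sub>R k) - f y)) {0..1}"
    by (simp only: K_def fst_conv snd_conv scaleR_one scaleR_zero_left add_0_right)
   from integral_unique[OF this] show ?thesis by simp
  qed
  have dK: "dird (0, h) K (w, y) = G (y + w *\<^sub>R (t *\<^sub>R k))" for w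
   unfolding G_def
  proof (rule dird_eqI[THEN trans])
   show "(K has_derivative (\<lambda>q. dird (snd q + fst q *\<^sub>R (t *\<^sub>R k)) (dird k f) (y + w *\<^sub>R (t *\<^sub>R k)))) (at (w, y))"
    unfolding K_def[abs_def]
    using has_derivative_compose[OF bounded_linear_imp_has_derivative[OF Lbl, of "at (w, y)"]
      smooth_has_derivative[OF smooth_dird[OF f, of k]]] by simp
  qed simp
  have "dird h (\<lambda>y. f (y + t *\<^sub>R k)) y = dird h f (y + t *\<^sub>R k)"
   by (rule dird_eqI, rule has_derivative_compose[OF _ smooth_has_derivative[OF f], where f = "\<lambda>y. y + t *\<^sub>R k"])
    (auto intro!: derivative_eq_intros)
  moreover have "dird h (\<lambda>y. f y + t *\<^sub>R integral {0..1} (\<lambda>w. K (w, y))) y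
    = dird h f y + t *\<^sub>R integral {0..1} (\<lambda>w. G (y + w *\<^sub>R (t *\<^sub>R k)))"
   unfolding dK[symmetric] dird_param_integral[OF K, symmetric]
   by (rule dird_eqI[OF has_derivative_add[OF smooth_has_derivative[OF f]
      bounded_linear.has_derivative[OF bounded_linear_scaleR_right
       smooth_has_derivative[OF smooth_param_integral[OF K]]]]])
  moreover have "(\<lambda>y. f (y + t *\<^sub>R k)) = (\<lambda>y. f y + t *\<^sub>R integral {0..1} (\<lambda>w. K (w, y)))"
   by (rule ext) (rule int)
  ultimately have "dird h f y + t *\<^sub>R integral {0..1} (\<lambda>w. G (y + w *\<^sub>R (t *\<^sub>R k))) = dird h f (y + t *\<^sub>R k)"
   by (simp only: )
  thus ?thesis by (metis add_diff_cancel_left')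
 qed
 define J where "J t = integral {0..1} (\<lambda>w. G (x + w *\<^sub>R (t *\<^sub>R k)))" for t
 have J: "(J \<longlongrightarrow> J 0) (at 0)"
 proof -
  have "continuous_on (UNIV \<times> cbox 0 1) (\<lambda>(t, w). G (x + w *\<^sub>R (t *\<^sub>R k)))"
   unfolding case_prod_beta
   by (intro continuous_on_compose2[OF smooth_imp_continuous[OF G, of UNIV]] continuous_intros) auto
  hence "continuous_on UNIV J"
   unfolding J_def using integral_continuous_on_param[of UNIV 0 1 "\<lambda>t w. G (x + w *\<^sub>R (t *\<^sub>R k))"] by simp
  thus ?thesis by (simp add: continuous_on_eq_continuous_at isCont_def)
 qed
 have "((\<lambda>t. t *\<^sub>R J t) has_vector_derivative J 0) (at 0)"
  unfolding has_vector_derivative_def has_derivative_at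
 proof (intro conjI bounded_linear_scaleR_left)
  have "((\<lambda>t. norm (J t - J 0)) \<longlongrightarrow> 0) (at 0)"
   using J by (intro tendsto_norm_zero LIM_zero)
  thus "(\<lambda>t. norm ((0 + t) *\<^sub>R J (0 + t) - 0 *\<^sub>R J 0 - t *\<^sub>R J 0) / norm t) \<midarrow>0\<rightarrow> 0"
  proof (rule Lim_transform_eventually)
   show "\<forall>\<^sub>F t in at 0. norm (J t - J 0) = norm ((0 + t) *\<^sub>R J (0 + t) - 0 *\<^sub>R J 0 - t *\<^sub>R J 0) / norm t"
    unfolding eventually_at by (intro exI[of _ 1]) (simp flip: scaleR_diff_right)
  qed
 qed
 hence "((\<lambda>t. t *\<^sub>R J t + dird h f x) has_vector_derivative J 0) (at 0)"
  by (simp add: has_vector_derivative_add_const)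
 moreover have "t *\<^sub>R J t + dird h f x = dird h f (x + t *\<^sub>R k)" for t
  using eq[of x t] by (simp add: J_def algebra_simps)
 ultimately have "((\<lambda>t. dird h f (x + t *\<^sub>R k)) has_vector_derivative J 0) (at 0)" by simp
 moreover have "((\<lambda>t. dird h f (x + t *\<^sub>R k)) has_vector_derivative dird k (dird h f) (x + 0 *\<^sub>R k)) (at 0)"
  using smooth_has_vector_derivative_line[OF smooth_dird[OF f, of h], of x k 0 UNIV] .
 ultimately have "J 0 = dird k (dird h f) (x + 0 *\<^sub>R k)" by (rule vector_derivative_unique_at)
 hence "dird k (dird h f) x = G x" by (simp add: J_def)
 thus ?thesis by (simp add: G_def)
qed

section \<open>The Cauchy problem of the Klein-Gordon equation\<close>

text \<open>Everywhere convergent power series.\<close>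

definition entire_coeffs :: "(nat => real) => bool"
 where "entire_coeffs c \<longleftrightarrow> (\<forall>x. summable (\<lambda>n. c n * x ^ n))"

definition pseries :: "(nat => real) => real => real"
 where "pseries c x = (\<Sum>n. c n * x ^ n)"

lemma entire_coeffs_diffs: "entire_coeffs c ==> entire_coeffs (diffs c)"
 unfolding entire_coeffs_def by (auto intro: termdiff_converges_all)

lemma pseries_deriv:
 assumes "entire_coeffs c"
 shows "(pseries c has_real_derivative pseries (diffs c) x) (at x)"
 unfolding pseries_def[abs_def]
 by (rule termdiffs_strong_converges_everywhere) (use assms in "simp add: entire_coeffs_def")

lemma smooth_pseries: assumes "entire_coeffs c" shows "smooth_fun (pseries c)"
proof -
 have "Ck n (pseries c)" if "entire_coeffs c" for n c
  using that
 proof (induction n arbitrary: c)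
  case 0
  thus ?case
   using pseries_deriv by (auto intro!: continuous_at_imp_continuous_on DERIV_isCont)
 next
  case (Suc n)
  show ?case
  proof (rule Ck_SucI)
   show "(pseries c has_derivative (\<lambda>h. pseries (diffs c) x * h)) (at x)" for x
    using pseries_deriv[OF Suc.prems, of x] by (simp add: has_field_derivative_def)
   show "Ck n (\<lambda>x. pseries (diffs c) x * h)" for h
    by (intro Ck_mult Ck_const Suc.IH entire_coeffs_diffs Suc.prems)
  qed
 qed
 thus ?thesis using assms by (simp add: smooth_fun_def)
qed

text \<open>The power series of \<open>J\<^sub>0(2 \<surd>(j z))\<close> in \<open>z\<close>, the solution of \<open>(z b')' = - j b\<close> with \<open>b(0) = 1\<close>.\<close>

definition bessel_coeff :: "real => nat => real"
 where "bessel_coeff j k = (- j) ^ k / (fact k)^2"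

lemma entire_bessel: "entire_coeffs (bessel_coeff j)"
 unfolding entire_coeffs_def
proof
 fix x :: real
 show "summable (\<lambda>n. bessel_coeff j n * x ^ n)"
 proof (rule summable_comparison_test)
  show "summable (\<lambda>n. inverse (fact n) * \<bar>j * x\<bar> ^ n)" by (rule summable_exp)
  have "norm (bessel_coeff j n * x ^ n) <= inverse (fact n) * \<bar>j * x\<bar> ^ n" for n
  proof -
   have "norm (bessel_coeff j n * x ^ n) = inverse (fact n) * (inverse (fact n) * \<bar>j * x\<bar> ^ n)"
    by (simp add: bessel_coeff_def abs_mult power_abs power_mult_distrib power2_eq_square divide_inverse)
   also have "... <= inverse (fact n) * (1 * \<bar>j * x\<bar> ^ n)"
    by (intro mult_left_mono mult_right_mono) (auto simp: inverse_le_1_iff)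
   finally show ?thesis by simp
  qed
  thus "\<exists>N. \<forall>n\<ge>N. norm (bessel_coeff j n * x ^ n) <= inverse (fact n) * \<bar>j * x\<bar> ^ n" by blast
 qed
qed

text \<open>The function and its first two derivatives.\<close>

abbreviation bes :: "real => real => real" where "bes j \<equiv> pseries (bessel_coeff j)"
abbreviation bes1 :: "real => real => real" where "bes1 j \<equiv> pseries (diffs (bessel_coeff j))"
abbreviation bes2 :: "real => real => real" where "bes2 j \<equiv> pseries (diffs (diffs (bessel_coeff j)))"

lemmas bes_deriv = pseries_deriv[OF entire_bessel]
lemmas bes1_deriv = pseries_deriv[OF entire_coeffs_diffs[OF entire_bessel]]
lemmas smooth_bes = smooth_pseries[OF entire_bessel]
lemmas smooth_bes1 = smooth_pseries[OF entire_coeffs_diffs[OF entire_bessel]]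

lemma bes_0: "bes j 0 = 1"
proof -
 have "bes j 0 = bessel_coeff j 0"
  unfolding pseries_def by (rule powser_zero)
 thus ?thesis by (simp add: bessel_coeff_def)
qed

lemma bes_ode: "bes1 j z + z * bes2 j z = - j * bes j z"
proof -
 let ?c = "bessel_coeff j"
 have s1: "summable (\<lambda>n. diffs ?c n * z ^ n)" and s2: "summable (\<lambda>n. diffs (diffs ?c) n * z ^ n)"
  using entire_coeffs_diffs[OF entire_bessel] entire_coeffs_diffs[OF entire_coeffs_diffs[OF entire_bessel]]
  by (auto simp: entire_coeffs_def)
 have shift: "(\<lambda>n. of_nat n * diffs ?c n * z ^ n) sums (z * bes2 j z)"
 proof -
  have "(\<lambda>n. of_nat (Suc n) * diffs ?c (Suc n) * z ^ Suc n) sums (z * bes2 j z)"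
   using sums_mult[OF summable_sums[OF s2], of z] unfolding pseries_def
   by (simp add: diffs_def[of "diffs ?c"] mult_ac)
  thus ?thesis using sums_Suc_iff[of "\<lambda>n. of_nat n * diffs ?c n * z ^ n"] by simp
 qed
 have "(\<lambda>n. diffs ?c n * z ^ n + of_nat n * diffs ?c n * z ^ n) sums (bes1 j z + z * bes2 j z)"
  by (intro sums_add shift) (use summable_sums[OF s1] in "simp add: pseries_def")
 moreover have "diffs ?c n * z ^ n + of_nat n * diffs ?c n * z ^ n = (- j) * (?c n * z ^ n)" for n
 proof -
  have "diffs ?c n + of_nat n * diffs ?c n = (- j) * ?c n"
   by (simp add: diffs_def bessel_coeff_def power2_eq_square field_simps del: of_nat_Suc)
    (simp add: algebra_simps)
  hence "(diffs ?c n + of_nat n * diffs ?c n) * z ^ n = ((- j) * ?c n) * z ^ n" by simp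
  thus ?thesis by (simp only: distrib_right mult.assoc)
 qed
 moreover have bs: "(\<lambda>n. (- j) * (?c n * z ^ n)) sums ((- j) * bes j z)"
  using entire_bessel unfolding pseries_def entire_coeffs_def by (intro sums_mult summable_sums) auto
 ultimately have "(\<lambda>n. (- j) * (?c n * z ^ n)) sums (bes1 j z + z * bes2 j z)"
  by (simp only:)
 thus ?thesis by (rule sums_unique2[OF _ bs])
qed

text \<open>The integral of \<open>k(y, u, v)\<close> over \<open>y\<close> from \<open>u\<close> to \<open>v\<close>, oriented and with the domain normalised.\<close>

definition oint :: "(real \<times> real \<times> real => real) => real \<times> real => real"
 where "oint k x = (snd x - fst x) * integral {0..1} (\<lambda>w. k (fst x + w * (snd x - fst x), x))"

text \<open>Differentiation of an integral with variable limits.\<close>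

lemma dird_oint:
 assumes k: "smooth_fun k"
 shows "dird h (oint k) x = snd h * k (snd x, x) - fst h * k (fst x, x) + oint (dird (0, h) k) x"
proof -
 define K where "K p = k (fst (snd p) + fst p * (snd (snd p) - fst (snd p)), snd p)" for p :: "real \<times> real \<times> real"
 define K' where "K' p q = dird (fst (snd q) + (fst p * (snd (snd q) - fst (snd q)) + fst q * (snd (snd p) - fst (snd p))), snd q) k
  (fst (snd p) + fst p * (snd (snd p) - fst (snd p)), snd p)" for p q :: "real \<times> real \<times> real"
 have K: "(K has_derivative K' p) (at p)" for p
  unfolding K_def[abs_def] K'_def[abs_def]
  by (rule has_derivative_compose[OF _ smooth_has_derivative[OF k],
     where f = "\<lambda>p. (fst (snd p) + fst p * (snd (snd p) - fst (snd p)), snd p)"])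
   (auto intro!: derivative_eq_intros)
 have lin: "dird (s, g) k p = s * dird (1, 0) k p + dird (0, g) k p" for s g p
  using dird_linear[OF k, of s "(1, 0)" 1 "(0, g)"] by simp
 have K'_eq: "K' p q = (fst (snd q) + (fst p * (snd (snd q) - fst (snd q)) + fst q * (snd (snd p) - fst (snd p))))
   * dird (1, 0) k (fst (snd p) + fst p * (snd (snd p) - fst (snd p)), snd p)
   + dird (0, snd q) k (fst (snd p) + fst p * (snd (snd p) - fst (snd p)), snd p)" for p q
  unfolding K'_def by (rule lin)
 have cK': "continuous_on UNIV (\<lambda>p. K' p q)" for q
  unfolding K'_eq
  by (intro continuous_intros continuous_on_compose2[OF smooth_imp_continuous[OF smooth_dird[OF k], of UNIV]]) auto
 have eq: "oint k = (\<lambda>x. (snd x - fst x) * integral {0..1} (\<lambda>w. K (w, x)))"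
  by (simp add: oint_def K_def fun_eq_iff)
 obtain u v where x: "x = (u, v)" by (cases x)
 obtain hu hv where h: "h = (hu, hv)" by (cases h)
 define d where "d = v - u"
 define c where "c w = hu + w * (hv - hu)" for w
 have K'h: "K' (w, x) (0, h) = c w * dird (1, 0) k (u + w * d, x) + dird (0, h) k (u + w * d, x)" for w
  unfolding K'_eq by (simp add: x h c_def d_def)
 have D: "dird h (oint k) x = (v - u) * integral {0..1} (\<lambda>w. K' (w, x) (0, h)) + (hv - hu) * integral {0..1} (\<lambda>w. K (w, x))"
  unfolding eq
  by (rule dird_eqI[THEN trans], rule has_derivative_mult[OF _ param_integral_has_derivative[OF K cK']])
   (auto intro!: derivative_eq_intros simp: x h)
 have cont: "continuous_on {0..1} (\<lambda>w. g (u + w * d, x))" if "smooth_fun g" for g :: "real \<times> real \<times> real => real"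
  by (intro continuous_on_compose2[OF smooth_imp_continuous[OF that, of UNIV]] continuous_intros) auto
 have cc: "continuous_on {0..1} c" unfolding c_def by (intro continuous_intros)
 have i1: "(\<lambda>w. k (u + w * d, x)) integrable_on {0..1}"
  and i2: "(\<lambda>w. dird (0, h) k (u + w * d, x)) integrable_on {0..1}"
  and i3: "(\<lambda>w. c w * dird (1, 0) k (u + w * d, x)) integrable_on {0..1}"
  by (intro integrable_continuous_real continuous_intros cont cc smooth_dird k)+
 have "((\<lambda>w. (hv - hu) * k (u + w * d, x) + d * (c w * dird (1, 0) k (u + w * d, x)))
   has_integral (c 1 * k (u + 1 * d, x) - c 0 * k (u + 0 * d, x))) {0..1}"
 proof (rule fundamental_theorem_of_calculus)
  fix w
  have "((\<lambda>w. k ((u, x) + w *\<^sub>R (d, 0))) has_vector_derivative dird (d, 0) k ((u, x) + w *\<^sub>R (d, 0))) (at w within {0..1})"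
   by (rule smooth_has_vector_derivative_line[OF k])
  hence "((\<lambda>w. k (u + w * d, x)) has_vector_derivative d * dird (1, 0) k (u + w * d, x)) (at w within {0..1})"
   using dird_linear[OF k, of d "(1, 0)" 0 0] by simp
  thus "((\<lambda>w. c w * k (u + w * d, x)) has_vector_derivative
    (hv - hu) * k (u + w * d, x) + d * (c w * dird (1, 0) k (u + w * d, x))) (at w within {0..1})"
   unfolding c_def has_real_derivative_iff_has_vector_derivative[symmetric]
   by (auto intro!: derivative_eq_intros simp: algebra_simps)
 qed simp
 moreover have "integral {0..1} (\<lambda>w. (hv - hu) * k (u + w * d, x) + d * (c w * dird (1, 0) k (u + w * d, x)))
   = (hv - hu) * integral {0..1} (\<lambda>w. k (u + w * d, x)) + d * integral {0..1} (\<lambda>w. c w * dird (1, 0) k (u + w * d, x))"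
  by (subst integral_add) (simp_all add: i1 i3 integrable_on_mult_right)
 ultimately have ftc: "(hv - hu) * integral {0..1} (\<lambda>w. k (u + w * d, x)) + d * integral {0..1} (\<lambda>w. c w * dird (1, 0) k (u + w * d, x))
   = hv * k (v, x) - hu * k (u, x)"
  by (simp add: integral_unique c_def d_def)
 have "integral {0..1} (\<lambda>w. K' (w, x) (0, h))
   = integral {0..1} (\<lambda>w. c w * dird (1, 0) k (u + w * d, x)) + integral {0..1} (\<lambda>w. dird (0, h) k (u + w * d, x))"
  unfolding K'h by (rule integral_add[OF i3 i2])
 with D ftc show ?thesis
  by (simp add: oint_def K_def x h d_def algebra_simps)
qed

text \<open>The solution \<open>F(u, v)\<close>, in light-cone coordinates, with vanishing field and velocity \<open>r\<close> on
 the diagonal: \<open>\<partial>\<^sub>u \<partial>\<^sub>v F = j F\<close>. Its support properties can be read off.\<close>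

definition kg_kernel :: "real => (real => real) => real \<times> real \<times> real => real"
 where "kg_kernel j r p = bes j ((fst p - fst (snd p)) * (snd (snd p) - fst p)) * r (fst p)"

definition kg_velocity :: "real => (real => real) => real \<times> real => real"
 where "kg_velocity j r x = oint (kg_kernel j r) x / 2"

lemma bounded_linear_coords:
 "bounded_linear (\<lambda>p :: real \<times> real \<times> real. fst p)" "bounded_linear (\<lambda>p :: real \<times> real \<times> real. fst (snd p))"
 "bounded_linear (\<lambda>p :: real \<times> real \<times> real. snd (snd p))"
 by (intro bounded_linear_fst bounded_linear_fst_comp bounded_linear_snd_comp bounded_linear_snd)+

lemma smooth_kg_velocity:
 assumes r: "smooth_fun r"
 shows "smooth_fun (kg_velocity j r)"
proof -
 define k where "k p = bes j (fst p * ((1 - fst p) * ((snd (snd p) - fst (snd p)) * (snd (snd p) - fst (snd p)))))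
   * r (fst (snd p) + fst p * (snd (snd p) - fst (snd p)))" for p :: "real \<times> real \<times> real"
 have smk: "smooth_fun k"
  unfolding k_def
  by (intro smooth_mult smooth_compose_real[OF smooth_bes] smooth_compose_real[OF r] smooth_diff smooth_add
    smooth_const smooth_linear bounded_linear_coords)
 have "kg_kernel j r (fst x + w * (snd x - fst x), x) = k (w, x)" for w x
  by (simp add: algebra_simps kg_kernel_def k_def)
 hence "kg_velocity j r = (\<lambda>x. ((snd x - fst x) * integral {0..1} (\<lambda>w. k (w, x))) / 2)"
  by (simp add: kg_velocity_def oint_def fun_eq_iff)
 thus ?thesis
  by (simp only:) (intro smooth_compose_linear[OF bounded_linear_divide] smooth_mult smooth_diff
    smooth_param_integral[OF smk] smooth_linear bounded_linear_fst bounded_linear_snd)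
qed

lemma kg_velocity_diag: "kg_velocity j r (x, x) = 0"
 by (simp add: kg_velocity_def oint_def)

lemma kg_velocity_zero:
 assumes "!!y. y \<in> closed_segment u v ==> r y = 0"
 shows "kg_velocity j r (u, v) = 0"
proof -
 have "r (u + w * (v - u)) = 0" if "w \<in> {0..1}" for w
  by (rule assms) (use that in "auto simp: in_segment algebra_simps intro!: exI[of _ w]")
 hence "integral {0..1} (\<lambda>w. kg_kernel j r (u + w * (v - u), u, v)) = integral {0..1} (\<lambda>w::real. 0)"
  by (intro integral_cong) (simp add: kg_kernel_def)
 thus ?thesis by (simp add: kg_velocity_def oint_def)
qed

lemma kg_velocity_derivs:
 assumes r: "smooth_fun r"
 shows "dird (0, 1) (kg_velocity j r) (u, u) = r u / 2" (is ?a)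
  and "dird (1, 0) (kg_velocity j r) (u, u) = - r u / 2" (is ?b)
  and "dird (1, 0) (dird (0, 1) (kg_velocity j r)) x = j * kg_velocity j r x" (is ?c)
proof -
 let ?q = "\<lambda>p :: real \<times> real \<times> real. (fst p - fst (snd p)) * (snd (snd p) - fst p)"
 define kv where "kv p = (fst p - fst (snd p)) * (bes1 j (?q p) * r (fst p))" for p
 define rr where "rr = (\<lambda>p :: real \<times> real \<times> real. r (fst p))"
 have kk: "kg_kernel j r = (\<lambda>p. bes j (?q p) * rr p)"
  by (simp add: kg_kernel_def rr_def fun_eq_iff)
 have kvv: "kv = (\<lambda>p. (fst p - fst (snd p)) * (bes1 j (?q p) * rr p))"
  by (simp add: kv_def rr_def fun_eq_iff)
 have smq: "smooth_fun ?q"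
  by (intro smooth_mult smooth_diff smooth_linear bounded_linear_coords)
 have smr: "smooth_fun rr"
  unfolding rr_def by (intro smooth_compose_real[OF r] smooth_linear bounded_linear_coords)
 have smk: "smooth_fun (kg_kernel j r)"
  unfolding kg_kernel_def[abs_def]
  by (intro smooth_mult smooth_compose_real[OF smooth_bes] smq smr[unfolded rr_def])
 have smkv: "smooth_fun kv"
  unfolding kv_def[abs_def]
  by (intro smooth_mult smooth_compose_real[OF smooth_bes1] smq smr[unfolded rr_def] smooth_diff smooth_linear bounded_linear_coords)
 have drr: "(rr has_derivative (\<lambda>h. dird h rr p)) (at p)" for p
  by (rule smooth_has_derivative[OF smr])
 have drr0: "dird (0, h) rr p = 0" for h p
 proof -
  have "(rr has_derivative (\<lambda>h. dird (fst h) r (fst p))) (at p)"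
   unfolding rr_def by (rule has_derivative_compose[OF _ smooth_has_derivative[OF r], where f = fst])
    (auto intro!: derivative_eq_intros)
  from dird_eqI[OF this, of "(0, h)"] have "dird (0, h) rr p = dird 0 r (fst p)" by simp
  thus ?thesis using dird_linear[OF r, of 0 0 0 0] by simp
 qed
 have dq: "(?q has_derivative (\<lambda>h. (fst p - fst (snd p)) * (snd (snd h) - fst h) + (fst h - fst (snd h)) * (snd (snd p) - fst p))) (at p)" for p
  by (auto intro!: derivative_eq_intros)
 have dk: "dird (0, h) (kg_kernel j r) p
   = ((fst p - fst (snd p)) * snd h - fst h * (snd (snd p) - fst p)) * bes1 j (?q p) * r (fst p)" for h p
 proof -
  have "((\<lambda>p. bes j (?q p) * rr p) has_derivative (\<lambda>h. bes j (?q p) * dird h rr p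
    + ((fst p - fst (snd p)) * (snd (snd h) - fst h) + (fst h - fst (snd h)) * (snd (snd p) - fst p)) * bes1 j (?q p) * rr p)) (at p)"
   by (rule has_derivative_mult[OF DERIV_compose_FDERIV[OF bes_deriv dq] drr])
  from dird_eqI[OF this] show ?thesis
   unfolding kk by (simp add: drr0) (simp add: rr_def)
 qed
 have dkv: "dird (0, (1, 0)) kv p = j * kg_kernel j r p" for p
 proof -
  have d1: "((\<lambda>p :: real \<times> real \<times> real. fst p - fst (snd p)) has_derivative (\<lambda>h. fst h - fst (snd h))) (at p)"
   by (auto intro!: derivative_eq_intros)
  have "((\<lambda>p. (fst p - fst (snd p)) * (bes1 j (?q p) * rr p)) has_derivative (\<lambda>h. (fst p - fst (snd p)) *
    (bes1 j (?q p) * dird h rr p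
    + ((fst p - fst (snd p)) * (snd (snd h) - fst h) + (fst h - fst (snd h)) * (snd (snd p) - fst p)) * bes2 j (?q p) * rr p)
    + (fst h - fst (snd h)) * (bes1 j (?q p) * rr p))) (at p)"
   by (rule has_derivative_mult[OF d1 has_derivative_mult[OF DERIV_compose_FDERIV[OF bes1_deriv dq] drr]])
  from dird_eqI[OF this, of "(0, 1, 0)"]
  have "dird (0, (1, 0)) kv p = - (bes1 j (?q p) + ?q p * bes2 j (?q p)) * rr p"
   unfolding kvv by (simp add: drr0 algebra_simps)
  thus ?thesis unfolding bes_ode by (simp add: kg_kernel_def rr_def)
 qed
 have dv: "dird h (kg_velocity j r) x = (snd h * kg_kernel j r (snd x, x) - fst h * kg_kernel j r (fst x, x)
   + oint (dird (0, h) (kg_kernel j r)) x) / 2" for h x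
 proof -
  have sm2: "smooth_fun (oint (kg_kernel j r))"
   using smooth_mult[OF smooth_const[of 2] smooth_kg_velocity[OF r, of j]] by (simp add: kg_velocity_def[abs_def])
  have "dird h (\<lambda>x. oint (kg_kernel j r) x / 2) x = dird h (oint (kg_kernel j r)) x / 2"
   by (rule dird_compose_linear[OF bounded_linear_divide sm2])
  thus ?thesis unfolding kg_velocity_def[abs_def] dird_oint[OF smk] .
 qed
 show ?a unfolding dv by (simp add: kg_kernel_def bes_0 oint_def)
 show ?b unfolding dv by (simp add: kg_kernel_def bes_0 oint_def)
 have dkv': "dird (0, (0, 1)) (kg_kernel j r) = kv"
  unfolding dk fun_eq_iff by (simp add: kv_def)
 have "dird (0, 1) (kg_velocity j r) = (\<lambda>x. r (snd x) / 2 + oint kv x / 2)"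
  unfolding fun_eq_iff dv dkv' by (simp add: kg_kernel_def bes_0)
 moreover have sm1: "smooth_fun (\<lambda>x. r (snd x) / 2)"
  by (intro smooth_compose_linear[OF bounded_linear_divide] smooth_compose_real[OF r] smooth_linear bounded_linear_snd)
 moreover from calculation have sm3: "smooth_fun (\<lambda>x. oint kv x / 2)"
  using smooth_diff[OF smooth_dird[OF smooth_kg_velocity[OF r, of j], of "(0, 1)"] sm1] by simp
 ultimately have "dird (1, 0) (dird (0, 1) (kg_velocity j r)) x
   = dird (1, 0) (\<lambda>x. r (snd x) / 2) x + dird (1, 0) (\<lambda>x. oint kv x / 2) x"
  using dird_add by simp
 also have "dird (1, 0) (\<lambda>x. r (snd x) / 2) x = 0"
 proof -
  have "((\<lambda>x :: real \<times> real. r (snd x)) has_derivative (\<lambda>h. dird (snd h) r (snd x))) (at x)"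
   by (rule has_derivative_compose[OF _ smooth_has_derivative[OF r], where f = snd])
    (auto intro!: derivative_eq_intros)
  from dird_eqI[OF bounded_linear.has_derivative[OF bounded_linear_divide this], of "(1, 0)" 2]
  show ?thesis using dird_linear[OF r, of 0 0 0 0] by simp
 qed
 also have "dird (1, 0) (\<lambda>x. oint kv x / 2) x = dird (1, 0) (oint kv) x / 2"
  by (rule dird_compose_linear[OF bounded_linear_divide])
   (use smooth_mult[OF smooth_const[of 2] sm3] in simp)
 also have "dird (1, 0) (oint kv) x = oint (\<lambda>p. j * kg_kernel j r p) x"
  unfolding dird_oint[OF smkv] ext[of "dird (0, 1, 0) kv", OF dkv] by (simp add: kv_def[of "(fst x, x)"])
 also have "... = j * oint (kg_kernel j r) x" by (simp add: oint_def)
 finally show ?c unfolding kg_velocity_def[of j r x] by simp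
qed

section \<open>Test functions as Cauchy data\<close>

lemma smooth_fun_real_iff:
 fixes f :: "real => 'b::real_normed_vector"
 shows "smooth_fun f \<longleftrightarrow> (\<forall>n x. ((\<lambda>g x. vector_derivative g (at x)) ^^ n) f differentiable (at x))"
  (is "_ \<longleftrightarrow> (\<forall>n x. (?D ^^ n) f differentiable (at x))")
proof
 assume f: "smooth_fun f"
 have "smooth_fun ((?D ^^ n) f)" for n
 proof (induction n)
  case (Suc n)
  have "?D g = dird 1 g" if "smooth_fun g" for g :: "real => 'b"
  proof
   fix x
   have "((\<lambda>t. g (0 + t *\<^sub>R 1)) has_vector_derivative dird 1 g (0 + x *\<^sub>R 1)) (at x within UNIV)"
    by (rule smooth_has_vector_derivative_line[OF that])
   thus "?D g x = dird 1 g x" by (simp add: vector_derivative_at)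
  qed
  thus ?case using Suc by (simp add: smooth_dird)
 qed (simp add: f)
 thus "\<forall>n x. (?D ^^ n) f differentiable (at x)"
  using smooth_has_derivative unfolding differentiable_def by blast
next
 assume D: "\<forall>n x. (?D ^^ n) f differentiable (at x)"
 have "Ck k g" if "\<forall>n x. (?D ^^ n) g differentiable (at x)" for k and g :: "real => 'b"
  using that
 proof (induction k arbitrary: g)
  case 0
  have "g differentiable (at x)" for x using 0[rule_format, of 0 x] by simp
  thus ?case
   by (auto intro!: continuous_at_imp_continuous_on differentiable_imp_continuous_within)
 next
  case (Suc k)
  have "g differentiable (at x)" for x using Suc.prems[rule_format, of 0 x] by simp
  hence "(g has_derivative (\<lambda>h. h *\<^sub>R ?D g x)) (at x)" for x
   using vector_derivative_works[of g "at x"] by (simp add: has_vector_derivative_def)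
  moreover have "\<forall>n x. (?D ^^ n) (?D g) differentiable (at x)"
   using Suc.prems by (metis funpow_simps_right(2) comp_apply)
  ultimately show ?case
   by (intro Ck_SucI[of g "\<lambda>x h. h *\<^sub>R ?D g x"] Ck_scaleR Ck_const Suc.IH)
 qed
 thus "smooth_fun f" using D by (simp add: smooth_fun_def)
qed

lemma test_functions_iff:
 "f \<in> \<D> \<longleftrightarrow> smooth_fun f \<and> (\<exists>a b. \<forall>x. f x ~= 0 --> a <= x \<and> x <= b)"
proof -
 have "compact (closure {x. f x ~= 0}) \<longleftrightarrow> (\<exists>a b. \<forall>x. f x ~= 0 --> a <= x \<and> x <= b)"
 proof
  assume "compact (closure {x. f x ~= 0})"
  hence "bounded {x. f x ~= 0}" by (rule bounded_subset[OF compact_imp_bounded closure_subset])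
  then obtain B where "\<forall>x\<in>{x. f x ~= 0}. norm x <= B" unfolding bounded_iff by blast
  thus "\<exists>a b. \<forall>x. f x ~= 0 --> a <= x \<and> x <= b"
   by (intro exI[of _ "-B"] exI[of _ B]) force
 next
  assume "\<exists>a b. \<forall>x. f x ~= 0 --> a <= x \<and> x <= b"
  then obtain a b where "\<forall>x. f x ~= 0 --> a <= x \<and> x <= b" by (elim exE)
  hence "{x. f x ~= 0} \<subseteq> {a..b}" by auto
  hence "bounded {x. f x ~= 0}" using bounded_subset bounded_closed_interval by blast
  thus "compact (closure {x. f x ~= 0})" by simp
 qed
 thus ?thesis unfolding test_functions_def smooth_fun_real_iff mem_Collect_eq
  by (intro iffI conjI; elim conjE; simp)
qed

lemma test_smooth: "f \<in> \<D> ==> smooth_fun f"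
 by (simp add: test_functions_iff)

lemma test_supportE:
 assumes "f \<in> \<D>"
 obtains L where "L > 0" "!!x. \<bar>x\<bar> > L ==> f x = 0"
proof -
 obtain a b where "\<forall>x. f x ~= 0 --> a <= x \<and> x <= b" using assms by (auto simp: test_functions_iff)
 thus ?thesis by (intro that[of "\<bar>a\<bar> + \<bar>b\<bar> + 1"]) fastforce+
qed

lemma test_functionsI: "smooth_fun f ==> (!!x. \<bar>x\<bar> > L ==> f x = 0) ==> f \<in> \<D>"
 unfolding test_functions_iff
 by (intro conjI exI[of _ "- L"] exI[of _ L]) (auto simp: abs_less_iff not_less abs_le_iff intro: ccontr)

lemma smooth_Re: "smooth_fun f ==> smooth_fun (\<lambda>x. Re (f x))"
 and smooth_Im: "smooth_fun f ==> smooth_fun (\<lambda>x. Im (f x))"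
 by (auto intro: smooth_compose_linear bounded_linear_Re bounded_linear_Im)

lemma smooth_of_real: "smooth_fun f ==> smooth_fun (\<lambda>x. of_real (f x))"
 by (rule smooth_compose_linear[OF bounded_linear_of_real])

text \<open>The solution of \<open>\<partial>\<^sub>u \<partial>\<^sub>v F = j F\<close> with field \<open>Im f\<close> and velocity \<open>Re f\<close> on the diagonal; the first term
 accounts for the velocity, the second is the time derivative of the solution with velocity \<open>Im f\<close>.\<close>

definition kg_field :: "real => (real => complex) => real \<times> real => real"
 where "kg_field j f x = kg_velocity j (\<lambda>x. Re (f x)) x +
  (dird (0, 1) (kg_velocity j (\<lambda>x. Im (f x))) x - dird (1, 0) (kg_velocity j (\<lambda>x. Im (f x))) x)"

context
 fixes f :: "real => complex" and j :: real
 assumes f: "smooth_fun f"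
begin

lemmas kg_smooth_parts = smooth_kg_velocity[OF smooth_Re[OF f], of j] smooth_kg_velocity[OF smooth_Im[OF f], of j]

lemma smooth_kg_field: "smooth_fun (kg_field j f)"
 unfolding kg_field_def[abs_def]
 by (intro smooth_add smooth_diff smooth_dird kg_smooth_parts)

lemma kg_equation: "dird (1, 0) (dird (0, 1) (kg_field j f)) x = j * kg_field j f x"
proof -
 define R I where "R = kg_velocity j (\<lambda>x. Re (f x))" and "I = kg_velocity j (\<lambda>x. Im (f x))"
 have sm: "smooth_fun R" "smooth_fun I" unfolding R_def I_def by (rule kg_smooth_parts)+
 have uvR: "dird (1, 0) (dird (0, 1) R) = (\<lambda>x. j * R x)"
  and uvI: "dird (1, 0) (dird (0, 1) I) = (\<lambda>x. j * I x)"
  unfolding R_def I_def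
  by (rule ext, rule kg_velocity_derivs(3)[OF smooth_Re[OF f]], rule ext, rule kg_velocity_derivs(3)[OF smooth_Im[OF f]])
 have *: "dird (1, 0) (dird (0, 1) (dird h I)) x = j * dird h I x" for h x
 proof -
  have "dird (0, 1) (dird h I) = dird h (dird (0, 1) I)" by (rule ext) (rule dird_commute[OF sm(2)])
  hence "dird (1, 0) (dird (0, 1) (dird h I)) x = dird h (dird (1, 0) (dird (0, 1) I)) x"
   using dird_commute[OF smooth_dird[OF sm(2)]] by simp
  also have "... = j * dird h I x"
   unfolding uvI by (rule dird_compose_linear[OF bounded_linear_mult_right sm(2)])
  finally show ?thesis .
 qed
 have 1: "dird (0, 1) (kg_field j f) = (\<lambda>x. dird (0, 1) R x + (dird (0, 1) (dird (0, 1) I) x - dird (0, 1) (dird (1, 0) I) x))"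
  unfolding kg_field_def[abs_def] R_def[symmetric] I_def[symmetric]
  by (rule ext) (simp add: dird_add dird_diff smooth_diff smooth_dird sm)
 show ?thesis
  unfolding 1
  by (simp add: dird_add dird_diff smooth_diff smooth_dird sm * uvR)
   (simp add: kg_field_def R_def I_def algebra_simps)
qed

lemma kg_field_diag: "kg_field j f (x, x) = Im (f x)"
 by (simp add: kg_field_def kg_velocity_diag kg_velocity_derivs smooth_Im[OF f])

lemma kg_field_diag_velocity: "dird (0, 1) (kg_field j f) (x, x) - dird (1, 0) (kg_field j f) (x, x) = Re (f x)"
proof -
 define R I where "R = kg_velocity j (\<lambda>x. Re (f x))" and "I = kg_velocity j (\<lambda>x. Im (f x))"
 have sm: "smooth_fun R" "smooth_fun I" unfolding R_def I_def by (rule kg_smooth_parts)+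
 have split: "dird (1, 1) F y = dird (1, 0) F y + dird (0, 1) F y" if "smooth_fun F" for F :: "real \<times> real => real" and y
  using dird_linear[OF that, of 1 "(1, 0)" 1 "(0, 1)" y] by simp
 have diag: "dird (1, 1) F (t, t) = 0" if F: "smooth_fun F" "!!t. F (t, t) = 0" for F :: "real \<times> real => real" and t
 proof -
  have "((\<lambda>t. F (0 + t *\<^sub>R (1, 1))) has_vector_derivative dird (1, 1) F (0 + t *\<^sub>R (1, 1))) (at t within UNIV)"
   by (rule smooth_has_vector_derivative_line[OF F(1)])
  hence "((\<lambda>t. 0) has_vector_derivative dird (1, 1) F (t, t)) (at t)" using F(2) by simp
  thus ?thesis using vector_derivative_unique_at has_vector_derivative_const by blast
 qed
 have "dird (1, 1) (dird (1, 1) I) (x, x) = 0"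
  by (intro diag smooth_dird sm) (simp add: I_def kg_velocity_diag)
 moreover have "dird (1, 1) I = (\<lambda>y. dird (1, 0) I y + dird (0, 1) I y)"
  by (rule ext) (rule split[OF sm(2)])
 ultimately have "dird (1, 0) (dird (1, 0) I) (x, x) + dird (1, 0) (dird (0, 1) I) (x, x)
   + (dird (0, 1) (dird (1, 0) I) (x, x) + dird (0, 1) (dird (0, 1) I) (x, x)) = 0"
  by (simp add: split smooth_add smooth_dird sm dird_add)
 moreover have "dird (0, 1) (dird (1, 0) I) (x, x) = dird (1, 0) (dird (0, 1) I) (x, x)"
  by (rule dird_commute[OF sm(2)])
 moreover have "dird (1, 0) (dird (0, 1) I) (x, x) = 0"
  unfolding I_def by (simp add: kg_velocity_derivs smooth_Im[OF f] kg_velocity_diag)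
 ultimately have I0: "dird (0, 1) (dird (0, 1) I) (x, x) + dird (1, 0) (dird (1, 0) I) (x, x)
   - dird (0, 1) (dird (1, 0) I) (x, x) - dird (1, 0) (dird (0, 1) I) (x, x) = 0" by simp
 have "dird h (kg_field j f) (x, x) = dird h R (x, x) + (dird h (dird (0, 1) I) (x, x) - dird h (dird (1, 0) I) (x, x))" for h
  unfolding kg_field_def[abs_def] R_def[symmetric] I_def[symmetric]
  by (simp add: dird_add dird_diff smooth_diff smooth_dird sm)
 moreover have "dird (0, 1) R (x, x) - dird (1, 0) R (x, x) = Re (f x)"
  unfolding R_def by (simp add: kg_velocity_derivs smooth_Re[OF f])
 ultimately show ?thesis using I0 by simp
qed

text \<open>Finite propagation speed: the field vanishes where the past or future light cone of the point
 meets the initial line only outside the support of the data.\<close>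

lemma kg_field_zero:
 assumes Z: "open Z" "!!u v. (u, v) \<in> Z ==> \<forall>y\<in>closed_segment u v. f y = 0" and x: "x \<in> Z"
 shows "kg_field j f x = 0" "dird h (kg_field j f) x = 0"
proof -
 have v: "kg_velocity j (\<lambda>x. g (f x)) y = 0" if "y \<in> Z" "g 0 = 0" for y and g :: "complex => real"
  using kg_velocity_zero[of "fst y" "snd y" "\<lambda>x. g (f x)" j] Z(2)[of "fst y" "snd y"] that by simp
 have dz: "dird h F y = 0" if F: "!!y. y \<in> Z ==> F y = 0" and y: "y \<in> Z" for F :: "real \<times> real => real" and h y
  by (metis has_derivative_transform_within_open[OF has_derivative_const[of 0] Z(1) y, of F] F dird_eqI)
 have z: "kg_field j f y = 0" if "y \<in> Z" for y
  unfolding kg_field_def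
  using v[OF that, of Re] dz[of "kg_velocity j (\<lambda>x. Im (f x))", OF v that] by simp
 show "kg_field j f x = 0" "dird h (kg_field j f) x = 0" using z[OF x] dz[OF z x] by simp_all
qed

end

section \<open>Closed one-forms\<close>

text \<open>The Poincare lemma in the plane: the potential is the integral of the form along the segment from
 the origin.\<close>

lemma closed_form_potential:
 fixes P Q :: "real \<times> real => complex"
 assumes P: "smooth_fun P" and Q: "smooth_fun Q"
  and closed: "!!x. dird (0, 1) P x = dird (1, 0) Q x"
 shows "\<exists>\<Psi>. \<forall>x. (\<Psi> has_derivative (\<lambda>h. fst h *\<^sub>R P x + snd h *\<^sub>R Q x)) (at x)"
proof -
 define k where "k p = fst (snd p) *\<^sub>R P (fst p *\<^sub>R snd p) + snd (snd p) *\<^sub>R Q (fst p *\<^sub>R snd p)"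
  for p :: "real \<times> real \<times> real"
 define k' where "k' p q = (fst (snd p) *\<^sub>R dird (fst p *\<^sub>R snd q + fst q *\<^sub>R snd p) P (fst p *\<^sub>R snd p)
   + fst (snd q) *\<^sub>R P (fst p *\<^sub>R snd p))
  + (snd (snd p) *\<^sub>R dird (fst p *\<^sub>R snd q + fst q *\<^sub>R snd p) Q (fst p *\<^sub>R snd p)
   + snd (snd q) *\<^sub>R Q (fst p *\<^sub>R snd p))" for p q :: "real \<times> real \<times> real"
 have comp: "((\<lambda>p :: real \<times> real \<times> real. F (fst p *\<^sub>R snd p)) has_derivative
   (\<lambda>q. dird (fst p *\<^sub>R snd q + fst q *\<^sub>R snd p) F (fst p *\<^sub>R snd p))) (at p)"
  if F: "smooth_fun F" for F :: "real \<times> real => complex" and p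
  by (rule has_derivative_compose[OF _ smooth_has_derivative[OF F], where f = "\<lambda>p. fst p *\<^sub>R snd p"])
   (auto intro!: derivative_eq_intros)
 have k: "(k has_derivative k' p) (at p)" for p
  unfolding k_def[abs_def] k'_def[abs_def]
  by (intro has_derivative_add has_derivative_scaleR comp P Q)
   (auto intro!: derivative_eq_intros)
 have lin: "dird h F x = fst h *\<^sub>R dird (1, 0) F x + snd h *\<^sub>R dird (0, 1) F x"
  if F: "smooth_fun F" for F :: "real \<times> real => complex" and h x
  using dird_linear[OF F, of "fst h" "(1, 0)" "snd h" "(0, 1)" x] by simp
 have cD: "continuous_on UNIV (\<lambda>p :: real \<times> real \<times> real. F (fst p *\<^sub>R snd p))" if "smooth_fun F" for F :: "real \<times> real => complex"
  by (intro continuous_on_compose2[OF smooth_imp_continuous[OF that, of UNIV]] continuous_intros) auto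
 have cl: "continuous_on UNIV (\<lambda>p :: real \<times> real \<times> real. dird (fst p *\<^sub>R snd q + fst q *\<^sub>R snd p) F (fst p *\<^sub>R snd p))"
  if F: "smooth_fun F" for F :: "real \<times> real => complex" and q
 proof -
  have "continuous_on UNIV (\<lambda>p :: real \<times> real \<times> real. fst (fst p *\<^sub>R snd q + fst q *\<^sub>R snd p) *\<^sub>R dird (1, 0) F (fst p *\<^sub>R snd p)
   + snd (fst p *\<^sub>R snd q + fst q *\<^sub>R snd p) *\<^sub>R dird (0, 1) F (fst p *\<^sub>R snd p))"
   by (intro continuous_intros cD smooth_dird F)
  moreover have "(\<lambda>p :: real \<times> real \<times> real. dird (fst p *\<^sub>R snd q + fst q *\<^sub>R snd p) F (fst p *\<^sub>R snd p))
   = (\<lambda>p. fst (fst p *\<^sub>R snd q + fst q *\<^sub>R snd p) *\<^sub>R dird (1, 0) F (fst p *\<^sub>R snd p)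
   + snd (fst p *\<^sub>R snd q + fst q *\<^sub>R snd p) *\<^sub>R dird (0, 1) F (fst p *\<^sub>R snd p))"
   by (rule ext) (rule lin[OF F])
  ultimately show ?thesis by (simp only:)
 qed
 have ck': "continuous_on UNIV (\<lambda>p. k' p q)" for q
  unfolding k'_def by (intro continuous_intros cl cD P Q)
 define \<Psi> where "\<Psi> x = integral {0..1} (\<lambda>w. k (w, x))" for x
 have "(\<Psi> has_derivative (\<lambda>h. fst h *\<^sub>R P x + snd h *\<^sub>R Q x)) (at x)" for x
 proof -
  have "integral {0..1} (\<lambda>w. k' (w, x) (0, h)) = fst h *\<^sub>R P x + snd h *\<^sub>R Q x" for h
  proof -
   define R where "R = (\<lambda>y. fst h *\<^sub>R P y + snd h *\<^sub>R Q y)"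
   have R: "smooth_fun R" unfolding R_def by (intro smooth_add smooth_scaleR smooth_const P Q)
   have "((\<lambda>w. R (w *\<^sub>R x) + w *\<^sub>R dird x R (w *\<^sub>R x)) has_integral (1 *\<^sub>R R (1 *\<^sub>R x) - 0 *\<^sub>R R (0 *\<^sub>R x))) {0..1}"
   proof (rule fundamental_theorem_of_calculus)
    fix w
    have "((\<lambda>w. R (0 + w *\<^sub>R x)) has_vector_derivative dird x R (0 + w *\<^sub>R x)) (at w within {0..1})"
     by (rule smooth_has_vector_derivative_line[OF R])
    hence "((\<lambda>w. w *\<^sub>R R (0 + w *\<^sub>R x)) has_vector_derivative
      w *\<^sub>R dird x R (0 + w *\<^sub>R x) + 1 *\<^sub>R R (0 + w *\<^sub>R x)) (at w within {0..1})"
     by (intro has_vector_derivative_scaleR) (auto intro!: derivative_eq_intros)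
    thus "((\<lambda>w. w *\<^sub>R R (w *\<^sub>R x)) has_vector_derivative R (w *\<^sub>R x) + w *\<^sub>R dird x R (w *\<^sub>R x)) (at w within {0..1})"
     by (simp add: add.commute)
   qed simp
   moreover have "R (w *\<^sub>R x) + w *\<^sub>R dird x R (w *\<^sub>R x) = k' (w, x) (0, h)" for w
   proof -
    have dR: "dird x R y = fst h *\<^sub>R dird x P y + snd h *\<^sub>R dird x Q y" for y
     unfolding R_def
     by (simp add: dird_add dird_compose_linear[OF bounded_linear_scaleR_right] smooth_scaleR smooth_const P Q)
    have dw: "dird (w *\<^sub>R h) F y = w *\<^sub>R dird h F y" if "smooth_fun F" for F :: "real \<times> real => complex" and y
     using dird_linear[OF that, of w h 0 0 y] by simp
    show ?thesis
     unfolding k'_def dR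
     by (simp add: dw P Q lin[OF P, of x] lin[OF Q, of x] lin[OF P, of h] lin[OF Q, of h] closed R_def
       algebra_simps)
   qed
   ultimately show ?thesis by (simp add: integral_unique R_def)
  qed
  thus ?thesis
   using param_integral_has_derivative[OF k ck', of x] unfolding \<Psi>_def[abs_def] by simp
 qed
 thus ?thesis by blast
qed

lemma lborel_integral_compact:
 fixes g :: "real => complex"
 assumes g: "continuous_on UNIV g" and L: "!!x. \<bar>x\<bar> > L ==> g x = 0"
 shows "integrable lborel g" "(LINT x|lborel. g x) = integral {-L..L} g"
proof -
 have "set_integrable lborel {-L..L} g"
  by (rule borel_integrable_atLeastAtMost') (rule continuous_on_subset[OF g], simp)
 moreover have eq: "indicator {-L..L} x *\<^sub>R g x = g x" for x
  using L[of x] by (auto simp: indicator_def split: if_splits)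
 ultimately show "integrable lborel g" "(LINT x|lborel. g x) = integral {-L..L} g"
  using set_borel_integral_eq_integral(2)[of "{-L..L}" g]
  by (simp_all add: set_integrable_def set_lebesgue_integral_def)
qed

text \<open>The integral of a closed one-form that vanishes far to the left and far to the right is the
 same along all spacelike lines.\<close>

lemma closed_form_line_integral:
 fixes P Q :: "real \<times> real => complex"
 assumes P: "smooth_fun P" and Q: "smooth_fun Q"
  and closed: "!!x. dird (0, 1) P x = dird (1, 0) Q x"
  and L: "!!u v. u > L \<and> v > L \<or> u < - L \<and> v < - L ==> P (u, v) = 0 \<and> Q (u, v) = 0"
  and pos: "\<alpha> > 0" "\<gamma> > 0"
 shows "(LINT z|lborel. \<alpha> *\<^sub>R P (\<alpha> * z + \<beta>, \<gamma> * z + \<delta>) + \<gamma> *\<^sub>R Q (\<alpha> * z + \<beta>, \<gamma> * z + \<delta>))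
  = (LINT z|lborel. P (z, z) + Q (z, z))"
proof -
 obtain \<Psi> where \<Psi>: "!!x. (\<Psi> has_derivative (\<lambda>h. fst h *\<^sub>R P x + snd h *\<^sub>R Q x)) (at x)"
  using closed_form_potential[OF P Q closed] by blast
 define A B where "A = {L<..} \<times> {L<..}" and "B = {..<-L} \<times> {..<-L}"
 have z: "(\<Psi> has_derivative (\<lambda>h. 0)) (at x within S)" if "x \<in> A \<union> B" for x S
  using has_derivative_at_withinI[OF \<Psi>[of x]] L[of "fst x" "snd x"] that by (auto simp: A_def B_def)
 have "convex A" "convex B" unfolding A_def B_def by (intro convex_Times convex_real_interval)+
 then obtain cA cB where cA: "!!x. x \<in> A ==> \<Psi> x = cA" and cB: "!!x. x \<in> B ==> \<Psi> x = cB"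
  using has_derivative_zero_constant[of A \<Psi>] has_derivative_zero_constant[of B \<Psi>] z by blast
 have main: "(LINT z|lborel. a *\<^sub>R P (a * z + b, c * z + d) + c *\<^sub>R Q (a * z + b, c * z + d)) = cA - cB"
  if ac: "a > 0" "c > 0" for a b c d
 proof -
  define M where "M = (\<bar>L\<bar> + \<bar>b\<bar> + 1) / a + (\<bar>L\<bar> + \<bar>d\<bar> + 1) / c"
  let ?g = "\<lambda>z. a *\<^sub>R P (a * z + b, c * z + d) + c *\<^sub>R Q (a * z + b, c * z + d)"
  have M1: "a * z >= \<bar>L\<bar> + \<bar>b\<bar> + 1" "c * z >= \<bar>L\<bar> + \<bar>d\<bar> + 1" if "z >= M" for z
  proof -
   have "z >= (\<bar>L\<bar> + \<bar>b\<bar> + 1) / a" "z >= (\<bar>L\<bar> + \<bar>d\<bar> + 1) / c"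
    using that ac by (auto simp: M_def intro: order_trans[rotated])
   thus "a * z >= \<bar>L\<bar> + \<bar>b\<bar> + 1" "c * z >= \<bar>L\<bar> + \<bar>d\<bar> + 1"
    using ac by (simp_all add: pos_divide_le_eq mult.commute)
  qed
  have M0: "M >= 0" using ac by (simp add: M_def)
  have inA: "(a * z + b, c * z + d) \<in> A" if "z >= M" for z
   using M1[OF that] by (auto simp: A_def)
  have inB: "(a * z + b, c * z + d) \<in> B" if "z <= - M" for z
   using M1[of "- z"] that by (auto simp: B_def)
  have g0: "?g z = 0" if "\<bar>z\<bar> > M" for z
  proof (cases "z >= M")
   case True thus ?thesis using inA[OF True] L by (simp add: A_def)
  next
   case False
   hence "z <= - M" using that by simp
   thus ?thesis using inB[of z] L by (simp add: B_def)
  qed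
  have cont: "continuous_on UNIV ?g"
   by (intro continuous_intros continuous_on_compose2[OF smooth_imp_continuous[OF P, of UNIV]]
     continuous_on_compose2[OF smooth_imp_continuous[OF Q, of UNIV]]) auto
  have "(?g has_integral (\<Psi> (a * M + b, c * M + d) - \<Psi> (a * (- M) + b, c * (- M) + d))) {-M..M}"
  proof (rule fundamental_theorem_of_calculus)
   fix z
   have "((\<lambda>z. \<Psi> (a * z + b, c * z + d)) has_derivative (\<lambda>h. (a * h) *\<^sub>R P (a * z + b, c * z + d)
     + (c * h) *\<^sub>R Q (a * z + b, c * z + d))) (at z)"
   proof -
    have "((\<lambda>z. (a * z + b, c * z + d)) has_derivative (\<lambda>h. (a * h, c * h))) (at z)"
     by (auto intro!: derivative_eq_intros)
    from has_derivative_compose[OF this \<Psi>] show ?thesis by simp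
   qed
   thus "((\<lambda>z. \<Psi> (a * z + b, c * z + d)) has_vector_derivative ?g z) (at z within {-M..M})"
    by (simp add: has_vector_derivative_def has_derivative_at_withinI algebra_simps)
  qed (use M0 in simp)
  thus ?thesis
   using lborel_integral_compact(2)[OF cont g0] cA[OF inA[of M]] cB[OF inB[of "- M"]]
   by (simp add: integral_unique)
 qed
 show ?thesis using main[OF pos, of \<beta> \<delta>] main[of 1 1 0 0] by simp
qed

section \<open>Injectivity of the Fourier transform on test functions\<close>

lemma test_integrable:
 assumes f: "f \<in> \<D>" and k: "continuous_on UNIV k"
 shows "integrable lborel (\<lambda>x. k x * f x :: complex)"
proof -
 obtain L where "!!x. \<bar>x\<bar> > L ==> f x = 0" using test_supportE[OF f] by blast
 thus ?thesis
  by (intro lborel_integral_compact(1)[of _ L] continuous_intros k smooth_imp_continuous test_smooth[OF f]) auto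
qed

lemma test_re_fun: assumes "f \<in> \<D>" shows "re_fun f \<in> \<D>"
proof -
 obtain L where "!!x. \<bar>x\<bar> > L ==> f x = 0" using test_supportE[OF assms] by blast
 thus ?thesis
  by (intro test_functionsI[OF smooth_of_real[OF smooth_Re[OF test_smooth[OF assms]]], of L]) simp
qed

lemma test_im_fun: assumes "f \<in> \<D>" shows "im_fun f \<in> \<D>"
proof -
 obtain L where "!!x. \<bar>x\<bar> > L ==> f x = 0" using test_supportE[OF assms] by blast
 thus ?thesis
  by (intro test_functionsI[OF smooth_of_real[OF smooth_Im[OF test_smooth[OF assms]]], of L]) simp
qed

lemma test_add: "f \<in> \<D> ==> g \<in> \<D> ==> (\<lambda>x. f x + g x) \<in> \<D>"
proof -
 assume fg: "f \<in> \<D>" "g \<in> \<D>"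
 obtain L where L: "!!x. \<bar>x\<bar> > L ==> f x = 0" using test_supportE[OF fg(1)] by blast
 obtain M where M: "!!x. \<bar>x\<bar> > M ==> g x = 0" using test_supportE[OF fg(2)] by blast
 show ?thesis
  by (rule test_functionsI[OF smooth_add[OF test_smooth[OF fg(1)] test_smooth[OF fg(2)]], of "max L M"])
   (simp add: L M)
qed

lemma test_scale: assumes "f \<in> \<D>" shows "(\<lambda>x. c * f x) \<in> \<D>"
proof -
 obtain L where "!!x. \<bar>x\<bar> > L ==> f x = 0" using test_supportE[OF assms] by blast
 thus ?thesis
  by (intro test_functionsI[OF smooth_mult[OF smooth_const test_smooth[OF assms]], of L]) simp
qed

lemma test_minus: "f \<in> \<D> ==> (\<lambda>x. - f x) \<in> \<D>"
 using test_scale[of f "-1"] by simp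

lemma test_diff: "f \<in> \<D> ==> g \<in> \<D> ==> (\<lambda>x. f x - g x) \<in> \<D>"
 using test_add[OF _ test_minus, of f g] by simp

lemma continuous_on_cis_linear [continuous_intros]: "continuous_on S (\<lambda>x::real. cis (c * x))"
 unfolding cis_conv_exp by (intro continuous_intros)

lemma cis_linear_has_vector_derivative:
 "((\<lambda>p. cis (c * p)) has_vector_derivative \<i> * of_real c * cis (c * p)) (at p within S)"
proof -
 have "((\<lambda>z. exp (\<i> * of_real c * z)) has_field_derivative
   \<i> * of_real c * exp (\<i> * of_real c * of_real p)) (at (of_real p))"
  by (auto intro!: derivative_eq_intros)
 from has_vector_derivative_real_field[OF this] show ?thesis
  by (simp add: cis_conv_exp mult.assoc)
qed

lemma cis_minus_has_vector_derivative:
 "((\<lambda>p. cis (- p * x)) has_vector_derivative \<i> * of_real (- x) * cis (- p * x)) (at p within S)"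
proof -
 have "- p * x = (- x) * p" for p by simp
 thus ?thesis using cis_linear_has_vector_derivative[of "- x" p S] by (simp only:)
qed

text \<open>Differentiating the transform at \<open>0\<close> shows that all moments of \<open>f\<close> vanish. By the Weierstrass
 theorem \<open>f\<close> is then orthogonal to itself.\<close>

lemma fourier_zero_imp_zero:
 assumes f: "f \<in> \<D>" and zero: "!!p. fourier f p = 0"
 shows "f x = 0"
proof -
 obtain L where L: "L > 0" "!!x. \<bar>x\<bar> > L ==> f x = 0" using test_supportE[OF f] by blast
 have cf: "continuous_on S f" for S by (rule smooth_imp_continuous[OF test_smooth[OF f]])
 have fb: "integral {-L..L} (\<lambda>x. cis (- p * x) * f x) = 0" for p
 proof -
  have "(LINT x|lborel. cis (- p * x) * f x) = integral {-L..L} (\<lambda>x. cis (- p * x) * f x)"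
   by (rule lborel_integral_compact(2)) (use L in "auto intro!: continuous_intros cf")
  thus ?thesis using zero[of p] by (simp add: fourier_def)
 qed
 have mom: "integral {-L..L} (\<lambda>x. cis (- p * x) * (of_real x ^ n * f x)) = 0" for n p
 proof (induction n arbitrary: p)
  case 0 thus ?case using fb by simp
 next
  case (Suc n)
  have ci: "continuous_on (UNIV \<times> cbox (-L) L) (\<lambda>q. cis (- fst q * snd q))"
   unfolding cis_conv_exp by (intro continuous_intros)
  have "((\<lambda>p. integral (cbox (-L) L) (\<lambda>x. cis (- p * x) * (of_real x ^ n * f x))) has_vector_derivative
    integral (cbox (-L) L) (\<lambda>x. \<i> * of_real (- x) * cis (- p * x) * (of_real x ^ n * f x))) (at p within UNIV)"
  proof (rule leibniz_rule_vector_derivative)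
   show "((\<lambda>p. cis (- p * x) * (of_real x ^ n * f x)) has_vector_derivative
     \<i> * of_real (- x) * cis (- p * x) * (of_real x ^ n * f x)) (at p within UNIV)" for p x
    by (rule has_vector_derivative_mult_left[OF cis_minus_has_vector_derivative])
   show "(\<lambda>x. cis (- p * x) * (of_real x ^ n * f x)) integrable_on cbox (- L) L" for p
    by (intro integrable_continuous continuous_intros cf)
   show "continuous_on (UNIV \<times> cbox (- L) L)
     (\<lambda>(p, x). \<i> * of_real (- x) * cis (- p * x) * (of_real x ^ n * f x))"
    unfolding case_prod_beta
    by (intro continuous_intros ci continuous_on_compose2[OF cf[of UNIV]]) auto
  qed auto
  hence "((\<lambda>p. 0) has_vector_derivative
    integral {-L..L} (\<lambda>x. \<i> * of_real (- x) * cis (- p * x) * (of_real x ^ n * f x))) (at p)"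
   using Suc by simp
  hence "integral {-L..L} (\<lambda>x. \<i> * of_real (- x) * cis (- p * x) * (of_real x ^ n * f x)) = 0"
   using vector_derivative_unique_at[OF _ has_vector_derivative_const] by blast
  moreover have "(\<lambda>x. \<i> * of_real (- x) * cis (- p * x) * (of_real x ^ n * f x))
    = (\<lambda>x. (- \<i>) * (cis (- p * x) * (of_real x ^ Suc n * f x)))"
   by (simp add: mult_ac)
  ultimately show ?case by (simp only: integral_mult_right) simp
 qed
 have part: "g (f y) = 0" if g: "bounded_linear g" "!!(r::real) z. g (of_real r * z) = r * g z" for g :: "complex => real" and y
 proof (cases "\<bar>y\<bar> > L")
  case True thus ?thesis using L(2) linear_0[OF bounded_linear.linear[OF g(1)]] by simp
 next
  case False
  define h where "h x = g (f x)" for x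
  have ch: "continuous_on S h" for S
   unfolding h_def by (rule bounded_linear.continuous_on[OF g(1) cf])
  have hm: "integral {-L..L} (\<lambda>x. x ^ n * h x) = 0" for n
  proof -
   have "integral {-L..L} (\<lambda>x. g (cis (- 0 * x) * (of_real x ^ n * f x))) = g 0"
    unfolding mom[of 0 n, symmetric]
    by (rule integral_linear[OF _ g(1), unfolded o_def])
     (intro integrable_continuous_real continuous_intros cf)
   thus ?thesis using g(2)[of "_ ^ n"] linear_0[OF bounded_linear.linear[OF g(1)]]
    by (simp add: h_def flip: of_real_power)
  qed
  have int: "F integrable_on {-L..L}" if "continuous_on UNIV F" for F :: "real => real"
   using that by (intro integrable_continuous_real) (rule continuous_on_subset, auto)
  have ie: "integral {-L..L} (\<lambda>x. h x * h x) <= e * integral {-L..L} (\<lambda>x. \<bar>h x\<bar>)" if e: "e > 0" for e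
  proof -
   obtain P where P: "real_polynomial_function P" "!!x. x \<in> {-L..L} ==> \<bar>h x - P x\<bar> < e"
    using Stone_Weierstrass_real_polynomial_function[of "{-L..L}" h e] ch e by auto
   obtain a n where Pa: "P = (\<lambda>x. \<Sum>i\<le>n. a i * x ^ i)" using P(1) real_polynomial_function_iff_sum by auto
   have cP: "continuous_on UNIV P" unfolding Pa by (intro continuous_intros)
   have "integral {-L..L} (\<lambda>x. P x * h x) = integral {-L..L} (\<lambda>x. \<Sum>i\<le>n. a i * (x ^ i * h x))"
    by (simp add: Pa sum_distrib_right mult.assoc)
   also have "... = (\<Sum>i\<le>n. integral {-L..L} (\<lambda>x. a i * (x ^ i * h x)))"
    by (intro integral_sum int continuous_intros ch) auto
   also have "... = 0" by (simp add: hm)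
   finally have "integral {-L..L} (\<lambda>x. h x * h x) = integral {-L..L} (\<lambda>x. h x * h x) - integral {-L..L} (\<lambda>x. P x * h x)" by simp
   also have "... = integral {-L..L} (\<lambda>x. h x * h x - P x * h x)"
    by (intro integral_diff[symmetric] int continuous_intros ch cP)
   also have "... <= integral {-L..L} (\<lambda>x. e * \<bar>h x\<bar>)"
   proof (intro integral_le int continuous_intros ch cP)
    fix x assume "x \<in> {-L..L}"
    hence "\<bar>h x - P x\<bar> * \<bar>h x\<bar> <= e * \<bar>h x\<bar>" using P(2) by (intro mult_right_mono) (auto intro: less_imp_le)
    thus "h x * h x - P x * h x <= e * \<bar>h x\<bar>"
     by (simp add: left_diff_distrib[symmetric] abs_mult[symmetric])
   qed
   finally show ?thesis by simp
  qed
  have le0: "integral {-L..L} (\<lambda>x. h x * h x) <= 0"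
  proof (rule field_le_epsilon)
   fix e :: real assume e: "e > 0"
   define K where "K = integral {-L..L} (\<lambda>x. \<bar>h x\<bar>)"
   have "(\<lambda>x. \<bar>h x\<bar>) integrable_on {-L..L}" by (intro int continuous_intros ch)
   hence K: "K >= 0" unfolding K_def by (rule integral_nonneg) simp
   have "integral {-L..L} (\<lambda>x. h x * h x) <= e / (K + 1) * K"
    unfolding K_def[symmetric] using ie[of "e / (K + 1)"] e K by (simp add: K_def[symmetric])
   also have "... <= e" using e K by (simp add: field_simps)
   finally show "integral {-L..L} (\<lambda>x. h x * h x) <= 0 + e" by simp
  qed
  have hi: "(\<lambda>x. h x * h x) integrable_on {-L..L}" by (intro int continuous_intros ch)
  have "0 <= integral {-L..L} (\<lambda>x. h x * h x)"
   by (rule integral_nonneg[OF hi]) simp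
  hence "((\<lambda>x. h x * h x) has_integral 0) (cbox (-L) L)"
   using integrable_integral[OF hi] le0 by simp
  moreover have "y \<in> cbox (-L) L" using False by auto
  ultimately have "h y * h y = 0"
   using L(1) by (intro has_integral_0_cbox_imp_0[of "-L" L "\<lambda>x. h x * h x"] continuous_intros ch) auto
  thus ?thesis by (simp add: h_def)
 qed
 show ?thesis
  using part[of Re x] part[of Im x] by (simp add: complex_eq_iff bounded_linear_Re bounded_linear_Im)
qed

lemma tilde_eq: 
 assumes f: "f \<in> \<D>"
 shows "tilde m f p = of_real (1 / sqrt (2 * pi)) *
  (LINT x|lborel. cis (- p * x) * (Re (f x) + \<i> * omega m p * Im (f x)))"
proof -
 have i: "integrable lborel (\<lambda>x. cis (- p * x) * of_real (Re (f x)))"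
  "integrable lborel (\<lambda>x. cis (- p * x) * of_real (Im (f x)))"
  by (intro test_integrable test_re_fun test_im_fun f continuous_intros)+
 have "(LINT x|lborel. cis (- p * x) * (Re (f x) + \<i> * omega m p * Im (f x)))
  = (LINT x|lborel. cis (- p * x) * of_real (Re (f x)) + \<i> * omega m p * (cis (- p * x) * of_real (Im (f x))))"
  by (simp add: algebra_simps)
 also have "... = (LINT x|lborel. cis (- p * x) * of_real (Re (f x)))
   + \<i> * omega m p * (LINT x|lborel. cis (- p * x) * of_real (Im (f x)))"
  using i by (subst Bochner_Integration.integral_add) auto
 finally show ?thesis by (simp add: tilde_def fourier_def algebra_simps)
qed

lemma fourier_diff:
 assumes "f \<in> \<D>" "g \<in> \<D>"
 shows "fourier (\<lambda>x. f x - g x) p = fourier f p - fourier g p"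
proof -
 have i: "integrable lborel (\<lambda>x. cis (- p * x) * f x)" "integrable lborel (\<lambda>x. cis (- p * x) * g x)"
  by (intro test_integrable assms continuous_on_cis_linear)+
 show ?thesis
  unfolding fourier_def right_diff_distrib Bochner_Integration.integral_diff[OF i] ..
qed

lemma fourier_minus_real:
 "fourier (\<lambda>x. of_real (r x)) (- p) = cnj (fourier (\<lambda>x. of_real (r x)) p)"
proof -
 have "(LINT x|lborel. cis (- (- p) * x) * of_real (r x))
   = (LINT x|lborel. cnj (cis (- p * x) * of_real (r x)))"
  by (simp add: cis_cnj)
 also have "... = cnj (LINT x|lborel. cis (- p * x) * of_real (r x))"
  by (rule Bochner_Integration.integral_cnj)
 finally show ?thesis by (simp add: fourier_def)
qed

text \<open>The transforms of the real and imaginary parts of \<open>f\<close> are recovered from the values of \<open>tilde m f\<close> at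
 \<open>p\<close> and \<open>- p\<close>. Hence the specification of the action has at most one solution.\<close>

lemma tilde_injective:
 assumes m: "m > 0" and f: "f \<in> \<D>" and g: "g \<in> \<D>"
  and eq: "!!p. tilde m f p = tilde m g p"
 shows "f = g"
proof -
 define d where "d = (\<lambda>x. f x - g x)"
 have d: "d \<in> \<D>" unfolding d_def by (rule test_diff[OF f g])
 have td: "tilde m d p = 0" for p
 proof -
  have "re_fun d = (\<lambda>x. re_fun f x - re_fun g x)" "im_fun d = (\<lambda>x. im_fun f x - im_fun g x)"
   by (simp_all add: d_def)
  thus ?thesis
   using eq[of p] by (simp add: tilde_def fourier_diff test_re_fun test_im_fun f g algebra_simps)
 qed
 have om: "omega m p > 0" "omega m (- p) = omega m p" for p
  using m by (auto simp: omega_def add_nonneg_pos)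
 have "fourier (re_fun d) p = 0 \<and> fourier (im_fun d) p = 0" for p
 proof -
  define R I where "R = fourier (re_fun d) p" and "I = fourier (im_fun d) p"
  have 1: "R + \<i> * omega m p * I = 0" using td[of p] by (simp add: tilde_def R_def I_def)
  have "cnj (tilde m d (- p)) = 0" using td by simp
  hence 2: "R - \<i> * omega m p * I = 0"
   by (simp add: tilde_def R_def I_def fourier_minus_real om)
  have "2 * R = (R + \<i> * omega m p * I) + (R - \<i> * omega m p * I)" by simp
  hence "R = 0" unfolding 1 2 by simp
  moreover have "\<i> * omega m p * I = 0" using 1 \<open>R = 0\<close> by simp
  hence "I = 0" using om(1)[of p] by simp
  ultimately show ?thesis by (simp add: R_def I_def)
 qed
 hence "re_fun d x = 0" "im_fun d x = 0" for x
  using fourier_zero_imp_zero[OF test_re_fun[OF d]] fourier_zero_imp_zero[OF test_im_fun[OF d]] by auto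
 hence "d x = 0" for x by (simp add: complex_eq_iff)
 thus ?thesis by (simp add: d_def fun_eq_iff)
qed

section \<open>The Poincare action on test functions\<close>

text \<open>Cauchy data of the solution with data \<open>f\<close> along the line \<open>z \<mapsto> (\<alpha> z + \<beta>, \<gamma> z + \<delta>)\<close>.\<close>

definition kg_data :: "real => real => real => real => real => (real => complex) => real => complex"
 where "kg_data j \<alpha> \<beta> \<gamma> \<delta> f z =
  of_real (\<gamma> * dird (0, 1) (kg_field j f) (\<alpha> * z + \<beta>, \<gamma> * z + \<delta>)
   - \<alpha> * dird (1, 0) (kg_field j f) (\<alpha> * z + \<beta>, \<gamma> * z + \<delta>))
  + \<i> * of_real (kg_field j f (\<alpha> * z + \<beta>, \<gamma> * z + \<delta>))"

lemma smooth_line: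
 assumes "smooth_fun F"
 shows "smooth_fun (\<lambda>z::real. F (\<alpha> * z + \<beta>, \<gamma> * z + \<delta>))"
proof -
 have "bounded_linear (\<lambda>z::real. (\<alpha> * z, \<gamma> * z))"
  by (intro bounded_linear_Pair bounded_linear_mult_right)
 from smooth_compose_affine[OF this assms, of "(\<beta>, \<delta>)"] show ?thesis by simp
qed

lemma smooth_kg_data: "smooth_fun f ==> smooth_fun (kg_data j \<alpha> \<beta> \<gamma> \<delta> f)"
 unfolding kg_data_def[abs_def]
 by (intro smooth_add smooth_mult smooth_const smooth_of_real smooth_diff smooth_line smooth_dird smooth_kg_field)

lemma kg_field_zero_right:
 assumes f: "smooth_fun f" and z: "!!y. y > b ==> f y = 0" and x: "fst x > b" "snd x > b"
 shows "kg_field j f x = 0" "dird h (kg_field j f) x = 0"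
proof -
 have Z: "\<forall>y\<in>closed_segment u v. f y = 0" if "(u, v) \<in> {b<..} \<times> {b<..}" for u v
  using that z by (auto simp: closed_segment_eq_real_ivl split: if_splits)
 have "open ({b<..} \<times> {b<..})" by (intro open_Times) auto
 from kg_field_zero[OF f this Z, where x = x and j = j] x
 show "kg_field j f x = 0" "dird h (kg_field j f) x = 0" by (auto simp: mem_Times_iff)
qed

lemma kg_field_zero_left:
 assumes f: "smooth_fun f" and z: "!!y. y < b ==> f y = 0" and x: "fst x < b" "snd x < b"
 shows "kg_field j f x = 0" "dird h (kg_field j f) x = 0"
proof -
 have Z: "\<forall>y\<in>closed_segment u v. f y = 0" if "(u, v) \<in> {..<b} \<times> {..<b}" for u v
  using that z by (auto simp: closed_segment_eq_real_ivl split: if_splits)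
 have "open ({..<b} \<times> {..<b})" by (intro open_Times) auto
 from kg_field_zero[OF f this Z, where x = x and j = j] x
 show "kg_field j f x = 0" "dird h (kg_field j f) x = 0" by (auto simp: mem_Times_iff)
qed

lemma kg_data_zero_right:
 assumes "smooth_fun f" "!!y. y > b ==> f y = 0" "\<alpha> * z + \<beta> > b" "\<gamma> * z + \<delta> > b"
 shows "kg_data j \<alpha> \<beta> \<gamma> \<delta> f z = 0"
 unfolding kg_data_def using kg_field_zero_right[OF assms(1,2), of b "(\<alpha> * z + \<beta>, \<gamma> * z + \<delta>)"] assms(3,4) by simp

lemma kg_data_zero_left:
 assumes "smooth_fun f" "!!y. y < b ==> f y = 0" "\<alpha> * z + \<beta> < b" "\<gamma> * z + \<delta> < b"
 shows "kg_data j \<alpha> \<beta> \<gamma> \<delta> f z = 0"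
 unfolding kg_data_def using kg_field_zero_left[OF assms(1,2), of b "(\<alpha> * z + \<beta>, \<gamma> * z + \<delta>)"] assms(3,4) by simp

lemma kg_data_test:
 assumes f: "f \<in> \<D>" and pos: "\<alpha> > 0" "\<gamma> > 0"
 shows "kg_data j \<alpha> \<beta> \<gamma> \<delta> f \<in> \<D>"
proof -
 obtain L where L: "L > 0" "!!x. \<bar>x\<bar> > L ==> f x = 0" using test_supportE[OF f] by blast
 define M where "M = (L + \<bar>\<beta>\<bar>) / \<alpha> + (L + \<bar>\<delta>\<bar>) / \<gamma>"
 have M: "\<alpha> * z > L + \<bar>\<beta>\<bar>" "\<gamma> * z > L + \<bar>\<delta>\<bar>" if "z > M" for z
 proof -
  have "(L + \<bar>\<beta>\<bar>) / \<alpha> >= 0" "(L + \<bar>\<delta>\<bar>) / \<gamma> >= 0" using L pos by simp_all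
  hence "z > (L + \<bar>\<beta>\<bar>) / \<alpha>" "z > (L + \<bar>\<delta>\<bar>) / \<gamma>" using that by (simp_all add: M_def)
  thus "\<alpha> * z > L + \<bar>\<beta>\<bar>" "\<gamma> * z > L + \<bar>\<delta>\<bar>" using pos by (simp_all add: pos_divide_less_eq mult.commute)
 qed
 show ?thesis
 proof (rule test_functionsI[OF smooth_kg_data[OF test_smooth[OF f]]])
  fix z assume z: "\<bar>z\<bar> > M"
  show "kg_data j \<alpha> \<beta> \<gamma> \<delta> f z = 0"
  proof (cases "z > M")
   case True
   show ?thesis
    by (rule kg_data_zero_right[OF test_smooth[OF f], of L]) (use L M[OF True] in auto)
  next
   case False
   hence "- z > M" using z by simp
   from M[OF this] show ?thesis
    by (intro kg_data_zero_left[OF test_smooth[OF f], of "- L"]) (use L in auto)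
  qed
 qed
qed

text \<open>The effect of a Poincare transformation on the transform of the Cauchy data. For the plane wave \<open>E = exp(i (k u + n v))\<close> with
 \<open>k n = - m\<^sup>2 / 4\<close>, the form \<open>(i k F - \<partial>\<^sub>u F) E du + (\<partial>\<^sub>v F - i n F) E dv\<close> is closed, and its integrals
 along the two lines are the transforms of the Cauchy data on them.\<close>

lemma tilde_kg_data:
 fixes m :: real
 assumes f: "f \<in> \<D>" and pos: "\<alpha> > 0" "\<gamma> > 0" "\<alpha> * \<gamma> = 1"
 defines "r \<equiv> \<lambda>p. \<gamma> * (omega m p - p) / 2" and "\<nu> \<equiv> \<lambda>p. - \<alpha> * (omega m p + p) / 2"
 shows "tilde m (kg_data (m^2 / 4) \<alpha> \<beta> \<gamma> \<delta> f) p
  = cis (- (r p * \<beta> + \<nu> p * \<delta>)) * tilde m f (- (r p + \<nu> p))"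
  and "omega m (- (r p + \<nu> p)) = r p - \<nu> p"
proof -
 define w where "w = omega m p"
 define k n where "k = r p" and "n = \<nu> p"
 have k: "k = \<gamma> * (w - p) / 2" and n: "n = - \<alpha> * (w + p) / 2"
  by (simp_all add: k_def n_def r_def \<nu>_def w_def)
 have w2: "w^2 = p^2 + m^2" by (simp add: w_def omega_def)
 have wp: "\<bar>p\<bar> <= w" unfolding w_def omega_def by (rule real_le_rsqrt) simp
 have kn: "k * n = - (m^2 / 4)"
 proof -
  have "k * n = - ((\<alpha> * \<gamma>) * (w^2 - p^2)) / 4" by (simp add: k n power2_eq_square algebra_simps)
  thus ?thesis using w2 pos(3) by simp
 qed
 have "k >= 0" "n <= 0" using pos wp by (auto simp: k n)
 hence kn0: "k - n >= 0" by simp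
 have "(k + n)^2 + m^2 = (k - n)^2" using kn by (simp add: power2_eq_square algebra_simps)
 hence om: "omega m (- (k + n)) = k - n"
  unfolding omega_def power2_minus using kn0 by (intro real_sqrt_unique) simp_all
 thus "omega m (- (r p + \<nu> p)) = r p - \<nu> p" by (simp add: k_def n_def)
 have ak: "\<alpha> * k = (w - p) / 2" and gn: "\<gamma> * n = - (w + p) / 2"
  using pos(3) by (simp_all add: k n mult.left_commute[of \<gamma>] flip: mult.assoc) (simp_all add: mult.commute)
 define \<phi> where "\<phi> = kg_field (m^2 / 4) f"
 have sf: "smooth_fun f" by (rule test_smooth[OF f])
 have s\<phi>: "smooth_fun \<phi>" unfolding \<phi>_def by (rule smooth_kg_field[OF sf])
 define E where "E x = cis (k * fst x + n * snd x)" for x :: "real \<times> real"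
 have dE: "(E has_derivative (\<lambda>h. (\<i> * (k * fst h + n * snd h)) * E x)) (at x)" for x
 proof -
  have d: "((\<lambda>x :: real \<times> real. k * fst x + n * snd x) has_derivative (\<lambda>h. k * fst h + n * snd h)) (at x)"
   by (auto intro!: derivative_eq_intros)
  have "(cis has_derivative (\<lambda>t. t *\<^sub>R (\<i> * cis (k * fst x + n * snd x)))) (at (k * fst x + n * snd x))"
   using cis_linear_has_vector_derivative[of 1 "k * fst x + n * snd x" UNIV] by (simp add: has_vector_derivative_def)
  from has_derivative_compose[OF d this] show ?thesis
   unfolding E_def[abs_def] by (simp add: scaleR_conv_of_real mult_ac)
 qed
 have sE: "smooth_fun E"
 proof -
  have "Ck j E" for j
  proof (induction j)
   case 0
   have "continuous_on UNIV E" by (rule has_derivative_continuous_on) (rule has_derivative_at_withinI[OF dE])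
   thus ?case by simp
  next
   case (Suc j) thus ?case by (intro Ck_SucI[OF dE] Ck_mult Ck_const)
  qed
  thus ?thesis by (simp add: smooth_fun_def)
 qed
 have dEu: "dird (1, 0) E x = \<i> * k * E x" and dEv: "dird (0, 1) E x = \<i> * n * E x" for x
  using dird_eqI[OF dE, of "(1, 0)"] dird_eqI[OF dE, of "(0, 1)"] by simp_all
 define P where "P x = (of_real (- dird (1, 0) \<phi> x) + \<i> * k * of_real (\<phi> x)) * E x" for x
 define Q where "Q x = (of_real (dird (0, 1) \<phi> x) + (- (\<i> * n)) * of_real (\<phi> x)) * E x" for x
 have sP: "smooth_fun P" and sQ: "smooth_fun Q"
  unfolding P_def[abs_def] Q_def[abs_def]
  by (intro smooth_mult smooth_add smooth_const smooth_of_real smooth_minus smooth_dird s\<phi> sE)+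
 have vP: "dird (0, 1) P x = dird (1, 0) Q x" for x
 proof -
  have dof: "dird h (\<lambda>x. of_real (F x)) x = of_real (dird h F x)" if "smooth_fun F" for h F and x :: "real \<times> real"
   by (rule dird_compose_linear[OF bounded_linear_of_real that])
  have dneg: "dird h (\<lambda>x. - F x) x = - dird h F x" if "smooth_fun F" for h and F :: "real \<times> real => real" and x
   by (rule dird_compose_linear[OF bounded_linear_minus[OF bounded_linear_ident] that])
  have dc: "dird h (\<lambda>x. c * F x) x = c * dird h F x" if "smooth_fun F" for h c and F :: "real \<times> real => complex" and x
   by (rule dird_compose_linear[OF bounded_linear_mult_right that])
  have eq: "dird (1, 0) (dird (0, 1) \<phi>) x = m^2 / 4 * \<phi> x" "dird (0, 1) (dird (1, 0) \<phi>) x = m^2 / 4 * \<phi> x"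
   using kg_equation[OF sf, of "m^2 / 4" x] dird_commute[OF s\<phi>, of "(0, 1)" "(1, 0)" x] unfolding \<phi>_def by simp_all
  have comb: "dird h (\<lambda>x. (of_real (F x) + c * of_real (\<phi> x)) * E x) x
    = (of_real (F x) + c * of_real (\<phi> x)) * dird h E x
     + (of_real (dird h F x) + c * of_real (dird h \<phi> x)) * E x"
   if F: "smooth_fun F" for F :: "real \<times> real => real" and c h x
  proof -
   have s1: "smooth_fun (\<lambda>x. of_real (F x))" and s2: "smooth_fun (\<lambda>x. c * of_real (\<phi> x))"
    by (rule smooth_of_real[OF F]) (rule smooth_mult[OF smooth_const smooth_of_real[OF s\<phi>]])
   show ?thesis
    unfolding dird_bilinear[OF bounded_bilinear_mult smooth_add[OF s1 s2] sE] dird_add[OF s1 s2]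
     dc[OF smooth_of_real[OF s\<phi>]] dof[OF s\<phi>] dof[OF F] ..
  qed
  have 1: "dird (0, 1) P x = (of_real (- dird (1, 0) \<phi> x) + \<i> * k * of_real (\<phi> x)) * (\<i> * n * E x)
    + (of_real (- (m^2 / 4 * \<phi> x)) + \<i> * k * of_real (dird (0, 1) \<phi> x)) * E x"
   unfolding P_def[abs_def] comb[OF smooth_minus[OF smooth_dird[OF s\<phi>]]] dneg[OF smooth_dird[OF s\<phi>]] eq dEv ..
  have 2: "dird (1, 0) Q x = (of_real (dird (0, 1) \<phi> x) + (- (\<i> * n)) * of_real (\<phi> x)) * (\<i> * k * E x)
    + (of_real (m^2 / 4 * \<phi> x) + (- (\<i> * n)) * of_real (dird (1, 0) \<phi> x)) * E x"
   unfolding Q_def[abs_def] comb[OF smooth_dird[OF s\<phi>]] eq dEu ..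
  have knc: "of_real k * of_real n = - of_real (m^2 / 4)"
   unfolding of_real_mult[symmetric] of_real_minus[symmetric] kn ..
  have "dird (0, 1) P x - dird (1, 0) Q x
   = - 2 * (of_real k * of_real n + of_real (m^2 / 4)) * of_real (\<phi> x) * E x"
   unfolding 1 2 by (simp add: algebra_simps)
  thus ?thesis unfolding knc by simp
 qed
 obtain L where L: "L > 0" "!!x. \<bar>x\<bar> > L ==> f x = 0" using test_supportE[OF f] by blast
 have zero: "P (u, v) = 0 \<and> Q (u, v) = 0" if "u > L \<and> v > L \<or> u < - L \<and> v < - L" for u v
  using that kg_field_zero_right[OF sf, of L "(u, v)"] kg_field_zero_left[OF sf, of "- L" "(u, v)"] L
  unfolding P_def Q_def \<phi>_def by (elim disjE) simp_all
 note main = closed_form_line_integral[OF sP sQ vP zero pos(1,2), where \<beta> = \<beta> and \<delta> = \<delta>]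
 have rhs: "P (z, z) + Q (z, z) = cis (- (- (k + n)) * z) * (Re (f z) + \<i> * omega m (- (k + n)) * Im (f z))" for z
 proof -
  have "P (z, z) + Q (z, z) = (of_real (dird (0, 1) \<phi> (z, z) - dird (1, 0) \<phi> (z, z))
    + \<i> * of_real (k - n) * of_real (\<phi> (z, z))) * E (z, z)"
   by (simp add: P_def Q_def algebra_simps)
  thus ?thesis
   unfolding \<phi>_def kg_field_diag[OF sf] kg_field_diag_velocity[OF sf] om
   by (simp add: E_def algebra_simps)
 qed
 have lhs: "\<alpha> *\<^sub>R P (\<alpha> * z + \<beta>, \<gamma> * z + \<delta>) + \<gamma> *\<^sub>R Q (\<alpha> * z + \<beta>, \<gamma> * z + \<delta>)
   = cis (k * \<beta> + n * \<delta>) * (cis (- p * z) * (Re (kg_data (m^2 / 4) \<alpha> \<beta> \<gamma> \<delta> f z)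
    + \<i> * omega m p * Im (kg_data (m^2 / 4) \<alpha> \<beta> \<gamma> \<delta> f z)))" for z
 proof -
  let ?l = "(\<alpha> * z + \<beta>, \<gamma> * z + \<delta>)"
  have El: "E ?l = cis (k * \<beta> + n * \<delta>) * cis (- p * z)"
  proof -
   have "k * (\<alpha> * z + \<beta>) + n * (\<gamma> * z + \<delta>) = (\<alpha> * k) * z + (\<gamma> * n) * z + (k * \<beta> + n * \<delta>)"
    by (simp add: algebra_simps)
   also have "... = (k * \<beta> + n * \<delta>) + - p * z" unfolding ak gn by (simp add: field_simps)
   finally show ?thesis by (simp add: E_def cis_mult)
  qed
  have "\<alpha> *\<^sub>R P ?l + \<gamma> *\<^sub>R Q ?l = (of_real (\<gamma> * dird (0, 1) \<phi> ?l - \<alpha> * dird (1, 0) \<phi> ?l)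
    + \<i> * of_real (\<alpha> * k - \<gamma> * n) * of_real (\<phi> ?l)) * E ?l"
   by (simp add: P_def Q_def scaleR_conv_of_real algebra_simps)
  moreover have "\<alpha> * k - \<gamma> * n = omega m p" unfolding ak gn w_def by (simp add: field_simps)
  ultimately show ?thesis unfolding El by (simp add: kg_data_def \<phi>_def)
 qed
 have "cis (k * \<beta> + n * \<delta>) * tilde m (kg_data (m^2 / 4) \<alpha> \<beta> \<gamma> \<delta> f) p = tilde m f (- (k + n))"
  unfolding tilde_eq[OF kg_data_test[OF f pos(1,2)]] tilde_eq[OF f]
  using main unfolding lhs rhs integral_mult_right_zero
  by (simp only: mult.left_commute[of "cis (k * \<beta> + n * \<delta>)"])
 hence "cis (- (k * \<beta> + n * \<delta>)) * (cis (k * \<beta> + n * \<delta>) * tilde m (kg_data (m^2 / 4) \<alpha> \<beta> \<gamma> \<delta> f) p)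
   = cis (- (k * \<beta> + n * \<delta>)) * tilde m f (- (k + n))" by simp
 thus "tilde m (kg_data (m^2 / 4) \<alpha> \<beta> \<gamma> \<delta> f) p = cis (- (r p * \<beta> + \<nu> p * \<delta>)) * tilde m f (- (r p + \<nu> p))"
  unfolding mult.assoc[symmetric] cis_mult by (simp add: k_def n_def)
qed

section \<open>Lorentz boosts\<close>

text \<open>The Lorentz boost of rapidity \<open>r\<close>, acting on vectors \<open>(t, x)\<close>.\<close>

definition boost :: "real => real^2^2"
 where "boost r = vector [vector [cosh r, sinh r], vector [sinh r, cosh r]]"

lemma boost_nth [simp]:
 "boost r $ 1 $ 1 = cosh r" "boost r $ 1 $ 2 = sinh r" "boost r $ 2 $ 1 = sinh r" "boost r $ 2 $ 2 = cosh r"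
 by (simp_all add: boost_def)

lemma boost_mult: "boost r ** boost h = boost (r + h)"
 by (simp add: vec_eq_iff forall_2 matrix_matrix_mult_def sum_2 cosh_add sinh_add)

lemma boost_zero: "boost 0 = mat 1"
 by (simp add: vec_eq_iff forall_2 mat_def)

lemma boost_apply:
 "(boost r *v x) $ 1 = cosh r * x $ 1 + sinh r * x $ 2"
 "(boost r *v x) $ 2 = sinh r * x $ 1 + cosh r * x $ 2"
 by (simp_all add: matrix_vector_mult_def sum_2)

lemma matrix_inv_eqI: 
 fixes A B :: "real^2^2" assumes "A ** B = mat 1" "B ** A = mat 1" shows "matrix_inv A = B"
proof -
 have "A ** matrix_inv A = mat 1 \<and> matrix_inv A ** A = mat 1"
  unfolding matrix_inv_def by (rule someI[of _ B]) (use assms in simp)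
 thus ?thesis
  using assms by (metis matrix_mul_assoc matrix_mul_lid matrix_mul_rid)
qed

lemma matrix_inv_boost: "matrix_inv (boost r) = boost (- r)"
 by (rule matrix_inv_eqI) (simp_all add: boost_mult boost_zero)

text \<open>In two dimensions every proper orthochronous Lorentz transformation is a boost.\<close>

lemma lorentz_eq: "lorentz = range boost"
proof (intro subset_antisym subsetI)
 fix L assume L: "L \<in> lorentz"
 define a b c d where "a = L $ 1 $ 1" and "b = L $ 1 $ 2" and "c = L $ 2 $ 1" and "d = L $ 2 $ 2"
 have "(transpose L ** minkowski ** L) $ i $ j = minkowski $ i $ j" for i j
  using L by (simp add: lorentz_def)
 from this[of 1 1] this[of 1 2] this[of 2 2]
 have eqs: "a * a - c * c = 1" "a * b - c * d = 0" "b * b - d * d = - 1"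
  by (simp_all add: matrix_matrix_mult_def sum_2 transpose_def minkowski_def a_def b_def c_def d_def)
 have det: "a * d - b * c = 1" and a0: "a > 0"
  using L by (simp_all add: lorentz_def det_2 a_def b_def c_def d_def)
 have "a = a * (a * d - b * c)" using det by simp
 also have "... = (a * a) * d - (a * b) * c" by (simp add: algebra_simps)
 also have "... = (1 + c * c) * d - (c * d) * c" using eqs by simp
 also have "... = d" by (simp add: algebra_simps)
 finally have ad: "a = d" .
 have "b = b * (a * d - b * c)" using det by simp
 also have "... = (a * b) * d - (b * b) * c" by (simp add: algebra_simps)
 also have "... = (c * d) * d - (d * d - 1) * c"
  using eqs by simp
 also have "... = c" by (simp add: algebra_simps)
 finally have bc: "b = c" .
 have "a^2 = 1 + c^2" using eqs(1) by (simp add: power2_eq_square)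
 hence "cosh (arsinh c) = a" using a0 by (simp add: cosh_arsinh_real real_sqrt_unique)
 hence "L = boost (arsinh c)"
  using ad bc by (simp add: vec_eq_iff forall_2 a_def b_def c_def d_def)
 thus "L \<in> range boost" by blast
next
 fix L assume "L \<in> range boost"
 then obtain r where L: "L = boost r" by blast
 have e: "cosh r * cosh r = 1 + sinh r * sinh r"
  using cosh_square_eq[of r] by (simp add: power2_eq_square)
 show "L \<in> lorentz"
  by (simp add: lorentz_def L vec_eq_iff forall_2 matrix_matrix_mult_def sum_2 transpose_def minkowski_def det_2 e)
qed

lemma poincare_group_iff: "g \<in> poincare_group \<longleftrightarrow> (\<exists>r y. g = (boost r, y))"
 by (cases g) (auto simp: poincare_group_def lorentz_eq)

lemma poincare_mult_boost:
 "poincare_mult (boost r, y) (boost h, z) = (boost (r + h), boost r *v z + y)"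
 by (simp add: poincare_mult_def boost_mult)

lemma poincare_inv_boost: "poincare_inv (boost r, y) = (boost (- r), - (boost (- r) *v y))"
 by (simp add: poincare_inv_def matrix_inv_boost)

definition tau :: "real => real => real^2 => (real => complex) => real => complex"
 where "tau m r y = kg_data (m^2 / 4) (exp (- r)) (- (exp (- r) * (y $ 2 + y $ 1)))
  (exp r) (- (exp r * (y $ 2 - y $ 1)))"

text \<open>The spatial momentum of \<open>\<Lambda>\<^sup>-\<^sup>1(\<omega>(p), p)\<close> for the boost \<open>\<Lambda>\<close> of rapidity \<open>r\<close>.\<close>

definition boostp :: "real => real => real => real"
 where "boostp m r p = cosh r * p - sinh r * omega m p"

lemma tau_test: "f \<in> \<D> ==> tau m r y f \<in> \<D>"
 unfolding tau_def by (rule kg_data_test) auto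

lemma tilde_tau:
 assumes f: "f \<in> \<D>"
 shows "tilde m (tau m r y f) p = cis (y $ 1 * omega m p - y $ 2 * p) * tilde m f (boostp m r p)"
  and "omega m (boostp m r p) = cosh r * omega m p - sinh r * p"
proof -
 have e: "exp (- r) * exp r = 1" by (simp flip: exp_add)
 have 1: "- (exp r * (omega m p - p) / 2 + - exp (- r) * (omega m p + p) / 2) = boostp m r p"
  by (simp add: boostp_def cosh_field_def sinh_field_def field_simps)
 have gen: "- (E * A / 2 * (- (E' * s)) + - E' * B / 2 * (- (E * t))) = (A * s - B * t) / 2"
  if "E' * E = 1" for E E' A B s t :: real
 proof -
  have "- (E * A / 2 * (- (E' * s)) + - E' * B / 2 * (- (E * t))) = (E' * E) * ((A * s - B * t) / 2)"
   by (simp add: algebra_simps add_divide_distrib)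
  thus ?thesis by (simp only: that mult_1)
 qed
 have 2: "((omega m p - p) * (y $ 2 + y $ 1) - (omega m p + p) * (y $ 2 - y $ 1)) / 2 = y $ 1 * omega m p - y $ 2 * p"
  by (simp add: field_simps)
 show "tilde m (tau m r y f) p = cis (y $ 1 * omega m p - y $ 2 * p) * tilde m f (boostp m r p)"
  unfolding tau_def tilde_kg_data(1)[OF f exp_gt_zero exp_gt_zero e] 1 gen[OF e] 2 ..
 show "omega m (boostp m r p) = cosh r * omega m p - sinh r * p"
  using tilde_kg_data(2)[OF f _ _ e, of m p] unfolding 1
  by (simp add: cosh_field_def sinh_field_def field_simps)
qed

lemma omega_boostp: "omega m (boostp m r p) = cosh r * omega m p - sinh r * p"
 using test_functionsI[of _ 0] smooth_const tilde_tau(2) by fastforce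

lemma boostp_add: "boostp m h (boostp m r p) = boostp m (r + h) p"
 unfolding boostp_def[of m h] omega_boostp
 by (simp add: boostp_def cosh_add sinh_add algebra_simps)

lemma boostp_zero [simp]: "boostp m 0 p = p"
 by (simp add: boostp_def)

text \<open>The explicit solution is the action that is specified by Fourier transforms.\<close>

lemma poincare_tau_eq:
 assumes m: "m > 0" and f: "f \<in> \<D>"
 shows "poincare_tau m (boost r, y) f = tau m r y f"
 using matrix_inv_boost boost_apply boostp_def poincare_tau_def tau_test[OF f] tilde_tau(1)[OF f] tilde_injective[OF m _ tau_test[OF f]] by auto

lemma tau_comp:
 assumes m: "m > 0" and f: "f \<in> \<D>"
 shows "tau m r y (tau m h z f) = tau m (r + h) (boost r *v z + y) f"
proof (rule tilde_injective[OF m])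
 fix p
 have e: "y $ 1 * omega m p - y $ 2 * p + (z $ 1 * omega m (boostp m r p) - z $ 2 * boostp m r p)
  = (boost r *v z + y) $ 1 * omega m p - (boost r *v z + y) $ 2 * p"
  unfolding omega_boostp by (simp add: boost_apply boostp_def algebra_simps)
 show "tilde m (tau m r y (tau m h z f)) p = tilde m (tau m (r + h) (boost r *v z + y) f) p"
  unfolding tilde_tau(1)[OF tau_test[OF f]] tilde_tau(1)[OF f] boostp_add mult.assoc[symmetric] cis_mult e ..
qed (intro tau_test f)+

lemma tau_zero: "m > 0 ==> f \<in> \<D> ==> tau m 0 0 f = f"
 by (rule tilde_injective[of m]) (auto simp: tau_test tilde_tau(1))

lemma tau_minus:
 assumes m: "m > 0" and f: "f \<in> \<D>"
 shows "tau m r y (\<lambda>x. - f x) = (\<lambda>x. - tau m r y f x)"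
proof (rule tilde_injective[OF m])
 have neg: "tilde m (\<lambda>x. - g x) p = - tilde m g p" if "g \<in> \<D>" for g p
 proof -
  have "(LINT x|lborel. cis (- p * x) * (Re (- g x) + \<i> * omega m p * Im (- g x)))
    = (LINT x|lborel. - (cis (- p * x) * (Re (g x) + \<i> * omega m p * Im (g x))))"
   by (simp add: algebra_simps)
  also have "... = - (LINT x|lborel. cis (- p * x) * (Re (g x) + \<i> * omega m p * Im (g x)))"
   by (rule Bochner_Integration.integral_minus)
  finally show ?thesis
   unfolding tilde_eq[OF that] tilde_eq[OF test_minus[OF that]] by simp
 qed
 show "tilde m (tau m r y (\<lambda>x. - f x)) p = tilde m (\<lambda>x. - tau m r y f x) p" for p
  by (simp add: neg tau_test f tilde_tau(1) test_minus)
qed (intro tau_test test_minus f)+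

text \<open>Finite propagation speed: bounds for the support of a transformed test function in terms of the
 light-cone coordinates of the transformed initial interval.\<close>

lemma tau_support:
 assumes f: "smooth_fun f" and z: "!!x. x < a \<or> x > b ==> f x = 0"
  and nz: "tau m r y f x ~= 0"
 shows "x <= exp r * b + (y $ 2 + y $ 1) \<or> x <= exp (- r) * b + (y $ 2 - y $ 1)"
  and "x >= exp r * a + (y $ 2 + y $ 1) \<or> x >= exp (- r) * a + (y $ 2 - y $ 1)"
proof -
 have e: "exp (- r) * t > c \<longleftrightarrow> t > exp r * c" "exp (- r) * t < c \<longleftrightarrow> t < exp r * c"
  "exp r * t > c \<longleftrightarrow> t > exp (- r) * c" "exp r * t < c \<longleftrightarrow> t < exp (- r) * c" for t c
  by (simp_all add: exp_minus field_simps)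
 show "x <= exp r * b + (y $ 2 + y $ 1) \<or> x <= exp (- r) * b + (y $ 2 - y $ 1)"
 proof (rule ccontr)
  assume "\<not> ?thesis"
  hence x: "x - (y $ 2 + y $ 1) > exp r * b" "x - (y $ 2 - y $ 1) > exp (- r) * b" by auto
  note iffD2[OF e(1) x(1)] iffD2[OF e(3) x(2)]
  hence "tau m r y f x = 0"
   unfolding tau_def by (intro kg_data_zero_right[OF f, of b]) (auto simp: z algebra_simps)
  thus False using nz by simp
 qed
 show "x >= exp r * a + (y $ 2 + y $ 1) \<or> x >= exp (- r) * a + (y $ 2 - y $ 1)"
 proof (rule ccontr)
  assume "\<not> ?thesis"
  hence x: "x - (y $ 2 + y $ 1) < exp r * a" "x - (y $ 2 - y $ 1) < exp (- r) * a" by auto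
  note iffD2[OF e(2) x(1)] iffD2[OF e(4) x(2)]
  hence "tau m r y f x = 0"
   unfolding tau_def by (intro kg_data_zero_left[OF f, of a]) (auto simp: z algebra_simps)
  thus False using nz by simp
 qed
qed

section \<open>The one-particle norm\<close>

lemma omega_pos: "m > 0 ==> omega m p > 0"
 by (simp add: omega_def add_nonneg_pos)

lemma omega_sq: "(omega m p)^2 = p^2 + m^2"
 by (simp add: omega_def)

lemma continuous_omega: "continuous_on S (omega m)"
 unfolding omega_def[abs_def] by (intro continuous_intros)

lemma mass_norm_sq_eq:
 assumes m: "m > 0"
 shows "mass_norm_sq m f = 1 / 2 * (LINT p|lborel. (cmod (tilde m f p))^2 / omega m p)"
proof -
 have "(cmod (of_real (omega m p powr (- 1 / 2)) * R + \<i> * of_real (omega m p powr (1 / 2)) * I))^2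
   = (cmod (R + \<i> * of_real (omega m p) * I))^2 / omega m p" for p R I
 proof -
  define w where "w = omega m p"
  have w: "w > 0" using omega_pos[OF m] by (simp add: w_def)
  have "w powr (1/2) = w powr (- 1 / 2) * w"
   using w powr_add[of w "- 1 / 2" 1] by simp
  hence "of_real (w powr (- 1 / 2)) * R + \<i> * of_real (w powr (1 / 2)) * I
    = of_real (w powr (- 1 / 2)) * (R + \<i> * of_real w * I)"
   by (simp add: algebra_simps)
  moreover have "(w powr (- 1 / 2))^2 = 1 / w"
   using w by (simp add: power2_eq_square flip: powr_add)
  ultimately show ?thesis by (simp add: norm_mult power_mult_distrib w_def)
 qed
 thus ?thesis by (simp add: mass_norm_sq_def tilde_def)
qed

lemma dird_zero_open:
 assumes "open Z" "!!y. y \<in> Z ==> F y = 0" "x \<in> Z"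
 shows "dird h F x = 0"
 by (metis has_derivative_transform_within_open[OF has_derivative_const[of 0] assms(1,3), of F] assms(2) dird_eqI)

lemma dird_zero_outside:
 fixes f :: "real => 'b::real_normed_vector"
 assumes "!!x. \<bar>x\<bar> > L ==> f x = 0" "\<bar>x\<bar> > L"
 shows "dird h f x = 0"
 by (rule dird_zero_open[of "{x. \<bar>x\<bar> > L}"])
  (use assms in "auto intro!: open_Collect_less continuous_intros")

lemma fourier_deriv:
 assumes f: "f \<in> \<D>"
 shows "fourier (dird 1 f) p = \<i> * p * fourier f p"
proof -
 obtain L where L: "L > 0" "!!x. \<bar>x\<bar> > L ==> f x = 0" using test_supportE[OF f] by blast
 have sf: "smooth_fun f" by (rule test_smooth[OF f])
 have fz: "f x = 0" "dird 1 f x = 0" if "\<bar>x\<bar> > L" for x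
  using L(2) dird_zero_outside[of L f x 1] that by auto
 have fd: "(f has_vector_derivative dird 1 f x) (at x within S)" for x S
  using smooth_has_vector_derivative_line[OF sf, of 0 1 x S] by simp
 have c1: "continuous_on S (\<lambda>x. cis (- p * x) * f x)" "continuous_on S (\<lambda>x. cis (- p * x) * dird 1 f x)" for S
  by (intro continuous_intros smooth_imp_continuous smooth_dird sf)+
 note i1 = lborel_integral_compact(2)[OF c1(1), of "L + 1"] and i2 = lborel_integral_compact(2)[OF c1(2), of "L + 1"]
 have "((\<lambda>x. cis (- p * x) * dird 1 f x + (\<i> * of_real (- p) * cis (- p * x)) * f x) has_integral
   (cis (- p * (L + 1)) * f (L + 1) - cis (- p * (- (L + 1))) * f (- (L + 1)))) {- (L + 1)..L + 1}"
  by (rule fundamental_theorem_of_calculus[OF _ has_vector_derivative_mult[OF cis_linear_has_vector_derivative fd]])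
   (use L(1) in simp)
 hence "integral {- (L + 1)..L + 1} (\<lambda>x. cis (- p * x) * dird 1 f x + (- \<i> * p) * (cis (- p * x) * f x)) = 0"
  using fz(1)[of "L + 1"] fz(1)[of "- (L + 1)"] by (simp add: integral_unique mult.assoc)
 moreover have "integral {- (L + 1)..L + 1} (\<lambda>x. cis (- p * x) * dird 1 f x + (- \<i> * p) * (cis (- p * x) * f x))
   = integral {- (L + 1)..L + 1} (\<lambda>x. cis (- p * x) * dird 1 f x)
    + (- \<i> * p) * integral {- (L + 1)..L + 1} (\<lambda>x. cis (- p * x) * f x)"
  by (subst Henstock_Kurzweil_Integration.integral_add)
   (intro integrable_continuous_real continuous_intros c1 | simp)+
 ultimately show ?thesis
  using i1 i2 fz unfolding fourier_def by (simp add: algebra_simps)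
qed

lemma dird_test: assumes "f \<in> \<D>" shows "dird 1 f \<in> \<D>"
 by (metis test_supportE[OF assms] test_functionsI smooth_dird[OF test_smooth[OF assms]] dird_zero_outside)

lemma fourier_bound:
 assumes "f \<in> \<D>"
 shows "\<exists>C. \<forall>p. cmod (fourier f p) <= C"
proof (intro exI allI)
 fix p
 have "cmod (LINT x|lborel. cis (- p * x) * f x) <= (LINT x|lborel. cmod (cis (- p * x) * f x))"
  by (rule integral_norm_bound)
 thus "cmod (fourier f p) <= 1 / sqrt (2 * pi) * (LINT x|lborel. cmod (f x))"
  by (simp add: fourier_def norm_mult norm_divide divide_right_mono)
qed

lemma fourier_decay:
 assumes f: "f \<in> \<D>"
 shows "\<exists>C. \<forall>p. cmod (fourier f p) * (p^2 + m^2) <= C"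
proof -
 obtain A where A: "!!p. cmod (fourier f p) <= A" using fourier_bound[OF f] by blast
 obtain B where B: "!!p. cmod (fourier (dird 1 (dird 1 f)) p) <= B"
  using fourier_bound[OF dird_test[OF dird_test[OF f]]] by blast
 have "cmod (fourier f p) * (p^2 + m^2) <= B + m^2 * A" for p
 proof -
  have "cmod (fourier (dird 1 (dird 1 f)) p) = \<bar>p\<bar> * (\<bar>p\<bar> * cmod (fourier f p))"
   by (simp add: fourier_deriv f dird_test norm_mult)
  hence "cmod (fourier f p) * p^2 <= B" using B[of p]
   by (simp add: power2_eq_square mult_ac)
  moreover have "m^2 * cmod (fourier f p) <= m^2 * A" using A by (intro mult_left_mono) auto
  ultimately show ?thesis by (simp add: algebra_simps)
 qed
 thus ?thesis by blast
qed

lemma tilde_decay: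
 assumes m: "m > 0" and f: "f \<in> \<D>"
 shows "\<exists>K\<ge>0. \<forall>p. cmod (tilde m f p) <= K / omega m p"
proof -
 obtain A where A: "!!p. cmod (fourier (re_fun f) p) * (p^2 + m^2) <= A"
  using fourier_decay[OF test_re_fun[OF f]] by blast
 obtain B where B: "!!p. cmod (fourier (im_fun f) p) * (p^2 + m^2) <= B"
  using fourier_decay[OF test_im_fun[OF f]] by blast
 have "cmod (tilde m f p) <= (A / m + B) / omega m p" for p
 proof -
  define w where "w = omega m p"
  have w: "w > 0" "w^2 = p^2 + m^2" "w >= m"
   using omega_pos[OF m] by (auto simp: w_def omega_def intro: real_le_rsqrt)
  have "cmod (fourier (re_fun f) p) * w * m <= cmod (fourier (re_fun f) p) * w * w"
   using w by (intro mult_left_mono) auto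
  also have "... <= A" using A[of p] w(2) by (simp add: power2_eq_square mult.assoc)
  finally have 1: "cmod (fourier (re_fun f) p) * w <= A / m" using m by (simp add: pos_le_divide_eq)
  have "w * cmod (fourier (im_fun f) p) * w = cmod (fourier (im_fun f) p) * w^2"
   by (simp add: power2_eq_square)
  hence 2: "w * cmod (fourier (im_fun f) p) * w <= B" using B[of p] unfolding w(2)[symmetric] by linarith
  have "cmod (tilde m f p) <= cmod (fourier (re_fun f) p) + w * cmod (fourier (im_fun f) p)"
   unfolding tilde_def w_def[symmetric]
   by (rule order_trans[OF norm_triangle_ineq]) (use w in "simp add: norm_mult")
  hence "cmod (tilde m f p) * w <= A / m + B"
   using 1 2 w(1) mult_right_mono[of "cmod (tilde m f p)" _ w] by (fastforce simp: distrib_right)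
  thus ?thesis using w(1) by (simp add: pos_le_divide_eq w_def)
 qed
 hence "cmod (tilde m f p) <= max 0 (A / m + B) / omega m p" for p
  using omega_pos[OF m, of p] by (meson divide_right_mono less_imp_le max.cobounded2 order_trans)
 thus ?thesis by (intro exI[of _ "max 0 (A / m + B)"]) simp
qed

lemma continuous_tilde:
 assumes f: "f \<in> \<D>"
 shows "continuous_on UNIV (tilde m f)"
proof -
 have four: "continuous_on UNIV (fourier g)" if g: "g \<in> \<D>" for g
 proof -
  obtain L where L: "L > 0" "!!x. \<bar>x\<bar> > L ==> g x = 0" using test_supportE[OF g] by blast
  have cg: "continuous_on S g" for S by (rule smooth_imp_continuous[OF test_smooth[OF g]])
  have eq: "fourier g p = of_real (1 / sqrt (2 * pi)) * integral (cbox (-L) L) (\<lambda>x. cis (- p * x) * g x)" for p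
   unfolding fourier_def cbox_interval
   by (subst lborel_integral_compact(2)[of _ L]) (use L in "auto intro!: continuous_intros cg")
  have "continuous_on UNIV (\<lambda>p. integral (cbox (-L) L) (\<lambda>x. cis (- p * x) * g x))"
  proof (rule integral_continuous_on_param)
   show "continuous_on (UNIV \<times> cbox (- L) L) (\<lambda>(p, x). cis (- p * x) * g x)"
    unfolding case_prod_beta cis_conv_exp
    by (intro continuous_intros continuous_on_compose2[OF cg[of UNIV]]) auto
  qed
  thus ?thesis unfolding eq[abs_def] by (intro continuous_intros)
 qed
 show ?thesis
  unfolding tilde_def[abs_def]
  by (intro continuous_intros four test_re_fun test_im_fun f continuous_omega)
qed

lemma integrable_inverse_omega_sq:
 fixes m :: real
 assumes m: "m > 0"
 shows "integrable lborel (\<lambda>p. 1 / (p^2 + m^2))"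
proof -
 have d: "DERIV (\<lambda>p. arctan (p / m) / m) p :> 1 / (p^2 + m^2)" for p
 proof -
  have "1 + (p / m)^2 = (p^2 + m^2) / m^2" using m by (simp add: field_simps)
  hence "inverse (1 + (p / m)^2) * (1 / m) / m = 1 / (p^2 + m^2)"
   using m by (simp add: power2_eq_square)
  moreover have "DERIV (\<lambda>p. arctan (p / m) / m) p :> inverse (1 + (p / m)^2) * (1 / m) / m"
   by (auto intro!: derivative_eq_intros simp: divide_inverse)
  ultimately show ?thesis by simp
 qed
 have c: "isCont (\<lambda>p. 1 / (p^2 + m^2)) p" for p
  using m by (intro continuous_intros) (simp add: add_nonneg_eq_0_iff)
 have "set_integrable lborel (einterval (- \<infinity>) \<infinity>) (\<lambda>p. 1 / (p^2 + m^2))"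
 proof (rule interval_integral_FTC_nonneg(1)[where F = "\<lambda>p. arctan (p / m) / m" and A = "- (pi / 2) / m" and B = "pi / 2 / m"])
  have top: "filterlim (\<lambda>p. p / m) at_top at_top" and bot: "filterlim (\<lambda>p. p / m) at_bot at_bot"
   using filterlim_tendsto_pos_mult_at_top[OF tendsto_const[of "1 / m"] _ filterlim_ident]
    filterlim_tendsto_pos_mult_at_bot[OF tendsto_const[of "1 / m"] _ filterlim_ident] m by simp_all
  show "(((\<lambda>p. arctan (p / m) / m) \<circ> real_of_ereal) \<longlongrightarrow> pi / 2 / m) (at_left \<infinity>)"
   unfolding ereal_tendsto_simps using m
   by (intro tendsto_divide tendsto_const filterlim_compose[OF tendsto_arctan_at_top top]) auto
  show "(((\<lambda>p. arctan (p / m) / m) \<circ> real_of_ereal) \<longlongrightarrow> - (pi / 2) / m) (at_right (- \<infinity>))"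
   unfolding ereal_tendsto_simps using m
   by (intro tendsto_divide tendsto_const filterlim_compose[OF tendsto_arctan_at_bot bot]) auto
 qed (use d c in auto)
 thus ?thesis by (simp add: set_integrable_def)
qed

lemma integrable_decay:
 fixes F :: "real => real"
 assumes m: "m > 0" and c: "F \<in> borel_measurable lborel" and F: "!!p. \<bar>F p\<bar> <= K / (omega m p)^2"
 shows "integrable lborel F"
proof (rule Bochner_Integration.integrable_bound)
 show "integrable lborel (\<lambda>p. K * (1 / (p^2 + m^2)))"
  by (intro integrable_mult_right integrable_inverse_omega_sq m)
 show "AE p in lborel. norm (F p) <= norm (K * (1 / (p^2 + m^2)))"
 proof (rule AE_I2)
  fix p
  have "\<bar>F p\<bar> <= K / (p^2 + m^2)" using F[of p] by (simp add: omega_sq)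
  also have "... <= \<bar>K\<bar> / (p^2 + m^2)" by (intro divide_right_mono) auto
  finally show "norm (F p) <= norm (K * (1 / (p^2 + m^2)))" by simp
 qed
qed (rule c)

lemma tilde_sq_bound:
 assumes m: "m > 0" and K: "0 <= K" "!!p. cmod (F p) <= K / omega m p"
 shows "\<bar>(cmod (F p))\<^sup>2 / omega m p\<bar> <= (K^2 / m) / (omega m p)^2"
proof -
 define w where "w = omega m p"
 have w: "w >= m" "w > 0" using omega_pos[OF m] by (auto simp: w_def omega_def intro: real_le_rsqrt)
 have "(cmod (F p))^2 <= (K / w)^2" using K(2)[of p] by (intro power_mono) (auto simp: w_def)
 hence "(cmod (F p))^2 / w <= (K / w)^2 / m"
  using w m by (intro frac_le) auto
 thus ?thesis using w by (simp add: w_def[symmetric] power_divide mult.commute)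
qed

lemma integrable_tilde_sq:
 assumes m: "m > 0" and f: "f \<in> \<D>"
 shows "integrable lborel (\<lambda>p. (cmod (tilde m f p))^2 / omega m p)"
proof -
 obtain K where K: "K >= 0" "!!p. cmod (tilde m f p) <= K / omega m p" using tilde_decay[OF m f] by blast
 have "continuous_on UNIV (\<lambda>p. (cmod (tilde m f p))^2 / omega m p)"
  using omega_pos[OF m] by (intro continuous_intros continuous_tilde f continuous_omega) (metis less_irrefl)
 hence "(\<lambda>p. (cmod (tilde m f p))^2 / omega m p) \<in> borel_measurable lborel"
  by (simp add: borel_measurable_continuous_onI)
 thus ?thesis using tilde_sq_bound[OF m K] by (rule integrable_decay[OF m])
qed

text \<open>Invariance under the Poincare group: \<open>dp / \<omega>(p)\<close> is invariant under boosts.\<close>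

lemma mass_norm_sq_tau:
 assumes m: "m > 0" and f: "f \<in> \<D>"
 shows "mass_norm_sq m (tau m r y f) = mass_norm_sq m f"
proof -
 define F where "F p = (cmod (tilde m f p))^2 / omega m p" for p
 define g' where "g' p = omega m (boostp m r p) / omega m p" for p
 have F: "integrable lborel F" unfolding F_def[abs_def] by (rule integrable_tilde_sq[OF m f])
 have g': "g' p > 0" for p unfolding g'_def by (intro divide_pos_pos omega_pos m)
 have dg: "(boostp m r has_field_derivative g' p) (at p within S)" for p S
 proof -
  have "p^2 + m^2 > 0" using m by (simp add: add_nonneg_pos)
  hence "(omega m has_field_derivative (p / omega m p)) (at p within S)"
   unfolding omega_def[abs_def]
   by (auto intro!: derivative_eq_intros simp: field_simps)
  hence "(boostp m r has_field_derivative (cosh r - sinh r * (p / omega m p))) (at p within S)"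
   unfolding boostp_def[abs_def] by (auto intro!: derivative_eq_intros)
  moreover have "cosh r - sinh r * (p / omega m p) = g' p"
   unfolding g'_def omega_boostp using omega_pos[OF m, of p] by (simp add: field_simps)
  ultimately show ?thesis by simp
 qed
 have inv: "boostp m (- r) (boostp m r p) = p" "boostp m r (boostp m (- r) p) = p" for p
  by (simp_all add: boostp_add)
 have inj: "inj_on (boostp m r) UNIV" by (rule inj_on_inverseI) (rule inv)
 have surj: "range (boostp m r) = UNIV" by (rule surjI) (rule inv)
 have trF: "(cmod (tilde m (tau m r y f) p))^2 / omega m p = \<bar>g' p\<bar> * F (boostp m r p)" for p
  using omega_pos[OF m, of p] omega_pos[OF m, of "boostp m r p"] g'[of p]
  by (simp add: tilde_tau(1)[OF f] norm_mult F_def g'_def)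
 have "F absolutely_integrable_on UNIV"
  by (simp add: F absolutely_integrable_on_def integrable_on_lborel)
 hence "integral UNIV (\<lambda>p. \<bar>g' p\<bar> * F (boostp m r p)) = integral UNIV F"
  using has_absolute_integral_change_of_variables_1'[of UNIV "boostp m r" g' F "integral UNIV F"] dg inj surj
  by simp
 moreover have "integrable lborel (\<lambda>p. \<bar>g' p\<bar> * F (boostp m r p))"
  unfolding trF[symmetric] by (rule integrable_tilde_sq[OF m tau_test[OF f]])
 ultimately have "(LINT p|lborel. \<bar>g' p\<bar> * F (boostp m r p)) = (LINT p|lborel. F p)"
  using integral_lborel F by metis
 thus ?thesis unfolding mass_norm_sq_eq[OF m] trF F_def by simp
qed

lemma tilde_diff:
 assumes "f \<in> \<D>" "g \<in> \<D>"
 shows "tilde m (\<lambda>x. f x - g x) p = tilde m f p - tilde m g p"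
 by (simp add: assms tilde_def fourier_diff test_re_fun test_im_fun algebra_simps)

lemma tendsto_boostp:
 assumes "r ---> t" shows "(\<lambda>n. boostp m (r n) p) ---> boostp m t p"
 unfolding boostp_def cosh_field_def sinh_field_def by (intro tendsto_intros assms) auto

lemma omega_boostp_ge:
 assumes m: "m > 0"
 shows "omega m (boostp m r p) >= exp (- \<bar>r\<bar>) * omega m p"
proof -
 have w: "\<bar>p\<bar> <= omega m p" unfolding omega_def by (rule real_le_rsqrt) simp
 have "sinh r * p <= \<bar>sinh r\<bar> * omega m p"
  using abs_ge_self[of "sinh r * p"] mult_left_mono[OF w, of "\<bar>sinh r\<bar>"] by (simp add: abs_mult)
 moreover have "cosh r - \<bar>sinh r\<bar> = exp (- \<bar>r\<bar>)"
  by (cases "r >= 0") (simp_all add: cosh_field_def sinh_field_def field_simps)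
 ultimately show ?thesis
  unfolding omega_boostp by (metis diff_left_mono left_diff_distrib)
qed

text \<open>Continuity of the action in the one-particle norm and in the symplectic form. For the norm,
 convergence is dominated by a multiple of \<open>1 / (p\<^sup>2 + m\<^sup>2)\<close>, uniformly for bounded rapidities.\<close>

lemma mass_norm_sq_tau_tendsto:
 assumes m: "m > 0" and f: "f \<in> \<D>" and r: "r ---> 0" and y: "y ---> 0"
 shows "(\<lambda>n. mass_norm_sq m (\<lambda>x. tau m (r n) (y n) f x - f x)) ---> 0"
proof -
 define D where "D n p = cis (y n $ 1 * omega m p - y n $ 2 * p) * tilde m f (boostp m (r n) p) - tilde m f p" for n p
 have D: "tilde m (\<lambda>x. tau m (r n) (y n) f x - f x) p = D n p" for n p
  by (simp add: tilde_diff tau_test f tilde_tau(1) D_def)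
 obtain K where K: "K >= 0" "!!p. cmod (tilde m f p) <= K / omega m p" using tilde_decay[OF m f] by blast
 have "Bseq r" using r convergent_def convergent_imp_Bseq by blast
 then obtain B where B: "!!n. \<bar>r n\<bar> <= B" unfolding Bseq_def by auto
 have bound: "cmod (D n p) <= (K * exp B + K) / omega m p" for n p
 proof -
  have w: "omega m p > 0" by (rule omega_pos[OF m])
  have "exp (- B) * omega m p <= exp (- \<bar>r n\<bar>) * omega m p" using B[of n] w by simp
  also have "... <= omega m (boostp m (r n) p)" by (rule omega_boostp_ge[OF m])
  finally have "K / omega m (boostp m (r n) p) <= K / (exp (- B) * omega m p)"
   using w K(1) by (intro divide_left_mono) (auto intro!: mult_pos_pos omega_pos[OF m])
  also have "... = K * exp B / omega m p" by (simp add: exp_minus field_simps)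
  finally have "cmod (tilde m f (boostp m (r n) p)) <= K * exp B / omega m p"
   using K(2)[of "boostp m (r n) p"] by linarith
  moreover have "cmod (D n p) <= cmod (tilde m f (boostp m (r n) p)) + cmod (tilde m f p)"
   unfolding D_def by (rule order_trans[OF norm_triangle_ineq4]) (simp add: norm_mult)
  ultimately show ?thesis using K(2)[of p] by (simp add: add_divide_distrib)
 qed
 have K0: "0 <= K * exp B + K" using K(1) by simp
 have meas: "(\<lambda>p. (cmod (D n p))^2 / omega m p) \<in> borel_measurable lborel" for n
 proof -
  have "continuous_on UNIV (\<lambda>p. (cmod (tilde m (\<lambda>x. tau m (r n) (y n) f x - f x) p))^2 / omega m p)"
   using omega_pos[OF m]
   by (intro continuous_intros continuous_tilde test_diff tau_test f continuous_omega) (metis less_irrefl)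
  thus ?thesis unfolding D by (simp add: borel_measurable_continuous_onI)
 qed
 have "(\<lambda>n. LINT p|lborel. (cmod (D n p))^2 / omega m p) ---> (LINT p|(lborel :: real measure). (0::real))"
 proof (rule integral_dominated_convergence[where f = "\<lambda>p::real. 0::real" and s = "\<lambda>n p. (cmod (D n p))^2 / omega m p" and w = "\<lambda>p. ((K * exp B + K)^2 / m) * (1 / (p^2 + m^2))"])
  show "integrable lborel (\<lambda>p. ((K * exp B + K)^2 / m) * (1 / (p^2 + m^2)))"
   by (rule integrable_mult_right[OF integrable_inverse_omega_sq[OF m]])
  show "AE p in lborel. (\<lambda>n. (cmod (D n p))^2 / omega m p) ---> 0"
  proof (rule AE_I2)
   fix p
   have "isCont (tilde m f) p" using continuous_tilde[OF f] by (simp add: continuous_on_eq_continuous_at)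
   hence t: "(\<lambda>n. tilde m f (boostp m (r n) p)) ---> tilde m f p"
    using tendsto_boostp[OF r, of m p] by (intro isCont_tendsto_compose[of p "tilde m f"]) simp_all
   have y1: "(\<lambda>n. y n $ 1) ---> (0::real^2) $ 1" by (rule tendsto_vec_nth[OF y])
   have y2: "(\<lambda>n. y n $ 2) ---> (0::real^2) $ 2" by (rule tendsto_vec_nth[OF y])
   have "(\<lambda>n. D n p) ---> cis ((0::real^2) $ 1 * omega m p - (0::real^2) $ 2 * p) * tilde m f p - tilde m f p"
    unfolding D_def cis_conv_exp by (intro tendsto_intros t y1 y2)
   hence "(\<lambda>n. (cmod (D n p))^2 / omega m p) ---> (cmod 0)\<^sup>2 / omega m p"
    using omega_pos[OF m, of p] by (intro tendsto_intros) auto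
   thus "(\<lambda>n. (cmod (D n p))^2 / omega m p) ---> 0" by simp
  qed
  show "AE p in lborel. norm ((cmod (D n p))^2 / omega m p) <= ((K * exp B + K)^2 / m) * (1 / (p^2 + m^2))" for n
   using tilde_sq_bound[OF m K0 bound] omega_pos[OF m] by (intro AE_I2) (simp add: omega_sq less_imp_le)
 qed (use meas in auto)
 hence "(\<lambda>n. 1 / 2 * (LINT p|lborel. (cmod (D n p))^2 / omega m p)) ---> 1 / 2 * 0"
  by (intro tendsto_intros) simp
 thus ?thesis by (simp add: mass_norm_sq_eq[OF m] D)
qed

lemma symp_tau_tendsto:
 assumes m: "m > 0" and f: "f \<in> \<D>" and r: "r ---> 0" and y: "y ---> 0"
 shows "(\<lambda>n. symp f (tau m (r n) (y n) f)) ---> 0"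
proof -
 obtain L where L: "L > 0" "!!x. \<bar>x\<bar> > L ==> f x = 0" using test_supportE[OF f] by blast
 have sf: "smooth_fun f" by (rule test_smooth[OF f])
 define G where "G s z = cnj (f z) * tau m (fst s) (snd s) f z" for s :: "real \<times> (real^2)" and z
 have eq: "symp f (tau m t x f) = Im (integral (cbox (- L) L) (G (t, x)))" for t x
 proof -
  have "(LINT z|lborel. cnj (f z) * tau m t x f z) = integral {-L..L} (\<lambda>z. cnj (f z) * tau m t x f z)"
   by (simp add: lborel_integral_compact(2) continuous_intros smooth_imp_continuous test_smooth tau_test f L)
  thus ?thesis by (simp add: symp_def G_def[abs_def])
 qed
 have "continuous_on UNIV (\<lambda>s. integral (cbox (- L) L) (G s))"
 proof (rule integral_continuous_on_param)
  have k: "continuous_on S (\<lambda>q. F (A q, B q))" if "smooth_fun F" "continuous_on S A" "continuous_on S B"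
   for F :: "real \<times> real => real" and A B :: "(real \<times> (real^2)) \<times> real => real" and S
   by (intro continuous_on_compose2[OF smooth_imp_continuous[OF that(1), of UNIV]] continuous_on_Pair that(2,3)) auto
  have cf: "continuous_on S (\<lambda>q. f (snd q))" for S :: "((real \<times> (real^2)) \<times> real) set"
   by (rule continuous_on_compose2[OF smooth_imp_continuous[OF sf, of UNIV]]) (auto intro: continuous_intros)
  have cx: "continuous_on S (\<lambda>q :: (real \<times> (real^2)) \<times> real. snd (fst q) $ i)" for S i
   by (intro continuous_intros)
  show "continuous_on (UNIV \<times> cbox (- L) L) (\<lambda>(s, z). G s z)"
   unfolding case_prod_beta G_def tau_def kg_data_def
   by (intro continuous_intros k smooth_dird smooth_kg_field sf cf cx)
 qed
 hence "isCont (\<lambda>s. integral (cbox (- L) L) (G s)) (0, 0)"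
  by (simp add: continuous_on_eq_continuous_at)
 hence "(\<lambda>n. integral (cbox (- L) L) (G (r n, y n))) ---> integral (cbox (- L) L) (G (0, 0))"
  by (rule isCont_tendsto_compose) (intro tendsto_Pair r y)
 hence "(\<lambda>n. symp f (tau m (r n) (y n) f)) ---> symp f (tau m 0 0 f)"
  unfolding eq by (rule tendsto_Im)
 moreover have "symp f (tau m 0 0 f) = 0"
 proof -
  have "cnj (f x) * f x = of_real ((cmod (f x))^2)" for x
   by (simp only: complex_norm_square mult.commute[of "cnj (f x)"])
  hence "(LINT x|lborel. cnj (f x) * f x) = of_real (LINT x|lborel. (cmod (f x))^2)"
   by (simp flip: integral_complex_of_real)
  thus ?thesis by (simp add: symp_def tau_zero[OF m f])
 qed
 ultimately show ?thesis by simp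
qed

lemma symp_zero_disjoint:
 assumes "!!x. f x = 0 \<or> g x = 0" shows "symp f g = 0"
proof -
 have "(\<lambda>x. cnj (f x) * g x) = (\<lambda>x. 0)" using assms by auto
 thus ?thesis by (simp add: symp_def)
qed

section \<open>Geometry of double cones\<close>

text \<open>In the light-cone coordinates \<open>x\<^sub>2 \<plusminus> x\<^sub>1\<close> the double cone over \<open>(a, b)\<close> is a square.\<close>

lemma base_cone_iff: "x \<in> base_cone a b \<longleftrightarrow> x $ 2 + x $ 1 \<in> {a<..<b} \<and> x $ 2 - x $ 1 \<in> {a<..<b}"
 by (auto simp: base_cone_def)

lemma boost_lightcone:
 "(boost r *v x) $ 2 + (boost r *v x) $ 1 = exp r * (x $ 2 + x $ 1)"
 "(boost r *v x) $ 2 - (boost r *v x) $ 1 = exp (- r) * (x $ 2 - x $ 1)"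
 by (simp_all add: boost_apply cosh_field_def sinh_field_def field_simps)

lemma lightcone_point:
 fixes p q :: real
 obtains x :: "real^2" where "x $ 2 + x $ 1 = p" "x $ 2 - x $ 1 = q"
 by (rule that[of "vector [(p - q) / 2, (p + q) / 2]"]) (simp_all add: field_simps)

lemma vec2_eqI: "(x::real^2) $ 2 + x $ 1 = y $ 2 + y $ 1 ==> x $ 2 - x $ 1 = y $ 2 - y $ 1 ==> x = y"
 by (simp add: vec_eq_iff forall_2)

lemma move_base_cone_iff:
 "x \<in> move_region (boost r, y) (base_cone a b) \<longleftrightarrow>
  x $ 2 + x $ 1 \<in> {exp r * a + (y $ 2 + y $ 1)<..<exp r * b + (y $ 2 + y $ 1)} \<and>
  x $ 2 - x $ 1 \<in> {exp (- r) * a + (y $ 2 - y $ 1)<..<exp (- r) * b + (y $ 2 - y $ 1)}"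
proof
 assume "x \<in> move_region (boost r, y) (base_cone a b)"
 then obtain z where z: "z \<in> base_cone a b" "x = boost r *v z + y" by (auto simp: move_region_def)
 have "x $ 2 + x $ 1 = exp r * (z $ 2 + z $ 1) + (y $ 2 + y $ 1)"
  "x $ 2 - x $ 1 = exp (- r) * (z $ 2 - z $ 1) + (y $ 2 - y $ 1)"
  using boost_lightcone[of r z] by (simp_all add: z(2))
 thus "x $ 2 + x $ 1 \<in> {exp r * a + (y $ 2 + y $ 1)<..<exp r * b + (y $ 2 + y $ 1)} \<and>
  x $ 2 - x $ 1 \<in> {exp (- r) * a + (y $ 2 - y $ 1)<..<exp (- r) * b + (y $ 2 - y $ 1)}"
  using z(1) by (simp add: base_cone_iff)
next
 assume x: "x $ 2 + x $ 1 \<in> {exp r * a + (y $ 2 + y $ 1)<..<exp r * b + (y $ 2 + y $ 1)} \<and>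
  x $ 2 - x $ 1 \<in> {exp (- r) * a + (y $ 2 - y $ 1)<..<exp (- r) * b + (y $ 2 - y $ 1)}"
 obtain z :: "real^2" where z: "z $ 2 + z $ 1 = exp (- r) * ((x $ 2 + x $ 1) - (y $ 2 + y $ 1))"
  "z $ 2 - z $ 1 = exp r * ((x $ 2 - x $ 1) - (y $ 2 - y $ 1))"
  by (rule lightcone_point)
 have ee: "exp r * (exp (- r) * t) = t" "exp (- r) * (exp r * t) = t" for t
  by (simp_all add: exp_minus)
 have "x = boost r *v z + y"
 proof (rule vec2_eqI)
  have "(boost r *v z + y) $ 2 + (boost r *v z + y) $ 1 = ((boost r *v z) $ 2 + (boost r *v z) $ 1) + (y $ 2 + y $ 1)"
   "(boost r *v z + y) $ 2 - (boost r *v z + y) $ 1 = ((boost r *v z) $ 2 - (boost r *v z) $ 1) + (y $ 2 - y $ 1)"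
   by simp_all
  thus "x $ 2 + x $ 1 = (boost r *v z + y) $ 2 + (boost r *v z + y) $ 1"
   "x $ 2 - x $ 1 = (boost r *v z + y) $ 2 - (boost r *v z + y) $ 1"
   by (simp_all only: boost_lightcone z ee diff_add_cancel)
 qed
 moreover have "z \<in> base_cone a b"
 proof -
  have t: "exp t * s < exp t * s' \<longleftrightarrow> s < s'" for t s s' :: real by simp
  have "exp (- r) * (exp r * a) < exp (- r) * ((x $ 2 + x $ 1) - (y $ 2 + y $ 1))"
   "exp (- r) * ((x $ 2 + x $ 1) - (y $ 2 + y $ 1)) < exp (- r) * (exp r * b)"
   "exp r * (exp (- r) * a) < exp r * ((x $ 2 - x $ 1) - (y $ 2 - y $ 1))"
   "exp r * ((x $ 2 - x $ 1) - (y $ 2 - y $ 1)) < exp r * (exp (- r) * b)"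
   unfolding t using x by auto
  thus ?thesis by (simp add: base_cone_iff z ee)
 qed
 ultimately show "x \<in> move_region (boost r, y) (base_cone a b)" by (auto simp: move_region_def)
qed

lemma double_cones_iff: "Q \<in> \<K> \<longleftrightarrow> (\<exists>r y a b. a < b \<and> Q = move_region (boost r, y) (base_cone a b))"
 unfolding double_cones_def poincare_group_iff by auto blast

lemma base_cone_double_cone: "a < b ==> base_cone a b \<in> \<K>"
 unfolding double_cones_iff
 by (rule exI[of _ 0], rule exI[of _ 0]) (auto simp: move_region_def boost_zero)

lemma move_region_comp: "move_region (poincare_mult g h) Q = move_region g (move_region h Q)"
 by (simp add: move_region_def poincare_mult_def image_image matrix_vector_mul_assoc[symmetric]
   matrix_vector_right_distrib add.assoc)

lemma scale_move_base_cone: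
 assumes l: "l > 0"
 shows "scale_region l (move_region (boost r, y) (base_cone a b)) = move_region (boost r, l *\<^sub>R y) (base_cone (l * a) (l * b))"
proof (intro set_eqI iffI)
 fix x assume "x \<in> scale_region l (move_region (boost r, y) (base_cone a b))"
 then obtain z where z: "x = l *\<^sub>R z" "z \<in> move_region (boost r, y) (base_cone a b)" by (auto simp: scale_region_def)
 thus "x \<in> move_region (boost r, l *\<^sub>R y) (base_cone (l * a) (l * b))"
  using l unfolding move_base_cone_iff
  by (simp add: mult.left_commute[of _ l] flip: distrib_left right_diff_distrib)
next
 fix x assume x: "x \<in> move_region (boost r, l *\<^sub>R y) (base_cone (l * a) (l * b))"
 have "(1 / l) *\<^sub>R x \<in> move_region (boost r, y) (base_cone a b)"
  using x l unfolding move_base_cone_iff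
  by (simp add: mult.left_commute[of _ l] pos_less_divide_eq pos_divide_less_eq mult.commute[of _ l]
    flip: add_divide_distrib diff_divide_distrib) (simp add: algebra_simps)
 thus "x \<in> scale_region l (move_region (boost r, y) (base_cone a b))"
  unfolding scale_region_def using l by (intro image_eqI[of _ _ "(1 / l) *\<^sub>R x"]) auto
qed

lemma scale_double_cone: "l > 0 ==> Q \<in> \<K> ==> scale_region l Q \<in> \<K>"
 unfolding double_cones_iff using scale_move_base_cone by (metis mult_less_cancel_left_pos)

lemma scale_base_cone: "l > 0 ==> scale_region l (base_cone a b) = base_cone (l * a) (l * b)"
 using scale_move_base_cone[of l 0 0 a b] by (simp add: move_region_def boost_zero)

lemma double_cone_in_base_cone:
 assumes "Q \<in> \<K>"
 obtains M where "M > 0" "Q \<subseteq> dc M" "closure Q \<subseteq> dc M"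
proof -
 obtain r y a b where Q: "Q = move_region (boost r, y) (base_cone a b)" using assms double_cones_iff by auto
 define M where "M = 1 + \<bar>exp r * a\<bar> + \<bar>exp r * b\<bar> + \<bar>exp (- r) * a\<bar> + \<bar>exp (- r) * b\<bar> + \<bar>y $ 1\<bar> + \<bar>y $ 2\<bar>"
 have sub: "Q \<subseteq> {x. \<bar>x $ 2 + x $ 1\<bar> <= M \<and> \<bar>x $ 2 - x $ 1\<bar> <= M}" (is "_ \<subseteq> ?C")
  unfolding Q by (auto simp: move_base_cone_iff M_def)
 have "closed ?C" by (intro closed_Collect_conj closed_Collect_le continuous_intros)
 hence "closure Q \<subseteq> ?C" using sub by (rule closure_minimal[rotated])
 hence "closure Q \<subseteq> dc (M + 1)" by (force simp: base_cone_iff)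
 moreover have "M + 1 > 0" by (simp add: M_def)
 ultimately show ?thesis using that[of "M + 1"] closure_subset[of Q] by auto
qed

lemma move_base_cone_subset:
 assumes ab: "a < b" and sub: "move_region (boost r, y) (base_cone a b) \<subseteq> base_cone c d"
 shows "c <= exp r * a + (y $ 2 + y $ 1)" "exp r * b + (y $ 2 + y $ 1) <= d"
  "c <= exp (- r) * a + (y $ 2 - y $ 1)" "exp (- r) * b + (y $ 2 - y $ 1) <= d"
proof -
 define A B C D where "A = exp r * a + (y $ 2 + y $ 1)" and "B = exp r * b + (y $ 2 + y $ 1)"
  and "C = exp (- r) * a + (y $ 2 - y $ 1)" and "D = exp (- r) * b + (y $ 2 - y $ 1)"
 have AB: "A < B" "C < D" using ab by (simp_all add: A_def B_def C_def D_def)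
 have *: "p \<in> {c<..<d} \<and> q \<in> {c<..<d}" if pq: "p \<in> {A<..<B}" "q \<in> {C<..<D}" for p q
 proof -
  obtain x :: "real^2" where x: "x $ 2 + x $ 1 = p" "x $ 2 - x $ 1 = q" by (rule lightcone_point)
  hence "x \<in> move_region (boost r, y) (base_cone a b)"
   using pq unfolding move_base_cone_iff A_def B_def C_def D_def by simp
  hence "x \<in> base_cone c d" using sub by auto
  thus ?thesis using x by (simp add: base_cone_iff)
 qed
 have "{A<..<B} \<subseteq> {c<..<d}" "{C<..<D} \<subseteq> {c<..<d}"
  using *[of _ "(C + D) / 2"] *[of "(A + B) / 2"] AB by auto
 thus "c <= exp r * a + (y $ 2 + y $ 1)" "exp r * b + (y $ 2 + y $ 1) <= d"
  "c <= exp (- r) * a + (y $ 2 - y $ 1)" "exp (- r) * b + (y $ 2 - y $ 1) <= d"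
  using AB unfolding A_def[symmetric] B_def[symmetric] C_def[symmetric] D_def[symmetric]
  by (auto simp: greaterThanLessThan_subseteq_greaterThanLessThan)
qed

text \<open>If the moved double cone lies in the one over \<open>(c, d)\<close>, then so do the supports of the
 moved test functions.\<close>

lemma tau_support_subset:
 assumes f: "f \<in> \<D>" "closure {x. f x ~= 0} \<subseteq> {a<..<b}" and ab: "a < b"
  and sub: "move_region (boost r, y) (base_cone a b) \<subseteq> base_cone c d"
 shows "closure {x. tau m r y f x ~= 0} \<subseteq> {c<..<d}"
proof (cases "{x. f x ~= 0} = {}")
 case True
 hence "f x = 0" for x by auto
 hence "tau m r y f x = 0" for x
  using tau_support(1)[OF test_smooth[OF f(1)], of x "x - \<bar>y $ 2\<bar> - 1" m r y x]
   kg_data_zero_right[OF test_smooth[OF f(1)]] unfolding tau_def by (metis lt_ex min_less_iff_conj)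
 thus ?thesis by simp
next
 case False
 have cpt: "compact (closure {x. f x ~= 0})" using f(1) by (simp add: test_functions_def)
 have ne: "closure {x. f x ~= 0} ~= {}" using False by simp
 obtain a' where a': "a' \<in> closure {x. f x ~= 0}" "!!x. x \<in> closure {x. f x ~= 0} ==> a' <= x"
  using compact_attains_inf[OF cpt ne] by blast
 obtain b' where b': "b' \<in> closure {x. f x ~= 0}" "!!x. x \<in> closure {x. f x ~= 0} ==> x <= b'"
  using compact_attains_sup[OF cpt ne] by blast
 have z: "f x = 0" if "x < a' \<or> x > b'" for x
  using a'(2)[of x] b'(2)[of x] that closure_subset[of "{x. f x ~= 0}"] by force
 have ab': "a < a'" "b' < b" using a'(1) b'(1) f(2) by auto
 define c' where "c' = min (exp r * a' + (y $ 2 + y $ 1)) (exp (- r) * a' + (y $ 2 - y $ 1))"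
 define d' where "d' = max (exp r * b' + (y $ 2 + y $ 1)) (exp (- r) * b' + (y $ 2 - y $ 1))"
 have "{x. tau m r y f x ~= 0} \<subseteq> {c'..d'}"
  using tau_support[OF test_smooth[OF f(1)] z] by (auto simp: c'_def d'_def min_le_iff_disj le_max_iff_disj)
 hence "closure {x. tau m r y f x ~= 0} \<subseteq> {c'..d'}" by (rule closure_minimal) simp
 moreover have "c < c'" "d' < d"
 proof -
  have "exp t * a < exp t * a'" "exp t * b' < exp t * b" for t using ab' by simp_all
  note * = this[of r] this[of "- r"] move_base_cone_subset[OF ab sub]
  show "c < c'" "d' < d" using * unfolding c'_def d'_def min_less_iff_conj max_less_iff_conj by linarith+
 qed
 ultimately show ?thesis by auto
qed

section \<open>The vacuum representation\<close>

lemma symp_self: "symp f f = 0"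
proof -
 have "cnj (f x) * f x = of_real ((cmod (f x))^2)" for x
  by (simp only: complex_norm_square mult.commute[of "cnj (f x)"])
 hence "(LINT x|lborel. cnj (f x) * f x) = of_real (LINT x|lborel. (cmod (f x))^2)"
  by (simp flip: integral_complex_of_real)
 thus ?thesis by (simp add: symp_def)
qed

lemma symp_minus_left: "symp (\<lambda>x. - f x) g = - symp f g"
 by (simp add: symp_def)

lemma test_zero: "(\<lambda>x. 0) \<in> \<D>"
 unfolding test_functions_iff by (simp add: smooth_const)

text \<open>A norm-preserving linear correspondence between dense families of vectors extends to an
 isometry.\<close>

lemma isometry_extension:
 fixes f g :: "'i => 'h::complex_hilbert"
 assumes add: "!!i j. i \<in> I ==> j \<in> I ==> \<exists>k\<in>I. f k = f i + f j \<and> g k = g i + g j"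
  and sc: "!!c i. i \<in> I ==> \<exists>k\<in>I. f k = c *\<^sub>C f i \<and> g k = c *\<^sub>C g i"
  and nrm: "!!i. i \<in> I ==> norm (g i) = norm (f i)"
  and dense: "closure (f ` I) = UNIV"
 shows "\<exists>U\<in>\<B>. (\<forall>i\<in>I. U (f i) = g i) \<and> (\<forall>x. norm (U x) = norm x)"
proof -
 define R where "R x y \<longleftrightarrow> (\<exists>s. (\<forall>n::nat. s n \<in> I) \<and> (\<lambda>n. f (s n)) ---> x \<and> (\<lambda>n. g (s n)) ---> y)" for x y
 have diff: "norm (g i - g j) = norm (f i - f j)" if ij: "i \<in> I" "j \<in> I" for i j
 proof -
  obtain j' where j': "j' \<in> I" "f j' = (-1) *\<^sub>C f j" "g j' = (-1) *\<^sub>C g j" using sc[OF ij(2), of "-1"] by blast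
  obtain k where "k \<in> I" "f k = f i + f j'" "g k = g i + g j'" using add[OF ij(1) j'(1)] by blast
  thus ?thesis using nrm[of k] j' by simp
 qed
 have ex: "\<exists>y. R x y" for x
 proof -
  have "x \<in> closure (f ` I)" using dense by simp
  then obtain z where z: "!!n. z n \<in> f ` I" "z ---> x" unfolding closure_sequential by blast
  hence "\<forall>n. \<exists>i. i \<in> I \<and> z n = f i" by blast
  then obtain s where s: "!!n. s n \<in> I" "!!n. z n = f (s n)" by metis
  have "Cauchy z" using z(2) by (rule LIMSEQ_imp_Cauchy)
  hence "Cauchy (\<lambda>n. g (s n))"
   unfolding Cauchy_def dist_norm using diff[OF s(1) s(1)] s(2) by simp
  then obtain y where "(\<lambda>n. g (s n)) ---> y" using Cauchy_convergent_iff convergent_def by metis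
  moreover have "(\<lambda>n. f (s n)) ---> x" using z(2) by (simp flip: s(2))
  ultimately show ?thesis unfolding R_def using s(1) by blast
 qed
 have nR: "norm y = norm x" if "R x y" for x y
 proof -
  obtain s where s: "!!n. s n \<in> I" "(\<lambda>n. f (s n)) ---> x" "(\<lambda>n. g (s n)) ---> y"
   using \<open>R x y\<close> unfolding R_def by blast
  have "(\<lambda>n. norm (f (s n))) ---> norm y" using tendsto_norm[OF s(3)] nrm[OF s(1)] by simp
  thus ?thesis using tendsto_norm[OF s(2)] LIMSEQ_unique by blast
 qed
 have addR: "R (x + x') (y + y')" if "R x y" "R x' y'" for x y x' y'
 proof -
  obtain s where s: "!!n. s n \<in> I" "(\<lambda>n. f (s n)) ---> x" "(\<lambda>n. g (s n)) ---> y"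
   using \<open>R x y\<close> unfolding R_def by blast
  obtain t where t: "!!n. t n \<in> I" "(\<lambda>n. f (t n)) ---> x'" "(\<lambda>n. g (t n)) ---> y'"
   using \<open>R x' y'\<close> unfolding R_def by blast
  have "\<forall>n. \<exists>k. k \<in> I \<and> f k = f (s n) + f (t n) \<and> g k = g (s n) + g (t n)" using add[OF s(1) t(1)] by blast
  then obtain r where "!!n. r n \<in> I \<and> f (r n) = f (s n) + f (t n) \<and> g (r n) = g (s n) + g (t n)" by metis
  thus ?thesis unfolding R_def
   using tendsto_add[OF s(2) t(2)] tendsto_add[OF s(3) t(3)] by (intro exI[of _ r]) simp
 qed
 have scR: "R (c *\<^sub>C x) (c *\<^sub>C y)" if "R x y" for c x y
 proof -
  obtain s where s: "!!n. s n \<in> I" "(\<lambda>n. f (s n)) ---> x" "(\<lambda>n. g (s n)) ---> y"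
   using \<open>R x y\<close> unfolding R_def by blast
  have "\<forall>n. \<exists>k. k \<in> I \<and> f k = c *\<^sub>C f (s n) \<and> g k = c *\<^sub>C g (s n)" using sc[OF s(1)] by blast
  then obtain r where "!!n. r n \<in> I \<and> f (r n) = c *\<^sub>C f (s n) \<and> g (r n) = c *\<^sub>C g (s n)" by metis
  thus ?thesis unfolding R_def
   using tendsto_scaleC[OF tendsto_const s(2), of c] tendsto_scaleC[OF tendsto_const s(3), of c]
   by (intro exI[of _ r]) simp
 qed
 have uniq: "y = y'" if "R x y" "R x y'" for x y y'
 proof -
  have "R (x + (-1) *\<^sub>C x) (y + (-1) *\<^sub>C y')" by (intro addR scR \<open>R x y\<close> \<open>R x y'\<close>)
  from nR[OF this] show ?thesis by simp
 qed
 define V where "V x = (THE y. R x y)" for x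
 have V: "R x y \<longleftrightarrow> V x = y" for x y
  unfolding V_def using ex[of x] uniq[of x] by (metis the_equality)
 have VR: "R x (V x)" for x using V by simp
 have Vadd: "V (x + x') = V x + V x'" for x x' using addR[OF VR VR] V by simp
 have Vsc: "V (c *\<^sub>C x) = c *\<^sub>C V x" for c x using scR[OF VR] V by simp
 have Vn: "norm (V x) = norm x" for x by (rule nR[OF VR])
 have bl: "bounded_linear V"
  using Vsc[of "of_real r" for r] Vn
  by (intro bounded_linear_intro[where K = 1]) (simp_all add: Vadd scaleR_scaleC)
 have "V (f i) = g i" if "i \<in> I" for i
 proof -
  have "R (f i) (g i)" unfolding R_def using \<open>i \<in> I\<close> by (intro exI[of _ "\<lambda>_. i"]) simp
  thus ?thesis using V by simp
 qed
 thus ?thesis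
  using bl Vsc Vn by (intro bexI[of _ "Blinfun V"]) (auto simp: bounded_linear_Blinfun_apply intro!: bounded_opsI)
qed

lemma compose_assoc: "(A oo B) oo C = A oo (B oo C)"
 by (rule blinfun_eqI) simp

lemma compose_id [simp]: "id_blinfun oo A = A" "A oo id_blinfun = A"
 by (rule blinfun_eqI, simp)+

lemma op_scale_one [simp]: "op_scale 1 A = A"
 by (rule blinfun_eqI) simp

text \<open>A massive free field in its vacuum representation. \<open>w f\<close> is the represented Weyl operator of \<open>f\<close>,
 \<open>vc A\<close> the vector \<open>A \<Omega>\<close>, \<open>\<A> Q\<close> the local algebra of \<open>Q\<close>, \<open>\<Q>\<close> the quasi-local algebra, and \<open>al r y\<close>
 its automorphism for rapidity \<open>r\<close> and translation \<open>y\<close>.\<close>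

locale vacuum_field =
 fixes m :: real and X :: "('w, 'h::complex_hilbert) free_field"
 assumes mass: "m > 0" and field: "massive_free_field m X"
begin

abbreviation "vc A \<equiv> ap (A :: 'h op) (vac X)"

abbreviation loc ("\<A>") where "\<A> \<equiv> local_algebra X"
abbreviation quasi ("\<Q>") where "\<Q> \<equiv> quasilocal X"
abbreviation al where "al r y \<equiv> aut X (boost r, y)"

abbreviation w :: "(real => complex) => 'h op" where "w f \<equiv> vac_rep X (weyl X f)"

lemma weyl_alg: "weyl_algebra (weyl_alg X) (weyl X)"
 using field by (simp add: massive_free_field_def)

lemma cstar_weyl: "cstar_algebra (weyl_alg X)"
 using weyl_alg by (simp add: weyl_algebra_def)

lemma weyl_unitary: "f \<in> \<D> ==> unitary_in (weyl_alg X) (weyl X f)"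
 using weyl_alg by (simp add: weyl_algebra_def)

lemma weyl_carr: "f \<in> \<D> ==> weyl X f \<in> carr (weyl_alg X)"
 using weyl_unitary by (simp add: unitary_in_def)

lemma gns: "gns_triple (weyl_alg X) (vac_state X) (vac_rep X) (vac X)"
 using field by (simp add: massive_free_field_def)

lemma rep: "cstar_morphism (weyl_alg X) (operator_algebra \<B>) (vac_rep X)"
 using gns by (simp add: gns_triple_def)

lemma rep_simps:
 shows "x \<in> carr (weyl_alg X) ==> y \<in> carr (weyl_alg X) ==> vac_rep X (aadd (weyl_alg X) x y) = vac_rep X x + vac_rep X y"
  "x \<in> carr (weyl_alg X) ==> y \<in> carr (weyl_alg X) ==> vac_rep X (amult (weyl_alg X) x y) = vac_rep X x oo vac_rep X y"
  "x \<in> carr (weyl_alg X) ==> vac_rep X (ascale (weyl_alg X) c x) = op_scale c (vac_rep X x)"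
  "x \<in> carr (weyl_alg X) ==> vac_rep X (astar (weyl_alg X) x) = adj (vac_rep X x)"
 using rep by (auto simp: cstar_morphism_def)

lemma rep_one: "vac_rep X (aone (weyl_alg X)) = id_blinfun"
 using rep by (auto simp: cstar_morphism_def)

lemma rep_bounded_ops: "x \<in> carr (weyl_alg X) ==> vac_rep X x \<in> \<B>"
 using rep by (auto simp: cstar_morphism_def)

lemma w_bounded_ops [simp]: "f \<in> \<D> ==> w f \<in> \<B>"
 by (simp add: rep_bounded_ops weyl_carr)

lemma w_mult:
 assumes "f \<in> \<D>" "g \<in> \<D>"
 shows "w f oo w g = op_scale (cis (- symp f g / 2)) (w (\<lambda>x. f x + g x))"
proof -
 have "amult (weyl_alg X) (weyl X f) (weyl X g) = ascale (weyl_alg X) (cis (- symp f g / 2)) (weyl X (\<lambda>x. f x + g x))"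
  using weyl_alg assms by (simp add: weyl_algebra_def)
 thus ?thesis using assms weyl_carr by (simp add: test_add flip: rep_simps)
qed

lemma w_unitary:
 assumes "f \<in> \<D>"
 shows "adj (w f) oo w f = id_blinfun" "w f oo adj (w f) = id_blinfun"
proof -
 have u: "amult (weyl_alg X) (astar (weyl_alg X) (weyl X f)) (weyl X f) = aone (weyl_alg X)"
  "amult (weyl_alg X) (weyl X f) (astar (weyl_alg X) (weyl X f)) = aone (weyl_alg X)"
  using weyl_unitary[OF assms] by (auto simp: unitary_in_def)
 have c: "weyl X f \<in> carr (weyl_alg X)" "astar (weyl_alg X) (weyl X f) \<in> carr (weyl_alg X)"
  using weyl_carr[OF assms] cstar_closed(6)[OF cstar_weyl] by auto
 show "adj (w f) oo w f = id_blinfun" "w f oo adj (w f) = id_blinfun"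
  using arg_cong[OF u(1), of "vac_rep X"] arg_cong[OF u(2), of "vac_rep X"]
  by (simp_all add: rep_simps c rep_one)
qed

lemma w_zero: "w (\<lambda>x. 0) = id_blinfun"
proof -
 have "w (\<lambda>x. 0) oo w (\<lambda>x. 0) = w (\<lambda>x. 0)" using w_mult[OF test_zero test_zero] by (simp add: symp_self)
 hence "adj (w (\<lambda>x. 0)) oo (w (\<lambda>x. 0) oo w (\<lambda>x. 0)) = id_blinfun" using w_unitary[OF test_zero] by simp
 thus ?thesis using w_unitary[OF test_zero] by (simp flip: compose_assoc)
qed

lemma w_minus_compose: "f \<in> \<D> ==> w (\<lambda>x. - f x) oo w f = id_blinfun"
 using w_mult[of "\<lambda>x. - f x" f] by (simp add: test_minus symp_minus_left symp_self w_zero)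

lemma adj_w: assumes f: "f \<in> \<D>" shows "adj (w f) = w (\<lambda>x. - f x)"
proof -
 have "adj (w f) = w (\<lambda>x. - f x) oo w f oo adj (w f)" by (simp add: w_minus_compose f)
 thus ?thesis by (simp add: compose_assoc w_unitary f)
qed

lemma norm_w_apply: assumes f: "f \<in> \<D>" shows "norm (w f x) = norm x"
proof -
 have "cinner (w f x) (w f x) = cinner x ((adj (w f) oo w f) x)"
  using f by (simp add: cinner_adj_right)
 thus ?thesis using f by (simp add: w_unitary norm_eq_sqrt_cinner)
qed

lemma vac_w: "f \<in> \<D> ==> cinner (vac X) (w f (vac X)) = of_real (exp (- mass_norm_sq m f / 2))"
proof -
 assume f: "f \<in> \<D>"
 have "vac_state X (weyl X f) = of_real (exp (- mass_norm_sq m f / 2))"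
  using field f by (simp add: massive_free_field_def)
 moreover have "vac_state X (weyl X f) = cinner (vac X) (w f (vac X))"
  using gns weyl_carr[OF f] by (simp add: gns_triple_def)
 ultimately show ?thesis by simp
qed

lemma norm_vac: "norm (vac X) = 1"
proof -
 have "vac_state X (aone (weyl_alg X)) = 1" using gns by (simp add: gns_triple_def state_on_def)
 moreover have "vac_state X (aone (weyl_alg X)) = cinner (vac X) (vac X)"
  using gns cstar_closed(2)[OF cstar_weyl] by (simp add: gns_triple_def rep_one)
 ultimately show ?thesis by (simp add: norm_eq_sqrt_cinner)
qed

text \<open>The linear span of the Weyl operators, and its norm closure, the represented Weyl algebra.\<close>

inductive_set weyl_span :: "'h op set" where
 gen: "f \<in> \<D> ==> w f \<in> weyl_span"
| add: "A \<in> weyl_span ==> B \<in> weyl_span ==> A + B \<in> weyl_span"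
| scale: "A \<in> weyl_span ==> op_scale c A \<in> weyl_span"

definition weyl_ops :: "'h op set" where "weyl_ops = closure weyl_span"

lemma op_scale_simps:
 "op_scale c (op_scale d A) = op_scale (c * d) A" "op_scale c (A + B) = op_scale c A + op_scale c B"
 "op_scale c A oo B = op_scale c (A oo B)" "A \<in> \<B> ==> A oo op_scale c B = op_scale c (A oo B)"
 "op_scale (-1) A = - A" "op_scale 0 A = 0"
 by (auto intro!: blinfun_eqI simp: scaleC_scaleC scaleC_add_right blinfun.add_left bounded_opsD blinfun.minus_left)

lemma compose_add: "(A + B) oo C = (A oo C) + (B oo C)" "C oo (A + B) = (C oo A) + (C oo B)"
 "(A - B) oo C = (A oo C) - (B oo C)" "C oo (A - B) = (C oo A) - (C oo B)"
 for A B C :: "'h op"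
 by (auto intro!: blinfun_eqI simp: blinfun.bilinear_simps)

lemma weyl_span_bounded_ops: "A \<in> weyl_span ==> A \<in> \<B>"
 by (induction rule: weyl_span.induct) auto

lemma weyl_span_compose_w: "A \<in> weyl_span ==> f \<in> \<D> ==> A oo w f \<in> weyl_span"
 by (induction rule: weyl_span.induct)
  (simp_all add: w_mult compose_add op_scale_simps weyl_span.intros test_add)

lemma weyl_span_compose: "B \<in> weyl_span ==> A \<in> weyl_span ==> A oo B \<in> weyl_span"
 by (induction rule: weyl_span.induct)
  (simp_all add: weyl_span_compose_w compose_add op_scale_simps weyl_span.intros weyl_span_bounded_ops)

lemma weyl_span_adj: "A \<in> weyl_span ==> adj A \<in> weyl_span"
 by (induction rule: weyl_span.induct)
  (simp_all add: adj_w adj_add adj_scale weyl_span.intros weyl_span_bounded_ops test_minus)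

lemma weyl_opsE: "A \<in> weyl_ops ==> \<exists>s. (\<forall>n::nat. s n \<in> weyl_span) \<and> s ---> A"
 unfolding weyl_ops_def closure_sequential .

lemma weyl_opsI: "(!!n::nat. s n \<in> weyl_span) ==> s ---> A ==> A \<in> weyl_ops"
 unfolding weyl_ops_def closure_sequential by blast

lemma weyl_ops_bounded_ops: "weyl_ops \<subseteq> \<B>"
 unfolding weyl_ops_def by (rule closure_minimal) (auto intro: weyl_span_bounded_ops closed_bounded_ops)

lemma weyl_span_weyl_ops: "weyl_span \<subseteq> weyl_ops"
 unfolding weyl_ops_def by (rule closure_subset)

lemma w_weyl_ops: "f \<in> \<D> ==> w f \<in> weyl_ops"
 using weyl_span.gen weyl_span_weyl_ops by blast

lemma tendsto_compose: "(F \<longlongrightarrow> A) G ==> (H \<longlongrightarrow> B) G ==> ((\<lambda>i. F i oo H i) \<longlongrightarrow> A oo B) G"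
 for A B :: "'h op"
 by (rule bounded_bilinear.tendsto[OF bounded_bilinear_blinfun_compose])

lemma tendsto_op_scale: "(F \<longlongrightarrow> A) G ==> A \<in> \<B> ==> (!!i. F i \<in> \<B>) ==> ((\<lambda>i. op_scale c (F i)) \<longlongrightarrow> op_scale c A) G"
 for A :: "'h op"
proof -
 assume F: "(F \<longlongrightarrow> A) G" and b: "A \<in> \<B>" "!!i. F i \<in> \<B>"
 have "op_scale c id_blinfun oo B = op_scale c B" for B :: "'h op" by (rule blinfun_eqI) simp
 thus ?thesis using tendsto_compose[OF tendsto_const F, of "op_scale c id_blinfun"] by simp
qed

lemma weyl_ops_closed:
 shows "A \<in> weyl_ops ==> B \<in> weyl_ops ==> A + B \<in> weyl_ops"
  and "A \<in> weyl_ops ==> B \<in> weyl_ops ==> A oo B \<in> weyl_ops"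
  and "A \<in> weyl_ops ==> op_scale c A \<in> weyl_ops"
  and "A \<in> weyl_ops ==> adj A \<in> weyl_ops"
  and "id_blinfun \<in> weyl_ops" "0 \<in> weyl_ops"
proof -
 have *: "F A B \<in> weyl_ops" if A: "A \<in> weyl_ops" and B: "B \<in> weyl_ops"
  and F: "!!A B. A \<in> weyl_span ==> B \<in> weyl_span ==> F A B \<in> weyl_span"
   "!!s t. (!!n. s n \<in> \<B>) ==> (!!n. t n \<in> \<B>) ==> s ---> A ==> t ---> B ==> (\<lambda>n. F (s n) (t n)) ---> F A B" for F A B
 proof -
  obtain s where s: "!!n::nat. s n \<in> weyl_span" "s ---> A" using weyl_opsE[OF A] by blast
  obtain t where t: "!!n::nat. t n \<in> weyl_span" "t ---> B" using weyl_opsE[OF B] by blast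
  show ?thesis using s t by (intro weyl_opsI[of "\<lambda>n. F (s n) (t n)"] F) (auto intro: weyl_span_bounded_ops)
 qed
 note b = subsetD[OF weyl_ops_bounded_ops]
 show "A \<in> weyl_ops ==> B \<in> weyl_ops ==> A + B \<in> weyl_ops" by (rule *[of A B]) (auto intro: weyl_span.intros tendsto_add)
 show "A \<in> weyl_ops ==> B \<in> weyl_ops ==> A oo B \<in> weyl_ops" by (rule *[of A B]) (auto intro: weyl_span_compose tendsto_compose)
 show "A \<in> weyl_ops ==> op_scale c A \<in> weyl_ops"
  by (rule *[of A A "\<lambda>A _. op_scale c A"]) (auto intro: weyl_span.intros tendsto_op_scale b)
 show "A \<in> weyl_ops ==> adj A \<in> weyl_ops" by (rule *[of A A "\<lambda>A _. adj A"]) (auto intro: weyl_span_adj tendsto_adj b)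
 show "id_blinfun \<in> weyl_ops" using w_weyl_ops[OF test_zero] by (simp add: w_zero)
 have "op_scale 0 (w (\<lambda>x. 0)) \<in> weyl_span" by (intro weyl_span.intros test_zero)
 thus "0 \<in> weyl_ops" using weyl_span_weyl_ops by (auto simp: op_scale_simps)
qed

lemma rep_weyl_ops: "x \<in> carr (weyl_alg X) ==> vac_rep X x \<in> weyl_ops"
proof -
 let ?A = "weyl_alg X"
 define M where "M = {x \<in> carr ?A. vac_rep X x \<in> weyl_ops}"
 have "cstar_subalgebra M ?A"
 proof (rule cstar_subalgebraI[OF cstar_weyl])
  show "M \<subseteq> carr ?A" by (auto simp: M_def)
  show "aone ?A \<in> M" using cstar_closed(2)[OF cstar_weyl] by (simp add: M_def rep_one weyl_ops_closed)
  have "vac_rep X (azero ?A) = vac_rep X (ascale ?A 0 (azero ?A))"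
  proof -
   have 1: "adiff ?A (azero ?A) (azero ?A) = azero ?A" by (rule cstar_diff_self[OF cstar_weyl cstar_closed(1)[OF cstar_weyl]])
   have 2: "adiff ?A (azero ?A) (azero ?A) = ascale ?A 0 (azero ?A)"
    using cstar_scale_add_left[OF cstar_weyl cstar_closed(1)[OF cstar_weyl], of 1 "-1"]
    by (simp add: adiff_def cstar_scale_one[OF cstar_weyl cstar_closed(1)[OF cstar_weyl]])
   show ?thesis by (rule arg_cong[OF trans[OF 1[symmetric] 2]])
  qed
  thus "azero ?A \<in> M" using cstar_closed(1)[OF cstar_weyl]
   by (simp add: M_def rep_simps op_scale_simps weyl_ops_closed)
 next
  fix x y assume "x \<in> M" "y \<in> M"
  thus "aadd ?A x y \<in> M" "amult ?A x y \<in> M"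
   using cstar_closed(3,4)[OF cstar_weyl, of x y] by (auto simp: M_def rep_simps weyl_ops_closed)
 next
  fix c x assume "x \<in> M"
  thus "ascale ?A c x \<in> M"
   using cstar_closed(5)[OF cstar_weyl, of x] by (auto simp: M_def rep_simps weyl_ops_closed)
 next
  fix x assume "x \<in> M"
  thus "astar ?A x \<in> M"
   using cstar_closed(6)[OF cstar_weyl, of x] by (auto simp: M_def rep_simps weyl_ops_closed)
 next
  fix s x assume s: "!!n::nat. s n \<in> M" and x: "x \<in> carr ?A" and lim: "(\<lambda>n. anorm ?A (adiff ?A (s n) x)) ---> 0"
  have sc: "s n \<in> carr ?A" "vac_rep X (s n) \<in> weyl_ops" for n using s by (auto simp: M_def)
  have "norm (vac_rep X (s n) - vac_rep X x) <= anorm ?A (adiff ?A (s n) x)" for n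
  proof -
   have "vac_rep X (adiff ?A (s n) x) = vac_rep X (s n) - vac_rep X x"
    using cstar_closed(5)[OF cstar_weyl x, of "-1"] by (simp add: adiff_def rep_simps sc x op_scale_simps)
   thus ?thesis
    using cstar_morphism_norm_le[OF rep order_refl cstar_closed(7)[OF cstar_weyl sc(1) x], of n] by simp
  qed
  hence "(\<lambda>n. vac_rep X (s n) - vac_rep X x) ---> 0"
   by (intro Lim_null_comparison[OF _ lim] always_eventually) auto
  hence "(\<lambda>n. vac_rep X (s n)) ---> vac_rep X x" by (simp add: LIM_zero_iff)
  hence "vac_rep X x \<in> closure weyl_ops"
   unfolding closure_sequential using sc(2) by (intro exI[of _ "\<lambda>n. vac_rep X (s n)"]) simp
  thus "x \<in> M" using x by (simp add: M_def weyl_ops_def)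
 qed
 moreover have "weyl X ` \<D> \<subseteq> M" using w_weyl_ops weyl_carr by (auto simp: M_def)
 ultimately have "M = carr ?A" using weyl_alg by (simp add: weyl_algebra_def)
 moreover assume "x \<in> carr ?A"
 ultimately show ?thesis by (auto simp: M_def)
qed

lemma vac_cyclic: "closure (vc ` weyl_ops) = UNIV"
proof -
 have dense: "closure ((\<lambda>x. vac_rep X x (vac X)) ` carr (weyl_alg X)) = UNIV"
  using gns by (simp add: gns_triple_def)
 have "(\<lambda>x. vac_rep X x (vac X)) ` carr (weyl_alg X) \<subseteq> vc ` weyl_ops"
  using rep_weyl_ops by auto
 from closure_mono[OF this] show ?thesis using dense by auto
qed

end

context vacuum_field begin

lemma weyl_ops_induct [consumes 1, case_names gen add scale lim]:
 assumes A: "A \<in> weyl_ops"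
  and gen: "!!f. f \<in> \<D> ==> P (w f)"
  and add: "!!A B. A \<in> weyl_span ==> B \<in> weyl_span ==> P A ==> P B ==> P (A + B)"
  and scale: "!!c A. A \<in> weyl_span ==> P A ==> P (op_scale c A)"
  and lim: "!!s A. (!!n::nat. s n \<in> weyl_span) ==> (!!n. P (s n)) ==> A \<in> weyl_ops ==> s ---> A ==> P A"
 shows "P A"
proof -
 obtain s where s: "!!n::nat. s n \<in> weyl_span" "s ---> A" using weyl_opsE[OF A] by blast
 have "P B" if "B \<in> weyl_span" for B
  using that by (induction rule: weyl_span.induct) (auto intro: gen add scale)
 thus ?thesis by (rule lim[OF s(1) _ A s(2)]) (rule s(1))
qed

subsection \<open>The net\<close>

text \<open>The test functions whose Weyl operators generate \<open>\<A> Q\<close>.\<close>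

definition local_gens :: "(real^2) set => (real => complex) set"
 where "local_gens Q = {tau m r y f | r y a b f. a < b \<and> Q = move_region (boost r, y) (base_cone a b) \<and>
  f \<in> \<D> \<and> closure {x. f x ~= 0} \<subseteq> {a<..<b}}"

lemma boost_poincare: "(boost r, y) \<in> poincare_group"
 using poincare_group_iff by blast

lemma field_aut:
 assumes "g \<in> poincare_group"
 shows "f \<in> \<D> ==> weyl_aut X g (weyl X f) = weyl X (poincare_tau m g f)"
  and "locally_normal_automorphism X (aut X g)"
  and "x \<in> carr (weyl_alg X) ==> aut X g (vac_rep X x) = vac_rep X (weyl_aut X g x)"
 using field assms by (simp_all add: massive_free_field_def)

lemma weyl_aut_w: "f \<in> \<D> ==> vac_rep X (weyl_aut X (boost r, y) (weyl X f)) = w (tau m r y f)"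
 by (simp add: field_aut(1)[OF boost_poincare] poincare_tau_eq[OF mass])

lemma local_algebra_eq: "\<A> Q = commutant (commutant (w ` local_gens Q))"
proof -
 have "{vac_rep X (weyl_aut X g (weyl X f)) | g a b f.
   g \<in> poincare_group \<and> a < b \<and> Q = move_region g (base_cone a b) \<and>
   f \<in> \<D> \<and> closure {x. f x ~= 0} \<subseteq> {a<..<b}} = w ` local_gens Q" (is "?L = ?R")
 proof
  show "?L \<subseteq> ?R" by (clarsimp simp: poincare_group_iff weyl_aut_w) (unfold local_gens_def, blast)
  show "?R \<subseteq> ?L" by (clarsimp simp: local_gens_def) (metis weyl_aut_w boost_poincare)
 qed
 thus ?thesis by (simp add: local_algebra_def)
qed

lemma local_gens_test: "f \<in> local_gens Q ==> f \<in> \<D>"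
 by (auto simp: local_gens_def tau_test)

lemma w_gens_bounded_ops: "w ` local_gens Q \<subseteq> \<B>"
 using local_gens_test by auto

lemma local_gens_minus: assumes "f \<in> local_gens Q" shows "(\<lambda>x. - f x) \<in> local_gens Q"
proof -
 obtain r y a b h where *: "f = tau m r y h" "a < b"
  "Q = move_region (boost r, y) (base_cone a b)" "h \<in> \<D>" "closure {x. h x ~= 0} \<subseteq> {a<..<b}"
  using assms unfolding local_gens_def by blast
 have "(\<lambda>x. - f x) = tau m r y (\<lambda>x. - h x)" using *(1,4) by (simp add: tau_minus mass)
 moreover have "(\<lambda>x. - h x) \<in> \<D>" "closure {x. - h x ~= 0} \<subseteq> {a<..<b}" using *(4,5) by (simp_all add: test_minus)
 ultimately show ?thesis using *(2,3) unfolding local_gens_def by blast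
qed

lemma w_gens_adj: "A \<in> w ` local_gens Q ==> adj A \<in> w ` local_gens Q"
 using local_gens_minus local_gens_test adj_w by auto

lemma commutant_gens_adj: "A \<in> commutant (w ` local_gens Q) ==> adj A \<in> commutant (w ` local_gens Q)"
 by (rule commutant_adj_closed[OF w_gens_bounded_ops w_gens_adj])

lemma commutant_subset_bounded: "commutant M \<subseteq> \<B>"
 using commutant_bounded_ops by blast

lemma local_algebra_bounded_ops: "\<A> Q \<subseteq> \<B>"
 unfolding local_algebra_def by (rule commutant_subset_bounded)

lemma local_algebra_closed:
 shows "0 \<in> \<A> Q" "id_blinfun \<in> \<A> Q"
  "A \<in> \<A> Q ==> B \<in> \<A> Q ==> A + B \<in> \<A> Q"
  "A \<in> \<A> Q ==> B \<in> \<A> Q ==> A - B \<in> \<A> Q"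
  "A \<in> \<A> Q ==> B \<in> \<A> Q ==> A oo B \<in> \<A> Q"
  "A \<in> \<A> Q ==> op_scale c A \<in> \<A> Q"
  "A \<in> \<A> Q ==> adj A \<in> \<A> Q"
  "closed (\<A> Q)"
proof -
 show "A \<in> \<A> Q ==> adj A \<in> \<A> Q"
  unfolding local_algebra_eq by (rule commutant_adj_closed[OF commutant_subset_bounded commutant_gens_adj])
 show "A \<in> \<A> Q ==> op_scale c A \<in> \<A> Q"
  unfolding local_algebra_eq by (rule commutant_closed(6)[OF commutant_subset_bounded])
qed (auto simp: local_algebra_eq commutant_closed closed_commutant)

lemma w_local_gens: "f \<in> local_gens Q ==> w f \<in> \<A> Q"
 unfolding local_algebra_eq using bicommutant_incl[OF w_gens_bounded_ops] by blast

lemma local_gens_base_cone: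
 assumes "f \<in> \<D>" "a < b" "closure {x. f x ~= 0} \<subseteq> {a<..<b}"
 shows "f \<in> local_gens (base_cone a b)"
proof -
 have "base_cone a b = move_region (boost 0, 0) (base_cone a b)" by (simp add: move_region_def boost_zero)
 moreover have "f = tau m 0 0 f" using assms by (simp add: tau_zero mass)
 ultimately show ?thesis unfolding local_gens_def using assms by blast
qed

text \<open>Isotony. A generator of the smaller region is moved to the rest frame of the larger one, where its
 support can be read off by finite propagation speed.\<close>

lemma local_gens_mono:
 assumes Q: "Q \<subseteq> R" and R: "R \<in> \<K>" shows "local_gens Q \<subseteq> local_gens R"
proof
 fix f assume "f \<in> local_gens Q"
 then obtain r y a b h where *: "f = tau m r y h" "a < b"
  "Q = move_region (boost r, y) (base_cone a b)" "h \<in> \<D>" "closure {x. h x ~= 0} \<subseteq> {a<..<b}"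
  unfolding local_gens_def by blast
 obtain t z c d where R: "c < d" "R = move_region (boost t, z) (base_cone c d)" using R double_cones_iff by auto
 define y' where "y' = boost (- t) *v (y - z)"
 have y': "boost t *v y' + z = y" by (simp add: y'_def matrix_vector_mul_assoc boost_mult boost_zero)
 have f: "f = tau m t z (tau m (r - t) y' h)"
  using *(4) by (simp add: tau_comp mass y' *(1))
 have "move_region (boost (r - t), y') (base_cone a b) \<subseteq> base_cone c d"
 proof
  fix x assume "x \<in> move_region (boost (r - t), y') (base_cone a b)"
  hence "boost t *v x + z \<in> move_region (boost t, z) (move_region (boost (r - t), y') (base_cone a b))"
   by (auto simp: move_region_def)
  also have "... = Q" by (simp add: *(3) poincare_mult_boost y' flip: move_region_comp)
  finally have "boost t *v x + z \<in> move_region (boost t, z) (base_cone c d)" using Q R(2) by auto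
  then obtain x' where x': "x' \<in> base_cone c d" "boost t *v x + z = boost t *v x' + z" by (auto simp: move_region_def)
  hence "boost (- t) *v (boost t *v x) = boost (- t) *v (boost t *v x')" by simp
  thus "x \<in> base_cone c d" using x'(1) by (simp add: matrix_vector_mul_assoc boost_mult boost_zero)
 qed
 hence "closure {x. tau m (r - t) y' h x ~= 0} \<subseteq> {c<..<d}" by (rule tau_support_subset[OF *(4,5,2)])
 moreover have "tau m (r - t) y' h \<in> \<D>" by (rule tau_test[OF *(4)])
 ultimately show "f \<in> local_gens R" unfolding local_gens_def using R f by blast
qed

lemma local_algebra_mono: "Q \<subseteq> R ==> R \<in> \<K> ==> \<A> Q \<subseteq> \<A> R"
 unfolding local_algebra_eq by (intro commutant_mono image_mono local_gens_mono)

text \<open>Locality at time zero: a Weyl operator whose test function vanishes on \<open>(c, d)\<close> commutes with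
 the algebras of all regions inside the double cone over \<open>(c, d)\<close>.\<close>

lemma local_gens_support:
 assumes "f \<in> local_gens Q" "Q \<subseteq> base_cone c d"
 shows "closure {x. f x ~= 0} \<subseteq> {c<..<d}"
proof -
 obtain r y a b h where *: "f = tau m r y h" "a < b"
  "Q = move_region (boost r, y) (base_cone a b)" "h \<in> \<D>" "closure {x. h x ~= 0} \<subseteq> {a<..<b}"
  using assms(1) unfolding local_gens_def by blast
 show ?thesis unfolding *(1) by (rule tau_support_subset[OF *(4,5,2)]) (use *(3) assms(2) in simp)
qed

lemma w_commute_local_algebra:
 assumes h: "h \<in> \<D>" "!!x. c < x ==> x < d ==> h x = 0"
  and Q: "Q \<subseteq> base_cone c d" and A: "A \<in> \<A> Q"
 shows "A oo w h = w h oo A"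
proof -
 have "w h oo w f = w f oo w h" if f: "f \<in> local_gens Q" for f
 proof -
  have "closure {x. f x ~= 0} \<subseteq> {c<..<d}" by (rule local_gens_support[OF f Q])
  hence "{x. f x ~= 0} \<subseteq> {c<..<d}" using closure_subset by (rule order_trans[rotated])
  hence z: "h x = 0 \<or> f x = 0" for x using h(2)[of x] by auto
  hence "symp h f = 0" "symp f h = 0" by (auto intro!: symp_zero_disjoint simp: disj_commute)
  moreover have "f \<in> \<D>" by (rule local_gens_test[OF f])
  ultimately show ?thesis using h(1) by (simp add: w_mult add.commute)
 qed
 hence "w h \<in> commutant (w ` local_gens Q)" using h(1) by (auto simp: commutant_def)
 thus ?thesis using A unfolding local_algebra_eq by (rule commutantD[rotated])
qed

subsection \<open>The quasi-local algebra and the Poincare automorphisms\<close>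

lemma quasilocal_bounded_ops: "\<Q> \<subseteq> \<B>"
 unfolding quasilocal_def using local_algebra_bounded_ops
 by (intro closure_minimal closed_bounded_ops) blast

lemma local_algebra_quasilocal: "Q \<in> \<K> ==> \<A> Q \<subseteq> \<Q>"
 unfolding quasilocal_def by (rule order_trans[OF _ closure_subset]) blast

lemma aut_normal: "locally_normal_automorphism X (al r y)"
 by (rule field_aut(2)[OF boost_poincare])

lemma aut_morphism: "cstar_morphism (operator_algebra \<Q>) (operator_algebra \<Q>) (al r y)"
 using aut_normal by (simp add: locally_normal_automorphism_def cstar_automorphism_def)

lemma quasilocal_cstar: "cstar_algebra (operator_algebra \<Q>)"
 using aut_morphism[of 0 0] by (simp add: cstar_morphism_def)

lemma quasilocal_closed:
 shows "A \<in> \<Q> ==> B \<in> \<Q> ==> A + B \<in> \<Q>"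
  "A \<in> \<Q> ==> B \<in> \<Q> ==> A oo B \<in> \<Q>"
  "A \<in> \<Q> ==> op_scale c A \<in> \<Q>"
  "A \<in> \<Q> ==> adj A \<in> \<Q>"
  "A \<in> \<Q> ==> B \<in> \<Q> ==> A - B \<in> \<Q>"
proof -
 note c = cstar_closed[OF quasilocal_cstar, simplified]
 show a: "A \<in> \<Q> ==> B \<in> \<Q> ==> A + B \<in> \<Q>"
  "A \<in> \<Q> ==> B \<in> \<Q> ==> A oo B \<in> \<Q>"
  "A \<in> \<Q> ==> op_scale c A \<in> \<Q>"
  "A \<in> \<Q> ==> adj A \<in> \<Q>" for A B c by (rule c; assumption)+
 show "A - B \<in> \<Q>" if "A \<in> \<Q>" "B \<in> \<Q>"
  using a(1)[OF that(1) a(3)[OF that(2), of "-1"]] by (simp add: op_scale_simps)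
qed

lemma w_quasilocal: assumes f: "f \<in> \<D>" shows "w f \<in> \<Q>"
proof -
 obtain L where L: "L > 0" "!!x. \<bar>x\<bar> > L ==> f x = 0" using test_supportE[OF f] by blast
 have "closure {x. f x ~= 0} \<subseteq> {- L..L}" using L(2) by (intro closure_minimal) (force simp: abs_le_iff not_less[symmetric])+
 hence "f \<in> local_gens (dc (L + 1))" using L(1) by (intro local_gens_base_cone f) force+
 thus ?thesis
  using w_local_gens local_algebra_quasilocal[OF base_cone_double_cone[of "- (L + 1)" "L + 1"]] L(1) by auto
qed

lemma weyl_ops_quasilocal: "weyl_ops \<subseteq> \<Q>"
proof -
 have "A \<in> \<Q>" if "A \<in> weyl_span" for A
  using that by (induction rule: weyl_span.induct) (simp_all add: w_quasilocal quasilocal_closed)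
 thus ?thesis unfolding weyl_ops_def by (intro closure_minimal) (auto simp: quasilocal_def)
qed

lemma aut_simps:
 shows "A \<in> \<Q> ==> al r y A \<in> \<Q>"
  "A \<in> \<Q> ==> B \<in> \<Q> ==> al r y (A + B) = al r y A + al r y B"
  "A \<in> \<Q> ==> B \<in> \<Q> ==> al r y (A oo B) = al r y A oo al r y B"
  "A \<in> \<Q> ==> al r y (op_scale c A) = op_scale c (al r y A)"
  "A \<in> \<Q> ==> al r y (adj A) = adj (al r y A)"
 using aut_morphism[of r y] by (auto simp: cstar_morphism_def)

lemma norm_aut_le: "A \<in> \<Q> ==> norm (al r y A) <= norm A"
 using cstar_morphism_norm_le[OF aut_morphism quasilocal_bounded_ops] by simp

lemma aut_diff:
 assumes "A \<in> \<Q>" "B \<in> \<Q>"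
 shows "al r y (A - B) = al r y A - al r y B"
 using aut_simps(2)[OF assms(1) quasilocal_closed(3)[OF assms(2)], of r y "-1"]
  aut_simps(4)[OF assms(2), of r y "-1"] by (simp add: op_scale_simps)

lemma aut_tendsto:
 assumes "!!n::nat. s n \<in> \<Q>" "A \<in> \<Q>" "s ---> A"
 shows "(\<lambda>n. al r y (s n)) ---> al r y A"
proof -
 have z: "(\<lambda>n. norm (s n - A)) ---> 0"
  by (rule tendsto_norm_zero[OF LIM_zero[OF assms(3)]])
 have b: "norm (al r y (s n) - al r y A) <= norm (s n - A)" for n
  unfolding aut_diff[OF assms(1,2), symmetric] by (rule norm_aut_le[OF quasilocal_closed(5)[OF assms(1,2)]])
 have "(\<lambda>n. al r y (s n) - al r y A) ---> 0"
  by (rule Lim_null_comparison[OF always_eventually[OF allI[OF b]] z])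
 thus ?thesis by (rule LIM_zero_cancel)
qed

lemma aut_w: "f \<in> \<D> ==> al r y (w f) = w (tau m r y f)"
 by (simp add: field_aut(3)[OF boost_poincare] weyl_carr weyl_aut_w)

lemma in_quasilocal: "A \<in> weyl_ops ==> A \<in> \<Q>" "A \<in> weyl_span ==> A \<in> \<Q>"
 using weyl_ops_quasilocal weyl_span_weyl_ops by auto

lemma aut_weyl_ops: "A \<in> weyl_ops ==> al r y A \<in> weyl_ops"
proof (induction rule: weyl_ops_induct)
 case (gen f) thus ?case by (simp add: aut_w w_weyl_ops tau_test)
next
 case (lim s A)
 note q = in_quasilocal(2)[OF lim.hyps(1)] in_quasilocal(1)[OF lim.hyps(2)]
 hence "al r y A \<in> closure weyl_ops"
  unfolding closure_sequential
  by (intro exI[of _ "\<lambda>n. al r y (s n)"]) (simp add: lim.IH aut_tendsto[OF q lim.hyps(3)])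
 thus ?case by (simp add: weyl_ops_def)
qed (simp_all add: aut_simps in_quasilocal weyl_ops_closed)

lemma aut_comp:
 "A \<in> weyl_ops ==> al r y (al h z A) = al (r + h) (boost r *v z + y) A"
proof (induction rule: weyl_ops_induct)
 case (gen f) thus ?case by (simp add: aut_w tau_test tau_comp mass)
next
 case (lim s A)
 note q = in_quasilocal(2)[OF lim.hyps(1)] in_quasilocal(1)[OF lim.hyps(2)]
 have "(\<lambda>n. al r y (al h z (s n))) ---> al r y (al h z A)"
  using q by (intro aut_tendsto aut_simps lim.hyps)
 thus ?case unfolding lim.IH using aut_tendsto[OF q lim.hyps(3)] by (rule LIMSEQ_unique)
qed (simp_all add: aut_simps in_quasilocal)

lemma aut_zero: "A \<in> weyl_ops ==> al 0 0 A = A"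
proof (induction rule: weyl_ops_induct)
 case (gen f) thus ?case by (simp add: aut_w tau_zero mass)
next
 case (lim s A)
 note q = in_quasilocal(2)[OF lim.hyps(1)] in_quasilocal(1)[OF lim.hyps(2)]
 have "(\<lambda>n. al 0 0 (s n)) ---> al 0 0 A"
  by (rule aut_tendsto[OF q lim.hyps(3)])
 thus ?case unfolding lim.IH using lim.hyps(3) by (rule LIMSEQ_unique)
qed (simp_all add: aut_simps in_quasilocal)

text \<open>The vacuum is invariant.\<close>

lemma vac_aut:
 "A \<in> weyl_ops ==> cinner (vac X) (al r y A (vac X)) = cinner (vac X) (A (vac X))"
proof (induction rule: weyl_ops_induct)
 case (gen f) thus ?case by (simp add: aut_w tau_test vac_w mass_norm_sq_tau mass)
next
 case (lim s A)
 note q = in_quasilocal(2)[OF lim.hyps(1)] in_quasilocal(1)[OF lim.hyps(2)]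
 have "(\<lambda>n. cinner (vac X) (al r y (s n) (vac X))) ---> cinner (vac X) (al r y A (vac X))"
  by (rule tendsto_cinner[OF tendsto_const tendsto_blinfun_apply_left[OF aut_tendsto[OF q lim.hyps(3)]]])
 moreover have "(\<lambda>n. cinner (vac X) (s n (vac X))) ---> cinner (vac X) (A (vac X))"
  by (rule tendsto_cinner[OF tendsto_const tendsto_blinfun_apply_left[OF lim.hyps(3)]])
 ultimately show ?case unfolding lim.IH by (rule LIMSEQ_unique)
qed (simp_all add: aut_simps in_quasilocal blinfun.add_left cinner_add_right cinner_scaleC_right)

end

lemma blinfun_eq_dense:
 fixes A B :: "'h::complex_hilbert op"
 assumes "closure S = UNIV" "!!x. x \<in> S ==> A x = B x"
 shows "A = B"
proof (rule blinfun_eqI)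
 fix x
 have "x \<in> closure S" using assms(1) by simp
 then obtain s where s: "!!n::nat. s n \<in> S" "s ---> x" unfolding closure_sequential by blast
 have "(\<lambda>n. A (s n)) ---> A x" by (intro blinfun.tendsto tendsto_const s(2))
 moreover have "(\<lambda>n. A (s n)) ---> B x"
  unfolding assms(2)[OF s(1)] by (intro blinfun.tendsto tendsto_const s(2))
 ultimately show "A x = B x" by (rule LIMSEQ_unique)
qed

text \<open>Contractions that converge to the identity on a set do so on its closure.\<close>

lemma isometries_tendsto_dense:
 fixes V :: "nat => 'h::complex_hilbert op"
 assumes iso: "!!n x. norm (V n x) <= norm x"
  and S: "!!x. x \<in> S ==> (\<lambda>n. V n x) ---> x"
  and x: "x \<in> closure S"
 shows "(\<lambda>n. V n x) ---> x"
proof (rule LIMSEQ_I)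
 fix e :: real assume e: "0 < e"
 obtain y where y: "y \<in> S" "norm (x - y) < e / 3"
  using x[unfolded closure_approachable, rule_format, of "e / 3"] e by (auto simp: dist_norm norm_minus_commute)
 obtain N where N: "!!n. n >= N ==> norm (V n y - y) < e / 3"
  using LIMSEQ_D[OF S[OF y(1)], of "e / 3"] e by auto
 show "\<exists>no. \<forall>n\<ge>no. norm (V n x - x) < e"
 proof (intro exI allI impI)
  fix n assume "n >= N"
  have "V n x - x = V n (x - y) + (V n y - y) - (x - y)"
   by (simp add: blinfun.diff_right)
  hence "norm (V n x - x) <= norm (V n (x - y)) + norm (V n y - y) + norm (x - y)"
   using norm_triangle_ineq4[of "V n (x - y) + (V n y - y)" "x - y"]
    norm_triangle_ineq[of "V n (x - y)" "V n y - y"] by simp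
  thus "norm (V n x - x) < e" using N[OF \<open>n >= N\<close>] iso[of n "x - y"] y(2) by simp
 qed
qed

lemma commutantI: "A \<in> \<B> ==> (!!B. B \<in> M ==> A oo B = B oo A) ==> A \<in> commutant M"
 by (simp add: commutant_def)

lemma matrix_vector_mult_minus: "(A :: real^'n^'m) *v (- x) = - (A *v x)"
 by (simp add: vec_eq_iff matrix_vector_mult_def sum_negf)

context vacuum_field begin

subsection \<open>The unitary representation of the Poincare group\<close>

lemma implementer_exists:
 "\<exists>U\<in>\<B>. (\<forall>A\<in>weyl_ops. ap U (vc A) = vc (al r y A)) \<and>
  (\<forall>x. norm (ap U x) = norm x)"
proof (rule isometry_extension)
 fix A B assume AB: "A \<in> weyl_ops" "B \<in> weyl_ops"
 thus "\<exists>C\<in>weyl_ops. vc C = vc A + vc B \<and>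
  vc (al r y C) = vc (al r y A) + vc (al r y B)"
  by (intro bexI[of _ "A + B"]) (simp_all add: weyl_ops_closed aut_simps in_quasilocal blinfun.add_left)
next
 fix c A assume A: "A \<in> weyl_ops"
 thus "\<exists>C\<in>weyl_ops. vc C = c *\<^sub>C vc A \<and>
  vc (al r y C) = c *\<^sub>C vc (al r y A)"
  by (intro bexI[of _ "op_scale c A"]) (simp_all add: weyl_ops_closed aut_simps in_quasilocal)
next
 fix A assume A: "A \<in> weyl_ops"
 have b: "A \<in> \<B>" "al r y A \<in> \<B>"
  using A aut_weyl_ops[OF A] weyl_ops_bounded_ops by auto
 have "cinner (vac X) (vc (al r y (adj A oo A))) = cinner (vac X) (vc (adj A oo A))"
  using A by (intro vac_aut weyl_ops_closed)
 moreover have "al r y (adj A oo A) = adj (al r y A) oo al r y A"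
  using A by (simp add: aut_simps in_quasilocal weyl_ops_closed)
 ultimately have "cinner (vc (al r y A)) (vc (al r y A)) =
   cinner (vc A) (vc A)"
  by (simp add: b cinner_adj_right)
 thus "norm (vc (al r y A)) = norm (vc A)"
  by (simp add: norm_eq_sqrt_cinner)
qed (rule vac_cyclic)

text \<open>The implementing unitary: \<open>U A \<Omega> = \<alpha>(A) \<Omega>\<close> for \<open>A\<close> in the represented Weyl algebra. It is unique by
 cyclicity of the vacuum.\<close>

definition U :: "real => real^2 => 'h op"
 where "U r y = (SOME U. U \<in> \<B> \<and>
  (\<forall>A\<in>weyl_ops. ap U (vc A) = vc (al r y A)) \<and>
  (\<forall>x. norm (ap U x) = norm x))"

lemma U_props:
 shows "U r y \<in> \<B>"
  and "A \<in> weyl_ops ==> ap (U r y) (vc A) = vc (al r y A)"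
  and "norm (ap (U r y) x) = norm x"
 using someI_ex[OF implementer_exists[of r y, unfolded Bex_def], folded U_def] by auto

lemma weyl_ops_eqI:
 assumes "!!A. A \<in> weyl_ops ==> ap S (vc A) = ap T (vc A)"
 shows "S = (T :: 'h op)"
 by (rule blinfun_eq_dense[OF vac_cyclic]) (use assms in blast)

lemma U_comp: "U r y oo U h z = U (r + h) (boost r *v z + y)"
 by (rule weyl_ops_eqI) (simp add: U_props aut_weyl_ops aut_comp)

lemma U_zero: "U 0 0 = id_blinfun"
 by (rule weyl_ops_eqI) (simp add: U_props aut_zero)

lemma U_inverse: "U r y oo U (- r) (- (boost (- r) *v y)) = id_blinfun"
 by (simp add: U_comp matrix_vector_mult_minus matrix_vector_mul_assoc boost_mult boost_zero U_zero)

lemma U_inverse': "U (- r) (- (boost (- r) *v y)) oo U r y = id_blinfun"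
 by (simp add: U_comp U_zero)

lemma U_vac: "U r y (vac X) = vac X"
proof -
 have "al r y id_blinfun = id_blinfun"
  using aut_morphism[of r y] by (simp add: cstar_morphism_def)
 thus ?thesis using U_props(2)[OF weyl_ops_closed(5), of r y] by simp
qed

text \<open>For Weyl operators \<open>\<parallel>U w(f) \<Omega> - w(f) \<Omega>\<parallel>\<close> is an expression in the one-particle norm of \<open>\<tau> f - f\<close> and the
 symplectic form of \<open>f\<close> and \<open>\<tau> f\<close>.\<close>

lemma U_strongly_continuous:
 assumes r: "r ---> 0" and y: "y ---> 0"
 shows "(\<lambda>n. U (r n) (y n) x) ---> x"
proof -
 let ?S = "vc ` weyl_span"
 have gen: "(\<lambda>n. U (r n) (y n) (w f (vac X))) ---> w f (vac X)"
  if f: "f \<in> \<D>" for f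
 proof -
  define \<psi> where "\<psi> = w f (vac X)"
  define t where "t n = tau m (r n) (y n) f" for n
  have t: "t n \<in> \<D>" for n by (simp add: t_def tau_test f)
  have U\<psi>: "U (r n) (y n) \<psi> = w (t n) (vac X)" for n
   by (simp add: \<psi>_def U_props w_weyl_ops f aut_w t_def)
  have n1: "norm \<psi> = 1" by (simp add: \<psi>_def norm_w_apply f norm_vac)
  have sq: "(norm (U (r n) (y n) \<psi> - \<psi>))^2 =
    2 - 2 * Re (cis (symp f (t n) / 2) * of_real (exp (- mass_norm_sq m (\<lambda>x. t n x - f x) / 2)))" for n
  proof -
   have "cinner \<psi> (w (t n) (vac X)) = cinner (vac X) ((adj (w f) oo w (t n)) (vac X))"
    using f by (simp add: \<psi>_def cinner_adj_right)
   also have "adj (w f) oo w (t n) = op_scale (cis (symp f (t n) / 2)) (w (\<lambda>x. t n x - f x))"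
    using w_mult[OF test_minus[OF f] t[of n]] f by (simp add: adj_w symp_minus_left)
   finally have "cinner \<psi> (w (t n) (vac X)) =
     cis (symp f (t n) / 2) * of_real (exp (- mass_norm_sq m (\<lambda>x. t n x - f x) / 2))"
    using vac_w[OF test_diff[OF t f], of n] by (simp add: cinner_scaleC_right)
   hence "Re (cinner (U (r n) (y n) \<psi>) \<psi>) =
     Re (cis (symp f (t n) / 2) * of_real (exp (- mass_norm_sq m (\<lambda>x. t n x - f x) / 2)))"
    by (subst cinner_commute) (simp add: U\<psi>)
   thus ?thesis unfolding norm_diff_sq by (simp add: U_props n1)
  qed
  have "(\<lambda>n. 2 - 2 * Re (cis (symp f (t n) / 2) * of_real (exp (- mass_norm_sq m (\<lambda>x. t n x - f x) / 2))))
    ---> 2 - 2 * Re (cis (0 / 2) * of_real (exp (- 0 / 2)))"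
   unfolding t_def cis_conv_exp
   by (intro tendsto_intros symp_tau_tendsto[OF mass f r y] mass_norm_sq_tau_tendsto[OF mass f r y]) auto
  hence "(\<lambda>n. (norm (U (r n) (y n) \<psi> - \<psi>))^2) ---> 0" by (simp add: sq)
  from tendsto_real_sqrt[OF this] have "(\<lambda>n. norm (U (r n) (y n) \<psi> - \<psi>)) ---> 0" by simp
  thus ?thesis unfolding \<psi>_def[symmetric] by (rule LIM_zero_cancel[OF tendsto_norm_zero_cancel])
 qed
 have "(\<lambda>n. U (r n) (y n) (A (vac X))) ---> A (vac X)" if "A \<in> weyl_span" for A
  using that
 proof (induction rule: weyl_span.induct)
  case (add A B)
  from tendsto_add[OF add.IH] show ?case unfolding blinfun.add_left blinfun.add_right .
 next
  case (scale A c)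
  have "(\<lambda>n. c *\<^sub>C U (r n) (y n) (A (vac X))) ---> c *\<^sub>C A (vac X)"
   by (rule tendsto_scaleC[OF tendsto_const scale.IH])
  thus ?case unfolding op_scale_apply bounded_opsD[OF U_props(1)] .
 qed (rule gen)
 hence S: "\<forall>x\<in>?S. (\<lambda>n. U (r n) (y n) x) ---> x" by blast
 have x: "x \<in> closure ?S"
 proof -
  have "vc ` weyl_ops \<subseteq> closure ?S"
   unfolding weyl_ops_def
   by (rule image_closure_subset[OF _ closed_closure closure_subset])
    (rule linear_continuous_on[OF blinfun.bounded_linear_left])
  hence "closure (vc ` weyl_ops) \<subseteq> closure ?S" by (rule closure_minimal) simp
  hence "UNIV \<subseteq> closure ?S" unfolding vac_cyclic .
  thus ?thesis by (rule subsetD) simp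
 qed
 show ?thesis by (rule isometries_tendsto_dense[OF _ bspec[OF S] x]) (simp add: U_props)
qed

text \<open>On local algebras the automorphisms are implemented by these unitaries. On the
 represented Weyl algebra this follows from their definition; normality extends it to the weak
 closures.\<close>

lemma aut_weyl_ops_implemented:
 assumes B: "B \<in> weyl_ops"
 shows "al r y B = U r y oo B oo U (- r) (- (boost (- r) *v y))" (is "_ = _ oo B oo ?V")
proof -
 have 1: "al r y B oo U r y = U r y oo B"
 proof (rule weyl_ops_eqI)
  fix A assume A: "A \<in> weyl_ops"
  show "ap (al r y B oo U r y) (vc A) = ap (U r y oo B) (vc A)"
   using U_props(2)[OF weyl_ops_closed(2)[OF B A], of r y] by (simp add: U_props A B aut_simps in_quasilocal)
 qed
 have "al r y B = (al r y B oo U r y) oo ?V"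
  by (simp add: compose_assoc U_inverse)
 thus ?thesis by (simp add: 1)
qed

lemma aut_implemented:
 assumes Q: "Q \<in> \<K>" and A: "A \<in> \<A> Q"
 shows "al r y A = U r y oo A oo U (- r) (- (boost (- r) *v y))"
proof -
 let ?N = "\<A> Q \<inter> weyl_ops"
 have N: "?N \<subseteq> \<B>" using local_algebra_bounded_ops by auto
 have eq: "commutant (commutant ?N) = \<A> Q"
 proof
  show "commutant (commutant ?N) \<subseteq> \<A> Q"
   unfolding local_algebra_eq by (rule bicommutant_minimal[OF _ commutant_subset_bounded]) blast
  have "w ` local_gens Q \<subseteq> ?N" using w_local_gens w_weyl_ops local_gens_test by auto
  thus "\<A> Q \<subseteq> commutant (commutant ?N)"
   unfolding local_algebra_eq[of Q] by (intro commutant_mono)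
 qed
 show ?thesis
 proof (rule normal_on_bicommutant_eq[of ?N])
  show "normal_on (commutant (commutant ?N)) (al r y)"
   unfolding eq using aut_normal Q by (simp add: locally_normal_automorphism_def)
  show "A \<in> commutant (commutant ?N)" unfolding eq by (rule A)
  show "al r y B = U r y oo B oo U (- r) (- (boost (- r) *v y))" if "B \<in> ?N" for B
   using that by (intro aut_weyl_ops_implemented) simp
 qed (use N in "simp_all add: local_algebra_closed weyl_ops_closed U_props")
qed

text \<open>Covariance of the Weyl operators, of their test functions and of the local algebras.\<close>

lemma U_w: assumes "f \<in> \<D>"
 shows "U r y oo w f oo U (- r) (- (boost (- r) *v y)) = w (tau m r y f)"
 using aut_weyl_ops_implemented[OF w_weyl_ops[OF assms], of r y] by (simp add: aut_w assms)

lemma tau_local_gens: "f \<in> local_gens Q ==> tau m r y f \<in> local_gens (move_region (boost r, y) Q)"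
proof -
 assume "f \<in> local_gens Q"
 then obtain t z a b h where *: "f = tau m t z h" "a < b"
  "Q = move_region (boost t, z) (base_cone a b)" "h \<in> \<D>" "closure {x. h x ~= 0} \<subseteq> {a<..<b}"
  unfolding local_gens_def by blast
 have "tau m r y f = tau m (r + t) (boost r *v z + y) h" using * by (simp add: tau_comp mass)
 moreover have "move_region (boost r, y) Q = move_region (boost (r + t), boost r *v z + y) (base_cone a b)"
  by (simp add: *(3) poincare_mult_boost flip: move_region_comp)
 ultimately show ?thesis using * unfolding local_gens_def by blast
qed

text \<open>If \<open>T\<close> commutes with \<open>B\<close>, then \<open>U T U\<^sup>-\<^sup>1\<close> commutes with \<open>U B U\<^sup>-\<^sup>1\<close>.\<close>

lemma conj_compose:
 fixes P P' A B :: "'h op"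
 assumes "P' oo P = id_blinfun"
 shows "(P oo A oo P') oo (P oo B oo P') = P oo (A oo B) oo P'"
proof -
 have "(P oo A oo P') oo (P oo B oo P') = P oo A oo (P' oo P) oo B oo P'" by (simp only: compose_assoc)
 thus ?thesis by (simp add: assms compose_assoc)
qed

lemma conj_local_algebra:
 assumes A: "A \<in> \<A> Q"
 shows "U r y oo A oo U (- r) (- (boost (- r) *v y)) \<in> \<A> (move_region (boost r, y) Q)" (is "?P oo A oo ?P' \<in> _")
proof -
 note P = U_inverse[of r y] U_inverse'[of r y]
 have "(?P oo A oo ?P') oo T = T oo (?P oo A oo ?P')" if T: "T \<in> commutant (w ` local_gens (move_region (boost r, y) Q))" for T
 proof -
  define T' where "T' = ?P' oo T oo ?P"
  have "?P oo T' oo ?P' = (?P oo ?P') oo T oo (?P oo ?P')" unfolding T'_def by (simp only: compose_assoc)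
  hence TT: "?P oo T' oo ?P' = T" unfolding P by simp
  have "T' oo w f = w f oo T'" if f: "f \<in> local_gens Q" for f
  proof -
   have "T oo (?P oo w f oo ?P') = (?P oo w f oo ?P') oo T"
    using commutantD[OF T imageI[OF tau_local_gens[OF f]]] unfolding U_w[OF local_gens_test[OF f]] .
   hence "?P oo (T' oo w f) oo ?P' = ?P oo (w f oo T') oo ?P'" unfolding TT[symmetric] conj_compose[OF P(2)] .
   from arg_cong[OF this, of "\<lambda>B. ?P' oo B oo ?P"]
   have "(?P' oo ?P) oo (T' oo w f) oo (?P' oo ?P) = (?P' oo ?P) oo (w f oo T') oo (?P' oo ?P)"
    by (simp only: compose_assoc)
   thus ?thesis unfolding P by simp
  qed
  hence "T' \<in> commutant (w ` local_gens Q)"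
   using commutant_bounded_ops[OF T] by (auto simp: commutant_def T'_def U_props)
  hence "A oo T' = T' oo A" using A unfolding local_algebra_eq by (rule commutantD[rotated])
  thus ?thesis unfolding TT[symmetric] conj_compose[OF P(2)] by simp
 qed
 thus ?thesis using subsetD[OF local_algebra_bounded_ops A] unfolding local_algebra_eq
  by (intro commutantI) (simp_all add: U_props)
qed

end

section \<open>Function algebras\<close>

lemma function_algebra_simps [simp]:
 "carr (function_algebra M) = M" "azero (function_algebra M) = (\<lambda>_. 0)"
 "aone (function_algebra M) = on_pos (\<lambda>_. id_blinfun)" "aadd (function_algebra M) A B = (\<lambda>l. A l + B l)"
 "amult (function_algebra M) A B = (\<lambda>l. A l oo B l)" "ascale (function_algebra M) c A = (\<lambda>l. op_scale c (A l))"
 "astar (function_algebra M) A = (\<lambda>l. adj (A l))" "anorm (function_algebra M) A = sup_norm A"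
 by (simp_all add: function_algebra_def op_scale_def)

lemma bounded_functionsI:
 assumes "!!l. l > 0 ==> A l \<in> \<B>" "!!l. l > 0 ==> norm (A l) <= K" "!!l. l <= 0 ==> A l = 0"
 shows "A \<in> \<F>"
proof -
 have "norm (A l) <= max K 0" for l using assms(2,3)[of l] by (cases "l > 0") auto
 moreover have "A l \<in> \<B>" for l using assms(1,3)[of l] by (cases "l > 0") auto
 ultimately show ?thesis using assms(3) unfolding bounded_functions_def bounded_iff by auto
qed

lemma bounded_functionsD:
 assumes "A \<in> \<F>"
 shows "A l \<in> \<B>" "l <= 0 ==> A l = 0"
 using assms by (auto simp: bounded_functions_def)

lemma bounded_functions_bound:
 assumes "A \<in> \<F>" shows "\<exists>K. \<forall>l. norm (A l) <= K"
 using assms by (auto simp: bounded_functions_def bounded_iff)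

lemma norm_le_sup_norm:
 assumes "A \<in> \<F>" "l > 0" shows "norm (A l) <= sup_norm A"
proof -
 obtain K where "!!l. norm (A l) <= K" using bounded_functions_bound[OF assms(1)] by blast
 thus ?thesis unfolding sup_norm_def using assms(2)
  by (intro cSUP_upper) (auto simp: bdd_above_def)
qed

lemma sup_norm_leI: "(!!l. l > 0 ==> norm (A l) <= K) ==> sup_norm A <= K"
 unfolding sup_norm_def by (intro cSUP_least) auto

lemma bounded_functions_diff:
 assumes "A \<in> \<F>" "B \<in> \<F>"
 shows "(\<lambda>l. A l - B l) \<in> \<F>"
proof (rule bounded_functionsI)
 fix l :: real assume l: "l > 0"
 show "A l - B l \<in> \<B>" using assms by (simp add: bounded_functionsD)
 show "norm (A l - B l) <= sup_norm A + sup_norm B"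
  using norm_triangle_ineq4[of "A l" "B l"] norm_le_sup_norm[OF assms(1) l] norm_le_sup_norm[OF assms(2) l] by simp
qed (use assms in "simp add: bounded_functionsD")

lemma sup_norm_triangle:
 assumes "A \<in> \<F>" "B \<in> \<F>" "C \<in> \<F>"
 shows "sup_norm (\<lambda>l. A l - C l) <= sup_norm (\<lambda>l. A l - B l) + sup_norm (\<lambda>l. B l - C l)"
proof (rule sup_norm_leI)
 fix l :: real assume l: "l > 0"
 have "norm (A l - C l) <= norm (A l - B l) + norm (B l - C l)" using norm_triangle_ineq[of "A l - B l" "B l - C l"] by simp
 also have "... <= sup_norm (\<lambda>l. A l - B l) + sup_norm (\<lambda>l. B l - C l)"
  using norm_le_sup_norm[OF bounded_functions_diff[OF assms(1,2)] l] norm_le_sup_norm[OF bounded_functions_diff[OF assms(2,3)] l]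
  by simp
 finally show "norm (A l - C l) <= sup_norm (\<lambda>l. A l - B l) + sup_norm (\<lambda>l. B l - C l)" .
qed

lemma sup_closure_bounded: "A \<in> sup_closure M ==> A \<in> \<F>"
 by (simp add: sup_closure_def)

lemma sup_closure_incl: "M \<subseteq> \<F> ==> M \<subseteq> sup_closure M"
proof
 fix A assume "M \<subseteq> \<F>" "A \<in> M"
 moreover have "sup_norm (\<lambda>l. A l - A l) <= 0" by (rule sup_norm_leI) simp
 ultimately show "A \<in> sup_closure M" unfolding sup_closure_def by force
qed

lemma sup_closure_idem:
 assumes A: "A \<in> \<F>" and M: "M \<subseteq> \<F>"
  and e: "!!e. e > 0 ==> \<exists>B\<in>sup_closure M. sup_norm (\<lambda>l. A l - B l) < e"
 shows "A \<in> sup_closure M"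
 unfolding sup_closure_def
proof (intro CollectI conjI A allI impI)
 fix e :: real assume "e > 0"
 hence e2: "e / 2 > 0" by simp
 obtain B where B: "B \<in> sup_closure M" "sup_norm (\<lambda>l. A l - B l) < e / 2" using e[OF e2] by blast
 obtain C where C: "C \<in> M" "sup_norm (\<lambda>l. B l - C l) < e / 2" using B(1) e2 unfolding sup_closure_def by blast
 have "sup_norm (\<lambda>l. A l - C l) <= sup_norm (\<lambda>l. A l - B l) + sup_norm (\<lambda>l. B l - C l)"
  using C(1) M by (intro sup_norm_triangle A sup_closure_bounded[OF B(1)]) auto
 thus "\<exists>C\<in>M. sup_norm (\<lambda>l. A l - C l) < e" using B(2) C by (intro bexI[of _ C]) auto
qed

lemma on_pos_simps [simp]: "l > 0 ==> on_pos F l = F l" "l <= 0 ==> on_pos F l = 0"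
 by (simp_all add: on_pos_def)

section \<open>Scaling algebras\<close>

text \<open>A scaling limit of the field, with its extension to \<open>\<A>\<^sup>\<bullet>\<close>. \<open>\<pi>\<close> and \<open>\<pi>b\<close> are the representation of the
 scaling algebra and its extension to \<open>\<A>\<^sup>\<bullet>\<close>, \<open>\<xi>\<close> is the limit vacuum, \<open>SL Q\<close>, \<open>BL Q\<close> and \<open>LL Q\<close> are the
 local algebras of the scaling algebra \<open>SA\<close>, of \<open>BA = \<A>\<^sup>\<bullet>\<close> and of the limit theory \<open>QL\<close>, and \<open>PA\<close> is the
 algebra \<open>\<A>\<^sub>\<phi>\<close>. \<open>sc k\<close> is the scale at the index \<open>k\<close> of the net, and \<open>vd A B k\<close> the distance of \<open>A\<close> and
 \<open>B\<close> on the vacuum there.\<close>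

locale scaling_field = vacuum_field m X for m and X :: "('w, 'h::complex_hilbert) free_field" +
 fixes S :: "('i, 'h, 'k::complex_hilbert) scaling_limit"
 assumes limit: "is_scaling_limit X S"
  and bullet_cstar: "\<forall>Q\<in>\<K>. cstar_algebra (function_algebra (bullet_local X S Q))"
  and extension: "is_bullet_extension X S"
begin

abbreviation "vd A B k \<equiv> norm (vc ((A (scale S k) :: 'h op) - B (scale S k)))"

abbreviation "\<pi> \<equiv> lim_rep S"
abbreviation "\<pi>b \<equiv> lim_rep_ext S"
abbreviation "\<xi> \<equiv> lim_vac S"
abbreviation "sc \<equiv> scale S"
abbreviation "QL \<equiv> limit_quasilocal X S"
abbreviation "LL \<equiv> limit_local X S"
abbreviation "SL \<equiv> scaling_local X S"
abbreviation "SA \<equiv> scaling_algebra X S"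
abbreviation "BL \<equiv> bullet_local X S"
abbreviation "BA \<equiv> bullet_algebra X S"
abbreviation "PA \<equiv> phi_algebra X S"

lemma bullet_local_bounded: "BL Q \<subseteq> \<F>"
 by (auto simp: bullet_local_def)

lemma bullet_algebra_bounded: "A \<in> BA ==> A \<in> \<F>"
 unfolding bullet_algebra_def by (rule sup_closure_bounded)

lemma bullet_local_algebra: "Q \<in> \<K> ==> BL Q \<subseteq> BA"
 unfolding bullet_algebra_def using bullet_local_bounded by (intro order_trans[OF _ sup_closure_incl]) blast+

lemma ext_morphism: "cstar_morphism (function_algebra BA) (operator_algebra QL) \<pi>b"
 using extension by (simp add: is_bullet_extension_def)

lemma bullet_algebra_cstar: "cstar_algebra (function_algebra BA)"
 using ext_morphism by (simp add: cstar_morphism_def)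

lemmas bullet_algebra_closed = cstar_closed[OF bullet_algebra_cstar, simplified]

lemma limit_local_bounded_ops: "LL Q \<subseteq> \<B>"
 unfolding limit_local_def using commutant_bounded_ops by blast

lemma limit_quasilocal_bounded_ops: "QL \<subseteq> \<B>"
 unfolding limit_quasilocal_def using limit_local_bounded_ops
 by (intro closure_minimal closed_bounded_ops) blast

lemma ext_simps:
 shows "A \<in> BA ==> \<pi>b A \<in> QL"
  "A \<in> BA ==> B \<in> BA ==> \<pi>b (\<lambda>l. A l + B l) = \<pi>b A + \<pi>b B"
  "A \<in> BA ==> B \<in> BA ==> \<pi>b (\<lambda>l. A l oo B l) = \<pi>b A oo \<pi>b B"
  "A \<in> BA ==> \<pi>b (\<lambda>l. op_scale c (A l)) = op_scale c (\<pi>b A)"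
  "A \<in> BA ==> \<pi>b (\<lambda>l. adj (A l)) = adj (\<pi>b A)"
  "\<pi>b (on_pos (\<lambda>_. id_blinfun)) = id_blinfun"
 using ext_morphism by (auto simp: cstar_morphism_def)

lemma norm_ext_le: "A \<in> BA ==> norm (\<pi>b A) <= sup_norm A"
 using cstar_morphism_norm_le[OF ext_morphism limit_quasilocal_bounded_ops] by simp

lemma bullet_algebra_diff:
 assumes "A \<in> BA" "B \<in> BA"
 shows "(\<lambda>l. A l - B l) \<in> BA" "\<pi>b (\<lambda>l. A l - B l) = \<pi>b A - \<pi>b B"
proof -
 have B: "(\<lambda>l. op_scale (-1) (B l)) \<in> BA" by (rule bullet_algebra_closed(5)[OF assms(2)])
 show "(\<lambda>l. A l - B l) \<in> BA" "\<pi>b (\<lambda>l. A l - B l) = \<pi>b A - \<pi>b B"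
  using bullet_algebra_closed(3)[OF assms(1) B] ext_simps(2)[OF assms(1) B] ext_simps(4)[OF assms(2), of "-1"]
  by (simp_all add: op_scale_simps)
qed

lemma norm_ext_diff_le:
 assumes "A \<in> BA" "B \<in> BA"
 shows "norm (\<pi>b A - \<pi>b B) <= sup_norm (\<lambda>l. A l - B l)"
 using norm_ext_le[OF bullet_algebra_diff(1)[OF assms]] bullet_algebra_diff(2)[OF assms] by simp

lemma scale_region_mono: "Q \<subseteq> R ==> scale_region l Q \<subseteq> scale_region l R"
 by (auto simp: scale_region_def)

lemma bullet_local_mono:
 assumes "Q \<subseteq> R" "R \<in> \<K>"
 shows "BL Q \<subseteq> BL R"
proof
 fix A assume A: "A \<in> BL Q"
 have "A l \<in> \<A> (scale_region l R)" if l: "l > 0" for l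
 proof -
  have "\<A> (scale_region l Q) \<subseteq> \<A> (scale_region l R)"
   by (rule local_algebra_mono[OF scale_region_mono[OF assms(1)] scale_double_cone[OF l assms(2)]])
  thus ?thesis using A l by (auto simp: bullet_local_def)
 qed
 moreover have "closure Q \<subseteq> closure R" by (rule closure_mono[OF assms(1)])
 ultimately show "A \<in> BL R" using A unfolding bullet_local_def by (auto dest: order_trans)
qed

subsection \<open>The dilation-covariant subalgebra\<close>

lemma dil_normal: "l > 0 ==> locally_normal_automorphism X (dil X l)"
 using field by (simp add: massive_free_field_def)

lemma dil_morphism: "l > 0 ==> cstar_morphism (operator_algebra \<Q>) (operator_algebra \<Q>) (dil X l)"
 using dil_normal by (simp add: locally_normal_automorphism_def cstar_automorphism_def)

lemma dil_simps:
 assumes "l > 0"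
 shows "A \<in> \<Q> ==> dil X l A \<in> \<Q>"
  "A \<in> \<Q> ==> B \<in> \<Q> ==> dil X l (A + B) = dil X l A + dil X l B"
  "A \<in> \<Q> ==> B \<in> \<Q> ==> dil X l (A oo B) = dil X l A oo dil X l B"
  "A \<in> \<Q> ==> dil X l (op_scale c A) = op_scale c (dil X l A)"
  "A \<in> \<Q> ==> dil X l (adj A) = adj (dil X l A)"
  "dil X l id_blinfun = id_blinfun"
 using dil_morphism[OF assms] by (auto simp: cstar_morphism_def)

lemma norm_dil_le: "l > 0 ==> A \<in> \<Q> ==> norm (dil X l A) <= norm A"
 using cstar_morphism_norm_le[OF dil_morphism quasilocal_bounded_ops] by simp

lemma dil_diff:
 assumes "l > 0" "A \<in> \<Q>" "B \<in> \<Q>"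
 shows "dil X l (A - B) = dil X l A - dil X l B"
 using dil_simps(2)[OF assms(1,2) quasilocal_closed(3)[OF assms(3)], of "-1"]
  dil_simps(4)[OF assms(1,3), of "-1"] by (simp add: op_scale_simps)

lemma phi_local_local: "phi_local X S Q \<subseteq> \<A> Q"
 by (auto simp: phi_local_def)

lemma phi_local_quasilocal: "Q \<in> \<K> ==> phi_local X S Q \<subseteq> \<Q>"
 using phi_local_local local_algebra_quasilocal by blast

lemma phi_bullet_simps:
 shows "A \<in> \<Q> ==> B \<in> \<Q> ==> phi_bullet X (A + B) = (\<lambda>l. phi_bullet X A l + phi_bullet X B l)"
  "A \<in> \<Q> ==> B \<in> \<Q> ==> phi_bullet X (A - B) = (\<lambda>l. phi_bullet X A l - phi_bullet X B l)"
  "A \<in> \<Q> ==> B \<in> \<Q> ==> phi_bullet X (A oo B) = (\<lambda>l. phi_bullet X A l oo phi_bullet X B l)"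
  "A \<in> \<Q> ==> phi_bullet X (op_scale c A) = (\<lambda>l. op_scale c (phi_bullet X A l))"
  "A \<in> \<Q> ==> phi_bullet X (adj A) = (\<lambda>l. adj (phi_bullet X A l))"
  "phi_bullet X id_blinfun = on_pos (\<lambda>_. id_blinfun)"
 unfolding phi_bullet_def on_pos_def
 by (auto simp: dil_simps dil_diff intro!: blinfun_eqI)

lemma phi_local_closed:
 assumes Q: "Q \<in> \<K>"
 shows "A \<in> phi_local X S Q ==> B \<in> phi_local X S Q ==> A + B \<in> phi_local X S Q"
  "A \<in> phi_local X S Q ==> B \<in> phi_local X S Q ==> A oo B \<in> phi_local X S Q"
  "A \<in> phi_local X S Q ==> op_scale c A \<in> phi_local X S Q"
  "A \<in> phi_local X S Q ==> adj A \<in> phi_local X S Q"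
  "id_blinfun \<in> phi_local X S Q"
proof -
 have q: "A \<in> \<Q>" if "A \<in> phi_local X S Q" for A using phi_local_quasilocal[OF Q] that by blast
 have "cstar_algebra (function_algebra (BL Q))" using bullet_cstar Q by blast
 note c = cstar_closed[OF this, simplified]
 show "A \<in> phi_local X S Q ==> B \<in> phi_local X S Q ==> A + B \<in> phi_local X S Q"
  using phi_bullet_simps(1)[of A B] q c(3)[of "phi_bullet X A" "phi_bullet X B"] by (simp add: phi_local_def local_algebra_closed)
 show "A \<in> phi_local X S Q ==> B \<in> phi_local X S Q ==> A oo B \<in> phi_local X S Q"
  using phi_bullet_simps(3)[of A B] q c(4)[of "phi_bullet X A" "phi_bullet X B"] by (simp add: phi_local_def local_algebra_closed)
 show "A \<in> phi_local X S Q ==> op_scale c A \<in> phi_local X S Q"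
  using phi_bullet_simps(4)[of A c] q c(5)[of "phi_bullet X A" c] by (simp add: phi_local_def local_algebra_closed)
 show "A \<in> phi_local X S Q ==> adj A \<in> phi_local X S Q"
  using phi_bullet_simps(5)[of A] q c(6)[of "phi_bullet X A"] by (simp add: phi_local_def local_algebra_closed)
 show "id_blinfun \<in> phi_local X S Q"
  using phi_bullet_simps(6) c(2) by (simp add: phi_local_def local_algebra_closed)
qed

lemma phi_local_mono:
 assumes "Q \<subseteq> R" "R \<in> \<K>" shows "phi_local X S Q \<subseteq> phi_local X S R"
 using local_algebra_mono[OF assms] bullet_local_mono[OF assms] by (auto simp: phi_local_def)

text \<open>The union of the local algebras \<open>\<A>\<^sub>\<phi>(O)\<close>.\<close>

definition phi_union :: "'h op set"
 where "phi_union = (\<Union>Q\<in>\<K>. phi_local X S Q)"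

lemma base_cone_mono: "c <= a ==> b <= d ==> base_cone a b \<subseteq> base_cone c d"
 by (auto simp: base_cone_iff)

lemma phi_union_common:
 assumes "A \<in> phi_union" "B \<in> phi_union"
 shows "\<exists>Q\<in>\<K>. A \<in> phi_local X S Q \<and> B \<in> phi_local X S Q"
proof -
 obtain Q R where Q: "Q \<in> \<K>" "A \<in> phi_local X S Q" and R: "R \<in> \<K>" "B \<in> phi_local X S R"
  using assms unfolding phi_union_def by blast
 obtain M where M: "M > 0" "Q \<subseteq> dc M" "closure Q \<subseteq> dc M"
  by (rule double_cone_in_base_cone[OF Q(1)])
 obtain N where N: "N > 0" "R \<subseteq> dc N" "closure R \<subseteq> dc N"
  by (rule double_cone_in_base_cone[OF R(1)])
 define P where "P = base_cone (- max M N) (max M N)"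
 have P: "P \<in> \<K>" unfolding P_def by (rule base_cone_double_cone) (use M(1) in linarith)
 have "dc M \<subseteq> P" unfolding P_def by (rule base_cone_mono) auto
 hence QP: "Q \<subseteq> P" by (rule order_trans[OF M(2)])
 have "dc N \<subseteq> P" unfolding P_def by (rule base_cone_mono) auto
 hence RP: "R \<subseteq> P" by (rule order_trans[OF N(2)])
 show ?thesis
  using subsetD[OF phi_local_mono[OF QP P] Q(2)] subsetD[OF phi_local_mono[OF RP P] R(2)] P by blast
qed

lemma phi_union_quasilocal: "phi_union \<subseteq> \<Q>"
 unfolding phi_union_def using phi_local_quasilocal by blast

lemma phi_algebra_eq: "PA = closure phi_union"
 by (simp add: phi_algebra_def phi_union_def)

lemma phi_union_closed:
 shows "A \<in> phi_union ==> B \<in> phi_union ==> A + B \<in> phi_union"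
  "A \<in> phi_union ==> B \<in> phi_union ==> A oo B \<in> phi_union"
  "A \<in> phi_union ==> op_scale c A \<in> phi_union"
  "A \<in> phi_union ==> adj A \<in> phi_union"
  "id_blinfun \<in> phi_union" "0 \<in> phi_union"
proof -
 show "A \<in> phi_union ==> B \<in> phi_union ==> A + B \<in> phi_union"
  using phi_union_common[of A B] phi_local_closed(1) unfolding phi_union_def by blast
 show "A \<in> phi_union ==> B \<in> phi_union ==> A oo B \<in> phi_union"
  using phi_union_common[of A B] phi_local_closed(2) unfolding phi_union_def by blast
 show sc: "A \<in> phi_union ==> op_scale c A \<in> phi_union" for A c
  using phi_local_closed(3) unfolding phi_union_def by blast
 show "A \<in> phi_union ==> adj A \<in> phi_union"
  using phi_local_closed(4) unfolding phi_union_def by blast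
 have "base_cone 0 1 \<in> \<K>" by (rule base_cone_double_cone) simp
 thus one: "id_blinfun \<in> phi_union" using phi_local_closed(5) unfolding phi_union_def by blast
 show "0 \<in> phi_union" using sc[OF one, of 0] by (simp add: op_scale_simps)
qed

lemma quasilocal_is_closed: "closed \<Q>"
 by (simp add: quasilocal_def)

lemma phi_algebra_quasilocal: "PA \<subseteq> \<Q>"
 unfolding phi_algebra_eq by (rule closure_minimal[OF phi_union_quasilocal quasilocal_is_closed])

lemma phi_algebra_sequence:
 "A \<in> PA ==> \<exists>s. (\<forall>n::nat. s n \<in> phi_union) \<and> s ---> A"
 unfolding phi_algebra_eq closure_sequential .

lemma phi_algebra_limit: "(!!n::nat. s n \<in> phi_union) ==> s ---> A ==> A \<in> PA"
 unfolding phi_algebra_eq closure_sequential by blast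

lemma phi_union_incl: "phi_union \<subseteq> PA"
 unfolding phi_algebra_eq by (rule closure_subset)

lemma phi_algebra_cstar: "cstar_algebra (operator_algebra PA)"
proof (rule cstar_algebra_operator_algebra)
 show sub: "PA \<subseteq> \<B>" using phi_algebra_quasilocal quasilocal_bounded_ops by (rule order_trans)
 have sb: "s \<in> \<B>" if "s \<in> phi_union" for s using that sub phi_union_incl by blast
 show "closed PA" by (simp add: phi_algebra_eq)
 show "0 \<in> PA" "id_blinfun \<in> PA" using phi_union_closed(5,6) phi_union_incl by auto
 fix A assume A: "A \<in> PA"
 obtain s where s: "!!n::nat. s n \<in> phi_union" "s ---> A" using phi_algebra_sequence[OF A] by blast
 show "op_scale c A \<in> PA" for c
 proof (rule phi_algebra_limit[where s = "\<lambda>n. op_scale c (s n)"])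
  show "op_scale c (s n) \<in> phi_union" for n by (rule phi_union_closed(3)[OF s(1)])
  show "(\<lambda>n. op_scale c (s n)) ---> op_scale c A"
   by (rule tendsto_op_scale[OF s(2) subsetD[OF sub A] sb[OF s(1)]])
 qed
 show "adj A \<in> PA"
 proof (rule phi_algebra_limit[where s = "\<lambda>n. adj (s n)"])
  show "adj (s n) \<in> phi_union" for n by (rule phi_union_closed(4)[OF s(1)])
  show "(\<lambda>n. adj (s n)) ---> adj A" by (rule tendsto_adj[OF s(2) sb[OF s(1)] subsetD[OF sub A]])
 qed
 fix B assume B: "B \<in> PA"
 obtain t where t: "!!n::nat. t n \<in> phi_union" "t ---> B" using phi_algebra_sequence[OF B] by blast
 show "A + B \<in> PA"
 proof (rule phi_algebra_limit[where s = "\<lambda>n. s n + t n"])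
  show "s n + t n \<in> phi_union" for n by (rule phi_union_closed(1)[OF s(1) t(1)])
 qed (rule tendsto_add[OF s(2) t(2)])
 show "A oo B \<in> PA"
 proof (rule phi_algebra_limit[where s = "\<lambda>n. s n oo t n"])
  show "s n oo t n \<in> phi_union" for n by (rule phi_union_closed(2)[OF s(1) t(1)])
 qed (rule tendsto_compose[OF s(2) t(2)])
qed

lemma phi_bullet_bounded: assumes A: "A \<in> \<Q>" shows "phi_bullet X A \<in> \<F>"
proof (rule bounded_functionsI)
 fix l :: real
 show "phi_bullet X A l \<in> \<B>" if l: "l > 0"
  using subsetD[OF quasilocal_bounded_ops dil_simps(1)[OF l A]] l by (simp add: phi_bullet_def)
 show "norm (phi_bullet X A l) <= norm A" if l: "l > 0" using norm_dil_le[OF l A] l by (simp add: phi_bullet_def)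
 show "phi_bullet X A l = 0" if "l <= 0" using that by (simp add: phi_bullet_def)
qed

lemma phi_bullet_diff_le:
 assumes A: "A \<in> \<Q>" "B \<in> \<Q>"
 shows "sup_norm (\<lambda>l. phi_bullet X A l - phi_bullet X B l) <= norm (A - B)"
proof (rule sup_norm_leI)
 fix l :: real assume l: "l > 0"
 have "norm (dil X l (A - B)) <= norm (A - B)" by (rule norm_dil_le[OF l quasilocal_closed(5)[OF A]])
 thus "norm (phi_bullet X A l - phi_bullet X B l) <= norm (A - B)"
  using l by (simp add: phi_bullet_def dil_diff[OF l A])
qed

lemma Union_bullet_local_bounded: "(\<Union>Q\<in>\<K>. BL Q) \<subseteq> \<F>"
 using bullet_local_bounded by blast

lemma bullet_algebraI:
 assumes "A \<in> \<F>" "!!e. e > 0 ==> \<exists>B\<in>BA. sup_norm (\<lambda>l. A l - B l) < e"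
 shows "A \<in> BA"
 unfolding bullet_algebra_def
 by (rule sup_closure_idem[OF assms(1) Union_bullet_local_bounded assms(2)[unfolded bullet_algebra_def]])

lemma phi_bullet_union: "A \<in> phi_union ==> phi_bullet X A \<in> BA"
 by (auto simp: phi_union_def phi_local_def dest: subsetD[OF bullet_local_algebra])

lemma phi_bullet_algebra: assumes A: "A \<in> PA" shows "phi_bullet X A \<in> BA"
proof (rule bullet_algebraI)
 have q: "A \<in> \<Q>" using A phi_algebra_quasilocal by blast
 show "phi_bullet X A \<in> \<F>" by (rule phi_bullet_bounded[OF q])
 fix e :: real assume "e > 0"
 then obtain B where B: "B \<in> phi_union" "dist B A < e"
  using A[unfolded phi_algebra_eq closure_approachable, rule_format, of e] by blast
 have "sup_norm (\<lambda>l. phi_bullet X A l - phi_bullet X B l) <= norm (A - B)"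
  by (rule phi_bullet_diff_le[OF q subsetD[OF phi_union_quasilocal B(1)]])
 hence "sup_norm (\<lambda>l. phi_bullet X A l - phi_bullet X B l) < e" using B(2) by (simp add: dist_norm norm_minus_commute)
 thus "\<exists>B\<in>BA. sup_norm (\<lambda>l. phi_bullet X A l - B l) < e"
  by (rule bexI[OF _ phi_bullet_union[OF B(1)]])
qed

end

section \<open>The sector morphisms\<close>

lemma symp_ifun: "symp (ifun v) (ifun v') = 0"
proof -
 have "cnj (ifun v x) * ifun v' x = of_real (v x * v' x)" for x
  by (simp add: ifun_def complex_eq_iff)
 hence "(LINT x|lborel. cnj (ifun v x) * ifun v' x) = of_real (LINT x|lborel. v x * v' x)"
  by (simp flip: integral_complex_of_real)
 thus ?thesis by (simp add: symp_def)
qed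

lemma dilate_ifun: "dilate l (ifun v) = ifun (\<lambda>x. v (x / l))"
 by (simp add: fun_eq_iff dilate_def ifun_def)

lemma ifun_test:
 assumes "(\<lambda>x. complex_of_real (v x)) \<in> \<D>" "l > 0"
 shows "ifun (\<lambda>x. v (x / l)) \<in> \<D>"
proof -
 obtain L where L: "!!x. \<bar>x\<bar> > L ==> complex_of_real (v x) = 0" using test_supportE[OF assms(1)] by blast
 have "smooth_fun (\<lambda>x. (\<lambda>x. complex_of_real (v x)) (x / l + 0))"
  by (rule smooth_compose_affine[OF bounded_linear_divide test_smooth[OF assms(1)]])
 hence "(\<lambda>x. complex_of_real (v (x / l))) \<in> \<D>"
  using L assms(2) by (intro test_functionsI[of _ "L * l"]) (simp_all add: pos_less_divide_eq)
 from test_scale[OF this, of \<i>] show ?thesis by (simp add: ifun_def)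
qed

text \<open>A scaling limit with charge functions \<open>u\<close> and the sector automorphism \<open>\<rho>\<close> that they define.\<close>

locale sector_field = scaling_field m X S for m X
 and S :: "('i, 'h::complex_hilbert, 'k::complex_hilbert) scaling_limit" +
 fixes u :: "nat => real => real" and q a :: real and \<rho> :: "'k op => 'k op"
 assumes weyl_bullet: "\<forall>f\<in>\<D>. scaled_weyl X f \<in> BA"
  and a_pos: "a > 0" and charge: "charge_functions q a u" and sector: "is_sector_automorphism X S u \<rho>"
begin

abbreviation "ra \<equiv> rho_approx X u"

text \<open>The test function \<open>\<delta>\<^sub>l(i u\<^sub>n)\<close> and its Weyl operator.\<close>

definition z :: "nat => real => real => complex" where "z n l = ifun (\<lambda>x. u n (x / l))"

abbreviation W :: "nat => real => 'h op" where "W n l \<equiv> w (z n l)"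

lemma u_test: "(\<lambda>x. of_real (u n x)) \<in> \<D>"
 using charge by (simp add: charge_functions_def)

lemma z_test [simp]: "l > 0 ==> z n l \<in> \<D>"
 unfolding z_def by (rule ifun_test[OF u_test])

lemma ifun_u_test: "ifun (u n) \<in> \<D>"
 using ifun_test[OF u_test, of 1 n] by simp

lemma scaled_weyl_eq: "scaled_weyl X (ifun (u n)) = on_pos (\<lambda>l. W n l)"
 by (simp add: scaled_weyl_def dilate_ifun z_def)

lemma scaled_weyl_bullet: "scaled_weyl X (ifun (u n)) \<in> BA"
 using weyl_bullet ifun_u_test by blast

lemma rho_approx_eq: "l > 0 ==> ra l B n = adj (W n l) oo dil X l B oo W n l"
 by (simp add: rho_approx_def scaled_weyl_eq)

lemma u_agree:
 assumes n: "real N * a >= M" "n >= N" and x: "- M < x" "x < M"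
 shows "u n x = u N x"
proof -
 note ch = charge[unfolded charge_functions_def, THEN conjunct2]
 note c = ch[THEN conjunct1, rule_format] ch[THEN conjunct2, THEN conjunct1, rule_format]
  ch[THEN conjunct2, THEN conjunct2, rule_format]
 have le: "real N * a <= real n * a" using n(2) a_pos by simp
 consider "x <= - a" | "- a < x" "x < a" | "a <= x" by linarith
 thus ?thesis
 proof cases
  case 1 thus ?thesis using c(1)[of x n] c(1)[of x N] by simp
 next
  case 2 thus ?thesis by (intro c(2) conjI)
 next
  case 3
  hence "x <= real N * a" "x <= real n * a" using n(1) x(2) le by linarith+
  thus ?thesis using c(3)[of x n] c(3)[of x N] 3 by simp
 qed
qed

text \<open>For \<open>x < n a\<close> the functions \<open>u\<^sub>n\<close> agree, so \<open>W(i u\<^sub>n)\<close> and \<open>W(i u\<^sub>N)\<close> differ by a Weyl operator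
 localized to the right. By locality the sequence defining \<open>\<rho>\<^sub>\<lambda>\<close> is eventually constant on local
 elements, from an index that does not depend on \<open>\<lambda>\<close>.\<close>

lemma conj_W_stable:
 assumes l: "l > 0" and Q: "Q \<subseteq> dc M" and N: "real N * a >= M" "n >= N"
  and T: "T \<in> \<A> (scale_region l Q)"
 shows "adj (W n l) oo T oo W n l = adj (W N l) oo T oo W N l"
proof -
 define h where "h = ifun (\<lambda>x. u n (x / l) - u N (x / l))"
 have hz: "h = (\<lambda>x. z n l x - z N l x)" by (simp add: h_def z_def ifun_def right_diff_distrib)
 have ht: "h \<in> \<D>" unfolding hz using l by (intro test_diff z_test)
 have "symp h (z N l) = 0" unfolding h_def z_def by (rule symp_ifun)
 hence Wn: "W n l = w h oo W N l" using w_mult[OF ht z_test[OF l, of N]] by (simp add: hz)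
 have "h x = 0" if x: "l * (- M) < x" "x < l * M" for x
 proof -
  have "- M < x / l" "x / l < M" using x l by (simp_all add: pos_less_divide_eq pos_divide_less_eq mult.commute)
  thus ?thesis using u_agree[OF N] by (simp add: h_def ifun_def)
 qed
 moreover have "scale_region l Q \<subseteq> base_cone (l * (- M)) (l * M)"
  using scale_region_mono[OF Q, of l] by (simp only: scale_base_cone[OF l])
 ultimately have comm: "T oo w h = w h oo T" by (intro w_commute_local_algebra[OF ht _ _ T])
 have adjW: "adj (W n l) = adj (W N l) oo adj (w h)" unfolding Wn using ht l by (simp add: adj_compose)
 have "adj (W n l) oo T oo W n l = adj (W N l) oo adj (w h) oo (T oo w h) oo W N l"
  unfolding adjW by (subst Wn) (simp only: compose_assoc)
 also have "... = adj (W N l) oo (adj (w h) oo w h) oo T oo W N l" unfolding comm by (simp only: compose_assoc)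
 finally show ?thesis using ht by (simp add: w_unitary)
qed

lemma norm_w_le: "f \<in> \<D> ==> norm (w f) <= 1"
 by (rule norm_blinfun_bound) (simp_all add: norm_w_apply)

lemma norm_conj_W_le: assumes l: "l > 0" shows "norm (adj (W n l) oo T oo W n l) <= norm T"
proof -
 have "norm (adj (W n l) oo T oo W n l) <= norm (adj (W n l)) * norm T * norm (W n l)" by (rule norm_compose3_le)
 also have "... <= 1 * norm T * 1"
  using l by (intro mult_mono) (simp_all add: norm_adj norm_w_le)
 finally show ?thesis by simp
qed

lemma rho_approx_quasilocal:
 assumes "l > 0" "B \<in> \<Q>" shows "ra l B n \<in> \<Q>"
 using assms by (simp add: rho_approx_eq quasilocal_closed dil_simps w_quasilocal)

lemma rho_approx_diff_le:
 assumes l: "l > 0" and BC: "B \<in> \<Q>" "C \<in> \<Q>"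
 shows "norm (ra l B n - ra l C n) <= norm (B - C)"
 using rho_approx_eq l dil_diff[OF l BC] compose_add order_trans[OF norm_conj_W_le[OF l] norm_dil_le[OF l quasilocal_closed(5)[OF BC]]] by simp

text \<open>From \<open>N\<close> on the sequences defining \<open>\<rho>\<^sub>\<lambda>(B)\<close> are constant, for all \<open>\<lambda>\<close> at once.\<close>

definition stable_index :: "'h op => nat => bool"
 where "stable_index B N \<longleftrightarrow> (\<forall>l>0. \<forall>n\<ge>N. ra l B n = ra l B N)"

lemma stable_index_exists:
 assumes "B \<in> phi_union" shows "\<exists>N. stable_index B N"
proof -
 obtain Q where Q: "Q \<in> \<K>" "B \<in> phi_local X S Q" using assms unfolding phi_union_def by blast
 obtain M where M: "M > 0" "Q \<subseteq> dc M" "closure Q \<subseteq> dc M"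
  by (rule double_cone_in_base_cone[OF Q(1)])
 obtain N where "M / a < real N" using reals_Archimedean2 by blast
 hence N: "real N * a >= M" using a_pos by (simp add: pos_divide_less_eq)
 have "dil X l B \<in> \<A> (scale_region l Q)" if "l > 0" for l
  using Q(2) that by (auto simp: phi_local_def bullet_local_def phi_bullet_def)
 hence "ra l B n = ra l B N" if "l > 0" "n >= N" for l n
  unfolding rho_approx_eq[OF that(1)] using that by (intro conj_W_stable[OF _ M(2) N])
 thus ?thesis unfolding stable_index_def by blast
qed

lemma rho_approx_tendsto_union:
 assumes "stable_index B N" "l > 0" shows "ra l B ---> ra l B N"
 by (rule tendsto_eventually, rule eventually_sequentiallyI[of N]) (rule assms(1)[unfolded stable_index_def, rule_format, OF assms(2)])

text \<open>On the closure, convergence follows from the stable case since conjugation and dilations are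
 contractive.\<close>

lemma rho_approx_convergent:
 assumes l: "l > 0" and B: "B \<in> PA" shows "convergent (ra l B)"
proof -
 have Bq: "B \<in> \<Q>" using B phi_algebra_quasilocal by blast
 have "Cauchy (ra l B)"
 proof (rule CauchyI)
  fix e :: real assume e: "e > 0"
  hence e3: "e / 3 > 0" by simp
  obtain C where C: "C \<in> phi_union" "dist C B < e / 3"
   using B[unfolded phi_algebra_eq closure_approachable, rule_format, OF e3] by blast
  have Cq: "C \<in> \<Q>" using C(1) phi_union_quasilocal by blast
  obtain N where N: "stable_index C N" using stable_index_exists[OF C(1)] by blast
  have d: "norm (ra l B n - ra l C N) < e / 3" if "n >= N" for n
  proof -
   have "ra l C n = ra l C N"
    by (rule N[unfolded stable_index_def, rule_format, OF l that])
   thus ?thesis using rho_approx_diff_le[OF l Bq Cq, of n] C(2) by (simp add: dist_norm norm_minus_commute)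
  qed
  show "\<exists>N. \<forall>i\<ge>N. \<forall>j\<ge>N. norm (ra l B i - ra l B j) < e"
  proof (intro exI allI impI)
   fix i j assume ij: "N <= i" "N <= j"
   have "norm (ra l B i - ra l B j) =
     norm ((ra l B i - ra l C N) - (ra l B j - ra l C N))" by simp
   also have "... <= norm (ra l B i - ra l C N) + norm (ra l B j - ra l C N)"
    by (rule norm_triangle_ineq4)
   finally show "norm (ra l B i - ra l B j) < e" using d[OF ij(1)] d[OF ij(2)] e by linarith
  qed
 qed
 thus ?thesis by (rule Cauchy_convergent)
qed

lemma rho_approx_tendsto:
 "l > 0 ==> B \<in> PA ==> ra l B ---> rho_scale X u l B"
 unfolding rho_scale_def using rho_approx_convergent by (simp add: convergent_LIMSEQ_iff)

lemma rho_scale_quasilocal: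
 assumes "l > 0" "B \<in> PA" shows "rho_scale X u l B \<in> \<Q>"
 using closed_sequentially[OF quasilocal_is_closed] rho_approx_quasilocal[OF assms(1) subsetD[OF phi_algebra_quasilocal assms(2)]] rho_approx_tendsto[OF assms] by blast

lemma rho_scale_eqI: "l > 0 ==> B \<in> PA ==> ra l B ---> T ==> rho_scale X u l B = T"
 by (rule LIMSEQ_unique[OF rho_approx_tendsto])

lemma rho_scale_union: "stable_index B N ==> B \<in> phi_union ==> l > 0 ==> rho_scale X u l B = ra l B N"
 by (rule rho_scale_eqI) (auto intro: rho_approx_tendsto_union subsetD[OF phi_union_incl])

lemma rho_scale_diff_le:
 assumes l: "l > 0" and BC: "B \<in> PA" "C \<in> PA"
 shows "norm (rho_scale X u l B - rho_scale X u l C) <= norm (B - C)"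
proof (rule LIMSEQ_le_const2)
 show "(\<lambda>n. norm (ra l B n - ra l C n)) ---> norm (rho_scale X u l B - rho_scale X u l C)"
  by (intro tendsto_norm tendsto_diff rho_approx_tendsto l BC)
 have q: "B \<in> \<Q>" "C \<in> \<Q>" using BC phi_algebra_quasilocal by auto
 show "\<exists>N. \<forall>n\<ge>N. norm (ra l B n - ra l C n) <= norm (B - C)"
  using rho_approx_diff_le[OF l q] by blast
qed

lemma rho_scale_morphism:
 assumes l: "l > 0"
 shows "cstar_morphism (operator_algebra PA) (operator_algebra \<Q>) (rho_scale X u l)"
proof -
 note c = cstar_closed[OF phi_algebra_cstar, simplified]
 have q: "B \<in> \<Q>" if "B \<in> PA" for B using that phi_algebra_quasilocal by blast
 have b: "dil X l B \<in> \<B>" if "B \<in> PA" for B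
  by (rule subsetD[OF quasilocal_bounded_ops dil_simps(1)[OF l q[OF that]]])
 have Wb: "W n l \<in> \<B>" "adj (W n l) \<in> \<B>" for n using l by simp_all
 have WW: "W n l oo (adj (W n l) oo T) = T" "adj (W n l) oo W n l = id_blinfun" for n T
  using w_unitary[OF z_test[OF l, of n]] by (simp_all flip: compose_assoc)
 have rb: "ra l B n \<in> \<B>" "rho_scale X u l B \<in> \<B>" if "B \<in> PA" for B n
  using rho_approx_quasilocal[OF l q[OF that]] rho_scale_quasilocal[OF l that] quasilocal_bounded_ops by auto
 have "rho_scale X u l id_blinfun = id_blinfun"
 proof (rule rho_scale_eqI[OF l c(2)])
  have "ra l id_blinfun = (\<lambda>n. id_blinfun)" by (simp add: fun_eq_iff rho_approx_eq l dil_simps WW)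
  thus "ra l id_blinfun ---> id_blinfun" by simp
 qed
 moreover have "rho_scale X u l (A + B) = rho_scale X u l A + rho_scale X u l B"
  if A: "A \<in> PA" and B: "B \<in> PA" for A B
 proof (rule rho_scale_eqI[OF l c(3)[OF A B]])
  have "ra l (A + B) = (\<lambda>n. ra l A n + ra l B n)"
   by (simp add: fun_eq_iff rho_approx_eq l dil_simps q A B compose_add)
  thus "ra l (A + B) ---> rho_scale X u l A + rho_scale X u l B"
   using tendsto_add[OF rho_approx_tendsto[OF l A] rho_approx_tendsto[OF l B]] by simp
 qed
 moreover have "rho_scale X u l (A oo B) = rho_scale X u l A oo rho_scale X u l B"
  if A: "A \<in> PA" and B: "B \<in> PA" for A B
 proof (rule rho_scale_eqI[OF l c(4)[OF A B]])
  have "ra l (A oo B) = (\<lambda>n. ra l A n oo ra l B n)"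
   by (simp add: fun_eq_iff rho_approx_eq l dil_simps q A B WW compose_assoc)
  thus "ra l (A oo B) ---> (rho_scale X u l A oo rho_scale X u l B)"
   using tendsto_compose[OF rho_approx_tendsto[OF l A] rho_approx_tendsto[OF l B]] by simp
 qed
 moreover have "rho_scale X u l (op_scale c A) = op_scale c (rho_scale X u l A)" if A: "A \<in> PA" for c A
 proof (rule rho_scale_eqI[OF l c(5)[OF A]])
  have "ra l (op_scale c A) = (\<lambda>n. op_scale c (ra l A n))"
   by (simp add: fun_eq_iff rho_approx_eq l dil_simps q A op_scale_simps)
  thus "ra l (op_scale c A) ---> op_scale c (rho_scale X u l A)"
   using tendsto_op_scale[OF rho_approx_tendsto[OF l A] rb(2)[OF A] rb(1)[OF A]] by simp
 qed
 moreover have "rho_scale X u l (adj A) = adj (rho_scale X u l A)" if A: "A \<in> PA" for A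
 proof (rule rho_scale_eqI[OF l c(6)[OF A]])
  have "ra l (adj A) = (\<lambda>n. adj (ra l A n))"
   by (simp add: fun_eq_iff rho_approx_eq l dil_simps q A adj_compose b compose_assoc)
  thus "ra l (adj A) ---> adj (rho_scale X u l A)"
   using tendsto_adj[OF rho_approx_tendsto[OF l A] rb(1)[OF A] rb(2)[OF A]] by simp
 qed
 moreover have "rho_scale X u l ` PA \<subseteq> \<Q>" using rho_scale_quasilocal[OF l] by blast
 ultimately show ?thesis by (simp add: cstar_morphism_def phi_algebra_cstar quasilocal_cstar)
qed

end

context sector_field begin

lemma rho_bullet_bounded: assumes B: "B \<in> PA" shows "rho_bullet X u B \<in> \<F>"
proof (rule bounded_functionsI)
 fix l :: real
 show "rho_bullet X u B l \<in> \<B>" if l: "l > 0"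
  using subsetD[OF quasilocal_bounded_ops rho_scale_quasilocal[OF l B]] l by (simp add: rho_bullet_def)
 show "norm (rho_bullet X u B l) <= norm B" if l: "l > 0"
  using cstar_morphism_norm_le[OF rho_scale_morphism[OF l] quasilocal_bounded_ops, of B] l B by (simp add: rho_bullet_def)
 show "rho_bullet X u B l = 0" if "l <= 0" using that by (simp add: rho_bullet_def)
qed

lemma rho_bullet_diff_le:
 assumes B: "B \<in> PA" "C \<in> PA"
 shows "sup_norm (\<lambda>l. rho_bullet X u B l - rho_bullet X u C l) <= norm (B - C)"
 by (rule sup_norm_leI) (simp add: rho_bullet_def rho_scale_diff_le B)

lemma rho_bullet_union:
 assumes N: "stable_index B N" and B: "B \<in> phi_union"
 shows "rho_bullet X u B = (\<lambda>l. adj (scaled_weyl X (ifun (u N)) l) oo phi_bullet X B l oo scaled_weyl X (ifun (u N)) l)"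
proof
 fix l :: real
 show "rho_bullet X u B l = adj (scaled_weyl X (ifun (u N)) l) oo phi_bullet X B l oo scaled_weyl X (ifun (u N)) l"
 proof (cases "l > 0")
  case True
  have "rho_scale X u l B = ra l B N" by (rule rho_scale_union[OF N B True])
  thus ?thesis using True by (simp add: rho_bullet_def phi_bullet_def rho_approx_def)
 next
  case False
  thus ?thesis by (simp add: rho_bullet_def phi_bullet_def)
 qed
qed

lemma stable_index_mono: "stable_index B N ==> N <= n ==> stable_index B n"
 unfolding stable_index_def by (metis order_trans)

lemma rho_bullet_union_algebra:
 assumes N: "stable_index B N" and B: "B \<in> phi_union"
 shows "rho_bullet X u B \<in> BA"
  "\<pi>b (rho_bullet X u B) =
   adj (limit_weyl X S (ifun (u N))) oo \<pi>b (phi_bullet X B) oo limit_weyl X S (ifun (u N))"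
proof -
 let ?W = "scaled_weyl X (ifun (u N))"
 note W = scaled_weyl_bullet[of N] and phi = phi_bullet_union[OF B]
 have aW: "(\<lambda>l. adj (?W l)) \<in> BA" by (rule bullet_algebra_closed(6)[OF W])
 have p: "(\<lambda>l. adj (?W l) oo phi_bullet X B l) \<in> BA" by (rule bullet_algebra_closed(4)[OF aW phi])
 show "rho_bullet X u B \<in> BA"
  unfolding rho_bullet_union[OF assms] by (rule bullet_algebra_closed(4)[OF p W])
 show "\<pi>b (rho_bullet X u B) =
   adj (limit_weyl X S (ifun (u N))) oo \<pi>b (phi_bullet X B) oo limit_weyl X S (ifun (u N))"
  unfolding rho_bullet_union[OF assms] limit_weyl_def ext_simps(3)[OF p W] ext_simps(3)[OF aW phi] ext_simps(5)[OF W] ..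
qed

lemma rho_bullet_algebra: assumes B: "B \<in> PA" shows "rho_bullet X u B \<in> BA"
proof (rule bullet_algebraI[OF rho_bullet_bounded[OF B]])
 fix e :: real assume "e > 0"
 then obtain C where C: "C \<in> phi_union" "dist C B < e"
  using B[unfolded phi_algebra_eq closure_approachable, rule_format, of e] by blast
 have "sup_norm (\<lambda>l. rho_bullet X u B l - rho_bullet X u C l) <= norm (B - C)"
  by (rule rho_bullet_diff_le[OF B subsetD[OF phi_union_incl C(1)]])
 hence "sup_norm (\<lambda>l. rho_bullet X u B l - rho_bullet X u C l) < e" using C(2) by (simp add: dist_norm norm_minus_commute)
 moreover obtain N where "stable_index C N" using stable_index_exists[OF C(1)] by blast
 ultimately show "\<exists>D\<in>BA. sup_norm (\<lambda>l. rho_bullet X u B l - D l) < e"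
  using rho_bullet_union_algebra(1)[OF _ C(1)] by blast
qed

lemma limit_quasilocal_cstar: "cstar_algebra (operator_algebra QL)"
 using ext_morphism by (simp add: cstar_morphism_def)

lemmas limit_quasilocal_closed = cstar_closed[OF limit_quasilocal_cstar, simplified]

lemma sector_morphism: "cstar_morphism (operator_algebra QL) (operator_algebra QL) \<rho>"
 using sector by (simp add: is_sector_automorphism_def cstar_automorphism_def)

lemma limit_quasilocal_diff: "A \<in> QL ==> B \<in> QL ==> A - B \<in> QL"
 using limit_quasilocal_closed(3)[of A "op_scale (-1) B"] limit_quasilocal_closed(5)[of B "-1"] by (simp add: op_scale_simps)

lemma sector_diff_le:
 assumes "A \<in> QL" "B \<in> QL"
 shows "norm (\<rho> A - \<rho> B) <= norm (A - B)"
proof -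
 have B: "op_scale (-1) B \<in> QL" by (rule limit_quasilocal_closed(5)[OF assms(2)])
 have "\<rho> (A + op_scale (-1) B) = \<rho> A + op_scale (-1) (\<rho> B)"
  using sector_morphism assms B by (simp add: cstar_morphism_def)
 hence "\<rho> (A - B) = \<rho> A - \<rho> B" by (simp add: op_scale_simps)
 thus ?thesis
  using cstar_morphism_norm_le[OF sector_morphism limit_quasilocal_bounded_ops, of "A - B"] limit_quasilocal_diff[OF assms] by simp
qed

lemma scaled_weyl_unitary:
 "(\<lambda>l. adj (scaled_weyl X (ifun (u n)) l) oo scaled_weyl X (ifun (u n)) l) = on_pos (\<lambda>_. id_blinfun)"
proof
 fix l :: real
 show "adj (scaled_weyl X (ifun (u n)) l) oo scaled_weyl X (ifun (u n)) l = on_pos (\<lambda>_. id_blinfun) l"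
  by (cases "l > 0") (simp_all add: scaled_weyl_eq w_unitary)
qed

lemma limit_weyl_norm: "limit_weyl X S (ifun (u n)) \<in> \<B>" "norm (limit_weyl X S (ifun (u n))) <= 1"
proof -
 let ?W = "scaled_weyl X (ifun (u n))"
 note W = scaled_weyl_bullet[of n]
 show b: "limit_weyl X S (ifun (u n)) \<in> \<B>"
  unfolding limit_weyl_def by (rule subsetD[OF limit_quasilocal_bounded_ops ext_simps(1)[OF W]])
 have "adj (limit_weyl X S (ifun (u n))) oo limit_weyl X S (ifun (u n)) = id_blinfun"
  unfolding limit_weyl_def ext_simps(5)[OF W, symmetric] ext_simps(3)[OF bullet_algebra_closed(6)[OF W] W, symmetric]
   scaled_weyl_unitary by (rule ext_simps(6))
 hence "(norm (limit_weyl X S (ifun (u n))))^2 = norm (id_blinfun :: 'k op)"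
  using norm_adj_compose_self[OF b] by simp
 also have "... <= 1" by (rule norm_blinfun_bound) simp_all
 finally show "norm (limit_weyl X S (ifun (u n))) <= 1" by (simp add: abs_square_le_1)
qed

text \<open>The sector automorphism is given by the same limit on the whole quasi-local algebra.\<close>

lemma sector_limit:
 assumes A: "A \<in> QL"
 shows "(\<lambda>n. adj (limit_weyl X S (ifun (u n))) oo A oo limit_weyl X S (ifun (u n))) ---> \<rho> A"
proof (rule LIMSEQ_I)
 fix e :: real assume e: "e > 0"
 let ?c = "\<lambda>n A. adj (limit_weyl X S (ifun (u n))) oo A oo limit_weyl X S (ifun (u n))"
 have e3: "e / 3 > 0" using e by simp
 obtain B Q where B: "Q \<in> \<K>" "B \<in> LL Q" "dist B A < e / 3"
  using A[unfolded limit_quasilocal_def closure_approachable, rule_format, OF e3] by blast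
 have Bq: "B \<in> QL"
  using B(1,2) unfolding limit_quasilocal_def by (intro subsetD[OF closure_subset]) blast
 have "(\<lambda>n. ?c n B) ---> \<rho> B" using sector B(1,2) unfolding is_sector_automorphism_def by blast
 then obtain N where N: "!!n. n >= N ==> norm (?c n B - \<rho> B) < e / 3" using LIMSEQ_D[OF _ e3] by blast
 have c: "norm (?c n A - ?c n B) <= norm (A - B)" for n
 proof -
  have "?c n A - ?c n B = ?c n (A - B)" by (rule blinfun_eqI) (simp add: blinfun.diff_left blinfun.diff_right)
  also have "norm ... <= norm (adj (limit_weyl X S (ifun (u n)))) * norm (A - B) * norm (limit_weyl X S (ifun (u n)))"
   by (rule norm_compose3_le)
  also have "... <= 1 * norm (A - B) * 1"
   by (intro mult_mono) (simp_all add: norm_adj limit_weyl_norm)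
  finally show ?thesis by simp
 qed
 show "\<exists>N. \<forall>n\<ge>N. norm (?c n A - \<rho> A) < e"
 proof (intro exI allI impI)
  fix n assume n: "N <= n"
  have "norm (?c n A - \<rho> A) = norm ((?c n A - ?c n B) + (?c n B - \<rho> B) + (\<rho> B - \<rho> A))" by simp
  also have "... <= norm (?c n A - ?c n B) + norm (?c n B - \<rho> B) + norm (\<rho> B - \<rho> A)"
   by (rule norm_triangle_le[OF add_right_mono[OF norm_triangle_ineq]])
  also have "... < e"
   using c[of n] N[OF n] sector_diff_le[OF Bq A] B(3) by (simp add: dist_norm norm_minus_commute)
  finally show "norm (?c n A - \<rho> A) < e" .
 qed
qed

lemma ext_rho_bullet:
 assumes B: "B \<in> PA"
 shows "\<pi>b (rho_bullet X u B) = \<rho> (\<pi>b (phi_bullet X B))"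
proof -
 have union: "\<pi>b (rho_bullet X u C) = \<rho> (\<pi>b (phi_bullet X C))" if C: "C \<in> phi_union" for C
 proof -
  obtain N where N: "stable_index C N" using stable_index_exists[OF C] by blast
  have q: "\<pi>b (phi_bullet X C) \<in> QL"
   by (rule ext_simps(1)[OF phi_bullet_union[OF C]])
  have "(\<lambda>n. adj (limit_weyl X S (ifun (u n))) oo \<pi>b (phi_bullet X C) oo limit_weyl X S (ifun (u n)))
    ---> \<pi>b (rho_bullet X u C)"
   by (simp add: tendsto_eventually eventually_sequentiallyI[of N] rho_bullet_union_algebra(2)[OF stable_index_mono[OF N] C])
  thus ?thesis using sector_limit[OF q] by (rule LIMSEQ_unique)
 qed
 obtain s where s: "!!n::nat. s n \<in> phi_union" "s ---> B" using phi_algebra_sequence[OF B] by blast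
 have sB: "s n \<in> PA" for n by (rule subsetD[OF phi_union_incl s(1)])
 have q: "A \<in> \<Q>" if "A \<in> PA" for A by (rule subsetD[OF phi_algebra_quasilocal that])
 have "(\<lambda>n. norm (s n - B)) ---> 0" by (rule tendsto_norm_zero[OF LIM_zero[OF s(2)]])
 note null = Lim_null_comparison[OF _ this]
 have 1: "norm (\<pi>b (rho_bullet X u (s n)) - \<pi>b (rho_bullet X u B)) <= norm (s n - B)" for n
  by (rule order_trans[OF norm_ext_diff_le[OF rho_bullet_algebra[OF sB] rho_bullet_algebra[OF B]] rho_bullet_diff_le[OF sB B]])
 have 2: "norm (\<rho> (\<pi>b (phi_bullet X (s n))) - \<rho> (\<pi>b (phi_bullet X B))) <= norm (s n - B)" for n
 proof -
  note p = phi_bullet_algebra[OF sB[of n]] phi_bullet_algebra[OF B]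
  show ?thesis
   by (rule order_trans[OF sector_diff_le[OF ext_simps(1)[OF p(1)] ext_simps(1)[OF p(2)]]
     order_trans[OF norm_ext_diff_le[OF p] phi_bullet_diff_le[OF q[OF sB] q[OF B]]]])
 qed
 have "(\<lambda>n. \<pi>b (rho_bullet X u (s n)) - \<pi>b (rho_bullet X u B)) ---> 0"
  by (rule null[OF always_eventually[OF allI[OF 1]]])
 from LIM_zero_cancel[OF this] have "(\<lambda>n. \<rho> (\<pi>b (phi_bullet X (s n)))) ---> \<pi>b (rho_bullet X u B)"
  by (simp add: union s(1))
 moreover have "(\<lambda>n. \<rho> (\<pi>b (phi_bullet X (s n))) - \<rho> (\<pi>b (phi_bullet X B))) ---> 0"
  by (rule null[OF always_eventually[OF allI[OF 2]]])
 from LIM_zero_cancel[OF this] have "(\<lambda>n. \<rho> (\<pi>b (phi_bullet X (s n)))) ---> \<rho> (\<pi>b (phi_bullet X B))" .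
 ultimately show ?thesis by (rule LIMSEQ_unique)
qed

text \<open>On local elements the functions \<open>\<rho>\<^sup>\<bullet>(B)\<close> are localized.\<close>

lemma rho_bullet_localized:
 assumes B: "B \<in> phi_union"
 shows "\<exists>M>0. \<forall>l>0. rho_bullet X u B l \<in> \<A> (scale_region l (dc M))"
proof -
 obtain Q where Q: "Q \<in> \<K>" "B \<in> phi_local X S Q" using B unfolding phi_union_def by blast
 obtain M where M: "M > 0" "Q \<subseteq> dc M" "closure Q \<subseteq> dc M"
  by (rule double_cone_in_base_cone[OF Q(1)])
 obtain N where N: "stable_index B N" using stable_index_exists[OF B] by blast
 obtain L where L: "L > 0" "!!x. \<bar>x\<bar> > L ==> ifun (u N) x = 0" using test_supportE[OF ifun_u_test] by blast
 define K where "K = max M (L + 1)"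
 have K: "K > 0" "L < K" "Q \<subseteq> dc K" "dc K \<in> \<K>"
  using M base_cone_mono[of "- K" "- M" M K] by (auto simp: K_def intro!: base_cone_double_cone)
 have "rho_bullet X u B l \<in> \<A> (scale_region l (dc K))" if l: "l > 0" for l
 proof -
  let ?R = "scale_region l (dc K)"
  have "dil X l B \<in> \<A> (scale_region l Q)"
   using Q(2) l by (auto simp: phi_local_def bullet_local_def phi_bullet_def)
  hence d: "dil X l B \<in> \<A> ?R"
   by (rule subsetD[OF local_algebra_mono[OF scale_region_mono[OF K(3)] scale_double_cone[OF l K(4)]]])
  have "z N l \<in> local_gens ?R"
  proof -
   have "z N l x = 0" if "\<bar>x\<bar> > l * L" for x
    using L(2)[of "x / l"] that l by (simp add: z_def ifun_def pos_less_divide_eq mult.commute)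
   hence "{x. z N l x ~= 0} \<subseteq> {- (l * L)..l * L}" by (force simp: abs_le_iff)
   hence "closure {x. z N l x ~= 0} \<subseteq> {- (l * L)..l * L}" by (rule closure_minimal) simp
   moreover have "l * L < l * K" using K(2) l by simp
   ultimately have "closure {x. z N l x ~= 0} \<subseteq> {l * (- K)<..<l * K}" by force
   moreover have "l * (- K) < l * K" using K(1) l by simp
   ultimately show ?thesis unfolding scale_base_cone[OF l] using z_test[OF l] by (intro local_gens_base_cone)
  qed
  hence W: "W N l \<in> \<A> ?R" by (rule w_local_gens)
  have "rho_bullet X u B l = adj (W N l) oo dil X l B oo W N l"
   using l by (simp add: rho_bullet_def rho_scale_union[OF N B] rho_approx_eq)
  thus ?thesis using d W by (simp add: local_algebra_closed)
 qed
 thus ?thesis using K(1) by blast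
qed

end

section \<open>Smearing over one-parameter groups\<close>

lemma integral_affine_diff_le:
 fixes F :: "real => 'b::banach"
 assumes F: "continuous_on UNIV F" "!!s. norm (F s) <= B" and k: "k > 0" and d: "d > 0"
 shows "norm (integral {-d..d} (\<lambda>s. F (k * s + r)) - integral {-d..d} F) <= (4 * \<bar>k - 1\<bar> * d + 2 * \<bar>r\<bar>) * B"
proof -
 define L where "L = k * d + \<bar>r\<bar> + d"
 have L: "- L <= - (k * d) + r" "k * d + r <= L" "- L <= - d" "d <= L" and kd: "k * d > 0"
 proof -
  show kd: "k * d > 0" using k d by simp
  show "- L <= - (k * d) + r" "k * d + r <= L" "- L <= - d" "d <= L"
   using d kd unfolding L_def by linarith+
 qed
 obtain \<Phi> where \<Phi>: "!!x. x \<in> {-L..L} ==> (\<Phi> has_vector_derivative F x) (at x within {-L..L})"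
  using antiderivative_continuous[of "-L" L F] continuous_on_subset[OF F(1)] by auto
 have ftc: "(F has_integral (\<Phi> b - \<Phi> a)) {a..b}" if "- L <= a" "a <= b" "b <= L" for a b
 proof (rule fundamental_theorem_of_calculus[OF that(2)])
  fix x assume "x \<in> {a..b}"
  hence "x \<in> {-L..L}" "{a..b} \<subseteq> {-L..L}" using that by auto
  thus "(\<Phi> has_vector_derivative F x) (at x within {a..b})"
   using \<Phi> has_vector_derivative_within_subset by blast
 qed
 have lip: "norm (\<Phi> b - \<Phi> a) <= B * (b - a)" if "- L <= a" "a <= b" "b <= L" for a b
 proof -
  have "norm (integral {a..b} F) <= B * (b - a)"
   using F(2) by (intro integral_bound that(2) continuous_on_subset[OF F(1)]) auto
  thus ?thesis using integral_unique[OF ftc[OF that]] by simp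
 qed
 have lip': "norm (\<Phi> b - \<Phi> a) <= B * \<bar>b - a\<bar>" if "- L <= a" "a <= L" "- L <= b" "b <= L" for a b
  using lip[of a b] lip[of b a] that by (cases "a <= b") (auto simp: norm_minus_commute)
 have B: "B >= 0" using F(2)[of 0] norm_ge_zero order_trans by blast
 define D where "D = \<Phi> (k * d + r) - \<Phi> (- (k * d) + r)"
 have D: "norm D <= B * (2 * (k * d))"
 proof -
  have *: "(k * d + r) - (- (k * d) + r) = 2 * (k * d)" by simp
  have "- (k * d) + r <= k * d + r" using kd by linarith
  from lip[OF L(1) this L(2)] show ?thesis unfolding D_def * .
 qed
 have i1: "integral {-d..d} F = \<Phi> d - \<Phi> (- d)" using ftc[OF L(3) _ L(4)] d by (intro integral_unique) simp
 have "(F has_integral D) (cbox (- (k * d) + r) (k * d + r))" unfolding D_def using ftc[OF L(1) _ L(2)] kd by simp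
 from has_integral_affinity'[OF this k, of r]
 have "((\<lambda>s. F (k * s + r)) has_integral (D /\<^sub>R k)) {-d..d}" using k by (simp flip: mult.assoc)
 hence i2: "integral {-d..d} (\<lambda>s. F (k * s + r)) = D /\<^sub>R k" by (rule integral_unique)
 have "D /\<^sub>R k - (\<Phi> d - \<Phi> (- d)) = ((1 - k) / k) *\<^sub>R D + ((\<Phi> (k * d + r) - \<Phi> d) - (\<Phi> (- (k * d) + r) - \<Phi> (- d)))"
 proof -
  have "((1 - k) / k) *\<^sub>R D = D /\<^sub>R k - D"
  proof -
   have "(1 - k) / k = inverse k - 1" using k by (simp add: field_simps)
   thus ?thesis by (simp add: scaleR_diff_left)
  qed
  thus ?thesis by (simp add: D_def)
 qed
 also have "norm ... <= norm (((1 - k) / k) *\<^sub>R D) + (norm (\<Phi> (k * d + r) - \<Phi> d) + norm (\<Phi> (- (k * d) + r) - \<Phi> (- d)))"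
  by (intro order_trans[OF norm_triangle_ineq] add_left_mono norm_triangle_ineq4)
 also have "... <= (\<bar>k - 1\<bar> / k) * (B * (2 * (k * d))) + (B * \<bar>k * d + r - d\<bar> + B * \<bar>- (k * d) + r - (- d)\<bar>)"
 proof (intro add_mono)
  have "norm (((1 - k) / k) *\<^sub>R D) = (\<bar>k - 1\<bar> / k) * norm D" using k by (simp add: abs_minus_commute)
  also have "... <= (\<bar>k - 1\<bar> / k) * (B * (2 * (k * d)))" using D k by (intro mult_left_mono) simp_all
  finally show "norm (((1 - k) / k) *\<^sub>R D) <= (\<bar>k - 1\<bar> / k) * (B * (2 * (k * d)))" .
  have L': "- L <= k * d + r" "- (k * d) + r <= L" "- L <= d" "- d <= L" using L kd d by linarith+
  show "norm (\<Phi> (k * d + r) - \<Phi> d) <= B * \<bar>k * d + r - d\<bar>" using L L' by (intro lip')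
  show "norm (\<Phi> (- (k * d) + r) - \<Phi> (- d)) <= B * \<bar>- (k * d) + r - (- d)\<bar>" using L L' by (intro lip')
 qed
 also have "... <= (\<bar>k - 1\<bar> / k) * (B * (2 * (k * d))) + (B * (\<bar>k - 1\<bar> * d + \<bar>r\<bar>) + B * (\<bar>k - 1\<bar> * d + \<bar>r\<bar>))"
 proof -
  have "\<bar>k - 1\<bar> * d = \<bar>k * d - d\<bar>" using d abs_mult_pos[of d "k - 1"] by (simp add: left_diff_distrib)
  hence "\<bar>k * d + r - d\<bar> <= \<bar>k - 1\<bar> * d + \<bar>r\<bar>" "\<bar>- (k * d) + r - (- d)\<bar> <= \<bar>k - 1\<bar> * d + \<bar>r\<bar>" by linarith+
  thus ?thesis using B by (intro add_mono mult_left_mono order_refl)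
 qed
 also have "... = (4 * \<bar>k - 1\<bar> * d + 2 * \<bar>r\<bar>) * B" using k by (simp add: field_simps)
 finally show ?thesis unfolding i1 i2 .
qed

text \<open>The average of \<open>V s A V(- s)\<close> over \<open>\<bar>s\<bar> \<le> d\<close>.\<close>

definition smear :: "(real => 'h::complex_hilbert op) => real => 'h op => 'h op"
 where "smear V d A = Blinfun (\<lambda>x. (1 / (2 * d)) *\<^sub>R
  integral {-d..d} (\<lambda>s. (V s) (A (V (- s) x))))"

text \<open>A strongly continuous one-parameter group of unitaries.\<close>

locale unitary_group =
 fixes V :: "real => 'h::complex_hilbert op"
 assumes V_ops: "V s \<in> \<B>"
  and V_add: "V s oo V t = V (s + t)" and V_zero: "V 0 = id_blinfun"
  and V_iso: "norm (V s x) = norm x"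
  and V_cont: "!!f. f ---> 0 ==> (\<lambda>n::nat. V (f n) x) ---> x"
begin

lemma V_add_apply: "V s (V t x) = V (s + t) x"
 by (simp flip: V_add)

lemma V_inv: "V s (V (- s) x) = x"
 by (simp add: V_add_apply V_zero)

lemma V_tendsto:
 assumes "f ---> s" "v ---> x"
 shows "(\<lambda>n::nat. V (f n) (v n)) ---> V s x"
proof -
 have "(\<lambda>n. f n - s) ---> 0" using assms(1) by (rule LIM_zero)
 hence 1: "(\<lambda>n. V (f n - s) (V s x)) ---> V s x" by (rule V_cont)
 have "(\<lambda>n. norm (v n - x)) ---> 0" by (rule tendsto_norm_zero[OF LIM_zero[OF assms(2)]])
 hence 2: "(\<lambda>n. norm (V (f n) (v n - x))) ---> 0" by (simp only: V_iso)
 have "(\<lambda>n. V (f n) (v n - x) + V (f n - s) (V s x)) ---> 0 + V s x"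
  by (rule tendsto_add[OF tendsto_norm_zero_cancel[OF 2] 1])
 thus ?thesis by (simp add: V_add_apply blinfun.diff_right)
qed

lemma continuous_conj:
 "continuous_on UNIV (\<lambda>s. ap (V s) (ap A (ap (V (- s)) x)))"
 unfolding continuous_on_sequentially o_def
 by (intro allI ballI impI V_tendsto blinfun.tendsto[OF tendsto_const] tendsto_minus tendsto_const; simp)

lemma integrable_conj:
 "(\<lambda>s. ap (V s) (ap A (ap (V (- s)) x))) integrable_on {a..b}"
 by (rule integrable_continuous_real[OF continuous_on_subset[OF continuous_conj]]) simp

lemma norm_conj_le: "norm (ap (V s) (ap A (ap (V t) x))) <= norm A * norm x"
 using norm_blinfun[of A "ap (V t) x"] by (simp add: V_iso)

context
 fixes d :: real assumes d: "d > 0"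
begin

lemma smear_bounded_linear:
 "bounded_linear (\<lambda>x. (1 / (2 * d)) *\<^sub>R
  integral {-d..d} (\<lambda>s. ap (V s) (ap A (ap (V (- s)) x))))"
proof (rule bounded_linear_intro[where K = "norm A"])
 fix x y :: 'h and r :: real
 let ?F = "\<lambda>x s. ap (V s) (ap A (ap (V (- s)) x))"
 show "(1 / (2 * d)) *\<^sub>R integral {-d..d} (?F (x + y)) = (1 / (2 * d)) *\<^sub>R integral {-d..d} (?F x) + (1 / (2 * d)) *\<^sub>R integral {-d..d} (?F y)"
  by (simp add: blinfun.add_right Henstock_Kurzweil_Integration.integral_add integrable_conj scaleR_add_right)
 show "(1 / (2 * d)) *\<^sub>R integral {-d..d} (?F (r *\<^sub>R x)) = r *\<^sub>R ((1 / (2 * d)) *\<^sub>R integral {-d..d} (?F x))"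
  by (simp add: blinfun.scaleR_right)
 have "norm (integral {-d..d} (?F x)) <= norm A * norm x * (d - (- d))"
  using d by (intro integral_bound continuous_on_subset[OF continuous_conj] norm_conj_le) auto
 thus "norm ((1 / (2 * d)) *\<^sub>R integral {-d..d} (?F x)) <= norm x * norm A"
  using d by (simp add: field_simps)
qed

lemma smear_apply: "smear V d A x = (1 / (2 * d)) *\<^sub>R
  integral {-d..d} (\<lambda>s. (V s) (A (V (- s) x)))"
 unfolding smear_def by (rule bounded_linear_Blinfun_apply[OF smear_bounded_linear, THEN fun_cong])

lemma smear_bounded_ops: assumes A: "A \<in> \<B>" shows "smear V d A \<in> \<B>"
proof (rule bounded_opsI)
 fix c x
 have "integral {-d..d} (\<lambda>s. (V s) (A (V (- s) (c *\<^sub>C x)))) =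
   c *\<^sub>C integral {-d..d} (\<lambda>s. (V s) (A (V (- s) x)))"
  using integral_linear[OF integrable_conj[of A x "-d" d] bounded_linear_scaleC[of c]]
  by (simp add: o_def bounded_opsD[OF V_ops] bounded_opsD[OF A])
 thus "smear V d A (c *\<^sub>C x) = c *\<^sub>C smear V d A x"
  by (simp add: smear_apply scaleR_scaleC scaleC_scaleC)
qed

text \<open>If all translates of \<open>A\<close> send \<open>y\<close> close to \<open>x\<close>, then so does the average.\<close>

lemma smear_approx:
 assumes "!!s. \<bar>s\<bar> <= d ==> norm (x - ap (V s) (ap A (ap (V (- s)) y))) <= e"
 shows "norm (x - ap (smear V d A) y) <= e"
proof -
 let ?F = "\<lambda>s. ap (V s) (ap A (ap (V (- s)) y))"
 have "integral {-d..d} (\<lambda>s. x - ?F s) = (2 * d) *\<^sub>R x - integral {-d..d} ?F"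
  using d by (simp add: Henstock_Kurzweil_Integration.integral_diff integrable_conj integrable_const_ivl)
 hence "x - ap (smear V d A) y = (1 / (2 * d)) *\<^sub>R integral {-d..d} (\<lambda>s. x - ?F s)"
  using d by (simp add: smear_apply scaleR_diff_right)
 moreover have "norm (integral {-d..d} (\<lambda>s. x - ?F s)) <= e * (d - (- d))"
  using d assms
  by (intro integral_bound continuous_on_diff continuous_on_const continuous_on_subset[OF continuous_conj]) auto
 ultimately show ?thesis using d by (simp add: pos_divide_le_eq)
qed

lemma norm_smear_le: "norm (smear V d A) <= norm A"
proof (rule norm_blinfun_bound)
 fix x
 have "norm (0 - smear V d A x) <= norm A * norm x"
  by (rule smear_approx) (simp add: norm_conj_le)
 thus "norm (smear V d A x) <= norm A * norm x" by simp
qed simp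

lemma smear_commute:
 assumes "!!s. \<bar>s\<bar> <= d ==> T oo (V s oo A oo V (- s)) = (V s oo A oo V (- s)) oo T"
 shows "T oo smear V d A = smear V d A oo T"
proof (rule blinfun_eqI)
 fix x
 have c: "T ((V s) (A (V (- s) x))) =
   (V s) (A (V (- s) (T x)))" if "s \<in> {-d..d}" for s
  using arg_cong[OF assms[of s], of "\<lambda>B. ap B x"] that by (simp add: abs_le_iff)
 have "T (integral {-d..d} (\<lambda>s. (V s) (A (V (- s) x)))) =
   integral {-d..d} (\<lambda>s. T ((V s) (A (V (- s) x))))"
  using integral_linear[OF integrable_conj[of A x "-d" d] blinfun.bounded_linear_right[of T]] by (simp add: o_def)
 also have "... = integral {-d..d} (\<lambda>s. (V s) (A (V (- s) (T x))))"
  by (rule Henstock_Kurzweil_Integration.integral_cong) (rule c)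
 finally show "(T oo smear V d A) x = (smear V d A oo T) x"
  by (simp add: smear_apply blinfun.scaleR_right)
qed

text \<open>An isometry that transforms the group by an affine change of parameter almost commutes with the
 average.\<close>

lemma smear_almost_commute:
 assumes P: "!!x. norm (ap P x) <= norm x" and k: "k > 0"
  and e: "!!s x. norm (ap P (ap (V s) (ap A (ap (V (- s)) x))) -
   ap (V (k * s + r)) (ap A (ap (V (- (k * s + r))) (ap P x)))) <= e * norm x"
 shows "norm (ap P (ap (smear V d A) x) - ap (smear V d A) (ap P x))
  <= (e + (2 * \<bar>k - 1\<bar> + \<bar>r\<bar> / d) * norm A) * norm x"
proof -
 let ?F = "\<lambda>s. ap (V s) (ap A (ap (V (- s)) x))"
 define G where "G s = ap (V s) (ap A (ap (V (- s)) (ap P x)))" for s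
 have cG: "continuous_on UNIV G" unfolding G_def by (rule continuous_conj)
 have cG': "continuous_on {-d..d} (\<lambda>s. G (k * s + r))"
  by (rule continuous_on_compose2[OF cG]) (auto intro!: continuous_intros)
 have cF: "continuous_on {-d..d} (\<lambda>s. ap P (?F s))"
  by (intro blinfun.continuous_on continuous_on_const continuous_on_subset[OF continuous_conj]) simp
 have PF: "ap P (integral {-d..d} ?F) = integral {-d..d} (\<lambda>s. ap P (?F s))"
  using integral_linear[OF integrable_conj[of A x "-d" d] blinfun.bounded_linear_right[of P]] by (simp add: o_def)
 have "norm (integral {-d..d} (\<lambda>s. ap P (?F s) - G (k * s + r))) <= e * norm x * (d - (- d))"
 proof (rule integral_bound)
  show "continuous_on {-d..d} (\<lambda>s. ap P (?F s) - G (k * s + r))" by (intro continuous_on_diff cF cG')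
  show "norm (ap P (?F s) - G (k * s + r)) <= e * norm x" for s unfolding G_def by (rule e)
 qed (use d in simp)
 also have "integral {-d..d} (\<lambda>s. ap P (?F s) - G (k * s + r)) =
   ap P (integral {-d..d} ?F) - integral {-d..d} (\<lambda>s. G (k * s + r))"
  unfolding PF
  by (rule Henstock_Kurzweil_Integration.integral_diff[OF integrable_continuous_real[OF cF] integrable_continuous_real[OF cG']])
 finally have 1: "norm (ap P (integral {-d..d} ?F) - integral {-d..d} (\<lambda>s. G (k * s + r))) <= 2 * d * (e * norm x)"
  by (simp add: mult.commute)
 have G: "norm (G s) <= norm A * norm x" for s
 proof -
  have "norm (G s) <= norm A * norm (ap P x)" unfolding G_def by (rule norm_conj_le)
  also have "... <= norm A * norm x" by (rule mult_left_mono[OF P]) simp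
  finally show ?thesis .
 qed
 have 2: "norm (integral {-d..d} (\<lambda>s. G (k * s + r)) - integral {-d..d} G) <= (4 * \<bar>k - 1\<bar> * d + 2 * \<bar>r\<bar>) * (norm A * norm x)"
  by (rule integral_affine_diff_le[OF cG G k d])
 have "ap P (ap (smear V d A) x) - ap (smear V d A) (ap P x) =
   (1 / (2 * d)) *\<^sub>R (ap P (integral {-d..d} ?F) - integral {-d..d} G)"
  by (simp add: smear_apply blinfun.scaleR_right scaleR_diff_right G_def[abs_def])
 also have "norm ... = (1 / (2 * d)) * norm (ap P (integral {-d..d} ?F) - integral {-d..d} G)"
  using d by simp
 also have "... <= (1 / (2 * d)) * (2 * d * (e * norm x) + (4 * \<bar>k - 1\<bar> * d + 2 * \<bar>r\<bar>) * (norm A * norm x))"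
  using d 1 2 norm_triangle_ineq[of "ap P (integral {-d..d} ?F) - integral {-d..d} (\<lambda>s. G (k * s + r))"
    "integral {-d..d} (\<lambda>s. G (k * s + r)) - integral {-d..d} G"]
  by (intro mult_left_mono) simp_all
 also have "... = (e + (2 * \<bar>k - 1\<bar> + \<bar>r\<bar> / d) * norm A) * norm x"
  using d by (simp add: field_simps)
 finally show ?thesis .
qed

lemma smear_almost_commute_self:
 "norm (ap (V r) (ap (smear V d A) x) - ap (smear V d A) (ap (V r) x))
  <= (\<bar>r\<bar> / d * norm A) * norm x"
proof -
 have "norm (ap (V r) (ap (V s) (ap A (ap (V (- s)) x))) -
   ap (V (1 * s + r)) (ap A (ap (V (- (1 * s + r))) (ap (V r) x)))) <= 0 * norm x" for s x
  by (simp add: V_add_apply add.commute)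
 from smear_almost_commute[OF _ _ this] show ?thesis by (simp add: V_iso)
qed

lemma smear_almost_commute_normalizer:
 assumes P: "!!x. norm (ap P x) <= norm x" and k: "k > 0"
  and PV: "!!s x. ap P (ap (V s) x) = ap (V (k * s)) (ap P x)"
  and e: "!!x. norm (ap P (ap A x) - ap A (ap P x)) <= e * norm x"
 shows "norm (ap P (ap (smear V d A) x) - ap (smear V d A) (ap P x))
  <= (e + 2 * \<bar>k - 1\<bar> * norm A) * norm x"
proof -
 have "norm (ap P (ap (V s) (ap A (ap (V (- s)) x))) -
   ap (V (k * s + 0)) (ap A (ap (V (- (k * s + 0))) (ap P x)))) <= e * norm x" for s x
 proof -
  have "ap (V (- (k * s + 0))) (ap P x) = ap P (ap (V (- s)) x)"
   by (simp add: PV)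
  hence "ap P (ap (V s) (ap A (ap (V (- s)) x))) -
    ap (V (k * s + 0)) (ap A (ap (V (- (k * s + 0))) (ap P x))) =
   ap (V (k * s)) (ap P (ap A (ap (V (- s)) x)) - ap A (ap P (ap (V (- s)) x)))"
   by (simp add: PV blinfun.diff_right)
  thus ?thesis using e[of "ap (V (- s)) x"] by (simp add: V_iso)
 qed
 from smear_almost_commute[OF P k this] show ?thesis by simp
qed

end

end

section \<open>Smearing in the scaling algebras\<close>

lemma boost_tendsto: "((\<lambda>p. (boost (fst p), snd p)) \<longlongrightarrow> (mat 1, 0)) (nhds (0, 0 :: real^2))"
proof -
 have f: "(fst \<longlongrightarrow> (0::real)) (nhds (0, 0 :: real^2))" and s: "(snd \<longlongrightarrow> (0 :: real^2)) (nhds (0::real, 0))"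
  using tendsto_fst[OF filterlim_ident[of "nhds (0::real, 0 :: real^2)"]] tendsto_snd[OF filterlim_ident[of "nhds (0::real, 0 :: real^2)"]] by simp_all
 have "((\<lambda>p. boost (fst p) $ i $ j) \<longlongrightarrow> boost 0 $ i $ j) (nhds (0, 0 :: real^2))" for i j
  using exhaust_2[of i] exhaust_2[of j] tendsto_cosh[OF f] tendsto_sinh[OF f] by auto
 thus ?thesis unfolding boost_zero[symmetric] by (intro tendsto_Pair vec_tendstoI s)
qed

text \<open>A subgroup of the reals is discrete or dense.\<close>

lemma real_subgroup_cases:
 fixes H :: "real set"
 assumes H: "0 \<in> H" "!!s t. s \<in> H ==> t \<in> H ==> s + t \<in> H" "!!s. s \<in> H ==> - s \<in> H"
 shows "(\<exists>e>0. \<forall>t\<in>H. \<bar>t\<bar> < e --> t = 0) \<or> closure H = UNIV"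
proof (rule disjCI)
 assume "closure H ~= UNIV"
 then obtain x where x: "x \<notin> closure H" by auto
 then obtain e where e: "e > 0" "!!t. t \<in> H ==> dist t x >= e" unfolding closure_approachable by (meson not_less)
 have "t = 0" if t: "t \<in> H" "\<bar>t\<bar> < e" for t
 proof (rule ccontr)
  assume "t ~= 0"
  have nat: "real n * t \<in> H" for n
   by (induction n) (auto simp: H t(1) algebra_simps)
  have int: "of_int k * t \<in> H" for k
   using nat[of "nat k"] H(3)[OF nat[of "nat (- k)"]] by (cases "k >= 0") auto
  \<comment> \<open>the multiples of a small \<open>t\<close> come close to \<open>x\<close>\<close>
  define k where "k = \<lfloor>x / t\<rfloor>"
  have "\<bar>x / t - of_int k\<bar> < 1" unfolding k_def by linarith
  hence "\<bar>x / t - of_int k\<bar> * \<bar>t\<bar> < 1 * \<bar>t\<bar>" using \<open>t ~= 0\<close> by (intro mult_strict_right_mono) auto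
  hence "\<bar>x - of_int k * t\<bar> < \<bar>t\<bar>" using \<open>t ~= 0\<close> by (simp add: left_diff_distrib flip: abs_mult)
  hence "dist (of_int k * t) x < e" using t(2) by (simp add: dist_real_def)
  thus False using e(2)[OF int[of k]] by simp
 qed
 thus "\<exists>e>0. \<forall>t\<in>H. \<bar>t\<bar> < e --> t = 0" using e(1) by blast
qed

context scaling_field begin

abbreviation G :: "poincare set" where "G \<equiv> sym_group S"

abbreviation net :: "'i filter" where "net \<equiv> scale_net S"

lemma G_props:
 shows "G \<subseteq> poincare_group" "(mat 1, y) \<in> G" "g \<in> G ==> h \<in> G ==> poincare_mult g h \<in> G"
  "g \<in> G ==> poincare_inv g \<in> G"
 using limit unfolding is_scaling_limit_def poincare_subgroup_with_translations_def by blast+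

text \<open>The rapidities of the boosts in the symmetry group.\<close>

definition rapidities :: "real set" where "rapidities = {r. \<exists>y. (boost r, y) \<in> G}"

lemma G_elem: "g \<in> G ==> \<exists>r\<in>rapidities. \<exists>y. g = (boost r, y)"
 using subsetD[OF G_props(1), of g] poincare_group_iff[of g] by (auto simp: rapidities_def)

lemma rapidities_G: assumes "r \<in> rapidities" shows "(boost r, y) \<in> G"
proof -
 obtain z where z: "(boost r, z) \<in> G" using assms by (auto simp: rapidities_def)
 have "(boost 0, y - z) \<in> G" unfolding boost_zero by (rule G_props(2))
 from G_props(3)[OF this z] show ?thesis unfolding poincare_mult_boost by (simp add: boost_zero)
qed

lemma rapidities_subgroup:
 shows "0 \<in> rapidities" "s \<in> rapidities ==> t \<in> rapidities ==> s + t \<in> rapidities" "s \<in> rapidities ==> - s \<in> rapidities"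
proof -
 show "0 \<in> rapidities" using G_props(2)[of 0] by (auto simp: rapidities_def simp flip: boost_zero)
 show "s + t \<in> rapidities" if s: "s \<in> rapidities" and t: "t \<in> rapidities"
  using G_props(3)[OF rapidities_G[OF s, of 0] rapidities_G[OF t, of 0]]
  by (auto simp: poincare_mult_boost rapidities_def)
 show "- s \<in> rapidities" if s: "s \<in> rapidities"
  using G_props(4)[OF rapidities_G[OF s, of 0]] by (auto simp: poincare_inv_boost rapidities_def)
qed

text \<open>Continuity under the group, as approximate commutation with the implementing unitaries.\<close>

definition almost_commutes :: "(real => 'h op) => real => real^2 => real => bool"
 where "almost_commutes A r y e \<longleftrightarrow> (\<forall>l>0. \<forall>x.
  norm (U r (l *\<^sub>R y) (A l x) - A l (U r (l *\<^sub>R y) x)) <= e * norm x)"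

text \<open>The change of \<open>A\<close> under \<open>g\<close>, whose limit at the identity is \<open>0\<close> for elements of the scaling algebra.\<close>

abbreviation "defect A g \<equiv> SUP l\<in>{0<..}. norm (aut X (fst g, l *\<^sub>R snd g) (A l) - A l)"

text \<open>The change of a local operator under an automorphism has the norm of its commutator with
 the implementing unitary.\<close>

lemma aut_defect:
 assumes Q: "Q \<in> \<K>" and A: "A \<in> \<A> Q" and e: "e >= 0"
 shows "norm (al r y A - A) <= e \<longleftrightarrow> (\<forall>x. norm (U r y (A x) - A (U r y x)) <= e * norm x)"
proof -
 let ?V = "U (- r) (- (boost (- r) *v y))"
 have 1: "U r y (?V x) = x" "?V (U r y x) = x" for x
  using arg_cong[OF U_inverse[of r y], of "\<lambda>B. ap B x"] arg_cong[OF U_inverse'[of r y], of "\<lambda>B. ap B x"] by simp_all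
 have 2: "U r y (A x) - A (U r y x) = (al r y A - A) (U r y x)" for x
  by (simp add: aut_implemented[OF Q A] 1 blinfun.diff_left)
 show ?thesis unfolding 2
 proof
  assume n: "norm (al r y A - A) <= e"
  show "\<forall>x. norm ((al r y A - A) (U r y x)) <= e * norm x"
   by (intro allI order_trans[OF norm_blinfun]) (simp add: U_props mult_right_mono n)
 next
  assume *: "\<forall>x. norm ((al r y A - A) (U r y x)) <= e * norm x"
  show "norm (al r y A - A) <= e"
   using *[rule_format, of "?V x" for x] by (intro norm_blinfun_bound e) (simp add: 1 U_props)
 qed
qed

lemma scaling_localI:
 assumes A: "A \<in> \<F>" "!!l. l > 0 ==> A l \<in> \<A> (scale_region l Q)" and Q: "Q \<in> \<K>"
  and e: "!!e. e > 0 ==> \<exists>d>0. \<forall>r\<in>rapidities. \<forall>y. \<bar>r\<bar> < d --> norm y < d --> almost_commutes A r y e"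
 shows "A \<in> SL Q"
proof -
 let ?F = "at (mat 1 :: real^2^2, 0 :: real^2) within G"
 have "(defect A \<longlongrightarrow> 0) ?F"
 proof (rule tendstoI)
  fix e :: real assume "e > 0"
  hence e2: "e / 2 > 0" by simp
  obtain d where d: "d > 0" "!!r y. r \<in> rapidities ==> \<bar>r\<bar> < d ==> norm y < d ==> almost_commutes A r y (e / 2)"
   using e[OF e2] by blast
  have g: "((\<lambda>g. g) \<longlongrightarrow> (mat 1, 0)) ?F" by (rule tendsto_ident_at)
  have "((\<lambda>g. fst g $ 1 $ 1 + fst g $ 1 $ 2) \<longlongrightarrow> fst (mat 1 :: real^2^2, 0 :: real^2) $ 1 $ 1 + fst (mat 1 :: real^2^2, 0 :: real^2) $ 1 $ 2) ?F"
   by (intro tendsto_intros g)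
  hence "((\<lambda>g. ln (fst g $ 1 $ 1 + fst g $ 1 $ 2)) \<longlongrightarrow> ln 1) ?F" by (intro tendsto_ln) (simp_all add: mat_def)
  hence "\<forall>\<^sub>F g in ?F. \<bar>ln (fst g $ 1 $ 1 + fst g $ 1 $ 2)\<bar> < d" using tendstoD d(1) by fastforce
  moreover have "\<forall>\<^sub>F g in ?F. norm (snd g) < d" using tendstoD[OF tendsto_snd[OF g] d(1)] by simp
  moreover have "\<forall>\<^sub>F g in ?F. g \<in> G" by (simp add: eventually_at_filter)
  ultimately show "\<forall>\<^sub>F g in ?F. dist (defect A g) 0 < e"
  proof eventually_elim
   case (elim g)
   obtain r y where r: "r \<in> rapidities" "g = (boost r, y)" using G_elem[OF elim(3)] by blast
   have "cosh r + sinh r = exp r" by (simp add: cosh_field_def sinh_field_def field_simps)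
   hence "almost_commutes A r y (e / 2)" using elim(1,2) by (intro d(2) r) (simp_all add: r(2))
   hence n: "norm (al r (l *\<^sub>R y) (A l) - A l) <= e / 2" if "l > 0" for l
    using that e2 unfolding almost_commutes_def by (subst aut_defect[OF scale_double_cone[OF that Q] A(2)]) simp_all
   hence "defect A g <= e / 2" unfolding r(2) by (intro cSUP_least) auto
   moreover have "0 <= defect A g"
    using n unfolding r(2) by (intro cSUP_upper2[of _ _ 1] bdd_aboveI2[where M = "e / 2"]) auto
   ultimately show ?case using \<open>e > 0\<close> by simp
  qed
 qed
 thus ?thesis unfolding scaling_local_def using A by blast
qed

lemma scaling_localD:
 assumes A: "A \<in> SL Q" and Q: "Q \<in> \<K>" and e: "e > 0"
 shows "\<exists>d>0. \<forall>r\<in>rapidities. \<forall>y. \<bar>r\<bar> < d --> norm y < d --> almost_commutes A r y e"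
proof -
 have bf: "A \<in> \<F>" and loc: "!!l. l > 0 ==> A l \<in> \<A> (scale_region l Q)"
  and lim: "(defect A \<longlongrightarrow> 0) (at (mat 1, 0) within G)" using A by (auto simp: scaling_local_def)
 have "\<forall>\<^sub>F g in nhds (mat 1, 0). g ~= (mat 1, 0) --> g \<in> G --> dist (defect A g) 0 < e"
  using tendstoD[OF lim e] by (simp add: eventually_at_filter)
 from filterlim_iff[THEN iffD1, OF boost_tendsto, rule_format, OF this]
 obtain d where d: "d > 0" "!!p. dist p (0, 0) < d ==> (boost (fst p), snd p) ~= (mat 1, 0) ==> (boost (fst p), snd p) \<in> G ==> dist (defect A (boost (fst p), snd p)) 0 < e"
  unfolding eventually_nhds_metric by blast
 have "almost_commutes A r y e" if r: "r \<in> rapidities" "\<bar>r\<bar> < d / 2" "norm y < d / 2" for r y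
 proof (cases "(boost r, y) = (mat 1, 0)")
  case True
  hence "boost r $ 1 $ 1 + boost r $ 1 $ 2 = (mat 1 :: real^2^2) $ 1 $ 1 + (mat 1 :: real^2^2) $ 1 $ 2" by simp
  hence "exp r = 1" by (simp add: mat_def cosh_field_def sinh_field_def field_simps)
  thus ?thesis using True e by (simp add: almost_commutes_def U_zero)
 next
  case False
  have "dist (r, y) (0, 0) <= \<bar>r\<bar> + norm y"
   unfolding dist_Pair_Pair dist_norm using sqrt_sum_squares_le_sum_abs[of "norm (r - 0)" "norm (y - 0)"] by (simp add: norm_Pair)
  hence s: "defect A (boost r, y) < e" using d(2)[of "(r, y)"] r False rapidities_G by simp
  have q: "A l \<in> \<Q>" if "l > 0" for l
   using loc[OF that] local_algebra_quasilocal[OF scale_double_cone[OF that Q]] by blast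
  have "norm (al r (l *\<^sub>R y) (A l) - A l) <= sup_norm A + sup_norm A" if "l > 0" for l
   using norm_triangle_ineq4[of "al r (l *\<^sub>R y) (A l)" "A l"] norm_aut_le[OF q[OF that], of r "l *\<^sub>R y"]
    norm_le_sup_norm[OF bf that] by linarith
  hence b: "bdd_above ((\<lambda>l. norm (al r (l *\<^sub>R y) (A l) - A l)) ` {0<..})" by (intro bdd_aboveI2) auto
  show ?thesis unfolding almost_commutes_def
  proof (intro allI impI)
   fix l :: real and x assume l: "l > 0"
   have "norm (al r (l *\<^sub>R y) (A l) - A l) <= e" using cSUP_upper[OF _ b, of l] s l by simp
   thus "norm (U r (l *\<^sub>R y) (A l x) - A l (U r (l *\<^sub>R y) x)) <= e * norm x"
    using aut_defect[OF scale_double_cone[OF l Q] loc[OF l]] e by simp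
  qed
 qed
 thus ?thesis using d(1) by (intro exI[of _ "d / 2"]) simp
qed

end

context scaling_field begin

lemma scaling_local_bounded: "SL Q \<subseteq> \<F>"
 by (auto simp: scaling_local_def)

lemma scaling_local_algebra: "Q \<in> \<K> ==> SL Q \<subseteq> SA"
proof -
 assume Q: "Q \<in> \<K>"
 have "(\<Union>Q\<in>\<K>. SL Q) \<subseteq> \<F>" using scaling_local_bounded by blast
 from sup_closure_incl[OF this] show ?thesis unfolding scaling_algebra_def using Q by blast
qed

lemma scaling_algebra_bounded: "A \<in> SA ==> A \<in> \<F>"
 unfolding scaling_algebra_def by (rule sup_closure_bounded)

lemma limit_gns: "gns_triple (function_algebra SA) (lim_state S) \<pi> \<xi>"
 using limit by (simp add: is_scaling_limit_def)

lemma limit_rep: "cstar_morphism (function_algebra SA) (operator_algebra \<B>) \<pi>"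
 using limit_gns by (simp add: gns_triple_def)

lemma scaling_algebra_cstar: "cstar_algebra (function_algebra SA)"
 using limit_rep by (simp add: cstar_morphism_def)

lemmas scaling_algebra_closed = cstar_closed[OF scaling_algebra_cstar, simplified]

lemma limit_rep_bounded_ops: "A \<in> SA ==> \<pi> A \<in> \<B>"
 using limit_rep by (auto simp: cstar_morphism_def)

lemma net_props:
 shows "net ~= bot" "sc k > 0"
  "A \<in> SA ==> ((\<lambda>j. cinner (vac X) (A (sc j) (vac X))) \<longlongrightarrow> lim_state S A) net"
 using limit by (simp_all add: is_scaling_limit_def)

text \<open>Norms of vectors in the scaling limit are limits of norms of vectors in the vacuum space.\<close>

lemma norm_limit_vector:
 assumes E: "E \<in> SA"
 shows "((\<lambda>k. (norm (E (sc k) (vac X)))^2) \<longlongrightarrow> (norm (\<pi> E \<xi>))\<^sup>2) net"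
proof -
 define D where "D = (\<lambda>l. adj (E l) oo E l)"
 have aE: "(\<lambda>l. adj (E l)) \<in> SA" by (rule scaling_algebra_closed(6)[OF E])
 have D: "D \<in> SA" unfolding D_def by (rule scaling_algebra_closed(4)[OF aE E])
 have El: "E l \<in> \<B>" for l by (rule bounded_functionsD(1)[OF scaling_algebra_bounded[OF E]])
 have rep: "\<pi> D = adj (\<pi> E) oo \<pi> E"
  using limit_rep E aE unfolding cstar_morphism_def by (simp add: D_def)
 have "lim_state S D = cinner \<xi> (\<pi> D \<xi>)"
  using limit_gns D by (simp add: gns_triple_def)
 hence st: "lim_state S D = of_real ((norm (\<pi> E \<xi>))^2)"
  using limit_rep_bounded_ops[OF E] by (simp add: rep cinner_adj_right cinner_self)
 have "cinner (vac X) (D l (vac X)) = of_real ((norm (E l (vac X)))^2)" for l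
  using El[of l] by (simp add: D_def cinner_adj_right cinner_self)
 hence "((\<lambda>k. complex_of_real ((norm (E (sc k) (vac X)))^2)) \<longlongrightarrow> of_real ((norm (\<pi> E \<xi>))^2)) net"
  using net_props(3)[OF D] st by simp
 thus ?thesis unfolding tendsto_of_real_iff .
qed

lemma norm_limit_vector_le:
 assumes E: "E \<in> SA" and c: "c >= 0"
  and ev: "\<forall>\<^sub>F k in net. norm (E (sc k) (vac X)) <= c"
 shows "norm (\<pi> E \<xi>) <= c"
proof -
 have "(norm (\<pi> E \<xi>))^2 <= c^2"
 proof (rule tendsto_upperbound[OF norm_limit_vector[OF E] _ net_props(1)])
  show "\<forall>\<^sub>F k in net. (norm (E (sc k) (vac X)))^2 <= c^2"
   using ev by eventually_elim (simp add: power_mono)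
 qed
 thus ?thesis using c by (rule power2_le_imp_le)
qed

lemma norm_lim_vac: "norm \<xi> = 1"
proof -
 have "lim_state S (on_pos (\<lambda>_. id_blinfun)) = 1" using limit_gns by (simp add: gns_triple_def state_on_def)
 moreover have "lim_state S (on_pos (\<lambda>_. id_blinfun)) = cinner \<xi> (\<pi> (on_pos (\<lambda>_. id_blinfun)) \<xi>)"
  using limit_gns scaling_algebra_closed(2) by (simp add: gns_triple_def)
 moreover have "\<pi> (on_pos (\<lambda>_. id_blinfun)) = id_blinfun" using limit_rep by (simp add: cstar_morphism_def)
 ultimately show ?thesis by (simp add: norm_eq_sqrt_cinner)
qed

text \<open>Elements of \<open>\<A>\<^sup>\<bullet>(O)\<close> agree on the vacuum with elements of the scaling algebra, up to small errors.\<close>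

lemma bullet_local_approx:
 assumes D: "D \<in> BL Q" and R: "R \<in> \<K>" "closure Q \<subseteq> R" and e: "e > 0"
 shows "\<exists>E\<in>SL R. Limsup net (\<lambda>k. ereal (vd D E k)) < ereal e"
proof -
 obtain E C where E: "E \<in> SL R"
  and L: "Limsup net (\<lambda>k. ereal (vd D E k +
     norm ((adj (D (sc k)) - C (sc k)) (vac X)))) < ereal e"
  using D R e unfolding bullet_local_def by blast
 have "Limsup net (\<lambda>k. ereal (vd D E k)) \<le>
   Limsup net (\<lambda>k. ereal (vd D E k +
     norm ((adj (D (sc k)) - C (sc k)) (vac X))))"
  by (rule Limsup_mono[OF always_eventually]) simp
 thus ?thesis using E L by (intro bexI[of _ E]) (rule le_less_trans)
qed

lemma bullet_algebraD:
 assumes "D \<in> BA" "e > 0"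
 shows "\<exists>D' Q R. Q \<in> \<K> \<and> R \<in> \<K> \<and> closure Q \<subseteq> R \<and> D' \<in> BL Q \<and>
  (\<forall>l>0. norm (D l - D' l) <= e) \<and> sup_norm (\<lambda>l. D l - D' l) <= e"
proof -
 obtain Q D' where Q: "Q \<in> \<K>" and D': "D' \<in> BL Q" and s: "sup_norm (\<lambda>l. D l - D' l) < e"
  using assms unfolding bullet_algebra_def sup_closure_def by blast
 obtain M where M: "M > 0" "Q \<subseteq> dc M" "closure Q \<subseteq> dc M"
  by (rule double_cone_in_base_cone[OF Q])
 have R: "dc M \<in> \<K>" using M(1) by (intro base_cone_double_cone) simp
 have "D' \<in> \<F>" using D' bullet_local_bounded by blast
 hence "(\<lambda>l. D l - D' l) \<in> \<F>" by (rule bounded_functions_diff[OF bullet_algebra_bounded[OF assms(1)]])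
 hence "\<forall>l>0. norm (D l - D' l) <= e"
  by (intro allI impI order_trans[OF norm_le_sup_norm less_imp_le[OF s]])
 thus ?thesis using Q R M(3) D' less_imp_le[OF s] by (intro exI conjI)
qed

lemma bullet_algebra_approx:
 assumes D: "D \<in> BA" and e: "e > 0"
 shows "\<exists>R\<in>\<K>. \<exists>E\<in>SL R. \<forall>\<^sub>F k in net. vd D E k <= e"
proof -
 have e2: "e / 2 > 0" using e by simp
 obtain D' Q R where *: "Q \<in> \<K>" "R \<in> \<K>" "closure Q \<subseteq> R" "D' \<in> BL Q"
  "\<forall>l>0. norm (D l - D' l) <= e / 2" "sup_norm (\<lambda>l. D l - D' l) <= e / 2"
  using bullet_algebraD[OF D e2] by blast
 obtain E where E: "E \<in> SL R"
  "Limsup net (\<lambda>k. ereal (vd D' E k)) < ereal (e / 2)"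
  using bullet_local_approx[OF *(4,2,3) e2] by blast
 have "\<forall>\<^sub>F k in net. vd D E k <= e"
  using Limsup_lessD[OF E(2)]
 proof eventually_elim
  case (elim k)
  let ?l = "sc k"
  have "norm ((D ?l - D' ?l) (vac X)) <= e / 2"
   using norm_blinfun[of "D ?l - D' ?l" "vac X"] *(5)[rule_format, OF net_props(2)[of k]] by (simp add: norm_vac)
  moreover have "(D ?l - E ?l) (vac X) = (D ?l - D' ?l) (vac X) + (D' ?l - E ?l) (vac X)"
   by (simp add: blinfun.diff_left)
  ultimately show ?case using elim norm_triangle_ineq[of "(D ?l - D' ?l) (vac X)" "(D' ?l - E ?l) (vac X)"]
   by simp
 qed
 thus ?thesis using *(2) E(1) by blast
qed

text \<open>Bounds on the vacuum along the net are inherited by the limit.\<close>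

lemma norm_ext_vector_le_local:
 assumes D: "D \<in> BL Q" and R: "Q \<in> \<K>" "R \<in> \<K>" "closure Q \<subseteq> R" and c: "c >= 0"
  and ev: "\<forall>\<^sub>F k in net. norm (D (sc k) (vac X)) <= c"
 shows "norm (\<pi>b D \<xi>) <= c"
proof -
 have pos: "1 / real (Suc j) > 0" for j by simp
 let ?L = "\<lambda>E. Limsup net (\<lambda>k. ereal (vd D E k))"
 have "\<forall>j. \<exists>E. E \<in> SL R \<and> ?L E < ereal (1 / real (Suc j))"
  using bullet_local_approx[OF D R(2,3) pos] by blast
 from choice[OF this] obtain E where EL: "\<forall>j. E j \<in> SL R \<and> ?L (E j) < ereal (1 / real (Suc j))" ..
 have E: "E j \<in> SL R" and L: "?L (E j) < ereal (1 / real (Suc j))" for j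
  using EL[rule_format, of j] by (rule conjunct1, rule conjunct2)
 have nn: "0 <= Limsup net (\<lambda>k. ereal (vd D (E j) k))" for j
  by (rule le_Limsup[OF net_props(1) always_eventually]) simp
 have "(\<lambda>j. ereal (1 / real (Suc j))) ---> 0"
  using tendsto_ereal[OF LIMSEQ_inverse_real_of_nat] by (simp add: inverse_eq_divide zero_ereal_def)
 hence "(\<lambda>j. Limsup net (\<lambda>k. ereal (vd D (E j) k))) ---> 0"
  by (rule tendsto_sandwich[OF always_eventually[OF allI[OF nn]] always_eventually[OF allI[OF less_imp_le[OF L]]] tendsto_const])
 hence lim: "(\<lambda>j. \<pi> (E j) \<xi>) ---> \<pi>b D \<xi>"
  by (rule extension[unfolded is_bullet_extension_def, THEN conjunct2, THEN conjunct2, rule_format, OF R(1) D R(2,3) E])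
 have "norm (\<pi> (E j) \<xi>) <= c + 1 / real (Suc j)" for j
 proof (rule norm_limit_vector_le)
  show "E j \<in> SA" using E scaling_local_algebra[OF R(2)] by blast
  show "0 <= c + 1 / real (Suc j)" using c by simp
  show "\<forall>\<^sub>F k in net. norm (E j (sc k) (vac X)) <= c + 1 / real (Suc j)"
   using ev Limsup_lessD[OF L[of j]]
  proof eventually_elim
   case (elim k)
   have "E j (sc k) (vac X) = D (sc k) (vac X) - (D (sc k) - E j (sc k)) (vac X)"
    by (simp add: blinfun.diff_left)
   thus ?case using elim norm_triangle_ineq4[of "D (sc k) (vac X)" "(D (sc k) - E j (sc k)) (vac X)"]
    by simp
  qed
 qed
 moreover have "(\<lambda>j. c + 1 / real (Suc j)) ---> c + 0"
  using LIMSEQ_inverse_real_of_nat by (intro tendsto_add tendsto_const) (simp add: inverse_eq_divide)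
 ultimately have "norm (\<pi>b D \<xi>) <= c + 0"
  by (intro LIMSEQ_le[OF tendsto_norm[OF lim]]) auto
 thus ?thesis by simp
qed

lemma norm_ext_vector_le:
 assumes D: "D \<in> BA" and c: "c >= 0"
  and ev: "\<forall>\<^sub>F k in net. norm (D (sc k) (vac X)) <= c"
 shows "norm (\<pi>b D \<xi>) <= c"
proof (rule field_le_epsilon)
 fix e :: real assume "e > 0"
 hence e2: "e / 2 > 0" by simp
 obtain D' Q R where *: "Q \<in> \<K>" "R \<in> \<K>" "closure Q \<subseteq> R" "D' \<in> BL Q"
  "\<forall>l>0. norm (D l - D' l) <= e / 2" "sup_norm (\<lambda>l. D l - D' l) <= e / 2"
  using bullet_algebraD[OF D e2] by blast
 have D'a: "D' \<in> BA" using *(4) bullet_local_algebra[OF *(1)] by blast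
 have "\<forall>\<^sub>F k in net. norm (D' (sc k) (vac X)) <= c + e / 2"
  using ev
 proof eventually_elim
  case (elim k)
  let ?l = "sc k"
  have "norm ((D ?l - D' ?l) (vac X)) <= e / 2"
   using norm_blinfun[of "D ?l - D' ?l" "vac X"] *(5)[rule_format, OF net_props(2)[of k]] by (simp add: norm_vac)
  moreover have "D' ?l (vac X) = D ?l (vac X) - (D ?l - D' ?l) (vac X)"
   by (simp add: blinfun.diff_left)
  ultimately show ?case using elim norm_triangle_ineq4[of "D ?l (vac X)" "(D ?l - D' ?l) (vac X)"]
   by simp
 qed
 hence 1: "norm (\<pi>b D' \<xi>) <= c + e / 2"
  using c e2 by (intro norm_ext_vector_le_local[OF *(4,1,2,3)]) simp_all
 have "norm ((\<pi>b D - \<pi>b D') \<xi>) <= e / 2"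
  using norm_blinfun[of "\<pi>b D - \<pi>b D'" "\<xi>"] norm_ext_diff_le[OF D D'a] *(6) by (simp add: norm_lim_vac)
 moreover have "\<pi>b D \<xi> = \<pi>b D' \<xi> + (\<pi>b D - \<pi>b D') \<xi>"
  by (simp add: blinfun.diff_left)
 ultimately show "norm (\<pi>b D \<xi>) <= c + e"
  using 1 norm_triangle_ineq[of "\<pi>b D' \<xi>" "(\<pi>b D - \<pi>b D') \<xi>"]
  by simp
qed

text \<open>Isotony of the scaling algebras, and their inclusion in \<open>\<A>\<^sup>\<bullet>\<close>.\<close>

lemma scaling_local_mono:
 assumes "Q \<subseteq> R" "R \<in> \<K>" shows "SL Q \<subseteq> SL R"
proof
 fix A assume A: "A \<in> SL Q"
 have "A l \<in> \<A> (scale_region l R)" if l: "l > 0" for l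
 proof -
  have "\<A> (scale_region l Q) \<subseteq> \<A> (scale_region l R)"
   by (rule local_algebra_mono[OF scale_region_mono[OF assms(1)] scale_double_cone[OF l assms(2)]])
  thus ?thesis using A l by (auto simp: scaling_local_def)
 qed
 thus "A \<in> SL R" using A by (simp add: scaling_local_def)
qed

lemma scaling_local_adj:
 assumes Q: "Q \<in> \<K>" and A: "A \<in> SL Q" shows "(\<lambda>l. adj (A l)) \<in> SL Q"
proof -
 have bf: "A \<in> \<F>" and loc: "!!l. l > 0 ==> A l \<in> \<A> (scale_region l Q)"
  and lim: "(defect A \<longlongrightarrow> 0) (at (mat 1, 0) within G)" using A by (auto simp: scaling_local_def)
 have bo: "A l \<in> \<B>" for l by (rule bounded_functionsD(1)[OF bf])
 have "norm (aut X (fst g, l *\<^sub>R snd g) (adj (A l)) - adj (A l)) = norm (aut X (fst g, l *\<^sub>R snd g) (A l) - A l)"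
  if g: "g \<in> G" and l: "l > 0" for g l
 proof -
  obtain r y where r: "g = (boost r, y)" using G_elem[OF g] by blast
  have q: "A l \<in> \<Q>" using loc[OF l] local_algebra_quasilocal[OF scale_double_cone[OF l Q]] by blast
  hence "al r (l *\<^sub>R y) (A l) \<in> \<B>" using aut_simps(1) quasilocal_bounded_ops by blast
  thus ?thesis using q bo by (simp add: r aut_simps(5) norm_adj flip: adj_diff)
 qed
 hence "g \<in> G ==> defect A g = defect (\<lambda>l. adj (A l)) g" for g by (intro SUP_cong refl) simp
 hence "(defect (\<lambda>l. adj (A l)) \<longlongrightarrow> 0) (at (mat 1, 0) within G)"
  by (intro Lim_transform_eventually[OF lim]) (simp add: eventually_at_filter)
 moreover have "(\<lambda>l. adj (A l)) \<in> \<F>"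
  using norm_le_sup_norm[OF bf] bo bounded_functionsD(2)[OF bf]
  by (intro bounded_functionsI[of _ "sup_norm A"]) (simp_all add: norm_adj)
 ultimately show ?thesis using loc by (simp add: scaling_local_def local_algebra_closed)
qed

lemma scaling_local_bullet:
 assumes Q: "Q \<in> \<K>" shows "SL Q \<subseteq> BL Q"
proof
 fix A assume A: "A \<in> SL Q"
 have bf: "A \<in> \<F>" and loc: "!!l. l > 0 ==> A l \<in> \<A> (scale_region l Q)"
  using A by (auto simp: scaling_local_def)
 have "\<exists>B\<in>SL R. \<exists>C\<in>SL R.
    Limsup net (\<lambda>k. ereal (vd A B k +
     norm ((adj (A (sc k)) - C (sc k)) (vac X)))) < ereal e"
  if R: "R \<in> \<K>" "closure Q \<subseteq> R" and e: "e > 0" for R e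
 proof (rule bexI, rule bexI)
  show "Limsup net (\<lambda>k. ereal (vd A A k +
     norm ((adj (A (sc k)) - (\<lambda>l. adj (A l)) (sc k)) (vac X)))) < ereal e"
   using Limsup_const[OF net_props(1), of "0::ereal"] e by (simp add: zero_ereal_def)
  have "Q \<subseteq> R" using R(2) closure_subset by (rule order_trans[rotated])
  note sub = scaling_local_mono[OF this R(1)]
  show "A \<in> SL R" "(\<lambda>l. adj (A l)) \<in> SL R"
   by (rule subsetD[OF sub A], rule subsetD[OF sub scaling_local_adj[OF Q A]])
 qed
 thus "A \<in> BL Q" using bf loc by (simp add: bullet_local_def)
qed

lemma ext_scaling: "A \<in> SA ==> \<pi>b A = \<pi> A"
 using extension by (simp add: is_bullet_extension_def)

text \<open>The local scaling algebras already generate a dense set of vectors.\<close>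

lemma limit_vectors_dense:
 "closure ((\<lambda>C. \<pi> C \<xi>) ` (\<Union>Q\<in>\<K>. SL Q)) = UNIV" (is "closure ?V = _")
proof -
 have "(\<lambda>A. \<pi> A \<xi>) ` SA \<subseteq> closure ?V"
 proof clarify
  fix A assume A: "A \<in> SA"
  show "\<pi> A \<xi> \<in> closure ?V"
   unfolding closure_approachable
  proof (intro allI impI)
   fix e :: real assume e: "e > 0"
   obtain Q C where C: "Q \<in> \<K>" "C \<in> SL Q" "sup_norm (\<lambda>l. A l - C l) < e"
    using A e unfolding scaling_algebra_def sup_closure_def by blast
   have Ca: "C \<in> SA" using C(2) scaling_local_algebra[OF C(1)] by blast
   have sC: "(\<lambda>l. op_scale (-1) (C l)) \<in> SA" by (rule scaling_algebra_closed(5)[OF Ca])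
   have AC: "(\<lambda>l. A l + op_scale (-1) (C l)) \<in> SA" by (rule scaling_algebra_closed(3)[OF A sC])
   have "\<pi> (\<lambda>l. A l + op_scale (-1) (C l)) = \<pi> A + op_scale (-1) (\<pi> C)"
    using limit_rep A Ca sC unfolding cstar_morphism_def by simp
   hence "norm (\<pi> A - \<pi> C) <= sup_norm (\<lambda>l. A l - C l)"
    using cstar_morphism_norm_le[OF limit_rep order_refl, of "\<lambda>l. A l + op_scale (-1) (C l)"] AC by (simp add: op_scale_simps)
   hence "norm ((\<pi> A - \<pi> C) \<xi>) < e"
    using norm_blinfun[of "\<pi> A - \<pi> C" "\<xi>"] C(3) by (simp add: norm_lim_vac)
   hence "dist (\<pi> C \<xi>) (\<pi> A \<xi>) < e"
    by (simp add: dist_norm norm_minus_commute blinfun.diff_left)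
   moreover have "\<pi> C \<xi> \<in> ?V" using C(1,2) by blast
   ultimately show "\<exists>v\<in>?V. dist v (\<pi> A \<xi>) < e" by blast
  qed
 qed
 hence sub: "closure ((\<lambda>A. \<pi> A \<xi>) ` SA) \<subseteq> closure ?V"
  by (rule closure_minimal) simp
 have "closure ((\<lambda>A. \<pi> A \<xi>) ` SA) = UNIV"
  using limit_gns by (simp add: gns_triple_def)
 from sub[unfolded this] show ?thesis by (rule top.extremum_uniqueI)
qed

end

lemma bounded_tendsto_zero_dense:
 fixes D :: "nat => 'h::complex_hilbert op"
 assumes K: "!!n. norm (D n) <= K" and S: "!!x. x \<in> S ==> (\<lambda>n. D n x) ---> 0"
  and x: "x \<in> closure S"
 shows "(\<lambda>n. D n x) ---> 0"
proof (rule LIMSEQ_I)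
 fix e :: real assume e: "0 < e"
 have K0: "K >= 0" using K[of 0] norm_ge_zero order_trans by blast
 define e' where "e' = e / (2 * (K + 1))"
 have e': "e' > 0" using e K0 by (simp add: e'_def)
 obtain y where y: "y \<in> S" "dist y x < e'" using x[unfolded closure_approachable, rule_format, OF e'] by blast
 obtain N where N: "!!n. n >= N ==> norm (D n y - 0) < e / 2"
  using LIMSEQ_D[OF S[OF y(1)], of "e / 2"] e by auto
 have "norm (D n x - 0) < e" if "n >= N" for n
 proof -
  have "norm (D n (x - y)) <= norm (D n) * norm (x - y)" by (rule norm_blinfun)
  also have "... <= (K + 1) * e'" using K[of n] K0 y(2) by (intro mult_mono) (simp_all add: dist_norm norm_minus_commute)
  also have "... = e / 2"
  proof -
   have "K + 1 ~= 0" using K0 by linarith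
   thus ?thesis unfolding e'_def by (simp add: field_simps)
  qed
  finally show ?thesis
   using N[OF that] norm_triangle_ineq[of "D n (x - y)" "D n y"] by (simp add: blinfun.diff_right)
 qed
 thus "\<exists>N. \<forall>n\<ge>N. norm (D n x - 0) < e" by blast
qed

text \<open>The lightlike vectors along which \<open>x + t\<close> and \<open>x - t\<close> increase, in coordinates \<open>(t, x)\<close>.\<close>

definition ep :: "real^2" where "ep = vector [1 / 2, 1 / 2]"
definition em :: "real^2" where "em = vector [- 1 / 2, 1 / 2]"

lemma ep_em_nth [simp]: "ep $ 1 = 1 / 2" "ep $ 2 = 1 / 2" "em $ 1 = - 1 / 2" "em $ 2 = 1 / 2"
 by (simp_all add: ep_def em_def)

lemma lightcone_decomposition: "y = (y $ 2 + y $ 1) *\<^sub>R ep + (y $ 2 - y $ 1) *\<^sub>R em"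
 by (simp add: vec_eq_iff forall_2 field_simps)

lemma boost_ep: "boost r *v (c *\<^sub>R ep) = (exp r * c) *\<^sub>R ep"
 and boost_em: "boost r *v (c *\<^sub>R em) = (exp (- r) * c) *\<^sub>R em"
 by (simp_all add: vec_eq_iff forall_2 boost_apply cosh_field_def sinh_field_def field_simps)

lemma norm_ep_em: "norm ep <= 1" "norm em <= 1"
 by (simp_all add: norm_vec_def UNIV_2 power2_eq_square)

context vacuum_field begin

text \<open>Lightlike translations with parameter scaled by \<open>l\<close>, and boosts with rapidity scaled by \<open>c\<close>.\<close>

definition Vp :: "real => real => 'h op" where "Vp l s = U 0 ((l * s) *\<^sub>R ep)"
definition Vm :: "real => real => 'h op" where "Vm l s = U 0 ((l * s) *\<^sub>R em)"
definition Vb :: "real => real => 'h op" where "Vb c s = U (c * s) 0"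

lemma group_translations: "unitary_group (\<lambda>s. U 0 ((l * s) *\<^sub>R y))"
proof
 fix s t :: real and x :: 'h
 show "U 0 ((l * s) *\<^sub>R y) \<in> \<B>" "norm (U 0 ((l * s) *\<^sub>R y) x) = norm x" by (rule U_props)+
 show "U 0 ((l * s) *\<^sub>R y) oo U 0 ((l * t) *\<^sub>R y) = U 0 ((l * (s + t)) *\<^sub>R y)"
  by (simp add: U_comp boost_zero algebra_simps)
 show "U 0 ((l * 0) *\<^sub>R y) = id_blinfun" by (simp add: U_zero)
 fix f :: "nat => real" assume "f ---> 0"
 hence "(\<lambda>n. (l * f n) *\<^sub>R y) ---> (l * 0) *\<^sub>R y" by (intro tendsto_intros)
 thus "(\<lambda>n. U 0 ((l * f n) *\<^sub>R y) x) ---> x"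
  by (intro U_strongly_continuous tendsto_const) simp
qed

lemma group_Vp: "unitary_group (Vp l)" and group_Vm: "unitary_group (Vm l)"
 using group_translations[of l ep] group_translations[of l em] by (simp_all add: Vp_def[abs_def] Vm_def[abs_def])

lemma group_Vb: "unitary_group (Vb c)"
proof
 fix s t :: real and x :: 'h
 show "Vb c s \<in> \<B>" "norm (Vb c s x) = norm x" unfolding Vb_def by (rule U_props)+
 show "Vb c s oo Vb c t = Vb c (s + t)" by (simp add: Vb_def U_comp algebra_simps)
 show "Vb c 0 = id_blinfun" by (simp add: Vb_def U_zero)
 fix f :: "nat => real" assume "f ---> 0"
 hence "(\<lambda>n. c * f n) ---> c * 0" by (intro tendsto_intros)
 thus "(\<lambda>n. Vb c (f n) x) ---> x"
  unfolding Vb_def by (intro U_strongly_continuous tendsto_const) simp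
qed

lemma U_apply_comp: "U r y (U h z x) = U (r + h) (boost r *v z + y) x"
 using arg_cong[OF U_comp[of r y h z], of "\<lambda>B. ap B x"] by simp

lemma U_Vp: "U b 0 (Vp l s x) = Vp l (exp b * s) (U b 0 x)"
 and U_Vm: "U b 0 (Vm l s x) = Vm l (exp (- b) * s) (U b 0 x)"
 and Vm_Vp: "Vm l r (Vp l s x) = Vp l (1 * s) (Vm l r x)"
 by (simp_all add: Vp_def Vm_def U_apply_comp boost_ep boost_em mult.left_commute add.commute)

lemma U_factor: "U r (l *\<^sub>R y) x =
  Vp l (y $ 2 + y $ 1) (Vm l (y $ 2 - y $ 1) (U r 0 x))"
proof -
 have "l *\<^sub>R y = (l * (y $ 2 - y $ 1)) *\<^sub>R em + (l * (y $ 2 + y $ 1)) *\<^sub>R ep"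
  by (subst lightcone_decomposition[of y]) (simp add: scaleR_add_right add.commute)
 thus ?thesis by (simp add: Vp_def Vm_def U_apply_comp boost_zero)
qed

text \<open>Averages over translations in the two lightlike directions, at scale \<open>l\<close>, and over boosts;
 the boosts are left out for \<open>c = 0\<close>.\<close>

definition regularize :: "real => real => real => 'h op => 'h op"
 where "regularize c d l T = smear (Vp l) d (smear (Vm l) d (smear (Vb c) d T))"

context
 fixes d :: real and T :: "'h op" assumes d: "d > 0" and T: "T \<in> \<B>"
begin

lemma norm_smear_chain:
 "norm (smear (Vb c) d T) <= norm T" "norm (smear (Vm l) d (smear (Vb c) d T)) <= norm T" "norm (regularize c d l T) <= norm T"
proof -
 show 1: "norm (smear (Vb c) d T) <= norm T" by (rule unitary_group.norm_smear_le[OF group_Vb d])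
 show 2: "norm (smear (Vm l) d (smear (Vb c) d T)) <= norm T"
  by (rule order_trans[OF unitary_group.norm_smear_le[OF group_Vm d] 1])
 show "norm (regularize c d l T) <= norm T" unfolding regularize_def
  by (rule order_trans[OF unitary_group.norm_smear_le[OF group_Vp d] 2])
qed

lemma regularize_bounded_ops: "regularize c d l T \<in> \<B>"
 unfolding regularize_def
 by (intro unitary_group.smear_bounded_ops[OF group_Vp d] unitary_group.smear_bounded_ops[OF group_Vm d]
   unitary_group.smear_bounded_ops[OF group_Vb d] T)

lemma regularize_commute_Vp:
 "norm (Vp l r (regularize c d l T x) - regularize c d l T (Vp l r x))
  <= (\<bar>r\<bar> / d * norm T) * norm x"
 unfolding regularize_def
 by (rule order_trans[OF unitary_group.smear_almost_commute_self[OF group_Vp d]])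
  (intro mult_right_mono mult_left_mono norm_smear_chain norm_ge_zero divide_nonneg_nonneg abs_ge_zero less_imp_le[OF d])

lemma regularize_commute_Vm:
 "norm (Vm l r (regularize c d l T x) - regularize c d l T (Vm l r x))
  <= (\<bar>r\<bar> / d * norm T) * norm x"
proof -
 let ?C = "smear (Vm l) d (smear (Vb c) d T)"
 have "norm (Vm l r (?C x) - ?C (Vm l r x)) <= (\<bar>r\<bar> / d * norm T) * norm x" for x
  by (rule order_trans[OF unitary_group.smear_almost_commute_self[OF group_Vm d]])
   (intro mult_right_mono mult_left_mono norm_smear_chain norm_ge_zero divide_nonneg_nonneg abs_ge_zero less_imp_le[OF d])
 from unitary_group.smear_almost_commute_normalizer[OF group_Vp d _ zero_less_one Vm_Vp this] show ?thesis
  unfolding regularize_def by (simp add: unitary_group.V_iso[OF group_Vm])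
qed

lemma regularize_commute_U:
 fixes c r :: real
 defines "s \<equiv> c * r"
 shows "norm (U s 0 (regularize c d l T x) - regularize c d l T (U s 0 x))
  <= ((\<bar>r\<bar> / d + 2 * \<bar>exp (- s) - 1\<bar> + 2 * \<bar>exp s - 1\<bar>) * norm T) * norm x"
proof -
 let ?B = "smear (Vb c) d T" and ?C = "smear (Vm l) d (smear (Vb c) d T)"
 have iso: "norm (U s 0 x) <= norm x" for x by (simp add: U_props)
 have "norm (U s 0 (?B x) - ?B (U s 0 x)) <= (\<bar>r\<bar> / d * norm T) * norm x" for x
  using unitary_group.smear_almost_commute_self[OF group_Vb[of c] d, of r T x] by (simp add: Vb_def s_def)
 from unitary_group.smear_almost_commute_normalizer[OF group_Vm d iso exp_gt_zero U_Vm this, of l]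
 have "norm (U s 0 (?C x) - ?C (U s 0 x))
  <= (\<bar>r\<bar> / d * norm T + 2 * \<bar>exp (- s) - 1\<bar> * norm ?B) * norm x" for x .
 also have "(\<bar>r\<bar> / d * norm T + 2 * \<bar>exp (- s) - 1\<bar> * norm ?B) * norm x
   <= (\<bar>r\<bar> / d * norm T + 2 * \<bar>exp (- s) - 1\<bar> * norm T) * norm x" for x
  by (intro mult_right_mono add_left_mono mult_left_mono norm_smear_chain) simp_all
 finally have "norm (U s 0 (?C x) - ?C (U s 0 x))
  <= (\<bar>r\<bar> / d * norm T + 2 * \<bar>exp (- s) - 1\<bar> * norm T) * norm x" for x .
 from unitary_group.smear_almost_commute_normalizer[OF group_Vp d iso exp_gt_zero U_Vp this, of l x]
 have "norm (U s 0 (regularize c d l T x) - regularize c d l T (U s 0 x))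
  <= (\<bar>r\<bar> / d * norm T + 2 * \<bar>exp (- s) - 1\<bar> * norm T + 2 * \<bar>exp s - 1\<bar> * norm ?C) * norm x"
  unfolding regularize_def .
 also have "... <= (\<bar>r\<bar> / d * norm T + 2 * \<bar>exp (- s) - 1\<bar> * norm T + 2 * \<bar>exp s - 1\<bar> * norm T) * norm x"
  by (intro mult_right_mono add_left_mono mult_left_mono norm_smear_chain) simp_all
 finally show ?thesis by (simp add: distrib_right)
qed

text \<open>A general element of the group is a product of two lightlike translations and a boost, each of
 which almost commutes with the average.\<close>

lemma regularize_almost_commute:
 fixes c r :: real
 defines "s \<equiv> c * r"
 shows "norm (U s (l *\<^sub>R y) (regularize c d l T x) - regularize c d l T (U s (l *\<^sub>R y) x))
  <= (((\<bar>y $ 2 + y $ 1\<bar> + \<bar>y $ 2 - y $ 1\<bar> + \<bar>r\<bar>) / d + 2 * \<bar>exp (- s) - 1\<bar> + 2 * \<bar>exp s - 1\<bar>) * norm T) * norm x"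
proof -
 define p q where "p = y $ 2 + y $ 1" and "q = y $ 2 - y $ 1"
 let ?P = "(Vp l p)" and ?M = "(Vm l q)" and ?B = "(U s 0)" and ?R = "(regularize c d l T)"
 have iso: "norm (?P x) = norm x" "norm (?M x) = norm x" "norm (?B x) = norm x" for x
  by (simp_all add: U_props unitary_group.V_iso[OF group_Vp] unitary_group.V_iso[OF group_Vm])
 have tri: "norm (?P (?M a) + ?P b + c) <= norm a + norm b + norm c" for a b c
 proof -
  have "norm (?P (?M a) + ?P b + c) <= norm (?P (?M a)) + norm (?P b) + norm c"
   by (rule order_trans[OF norm_triangle_ineq add_right_mono[OF norm_triangle_ineq]])
  thus ?thesis unfolding iso .
 qed
 have "U s (l *\<^sub>R y) (?R x) - ?R (U s (l *\<^sub>R y) x) =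
   ?P (?M (?B (?R x) - ?R (?B x))) + ?P (?M (?R (?B x)) - ?R (?M (?B x))) + (?P (?R (?M (?B x))) - ?R (?P (?M (?B x))))"
  unfolding U_factor[of s l y] p_def[symmetric] q_def[symmetric] by (simp add: blinfun.diff_right)
 hence "norm (U s (l *\<^sub>R y) (?R x) - ?R (U s (l *\<^sub>R y) x)) \<le>
   norm (?B (?R x) - ?R (?B x)) + norm (?M (?R (?B x)) - ?R (?M (?B x))) + norm (?P (?R (?M (?B x))) - ?R (?P (?M (?B x))))"
  by (simp only: tri)
 also have "... <= ((\<bar>r\<bar> / d + 2 * \<bar>exp (- s) - 1\<bar> + 2 * \<bar>exp s - 1\<bar>) * norm T) * norm x + (\<bar>q\<bar> / d * norm T) * norm x + (\<bar>p\<bar> / d * norm T) * norm x"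
 proof (rule add_mono[OF add_mono])
  show "norm (?B (?R x) - ?R (?B x)) <= ((\<bar>r\<bar> / d + 2 * \<bar>exp (- s) - 1\<bar> + 2 * \<bar>exp s - 1\<bar>) * norm T) * norm x"
   using regularize_commute_U[of c r l x] by (simp only: s_def)
  show "norm (?M (?R (?B x)) - ?R (?M (?B x))) <= (\<bar>q\<bar> / d * norm T) * norm x"
   using regularize_commute_Vm[of l q c "?B x"] by (simp only: iso)
  show "norm (?P (?R (?M (?B x))) - ?R (?P (?M (?B x)))) <= (\<bar>p\<bar> / d * norm T) * norm x"
   using regularize_commute_Vp[of l p c "?M (?B x)"] by (simp only: iso)
 qed
 also have "... = (((\<bar>p\<bar> + \<bar>q\<bar> + \<bar>r\<bar>) / d + 2 * \<bar>exp (- s) - 1\<bar> + 2 * \<bar>exp s - 1\<bar>) * norm T) * norm x"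
  by (simp add: add_divide_distrib distrib_right)
 finally show ?thesis by (simp only: p_def q_def)
qed

text \<open>Bounds for all conjugates of \<open>T\<close> that enter the average pass to the average.\<close>

lemma regularize_approx:
 assumes "!!r s t. \<bar>r\<bar> <= d ==> \<bar>s\<bar> <= d ==> \<bar>t\<bar> <= d ==>
  norm (x - ap (Vp l s) (ap (Vm l t) (ap (Vb c r)
   (ap T (ap (Vb c (- r)) (ap (Vm l (- t)) (ap (Vp l (- s)) v))))))) <= e"
 shows "norm (x - ap (regularize c d l T) v) <= e"
 unfolding regularize_def
proof (rule unitary_group.smear_approx[OF group_Vp d])
 fix s assume s: "\<bar>s\<bar> <= d"
 interpret P: unitary_group "Vp l" by (rule group_Vp)
 interpret M: unitary_group "Vm l" by (rule group_Vm)
 have P: "norm (x - ap (Vp l s) z) = norm (ap (Vp l (- s)) x - z)" for x z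
  using P.V_iso[of "- s" "x - ap (Vp l s) z"] P.V_inv[of "- s" z] by (simp add: blinfun.diff_right)
 have M: "norm (x - ap (Vm l t) z) = norm (ap (Vm l (- t)) x - z)" for t x z
  using M.V_iso[of "- t" "x - ap (Vm l t) z"] M.V_inv[of "- t" z] by (simp add: blinfun.diff_right)
 show "norm (x - ap (Vp l s) (ap (smear (Vm l) d (smear (Vb c) d T)) (ap (Vp l (- s)) v))) <= e"
  unfolding P
 proof (rule unitary_group.smear_approx[OF group_Vm d])
  fix t assume t: "\<bar>t\<bar> <= d"
  show "norm (ap (Vp l (- s)) x - ap (Vm l t) (ap (smear (Vb c) d T) (ap (Vm l (- t)) (ap (Vp l (- s)) v)))) <= e"
   unfolding M
   by (metis unitary_group.smear_approx[OF group_Vb d] assms s t P M)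
 qed
qed

end

text \<open>Averages over a bounded range of transformations are localized in an enlarged region.\<close>

lemma smear_local_algebra:
 assumes V: "unitary_group V" and d: "d > 0" and A: "A \<in> \<B>"
  and loc: "!!s. \<bar>s\<bar> <= d ==> V s oo A oo V (- s) \<in> \<A> Q"
 shows "smear V d A \<in> \<A> Q"
 unfolding local_algebra_eq
proof (rule commutantI)
 show "smear V d A \<in> \<B>" by (rule unitary_group.smear_bounded_ops[OF V d A])
 fix T assume T: "T \<in> commutant (w ` local_gens Q)"
 have "T oo smear V d A = smear V d A oo T"
  using unitary_group.smear_commute[OF V d] loc local_algebra_eq commutantD[OF _ T, symmetric] by simp
 thus "smear V d A oo T = T oo smear V d A" by simp
qed

lemma conj_translation_local:
 assumes A: "A \<in> \<A> (dc M)" and M: "M > 0"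
  and N: "\<bar>y $ 2 + y $ 1\<bar> <= N" "\<bar>y $ 2 - y $ 1\<bar> <= N"
 shows "U 0 y oo A oo U 0 (- y) \<in> \<A> (dc (M + N))"
proof -
 have sub: "move_region (boost 0, y) (dc M) \<subseteq> dc (M + N)"
  using N by (auto simp: move_base_cone_iff base_cone_iff)
 have dc: "dc (M + N) \<in> \<K>" using M N(1) by (intro base_cone_double_cone) linarith
 have "U 0 y oo A oo U 0 (- y) \<in> \<A> (move_region (boost 0, y) (dc M))"
  using conj_local_algebra[OF A, of 0 y] by (simp add: boost_zero)
 thus ?thesis by (rule subsetD[OF local_algebra_mono[OF sub dc]])
qed

lemma conj_boost_local:
 assumes A: "A \<in> \<A> (dc M)" and M: "M > 0" and r: "\<bar>r\<bar> <= 1"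
 shows "U r 0 oo A oo U (- r) 0 \<in> \<A> (dc (3 * M))"
proof -
 have e: "exp t * M <= 3 * M" if "t <= 1" for t
 proof -
  have "exp t <= exp 1" using that by simp
  hence "exp t <= 3" using exp_le by linarith
  thus ?thesis using M by simp
 qed
 have le: "exp r * M <= 3 * M" "exp (- r) * M <= 3 * M" using r by (intro e; linarith)+
 have sub: "move_region (boost r, 0) (dc M) \<subseteq> dc (3 * M)"
 proof
  fix x :: "real^2" assume "x \<in> move_region (boost r, 0) (dc M)"
  thus "x \<in> dc (3 * M)"
   unfolding move_base_cone_iff base_cone_iff greaterThanLessThan_iff zero_index mult_minus_right using le by linarith
 qed
 have dc: "dc (3 * M) \<in> \<K>" using M by (intro base_cone_double_cone) linarith
 have "U r 0 oo A oo U (- r) 0 \<in> \<A> (move_region (boost r, 0) (dc M))"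
  using conj_local_algebra[OF A, of r 0] by simp
 thus ?thesis by (rule subsetD[OF local_algebra_mono[OF sub dc]])
qed

lemma regularize_local:
 assumes A: "A \<in> \<A> (dc (l * M))" and M: "M > 0" and l: "l > 0" and d: "0 < d" "d <= 1"
  and c: "\<bar>c\<bar> <= 1"
 shows "regularize c d l A \<in> \<A> (dc (l * (3 * M + 2)))"
proof -
 have ld: "\<bar>l * s\<bar> <= l" if "\<bar>s\<bar> <= d" for s
  using that l d by (simp add: abs_mult)
 have lM: "l * M > 0" "3 * (l * M) > 0" "3 * (l * M) + l > 0" using M l by (simp_all add: add_pos_pos)
 have 0: "smear (Vb c) d A \<in> \<A> (dc (3 * (l * M)))"
 proof (rule smear_local_algebra[OF group_Vb d(1)])
  show "A \<in> \<B>" using A local_algebra_bounded_ops by blast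
  fix s assume "\<bar>s\<bar> <= d"
  hence "\<bar>c * s\<bar> <= 1" using c d(2) by (simp add: abs_mult mult_le_one)
  from conj_boost_local[OF A lM(1) this]
  show "Vb c s oo A oo Vb c (- s) \<in> \<A> (dc (3 * (l * M)))" by (simp add: Vb_def)
 qed
 have 1: "smear (Vm l) d (smear (Vb c) d A) \<in> \<A> (dc (3 * (l * M) + l))"
 proof (rule smear_local_algebra[OF group_Vm d(1)])
  show "smear (Vb c) d A \<in> \<B>" using 0 local_algebra_bounded_ops by blast
  fix s assume "\<bar>s\<bar> <= d"
  from conj_translation_local[OF 0 lM(2), of "(l * s) *\<^sub>R em" l] ld[OF this] l
  show "Vm l s oo smear (Vb c) d A oo Vm l (- s) \<in> \<A> (dc (3 * (l * M) + l))"
   by (simp add: Vm_def)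
 qed
 have "smear (Vp l) d (smear (Vm l) d (smear (Vb c) d A)) \<in> \<A> (dc (3 * (l * M) + l + l))"
 proof (rule smear_local_algebra[OF group_Vp d(1)])
  show "smear (Vm l) d (smear (Vb c) d A) \<in> \<B>" using 1 local_algebra_bounded_ops by blast
  fix s assume "\<bar>s\<bar> <= d"
  from conj_translation_local[OF 1 lM(3), of "(l * s) *\<^sub>R ep" l] ld[OF this] l
  show "Vp l s oo smear (Vm l) d (smear (Vb c) d A) oo Vp l (- s) \<in> \<A> (dc (3 * (l * M) + l + l))"
   by (simp add: Vp_def)
 qed
 moreover have "3 * (l * M) + l + l = l * (3 * M + 2)" by (simp add: algebra_simps)
 ultimately show ?thesis by (simp add: regularize_def)
qed

end

context scaling_field begin

text \<open>The boosts in the symmetry group are dense (\<open>c = 1\<close>) or trivial near the identity (\<open>c = 0\<close>).\<close>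

definition boost_type :: "real => bool"
 where "boost_type c \<longleftrightarrow> c = 1 \<and> closure rapidities = UNIV \<or> c = 0 \<and> (\<exists>e>0. \<forall>t\<in>rapidities. \<bar>t\<bar> < e --> t = 0)"

lemma boost_type_exists: "\<exists>c. boost_type c"
 using real_subgroup_cases[of rapidities, OF rapidities_subgroup] unfolding boost_type_def by auto

lemma boost_type_small: assumes "boost_type c" shows "\<exists>e>0. \<forall>t\<in>rapidities. \<bar>t\<bar> < e --> c * t = t"
 using assms unfolding boost_type_def by (auto intro: exI[of _ "1::real"])

lemma almost_commutes_closure:
 assumes ac: "!!b. b \<in> rapidities ==> \<bar>b\<bar> < d ==> almost_commutes A b y e"
  and r: "r \<in> closure rapidities" "\<bar>r\<bar> < d"
 shows "almost_commutes A r y e"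
 unfolding almost_commutes_def
proof (intro allI impI)
 fix l :: real and x :: 'h assume l: "l > 0"
 obtain s where s: "!!n::nat. s n \<in> rapidities" "s ---> r" using r(1) unfolding closure_sequential by blast
 have U: "(\<lambda>n. U (s n) (l *\<^sub>R y) z) ---> U r (l *\<^sub>R y) z" for z
 proof -
  have "(\<lambda>n. U (s n - r) 0 z) ---> z"
   by (rule U_strongly_continuous[OF LIM_zero[OF s(2)] tendsto_const])
  hence "(\<lambda>n. U r (l *\<^sub>R y) (U (s n - r) 0 z)) ---> U r (l *\<^sub>R y) z"
   by (rule blinfun.tendsto[OF tendsto_const])
  thus ?thesis by (simp add: U_apply_comp)
 qed
 have "(\<lambda>n. \<bar>s n\<bar>) ---> \<bar>r\<bar>" by (rule tendsto_rabs[OF s(2)])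
 hence "\<forall>\<^sub>F n in sequentially. \<bar>s n\<bar> < d" using r(2) by (rule order_tendstoD(2))
 hence ev: "\<forall>\<^sub>F n in sequentially. norm (U (s n) (l *\<^sub>R y) (A l x) -
   A l (U (s n) (l *\<^sub>R y) x)) <= e * norm x"
 proof eventually_elim
  case (elim n)
  show ?case by (rule ac[OF s(1) elim, unfolded almost_commutes_def, rule_format, OF l])
 qed
 have lim: "(\<lambda>n. norm (U (s n) (l *\<^sub>R y) (A l x) - A l (U (s n) (l *\<^sub>R y) x)))
   ---> norm (U r (l *\<^sub>R y) (A l x) - A l (U r (l *\<^sub>R y) x))"
  by (rule tendsto_norm[OF tendsto_diff[OF U blinfun.tendsto[OF tendsto_const U]]])
 show "norm (U r (l *\<^sub>R y) (A l x) - A l (U r (l *\<^sub>R y) x)) <= e * norm x"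
  by (rule tendsto_upperbound[OF lim ev]) simp
qed

lemma scaling_local_near_identity:
 assumes A: "A \<in> SL Q" and Q: "Q \<in> \<K>" and e: "e > 0" and c: "boost_type c"
 shows "\<exists>d>0. \<forall>r y. \<bar>r\<bar> < d --> norm y < d --> almost_commutes A (c * r) y e"
proof -
 obtain d where d: "d > 0" "!!s y. s \<in> rapidities ==> \<bar>s\<bar> < d ==> norm y < d ==> almost_commutes A s y e"
  using scaling_localD[OF A Q e] by blast
 have "almost_commutes A (c * r) y e" if r: "\<bar>r\<bar> < d" and y: "norm y < d" for r y
 proof (rule almost_commutes_closure[where d = d])
  show "almost_commutes A s y e" if "s \<in> rapidities" "\<bar>s\<bar> < d" for s by (rule d(2)[OF that y])
  show "c * r \<in> closure rapidities"
   using c subsetD[OF closure_subset rapidities_subgroup(1)] by (auto simp: boost_type_def)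
  show "\<bar>c * r\<bar> < d" using c r by (auto simp: boost_type_def)
 qed
 thus ?thesis using d(1) by blast
qed

subsection \<open>Regularized functions\<close>

text \<open>The average at each scale; functions of the scale vanish for \<open>l \<le> 0\<close>.\<close>

definition regularized :: "real => real => (real => 'h op) => real => 'h op"
 where "regularized c d A = on_pos (\<lambda>l. regularize c d l (A l))"

lemma regularized_bounded:
 assumes A: "A \<in> \<F>" and d: "d > 0"
 shows "regularized c d A \<in> \<F>" "l > 0 ==> norm (regularized c d A l) <= norm (A l)"
proof -
 have b: "A l \<in> \<B>" for l by (rule bounded_functionsD(1)[OF A])
 show n: "norm (regularized c d A l) <= norm (A l)" if "l > 0" for l
  using norm_smear_chain(3)[OF d b] that by (simp add: regularized_def)
 show "regularized c d A \<in> \<F>"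
 proof (rule bounded_functionsI)
  fix l :: real
  show "regularized c d A l \<in> \<B>" if "l > 0"
   using regularize_bounded_ops[OF d b] that by (simp add: regularized_def)
  show "norm (regularized c d A l) <= sup_norm A" if l: "l > 0"
   by (rule order_trans[OF n[OF l] norm_le_sup_norm[OF A l]])
  show "regularized c d A l = 0" if "l <= 0" using that by (simp add: regularized_def)
 qed
qed

text \<open>Regularized functions belong to the scaling algebra: \<open>d\<close> is fixed, and the commutator bounds are
 uniform in the scale.\<close>

lemma regularized_scaling_local:
 assumes A: "A \<in> \<F>" and M: "M > 0"
  and loc: "!!l. l > 0 ==> A l \<in> \<A> (scale_region l (dc M))"
  and d: "0 < d" "d <= 1" and c: "boost_type c"
 shows "regularized c d A \<in> SL (dc (3 * M + 2))"
proof (rule scaling_localI[OF regularized_bounded(1)[OF A d(1)]])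
 show "dc (3 * M + 2) \<in> \<K>" using M by (intro base_cone_double_cone) linarith
 show "regularized c d A l \<in> \<A> (scale_region l (dc (3 * M + 2)))" if l: "l > 0" for l
 proof -
  have c1: "\<bar>c\<bar> <= 1" using c by (auto simp: boost_type_def)
  have "A l \<in> \<A> (dc (l * M))" using loc[OF l] by (simp add: scale_base_cone l)
  from regularize_local[OF this M l d c1] show ?thesis using l
   unfolding scale_base_cone[OF l] mult_minus_right by (simp add: regularized_def)
 qed
 fix e :: real assume e: "e > 0"
 obtain d0 where d0: "d0 > 0" "!!t. t \<in> rapidities ==> \<bar>t\<bar> < d0 ==> c * t = t" using boost_type_small[OF c] by blast
 define C where "C = sup_norm A + 1"
 have C: "C > 0" "!!l. l > 0 ==> norm (A l) <= C"
 proof -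
  have n: "norm (A l) <= sup_norm A" if "l > 0" for l by (rule norm_le_sup_norm[OF A that])
  show "norm (A l) <= C" if "l > 0" for l using n[OF that] by (simp add: C_def)
  show "C > 0" using order_trans[OF norm_ge_zero n[OF zero_less_one]] by (simp add: C_def)
 qed
 define h where "h = e / (8 * C)"
 have h: "h > 0" using e C by (simp add: h_def)
 have "isCont exp (0::real)" by simp
 then obtain d1 where d1: "d1 > 0" "!!t::real. \<bar>t\<bar> < d1 ==> \<bar>exp t - 1\<bar> < h"
  unfolding continuous_at_eps_delta using h by (auto simp: dist_real_def)
 \<comment> \<open>below \<open>d0\<close> the boosts of the group are among those averaged over, or trivial; the other two
  bounds make each term of \<open>regularize_almost_commute\<close> a fraction of \<open>e\<close>\<close>
 define D where "D = min d0 (min d1 (d * h / 2))"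
 have D: "D > 0" "D <= d0" "D <= d1" "D <= d * h / 2" using d0 d1 d h by (auto simp: D_def)
 show "\<exists>d'>0. \<forall>r\<in>rapidities. \<forall>y. \<bar>r\<bar> < d' --> norm y < d' --> almost_commutes (regularized c d A) r y e"
 proof (intro exI[of _ D] conjI ballI allI impI)
  show "0 < D" by (rule D(1))
  fix r y assume r: "r \<in> rapidities" "\<bar>r\<bar> < D" and y: "norm (y :: real^2) < D"
  have cr: "c * r = r" using r D by (intro d0(2)) auto
  have y12: "\<bar>y $ 1\<bar> < D" "\<bar>y $ 2\<bar> < D" using y component_le_norm_cart[of y 1] component_le_norm_cart[of y 2] by simp_all
  have sum: "\<bar>y $ 2 + y $ 1\<bar> + \<bar>y $ 2 - y $ 1\<bar> + \<bar>r\<bar> <= 5 * (d * h / 2)" using y12 r(2) D(4) by linarith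
  have 1: "(\<bar>y $ 2 + y $ 1\<bar> + \<bar>y $ 2 - y $ 1\<bar> + \<bar>r\<bar>) / d <= 4 * h"
  proof -
   have "d * h > 0" "4 * h * d = 4 * (d * h)" using d(1) h by simp_all
   hence "5 * (d * h / 2) <= 4 * h * d" by linarith
   with sum have "\<bar>y $ 2 + y $ 1\<bar> + \<bar>y $ 2 - y $ 1\<bar> + \<bar>r\<bar> <= 4 * h * d" by (rule order_trans)
   thus ?thesis using d(1) by (simp only: pos_divide_le_eq)
  qed
  have 2: "\<bar>exp (- r) - 1\<bar> < h" "\<bar>exp r - 1\<bar> < h" using r(2) D(3) by (intro d1(2); simp)+
  have "(\<bar>y $ 2 + y $ 1\<bar> + \<bar>y $ 2 - y $ 1\<bar> + \<bar>r\<bar>) / d + 2 * \<bar>exp (- r) - 1\<bar> + 2 * \<bar>exp r - 1\<bar> <= 8 * h" (is "?K <= _")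
   using 1 2 by linarith
  hence K: "?K * norm (A l) <= e" if "l > 0" for l
  proof -
   have "?K * norm (A l) <= 8 * h * C" using \<open>?K <= 8 * h\<close> C(2)[OF that] h by (intro mult_mono) simp_all
   thus ?thesis using C(1) by (simp add: h_def)
  qed
  show "almost_commutes (regularized c d A) r y e"
   unfolding almost_commutes_def
  proof (intro allI impI)
   fix l :: real and x :: 'h assume l: "l > 0"
   have "norm (U r (l *\<^sub>R y) (regularize c d l (A l) x) - regularize c d l (A l) (U r (l *\<^sub>R y) x))
     <= (?K * norm (A l)) * norm x"
    using regularize_almost_commute[OF d(1) bounded_functionsD(1)[OF A], of c r l y l x] unfolding cr .
   also have "... <= e * norm x" by (rule mult_right_mono[OF K[OF l] norm_ge_zero])
   finally show "norm (U r (l *\<^sub>R y) (regularized c d A l x) - regularized c d A l (U r (l *\<^sub>R y) x)) <= e * norm x"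
    using l by (simp add: regularized_def)
  qed
 qed
qed

text \<open>On the vectors \<open>C\<^sub>\<lambda>\<Omega>\<close> with \<open>C\<close> in the scaling algebra, regularization changes \<open>A\<close> only
 little, because there \<open>A C\<^sub>\<lambda>\<Omega>\<close> is close to \<open>E\<^sub>\<lambda>\<Omega>\<close> with \<open>E\<close> in the scaling algebra.\<close>

lemma regularized_vector_close:
 assumes d: "d > 0" and T: "A l \<in> \<B>" and l: "l > 0" and e: "e >= 0"
  and C: "!!r y. \<bar>r\<bar> < D ==> norm y < D ==> almost_commutes C (c * r) y e"
  and E: "!!r y. \<bar>r\<bar> < D ==> norm y < D ==> almost_commutes E (c * r) y e"
  and ACE: "norm (A l (C l (vac X)) - E l (vac X)) <= e"
  and dD: "2 * d < D" and K: "norm (A l) <= K"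
 shows "norm (A l (C l (vac X)) - regularized c d A l (C l (vac X))) <= (3 + K) * e"
proof -
 define v where "v = C l (vac X)"
 define E' where "E' = E l (vac X)"
 have "norm (A l v - regularize c d l (A l) v) <= (3 + K) * e"
 proof (rule regularize_approx[OF d T])
  fix r s t assume rst: "\<bar>r\<bar> <= d" "\<bar>s\<bar> <= d" "\<bar>t\<bar> <= d"
  define y where "y = s *\<^sub>R ep + t *\<^sub>R em"
  let ?P = "(U (c * r) (l *\<^sub>R y))"
  define v' where "v' = (Vb c (- r)) (Vm l (- t) (Vp l (- s) v))"
  interpret P: unitary_group "Vp l" by (rule group_Vp)
  interpret M: unitary_group "Vm l" by (rule group_Vm)
  interpret B: unitary_group "Vb c" by (rule group_Vb)
  have P: "Vp l s (Vm l t (Vb c r z)) = ?P z" for z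
   unfolding U_factor by (simp add: y_def Vb_def)
  have Pv': "?P v' = v" unfolding P[symmetric] v'_def by (simp only: B.V_inv M.V_inv P.V_inv)
  have Pn: "norm (?P z) = norm z" for z by (rule U_props(3))
  have "norm y <= norm (s *\<^sub>R ep) + norm (t *\<^sub>R em)" unfolding y_def by (rule norm_triangle_ineq)
  also have "... <= d * 1 + d * 1" unfolding norm_scaleR real_norm_def
   using rst d norm_ep_em by (intro add_mono mult_mono) simp_all
  finally have y: "norm y < D" using dD by simp
  have r: "\<bar>r\<bar> < D" using rst(1) dD by linarith
  have vac: "?P (vac X) = vac X" by (rule U_vac)
  have Cv: "norm (?P v - v) <= e"
   using C[OF r y, unfolded almost_commutes_def, rule_format, OF l, of "vac X"] by (simp add: v_def vac norm_vac)
  have Ev: "norm (?P E' - E') <= e"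
   using E[OF r y, unfolded almost_commutes_def, rule_format, OF l, of "vac X"] by (simp add: E'_def vac norm_vac)
  have "norm (?P (v - v')) = norm (?P v - v)" by (simp add: blinfun.diff_right Pv')
  hence vv': "norm (v - v') <= e" using Cv by (simp add: Pn)
  have AE: "norm (A l v - E') <= e" using ACE by (simp add: v_def E'_def)
  have "A l v - ?P (A l v') = (A l v - E') + (E' - ?P E') +
    ?P (E' - A l v) + ?P (A l (v - v'))"
   by (simp add: blinfun.diff_right)
  hence "norm (A l v - ?P (A l v')) <= norm (A l v - E') + norm (E' - ?P E') +
    norm (?P (E' - A l v)) + norm (?P (A l (v - v')))"
   by (simp only: order_trans[OF norm_triangle_ineq add_right_mono[OF order_trans[OF norm_triangle_ineq add_right_mono[OF norm_triangle_ineq]]]])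
  also have "... <= e + e + e + K * e"
  proof (intro add_mono)
   show "norm (A l v - E') <= e" by (rule AE)
   show "norm (E' - ?P E') <= e" using Ev by (simp add: norm_minus_commute)
   show "norm (?P (E' - A l v)) <= e" using AE by (simp add: Pn norm_minus_commute)
   have "norm (A l (v - v')) <= norm (A l) * norm (v - v')" by (rule norm_blinfun)
   also have "... <= K * e" by (rule mult_mono[OF K vv' order_trans[OF norm_ge_zero K] norm_ge_zero])
   finally show "norm (?P (A l (v - v'))) <= K * e" by (simp only: Pn)
  qed
  finally have "norm (A l v - ?P (A l v')) <= (3 + K) * e" by (simp add: distrib_right)
  thus "norm (A l v - (Vp l s) ((Vm l t) ((Vb c r)
   ((A l) ((Vb c (- r)) (Vm l (- t) (Vp l (- s) v))))))) <= (3 + K) * e"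
   unfolding v'_def[symmetric] P .
 qed
 thus ?thesis using l by (simp add: regularized_def v_def)
qed

text \<open>Elements of \<open>\<A>\<^sup>\<bullet>\<close> whose values are localized in the scaled double cones are represented in
 the scaling limit by local operators, even if they are only limits of local elements of
 \<open>\<A>\<^sup>\<bullet>\<close> in larger and larger regions.\<close>

theorem ext_localized:
 assumes A: "A \<in> BA" and M: "M > 0"
  and loc: "!!l. l > 0 ==> A l \<in> \<A> (scale_region l (dc M))"
 shows "\<pi>b A \<in> LL (dc (3 * M + 2))"
proof -
 let ?R = "dc (3 * M + 2)"
 have R: "?R \<in> \<K>" using M by (intro base_cone_double_cone) linarith
 obtain c where c: "boost_type c" using boost_type_exists by blast
 have Ab: "A \<in> \<F>" by (rule bullet_algebra_bounded[OF A])
 define d where "d n = 1 / real (Suc n)" for n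
 have d: "0 < d n" "d n <= 1" for n by (simp_all add: d_def)
 have d0: "d ---> 0" using LIMSEQ_inverse_real_of_nat by (simp add: d_def[abs_def] inverse_eq_divide)
 define B where "B n = regularized c (d n) A" for n
 have Bl: "B n \<in> SL ?R" for n unfolding B_def by (rule regularized_scaling_local[OF Ab M loc d c])
 have Ba: "B n \<in> SA" for n by (rule subsetD[OF scaling_local_algebra[OF R] Bl])
 have Bb: "B n \<in> BA" for n
  by (rule subsetD[OF bullet_local_algebra[OF R] subsetD[OF scaling_local_bullet[OF R] Bl]])
 define \<Delta> where "\<Delta> n = \<pi>b A - \<pi> (B n)" for n
 have \<Delta>n: "norm (\<Delta> n) <= sup_norm A + sup_norm A" for n
 proof -
  have "norm (\<Delta> n) <= sup_norm (\<lambda>l. A l - B n l)"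
   using norm_ext_diff_le[OF A Bb[of n]] by (simp add: \<Delta>_def ext_scaling[OF Ba])
  also have "... <= sup_norm A + sup_norm A"
  proof (rule sup_norm_leI)
   fix l :: real assume l: "l > 0"
   have "norm (A l - B n l) <= norm (A l) + norm (B n l)" by (rule norm_triangle_ineq4)
   also have "... <= sup_norm A + sup_norm A"
    using norm_le_sup_norm[OF Ab l] regularized_bounded(2)[OF Ab d(1)[of n] l, of c] unfolding B_def by linarith
   finally show "norm (A l - B n l) <= sup_norm A + sup_norm A" .
  qed
  finally show ?thesis .
 qed
 have dense: "(\<lambda>n. \<Delta> n x) ---> 0"
  if x: "x \<in> (\<lambda>C. \<pi> C \<xi>) ` (\<Union>Q\<in>\<K>. SL Q)" for x
 proof -
  obtain Q C where Q: "Q \<in> \<K>" and C: "C \<in> SL Q" and x: "x = \<pi> C \<xi>"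
   using x by blast
  have Cb: "C \<in> BA"
   by (rule subsetD[OF bullet_local_algebra[OF Q] subsetD[OF scaling_local_bullet[OF Q] C]])
  have Ca: "C \<in> SA" by (rule subsetD[OF scaling_local_algebra[OF Q] C])
  have AC: "(\<lambda>l. A l oo C l) \<in> BA" by (rule bullet_algebra_closed(4)[OF A Cb])
  show ?thesis
  proof (rule LIMSEQ_I)
   fix e :: real assume e: "0 < e"
   define K where "K = sup_norm A"
   have K: "norm (A l) <= K" if "l > 0" for l unfolding K_def by (rule norm_le_sup_norm[OF Ab that])
   have K0: "K >= 0" by (rule order_trans[OF norm_ge_zero K[OF zero_less_one]])
   define h where "h = e / (2 * (3 + K))"
   have h: "h > 0" "(3 + K) * h < e"
   proof -
    have "3 + K > 0" using K0 by linarith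
    hence "(3 + K) * h = e / 2" "h > 0" using e unfolding h_def by (simp_all add: field_simps)
    thus "h > 0" "(3 + K) * h < e" using e by simp_all
   qed
   obtain R' E where R': "R' \<in> \<K>" and E: "E \<in> SL R'"
    and AE: "\<forall>\<^sub>F k in net. norm (((A (sc k) oo C (sc k)) - E (sc k)) (vac X)) <= h"
    using bullet_algebra_approx[OF AC h(1)] by blast
   obtain D1 where D1: "D1 > 0" "!!r y. \<bar>r\<bar> < D1 ==> norm y < D1 ==> almost_commutes C (c * r) y h"
    using scaling_local_near_identity[OF C Q h(1) c] by blast
   obtain D2 where D2: "D2 > 0" "!!r y. \<bar>r\<bar> < D2 ==> norm y < D2 ==> almost_commutes E (c * r) y h"
    using scaling_local_near_identity[OF E R' h(1) c] by blast
   define D where "D = min D1 D2"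
   have D: "D / 2 > 0" using D1(1) D2(1) by (simp add: D_def)
   obtain N where N: "!!n. n >= N ==> norm (d n - 0) < D / 2" using LIMSEQ_D[OF d0 D] by blast
   have "norm (\<Delta> n x - 0) < e" if n: "n >= N" for n
   proof -
    have dn: "2 * d n < D" using N[OF n] by simp
    define F where "F = (\<lambda>l. (A l - B n l) oo C l)"
    have F: "F \<in> BA" unfolding F_def
     by (rule bullet_algebra_closed(4)[OF bullet_algebra_diff(1)[OF A Bb] Cb])
    have "\<forall>\<^sub>F k in net. norm (F (sc k) (vac X)) <= (3 + K) * h"
     using AE
    proof eventually_elim
     case (elim k)
     have l: "sc k > 0" by (rule net_props(2))
     have "norm (A (sc k) (C (sc k) (vac X)) -
       regularized c (d n) A (sc k) (C (sc k) (vac X))) <= (3 + K) * h"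
     proof (rule regularized_vector_close[where A = A and C = C and E = E and l = "sc k" and D = D, OF d(1) bounded_functionsD(1)[OF Ab] l less_imp_le[OF h(1)] _ _ _ dn K[OF l]])
      show "almost_commutes C (c * r) y h" if "\<bar>r\<bar> < D" "norm y < D" for r y using that by (intro D1(2)) (simp_all add: D_def)
      show "almost_commutes E (c * r) y h" if "\<bar>r\<bar> < D" "norm y < D" for r y using that by (intro D2(2)) (simp_all add: D_def)
      show "norm (A (sc k) (C (sc k) (vac X)) - E (sc k) (vac X)) <= h"
       using elim by (simp add: blinfun.diff_left)
     qed
     thus ?case by (simp add: F_def B_def blinfun.diff_left)
    qed
    hence "norm (\<pi>b F \<xi>) <= (3 + K) * h"
     using h(1) K0 by (intro norm_ext_vector_le[OF F]) simp_all
    moreover have "\<pi>b F = \<Delta> n oo \<pi> C"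
     unfolding F_def \<Delta>_def ext_simps(3)[OF bullet_algebra_diff(1)[OF A Bb] Cb] bullet_algebra_diff(2)[OF A Bb]
      ext_scaling[OF Ba] ext_scaling[OF Ca] ..
    ultimately show ?thesis using h(2) by (simp add: x)
   qed
   thus "\<exists>N. \<forall>n\<ge>N. norm (\<Delta> n x - 0) < e" by blast
  qed
 qed
 \<comment> \<open>convergence on the dense set of vectors generated by the scaling algebra suffices, since the
  differences are uniformly bounded\<close>
 have zero: "(\<lambda>n. \<Delta> n x) ---> 0" for x
  using limit_vectors_dense by (intro bounded_tendsto_zero_dense[OF \<Delta>n dense]) auto
 have lim: "(\<lambda>n. \<pi> (B n) x) ---> \<pi>b A x" for x
  using tendsto_diff[OF tendsto_const zero[of x], of "\<pi>b A x"] by (simp add: \<Delta>_def blinfun.diff_left)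
 show ?thesis unfolding limit_local_def
 proof (rule commutantI)
  show "\<pi>b A \<in> \<B>" by (rule subsetD[OF limit_quasilocal_bounded_ops ext_simps(1)[OF A]])
  fix T assume T: "T \<in> commutant (\<pi> ` SL ?R)"
  show "\<pi>b A oo T = T oo \<pi>b A"
  proof (rule blinfun_eqI)
   fix x
   have "T (\<pi> (B n) x) = \<pi> (B n) (T x)" for n
    using arg_cong[OF commutantD[OF T imageI[OF Bl]], of "\<lambda>F. ap F x"] by simp
   hence "(\<lambda>n. \<pi> (B n) (T x)) ---> T (\<pi>b A x)"
    using blinfun.tendsto[OF tendsto_const lim, of T x] by simp
   from LIMSEQ_unique[OF lim this] show "(\<pi>b A oo T) x = (T oo \<pi>b A) x" by simp
  qed
 qed
qed

end

theorem proposition4p5: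
  fixes m q a :: real
    and X :: "('w, 'h::complex_hilbert) free_field"
    and S :: "('i, 'h, 'k::complex_hilbert) scaling_limit"
    and u :: "nat \<Rightarrow> real \<Rightarrow> real"
    and \<rho>\<^sub>q :: "'k op \<Rightarrow> 'k op"
  assumes mass: "m > 0"
    and field: "massive_free_field m X"
    and limit: "is_scaling_limit X S"
    and bullet_cstar:
      "\<forall>Q\<in>double_cones. cstar_algebra (function_algebra (bullet_local X S Q))"
    and extension: "is_bullet_extension X S"
    and weyl_bullet: "\<forall>f\<in>test_functions. scaled_weyl X f \<in> bullet_algebra X S"
    and a_pos: "a > 0"
    and charge: "charge_functions q a u"
    and sector: "is_sector_automorphism X S u \<rho>\<^sub>q"
  shows
    \<comment> \<open>the norm limits defining the maps \<open>rho_scale\<close> exist and define morphisms\<close>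
    "(\<forall>l>0. (\<forall>B\<in>phi_algebra X S. convergent (rho_approx X u l B)) \<and>
        cstar_morphism (operator_algebra (phi_algebra X S))
          (operator_algebra (quasilocal X)) (rho_scale X u l)) \<and>
     \<comment> \<open>(i)\<close>
     (\<forall>B\<in>phi_algebra X S.
        rho_bullet X u B \<in> bullet_algebra X S \<and>
        lim_rep_ext S (rho_bullet X u B) = \<rho>\<^sub>q (lim_rep_ext S (phi_bullet X B)) \<and>
        lim_rep_ext S (rho_bullet X u B) \<in> limit_quasilocal X S) \<and>
     \<comment> \<open>(ii)\<close>
     (\<forall>B\<in>phi_algebra X S. \<forall>e>0. \<exists>d>0. \<forall>C\<in>phi_algebra X S.
        norm (C - B) < d \<longrightarrow> sup_norm (\<lambda>l. rho_bullet X u C l - rho_bullet X u B l) < e) \<and>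
     \<comment> \<open>(iii)\<close>
     lim_rep_ext S ` rho_bullet X u ` (\<Union>Q\<in>double_cones. phi_local X S Q)
        \<subseteq> (\<Union>Q\<in>double_cones. limit_local X S Q)"
proof -
 interpret sector_field m X S u q a \<rho>\<^sub>q
  using assms by unfold_locales
 have "convergent (rho_approx X u l B)" if "l > 0" "B \<in> phi_algebra X S" for l B
  using that by (rule rho_approx_convergent)
 moreover have "lim_rep_ext S (rho_bullet X u B) \<in> limit_quasilocal X S" if "B \<in> phi_algebra X S" for B
  by (rule ext_simps(1)[OF rho_bullet_algebra[OF that]])
 moreover have "sup_norm (\<lambda>l. rho_bullet X u C l - rho_bullet X u B l) < e"
  if "B \<in> phi_algebra X S" "C \<in> phi_algebra X S" "norm (C - B) < e" for B C e
  using rho_bullet_diff_le[OF that(2,1)] that(3) by linarith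
 moreover have "\<exists>Q\<in>double_cones. lim_rep_ext S (rho_bullet X u B) \<in> limit_local X S Q" if B: "B \<in> phi_union" for B
 proof -
  obtain M where M: "M > 0" "\<forall>l>0. rho_bullet X u B l \<in> local_algebra X (scale_region l (base_cone (- M) M))"
   using rho_bullet_localized[OF B] by blast
  have "rho_bullet X u B \<in> bullet_algebra X S" by (rule rho_bullet_algebra[OF subsetD[OF phi_union_incl B]])
  from ext_localized[OF this M(1) M(2)[rule_format]]
  have "lim_rep_ext S (rho_bullet X u B) \<in> limit_local X S (base_cone (- (3 * M + 2)) (3 * M + 2))" .
  moreover have "base_cone (- (3 * M + 2)) (3 * M + 2) \<in> double_cones" using M(1) by (intro base_cone_double_cone) linarith
  ultimately show ?thesis by (rule bexI)
 qed
 ultimately show ?thesis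
  using rho_scale_morphism rho_bullet_algebra ext_rho_bullet unfolding phi_union_def[symmetric]
  by (intro conjI allI ballI impI image_subsetI) auto
qed

end
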